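(* Let $\Omega\subset\mathbb{R}^2$ be a simply connected region (a bounded, open, connected, simply connected set) containing the origin $O$, with boundary $\partial\Omega$ and outward normal $\boldsymbol{n}$. Let $\mathbb{C}:\mathrm{Sym}\to\mathrm{Sym}$ be a linear map (the elasticity tensor) that is symmetric, $\langle\mathbb{C}\boldsymbol{V}_1,\boldsymbol{V}_2\rangle=\langle\mathbb{C}\boldsymbol{V}_2,\boldsymbol{V}_1\rangle$ for all $\boldsymbol{V}_1,\boldsymbol{V}_2\in\mathrm{Sym}$, and positive-definite, $\langle\mathbb{C}\boldsymbol{V},\boldsymbol{V}\rangle>0$ for all non-zero $\boldsymbol{V}\in\mathrm{Sym}$. Let a body force $\boldsymbol{B}\in\mathcal{A}(\Omega,\mathbb{R}^2)$, a smooth traction $\boldsymbol{t}:\partial\Omega\to\mathbb{R}^2$, and an incompatibility $N\in\mathcal{A}(\Omega)$ be given. Let $\boldsymbol{\sigma}_1,\boldsymbol{\sigma}_2\in\mathcal{A}(\Omega,\mathrm{Sym})$ be any two solutions $\boldsymbol{\sigma}$ of the problem $$\operatorname{Div}\boldsymbol{\sigma}+\boldsymbol{B}=\boldsymbol{0},\qquad \operatorname{Curl}\operatorname{Curl}(\mathbb{C}^{-1}\boldsymbol{\sigma})=N,\qquad \boldsymbol{\sigma}\boldsymbol{n}=\boldsymbol{t}\ \text{on }\partial\Omega,$$ where the first two equations hold in the sense of distributions on $\Omega$ and the third is a pointwise condition. Then $\boldsymbol{\sigma}_1=\boldsymbol{\sigma}_2$.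
   Context: $\mathrm{Sym}$ is the space of symmetric linear maps $\mathbb{R}^2\to\mathbb{R}^2$ with inner product $\langle\boldsymbol{V},\boldsymbol{W}\rangle=V_{ij}W_{ij}$ (summation convention). $\mathcal{A}(\Omega,V)$ is the set of $V$-valued distributions on $\Omega$ whose singular support is contained in $\{O\}$, i.e. whose restriction to $\Omega\setminus\{O\}$ is given by a smooth function; $\mathcal{A}(\Omega)=\mathcal{A}(\Omega,\mathbb{R})$. The boundary condition is a pointwise condition since the restriction of $\boldsymbol{\sigma}$ to $\Omega\setminus\{O\}$ is smooth and $O$ lies in the interior of the domain. All derivatives are distributional. $(\operatorname{Div}\boldsymbol{\sigma})_i=\partial_j\sigma_{ij}$. For a vector distribution $\boldsymbol{v}$, $\operatorname{Curl}\boldsymbol{v}=\partial_1v_2-\partial_2v_1$; for a tensor distribution $\boldsymbol{V}$, $(\operatorname{Curl}\boldsymbol{V})_i=\partial_1V_{i2}-\partial_2V_{i1}$; thus $\operatorname{Curl}\operatorname{Curl}\boldsymbol{E}=\partial_1\partial_1E_{22}-2\partial_1\partial_2E_{12}+\partial_2\partial_2E_{11}$ for symmetric $\boldsymbol{E}$. *)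

theory Defs
  imports "HOL-Analysis.Analysis"
begin

section \<open>Smooth functions of two variables\<close>

definition partial :: "2 \<Rightarrow> (real^2 \<Rightarrow> 'v::real_normed_vector) \<Rightarrow> real^2 \<Rightarrow> 'v" where
  "partial i f = (\<lambda>x. frechet_derivative f (at x) (axis i 1))"

primrec partials :: "2 list \<Rightarrow> (real^2 \<Rightarrow> 'v::real_normed_vector) \<Rightarrow> real^2 \<Rightarrow> 'v" where
  "partials [] f = f"
| "partials (i # js) f = partial i (partials js f)"

text \<open>
  Meant for open \<open>U\<close>. Total differentiability of all iterated partial derivatives makes
  all of them continuous, so this is \<open>C\<close>-infinity on \<open>U\<close>.
\<close>

definition smooth_on :: "(real^2) set \<Rightarrow> (real^2 \<Rightarrow> 'v::real_normed_vector) \<Rightarrow> bool" where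
  "smooth_on U f \<longleftrightarrow> (\<forall>js. \<forall>x\<in>U. partials js f differentiable (at x))"

text \<open>
  Smoothness of a function given only on a (typically closed) set, such as the traction on
  the boundary curve: it is the restriction of a smooth function on a
  neighbourhood of the set.
\<close>

definition smooth_on_subset :: "(real^2) set \<Rightarrow> (real^2 \<Rightarrow> 'v::real_normed_vector) \<Rightarrow> bool" where
  "smooth_on_subset S f \<longleftrightarrow>
     (\<exists>U g. open U \<and> S \<subseteq> U \<and> smooth_on U g \<and> (\<forall>x\<in>S. g x = f x))"


section \<open>Vector-valued distributions\<close>

definition fun_support :: "(real^2 \<Rightarrow> real) \<Rightarrow> (real^2) set" where
  "fun_support \<phi> = closure {x. \<phi> x \<noteq> 0}"

definition test_functions :: "(real^2) set \<Rightarrow> (real^2 \<Rightarrow> real) set" where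
  "test_functions U =
     {\<phi>. smooth_on UNIV \<phi> \<and> compact (fun_support \<phi>) \<and> fun_support \<phi> \<subseteq> U}"

text \<open>
  A distribution on \<open>U\<close> with values in the subspace \<open>V\<close> is a continuous linear map from
  scalar test functions to \<open>V\<close>; only its values on \<^term>\<open>test_functions U\<close> matter, and two
  distributions on \<open>U\<close> are equal when they agree there. Continuity is expressed by the usual
  seminorm estimates on compact subsets.
\<close>

definition distributions ::
    "(real^2) set \<Rightarrow> 'v::euclidean_space set \<Rightarrow> ((real^2 \<Rightarrow> real) \<Rightarrow> 'v) set" where
  "distributions U V =
     {T. (\<forall>\<phi>\<in>test_functions U. T \<phi> \<in> V) \<and>
         (\<forall>\<phi>\<in>test_functions U. \<forall>\<psi>\<in>test_functions U. \<forall>a b.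
            T (\<lambda>x. a * \<phi> x + b * \<psi> x) = a *\<^sub>R T \<phi> + b *\<^sub>R T \<psi>) \<and>
         (\<forall>K. compact K \<and> K \<subseteq> U \<longrightarrow>
            (\<exists>c m. \<forall>\<phi>\<in>test_functions U. fun_support \<phi> \<subseteq> K \<longrightarrow>
               norm (T \<phi>) \<le> c * (\<Sum>js | length js \<le> m. SUP x. \<bar>partials js \<phi> x\<bar>)))}"

definition represented_on ::
    "(real^2) set \<Rightarrow> ((real^2 \<Rightarrow> real) \<Rightarrow> 'v::euclidean_space) \<Rightarrow> (real^2 \<Rightarrow> 'v) \<Rightarrow> bool" where
  "represented_on U T f \<longleftrightarrow>
     (\<forall>\<phi>\<in>test_functions U. T \<phi> = (\<integral>x. \<phi> x *\<^sub>R f x \<partial>lborel))"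

text \<open>The distributions on \<open>\<Omega>\<close> whose singular support is contained in the origin.\<close>

definition smooth_off_origin ::
    "(real^2) set \<Rightarrow> 'v::euclidean_space set \<Rightarrow> ((real^2 \<Rightarrow> real) \<Rightarrow> 'v) set" where
  "smooth_off_origin \<Omega> V =
     {T \<in> distributions \<Omega> V. \<exists>f. smooth_on (\<Omega> - {0}) f \<and> represented_on (\<Omega> - {0}) T f}"

definition distr_deriv ::
    "2 \<Rightarrow> ((real^2 \<Rightarrow> real) \<Rightarrow> 'v::euclidean_space) \<Rightarrow> (real^2 \<Rightarrow> real) \<Rightarrow> 'v" where
  "distr_deriv i T = (\<lambda>\<phi>. - T (partial i \<phi>))"

definition Div :: "((real^2 \<Rightarrow> real) \<Rightarrow> real^2^2) \<Rightarrow> (real^2 \<Rightarrow> real) \<Rightarrow> real^2" where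
  "Div \<sigma> = (\<lambda>\<phi>. \<chi> i. \<Sum>j\<in>UNIV. distr_deriv j (\<lambda>\<psi>. \<sigma> \<psi> $ i $ j) \<phi>)"

definition Curl :: "((real^2 \<Rightarrow> real) \<Rightarrow> real^2) \<Rightarrow> (real^2 \<Rightarrow> real) \<Rightarrow> real" where
  "Curl v = (\<lambda>\<phi>. distr_deriv 1 (\<lambda>\<psi>. v \<psi> $ 2) \<phi> - distr_deriv 2 (\<lambda>\<psi>. v \<psi> $ 1) \<phi>)"

definition Curl_tensor :: "((real^2 \<Rightarrow> real) \<Rightarrow> real^2^2) \<Rightarrow> (real^2 \<Rightarrow> real) \<Rightarrow> real^2" where
  "Curl_tensor E = (\<lambda>\<phi>. \<chi> i. Curl (\<lambda>\<psi>. E \<psi> $ i) \<phi>)"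


section \<open>Domain, elasticity tensor, and the stress problem\<close>

text \<open>
  \<open>n\<close> is the outward unit normal field on the boundary of the open set \<open>\<Omega>\<close>, whose boundary is
  of class \<open>C1\<close>: near each boundary point, \<open>\<Omega>\<close> is the sublevel set of a continuously
  differentiable function \<open>\<rho>\<close> whose gradient \<open>G\<close> has no zeros.
\<close>

definition outward_unit_normal :: "(real^2) set \<Rightarrow> (real^2 \<Rightarrow> real^2) \<Rightarrow> bool" where
  "outward_unit_normal \<Omega> n \<longleftrightarrow>
     (\<forall>p\<in>frontier \<Omega>. \<exists>U \<rho> G. open U \<and> p \<in> U \<and>
        (\<forall>x\<in>U. (\<rho> has_derivative (\<lambda>h. G x \<bullet> h)) (at x)) \<and>
        continuous_on U G \<and> (\<forall>x\<in>U. G x \<noteq> 0) \<and>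
        \<Omega> \<inter> U = {x \<in> U. \<rho> x < (0::real)} \<and>
        n p = G p /\<^sub>R norm (G p))"

definition Sym :: "(real^2^2) set" where
  "Sym = {V. transpose V = V}"

text \<open>
  The map \<open>C\<close> is only considered on \<^const>\<open>Sym\<close>. The library's inner product on
  \<^typ>\<open>real^2^2\<close> is the sum of the products of the entries.
\<close>

definition elasticity_tensor :: "(real^2^2 \<Rightarrow> real^2^2) \<Rightarrow> bool" where
  "elasticity_tensor C \<longleftrightarrow>
     (\<forall>V\<in>Sym. C V \<in> Sym) \<and>
     (\<forall>V\<in>Sym. \<forall>W\<in>Sym. C (V + W) = C V + C W) \<and>
     (\<forall>a. \<forall>V\<in>Sym. C (a *\<^sub>R V) = a *\<^sub>R C V) \<and>
     (\<forall>V\<in>Sym. \<forall>W\<in>Sym. C V \<bullet> W = C W \<bullet> V) \<and>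
     (\<forall>V\<in>Sym. V \<noteq> 0 \<longrightarrow> C V \<bullet> V > 0)"

text \<open>
  The pointwise condition \<open>\<sigma>n = t\<close>: the boundary value of \<open>\<sigma>\<close> at a boundary point is the
  limit, from inside \<open>\<Omega>\<close>, of the smooth function representing \<open>\<sigma>\<close> away from the origin.
\<close>

definition traction_condition ::
    "(real^2) set \<Rightarrow> (real^2 \<Rightarrow> real^2) \<Rightarrow> (real^2 \<Rightarrow> real^2) \<Rightarrow>
     ((real^2 \<Rightarrow> real) \<Rightarrow> real^2^2) \<Rightarrow> bool" where
  "traction_condition \<Omega> n t \<sigma> \<longleftrightarrow>
     (\<exists>f. smooth_on (\<Omega> - {0}) f \<and> represented_on (\<Omega> - {0}) \<sigma> f \<and>
        (\<forall>p\<in>frontier \<Omega>. \<exists>S. (f \<longlongrightarrow> S) (at p within \<Omega>) \<and> S *v n p = t p))"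

definition stress_solution ::
    "(real^2) set \<Rightarrow> (real^2 \<Rightarrow> real^2) \<Rightarrow> (real^2^2 \<Rightarrow> real^2^2) \<Rightarrow>
     ((real^2 \<Rightarrow> real) \<Rightarrow> real^2) \<Rightarrow> (real^2 \<Rightarrow> real^2) \<Rightarrow> ((real^2 \<Rightarrow> real) \<Rightarrow> real) \<Rightarrow>
     ((real^2 \<Rightarrow> real) \<Rightarrow> real^2^2) \<Rightarrow> bool" where
  "stress_solution \<Omega> n C B t N \<sigma> \<longleftrightarrow>
     \<sigma> \<in> smooth_off_origin \<Omega> Sym \<and>
     (\<forall>\<phi>\<in>test_functions \<Omega>. Div \<sigma> \<phi> + B \<phi> = 0) \<and>
     (\<forall>\<phi>\<in>test_functions \<Omega>. Curl (Curl_tensor (\<lambda>\<psi>. inv_into Sym C (\<sigma> \<psi>))) \<phi> = N \<phi>) \<and>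
     traction_condition \<Omega> n t \<sigma>"

end

theory Submission
  imports Defs "HOL-Complex_Analysis.Complex_Analysis" "HOL-Real_Asymp.Real_Asymp"
    "HOL-Computational_Algebra.Fundamental_Theorem_Algebra"
begin

text \<open>
  By linearity consider the difference \<open>\<sigma>\<close> of two solutions. Equilibrium and compatibility
  imply that every component of \<open>\<sigma>\<close> is annihilated by a scalar homogeneous elliptic operator
  of order four with constant coefficients. Its symbol is a positive quartic form, hence a product
  of two positive quadratic forms, and a second-order elliptic operator with an explicit logarithmic
  fundamental solution only admits removable singularities of distributional solutions. So
  \<open>\<sigma>\<close> is smooth in \<open>\<Omega>\<close>, including the origin.

  As its normal trace vanishes, the extension of \<open>\<sigma>\<close> by zero is weakly divergence free in
  the plane and has an Airy potential \<open>\<phi>\<close> with bounded second derivatives. The exterior of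
  a simply connected domain with \<open>C\<^sup>1\<close> boundary is connected, so \<open>\<phi>\<close> can be taken
  to vanish there. Then \<open>\<phi>\<close> is an admissible test function in
  \<open>Curl Curl (C\<^sup>-\<^sup>1 \<sigma>) = 0\<close>, and this gives \<open>\<integral> \<langle>C\<^sup>-\<^sup>1 \<sigma>, \<sigma>\<rangle> = 0\<close>.
\<close>

text \<open>The obstacle is the boundary. There a solution is known only through the limits of its
  values: its derivatives are not controlled, and the normal is merely continuous. Hence the zero
  traction of the difference is turned into a weak identity by cutting off along level sets of a
  defining function. For the same reason the Airy potential is mollified and multiplied by a cutoff
  before it enters the compatibility equation. On a layer of width e along the boundary the first
  and second derivatives of the cutoff are of size 1/e and 1/e^2, while the gradient of the
  potential and the potential itself are of size e and e^2; so the error is bounded on the layer,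
  whose area tends to 0.

  Factoring the symbol avoids a fundamental solution of order four: regularity for one quadratic
  factor, with a smooth right-hand side, is applied twice. For a factor with coefficient matrix A
  the fundamental solution is a multiple of ln q, q the form of the adjugate of A. It arises as the
  limit of ln (q + e^2), which the operator maps to a nonnegative kernel concentrating at the
  origin.\<close>

no_notation fps_nth (infixl "$" 75)

section \<open>Smooth functions and test functions\<close>

lemma partial_eqI:
  assumes "(f has_derivative f') (at x)"
  shows "partial i f x = f' (axis i 1)"
  unfolding partial_def using frechet_derivative_at[OF assms] by simp

lemma has_derivative_partial:
  assumes "f differentiable (at x)"
  shows "(f has_derivative (\<lambda>h. h $ 1 *\<^sub>R partial 1 f x + h $ 2 *\<^sub>R partial 2 f x)) (at x)"
proof -
  obtain f' where f': "(f has_derivative f') (at x)"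
    using assms unfolding differentiable_def by blast
  have "f' h = h $ 1 *\<^sub>R partial 1 f x + h $ 2 *\<^sub>R partial 2 f x" for h
  proof -
    have h: "h = h $ 1 *\<^sub>R axis 1 1 + h $ 2 *\<^sub>R axis 2 1"
      by (simp add: vec_eq_iff axis_def forall_2)
    interpret bounded_linear f' using f' by (rule has_derivative_bounded_linear)
    show ?thesis
      by (subst h) (simp only: add scaleR partial_eqI[OF f'])
  qed
  then show ?thesis using f' by (metis (no_types, lifting) ext)
qed

lemma partial_cong_open:
  assumes "open U" "x \<in> U" "\<And>y. y \<in> U \<Longrightarrow> f y = g y"
  shows "partial i f x = partial i g x"
proof -
  have "(f has_derivative D) (at x) \<longleftrightarrow> (g has_derivative D) (at x)" for D
    using has_derivative_transform_within_open[of f D x UNIV U g]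
      has_derivative_transform_within_open[of g D x UNIV U f] assms by auto
  then show ?thesis by (simp add: partial_def frechet_derivative_def)
qed

lemma differentiable_cong_open:
  assumes "open U" "x \<in> U" "\<And>y. y \<in> U \<Longrightarrow> f y = g y" "f differentiable (at x)"
  shows "g differentiable (at x)"
  using has_derivative_transform_within_open[of f _ x UNIV U g] assms
  by (force simp: differentiable_def)

text \<open>\<open>smooth_on\<close> speaks of all orders at once and so offers no induction, since
  the derivative of a product or an inverse again contains the functions themselves. With a finite
  order, and the recursion on the innermost derivative, the closure rules follow by induction on
  \<open>n\<close> with the functions arbitrary.\<close>

primrec times_differentiable_on :: "nat \<Rightarrow> (real^2) set \<Rightarrow> (real^2 \<Rightarrow> 'v::real_normed_vector) \<Rightarrow> bool"
    where
  "times_differentiable_on 0 U f = True"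
| "times_differentiable_on (Suc n) U f =
     ((\<forall>x\<in>U. f differentiable (at x)) \<and> (\<forall>i. times_differentiable_on n U (partial i f)))"

lemma partials_snoc: "partials (js @ [i]) f = partials js (partial i f)"
  by (induction js) auto

lemma times_differentiable_on_iff_partials:
  "times_differentiable_on n U f \<longleftrightarrow>
     (\<forall>js. length js < n \<longrightarrow> (\<forall>x\<in>U. partials js f differentiable (at x)))"
proof (induction n arbitrary: f)
  case (Suc n)
  have "(\<forall>js. length js < Suc n \<longrightarrow> P js) \<longleftrightarrow> P [] \<and> (\<forall>i js. length js < n \<longrightarrow> P (js @ [i]))"
    for P :: "2 list \<Rightarrow> bool"
  proof safe
    fix js :: "2 list" assume "P []" "\<forall>i js. length js < n \<longrightarrow> P (js @ [i])" "length js < Suc n"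
    then show "P js" by (cases js rule: rev_cases) auto
  qed auto
  from this[of "\<lambda>js. \<forall>x\<in>U. partials js f differentiable (at x)"] Suc show ?case
    by (simp add: partials_snoc)
qed simp

lemma smooth_on_iff: "smooth_on U f \<longleftrightarrow> (\<forall>n. times_differentiable_on n U f)"
  unfolding smooth_on_def times_differentiable_on_iff_partials by blast

lemma times_differentiable_on_mono_nat:
  "times_differentiable_on n U f \<Longrightarrow> m \<le> n \<Longrightarrow> times_differentiable_on m U f"
  unfolding times_differentiable_on_iff_partials by auto

lemma times_differentiable_on_cong:
  assumes "open U" "\<And>x. x \<in> U \<Longrightarrow> f x = g x" "times_differentiable_on n U f"
  shows "times_differentiable_on n U g"
  using assms(2,3)
proof (induction n arbitrary: f g)
  case (Suc n)
  have "partial i f x = partial i g x" if "x \<in> U" for i x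
    using partial_cong_open[OF assms(1) that] Suc.prems(1) by blast
  moreover have "g differentiable (at x)" if "x \<in> U" for x
    using differentiable_cong_open[OF assms(1) that] Suc.prems that by auto
  ultimately show ?case using Suc.IH[of "partial _ f"] Suc.prems(2) by auto
qed simp

lemma smooth_on_cong:
  assumes "open U" "\<And>x. x \<in> U \<Longrightarrow> f x = g x" "smooth_on U f"
  shows "smooth_on U g"
  using assms times_differentiable_on_cong unfolding smooth_on_iff by blast

lemma smooth_on_differentiable: "smooth_on U f \<Longrightarrow> x \<in> U \<Longrightarrow> f differentiable (at x)"
  unfolding smooth_on_def using partials.simps(1) by metis

lemma smooth_on_partial: "smooth_on U f \<Longrightarrow> smooth_on U (partial i f)"
  unfolding smooth_on_def using partials_snoc by metis

lemma smooth_on_subset: "smooth_on U f \<Longrightarrow> V \<subseteq> U \<Longrightarrow> smooth_on V f"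
  unfolding smooth_on_def by blast

lemma smooth_on_Un: "smooth_on U f \<Longrightarrow> smooth_on V f \<Longrightarrow> smooth_on (U \<union> V) f"
  unfolding smooth_on_def by blast

lemma smooth_on_continuous_on: "smooth_on U f \<Longrightarrow> continuous_on U f"
  by (meson continuous_at_imp_continuous_on differentiable_imp_continuous_within
      smooth_on_differentiable)

lemma times_differentiable_onI:
  assumes "open U" "\<And>x. x \<in> U \<Longrightarrow> (f has_derivative f' x) (at x)"
    and "\<And>i. times_differentiable_on n U (\<lambda>x. f' x (axis i 1))"
  shows "times_differentiable_on (Suc n) U f"
proof -
  have "times_differentiable_on n U (partial i f)" for i
    by (rule times_differentiable_on_cong[OF assms(1) _ assms(3)[of i]])
       (simp add: partial_eqI[OF assms(2)])
  then show ?thesis using assms(2) by (auto simp: differentiable_def)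
qed

lemma has_derivative_frechet:
  "f differentiable (at x) \<Longrightarrow> (f has_derivative frechet_derivative f (at x)) (at x)"
  by (simp add: frechet_derivative_works)

lemma times_differentiable_on_const: "times_differentiable_on n UNIV (\<lambda>x. c)"
proof (induction n arbitrary: c)
  case (Suc n)
  show ?case
    by (rule times_differentiable_onI[OF open_UNIV has_derivative_const]) (rule Suc)
qed simp

lemma times_differentiable_on_bounded_linear:
  assumes "open U" "bounded_linear L" "times_differentiable_on n U f"
  shows "times_differentiable_on n U (\<lambda>x. L (f x))"
  using assms(3)
proof (induction n arbitrary: f)
  case (Suc n)
  show ?case
    by (rule times_differentiable_onI[OF assms(1)
          bounded_linear.has_derivative[OF assms(2) has_derivative_frechet]])
       (use Suc in \<open>auto simp: partial_def\<close>)
qed simp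

lemma times_differentiable_on_add:
  assumes "open U" "times_differentiable_on n U f" "times_differentiable_on n U g"
  shows "times_differentiable_on n U (\<lambda>x. f x + g x)"
  using assms(2,3)
proof (induction n arbitrary: f g)
  case (Suc n)
  show ?case
    by (rule times_differentiable_onI[OF assms(1)
          has_derivative_add[OF has_derivative_frechet has_derivative_frechet]])
       (use Suc in \<open>auto simp: partial_def\<close>)
qed simp

lemma times_differentiable_on_mult:
  fixes f g :: "real^2 \<Rightarrow> real"
  assumes "open U" "times_differentiable_on n U f" "times_differentiable_on n U g"
  shows "times_differentiable_on n U (\<lambda>x. f x * g x)"
  using assms(2,3)
proof (induction n arbitrary: f g)
  case (Suc n)
  have 1: "times_differentiable_on n U f" "times_differentiable_on n U g"
    using times_differentiable_on_mono_nat[of "Suc n" U _ n] Suc.prems by auto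
  have "times_differentiable_on n U (\<lambda>x. f x * partial i g x + partial i f x * g x)" for i
    using Suc 1 by (intro times_differentiable_on_add[OF assms(1)]) auto
  then show ?case
    by (intro times_differentiable_onI[OF assms(1)
          has_derivative_mult[OF has_derivative_frechet has_derivative_frechet]])
       (use Suc in \<open>auto simp: partial_def\<close>)
qed simp

lemma smooth_on_const [simp]: "smooth_on U (\<lambda>x. c)"
  by (rule smooth_on_subset[of UNIV]) (simp_all add: smooth_on_iff times_differentiable_on_const)

lemma smooth_on_bounded_linear:
  "open U \<Longrightarrow> bounded_linear L \<Longrightarrow> smooth_on U f \<Longrightarrow> smooth_on U (\<lambda>x. L (f x))"
  using times_differentiable_on_bounded_linear unfolding smooth_on_iff by blast

lemma smooth_on_add:
  "open U \<Longrightarrow> smooth_on U f \<Longrightarrow> smooth_on U g \<Longrightarrow> smooth_on U (\<lambda>x. f x + g x)"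
  using times_differentiable_on_add unfolding smooth_on_iff by blast

lemma smooth_on_mult:
  fixes f g :: "real^2 \<Rightarrow> real"
  shows "open U \<Longrightarrow> smooth_on U f \<Longrightarrow> smooth_on U g \<Longrightarrow> smooth_on U (\<lambda>x. f x * g x)"
  using times_differentiable_on_mult unfolding smooth_on_iff by blast

lemma smooth_on_minus: "open U \<Longrightarrow> smooth_on U f \<Longrightarrow> smooth_on U (\<lambda>x. - f x)"
  by (rule smooth_on_bounded_linear[OF _ bounded_linear_minus[OF bounded_linear_ident]])

lemma smooth_on_diff:
  assumes "open U" "smooth_on U f" "smooth_on U g" shows "smooth_on U (\<lambda>x. f x - g x)"
  using smooth_on_add[OF assms(1,2) smooth_on_minus[OF assms(1,3)]] by simp

lemma smooth_on_coordinate: "smooth_on U (\<lambda>x. x $ i)"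
proof -
  have "times_differentiable_on n UNIV (\<lambda>x::real^2. x $ i)" for n
  proof (cases n)
    case (Suc m)
    show ?thesis unfolding Suc
      by (rule times_differentiable_onI[OF open_UNIV
            bounded_linear.has_derivative[OF bounded_linear_vec_nth has_derivative_ident]])
         (rule times_differentiable_on_const)
  qed simp
  then have "smooth_on UNIV (\<lambda>x::real^2. x $ i)" by (simp add: smooth_on_iff)
  then show ?thesis using smooth_on_subset by blast
qed

lemma has_derivative_affine_compose:
  fixes f :: "real^2 \<Rightarrow> 'v::real_normed_vector"
  assumes "f differentiable (at (c + s *\<^sub>R x))"
  shows "((\<lambda>x. f (c + s *\<^sub>R x)) has_derivative
      (\<lambda>h. frechet_derivative f (at (c + s *\<^sub>R x)) (s *\<^sub>R h))) (at x)"
proof -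
  have "((\<lambda>x. c + s *\<^sub>R x) has_derivative (\<lambda>h. s *\<^sub>R h)) (at x)"
    by (auto intro!: derivative_eq_intros)
  from has_derivative_compose[OF this has_derivative_frechet[OF assms]] show ?thesis .
qed

lemma partial_affine_compose:
  assumes "f differentiable (at (c + s *\<^sub>R x))"
  shows "partial i (\<lambda>x. f (c + s *\<^sub>R x)) x = s *\<^sub>R partial i f (c + s *\<^sub>R x)"
  using partial_eqI[OF has_derivative_affine_compose[OF assms], of i]
    linear_scale[OF has_derivative_linear[OF has_derivative_frechet[OF assms]]]
  by (simp add: partial_def)

lemma smooth_on_affine_compose:
  fixes f :: "real^2 \<Rightarrow> 'v::real_normed_vector"
  assumes "smooth_on UNIV f"
  shows "smooth_on UNIV (\<lambda>x. f (c + s *\<^sub>R x))"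
proof -
  have "times_differentiable_on n UNIV (\<lambda>x. f (c + s *\<^sub>R x))"
    if "times_differentiable_on n UNIV f" for n
    using that
  proof (induction n arbitrary: f)
    case (Suc n)
    have eq: "frechet_derivative f (at (c + s *\<^sub>R x)) (s *\<^sub>R axis i 1) = s *\<^sub>R partial i f (c + s
        *\<^sub>R x)" for i x
      using Suc.prems linear_scale[OF has_derivative_linear[OF has_derivative_frechet], of f "c + s
          *\<^sub>R x" s "axis i 1"]
      by (auto simp: partial_def)
    show ?case
      by (rule times_differentiable_onI[OF open_UNIV has_derivative_affine_compose])
         (use Suc eq in \<open>auto intro!: times_differentiable_on_bounded_linear
            [OF open_UNIV bounded_linear_scaleR_right]\<close>)
  qed simp
  then show ?thesis using assms by (simp add: smooth_on_iff)
qed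

lemma partial_add:
  assumes "f differentiable (at x)" "g differentiable (at x)"
  shows "partial i (\<lambda>x. f x + g x) x = partial i f x + partial i g x"
  using partial_eqI[OF has_derivative_add[OF has_derivative_frechet[OF assms(1)]
      has_derivative_frechet[OF assms(2)]]]
  by (simp add: partial_def)

lemma partial_bounded_linear:
  assumes "bounded_linear L" "f differentiable (at x)"
  shows "partial i (\<lambda>x. L (f x)) x = L (partial i f x)"
  using partial_eqI[OF bounded_linear.has_derivative[OF assms(1) has_derivative_frechet[OF
      assms(2)]]]
  by (simp add: partial_def)

lemma partial_cmult:
  fixes f :: "real^2 \<Rightarrow> real"
  assumes "f differentiable (at x)"
  shows "partial i (\<lambda>x. c * f x) x = c * partial i f x"
  by (rule partial_bounded_linear[OF bounded_linear_mult_right assms])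

lemma partial_mult:
  fixes f g :: "real^2 \<Rightarrow> real"
  assumes "f differentiable (at x)" "g differentiable (at x)"
  shows "partial i (\<lambda>x. f x * g x) x = f x * partial i g x + partial i f x * g x"
  using partial_eqI[OF has_derivative_mult[OF has_derivative_frechet[OF assms(1)]
      has_derivative_frechet[OF assms(2)]]]
  by (simp add: partial_def)

lemma partial_const [simp]: "partial i (\<lambda>x. c) = (\<lambda>x. 0)"
  by (rule ext) (rule partial_eqI[OF has_derivative_const])

lemma partial_has_real_derivative:
  fixes f :: "real^2 \<Rightarrow> real"
  assumes "f differentiable (at (x + t *\<^sub>R axis i 1))"
  shows "((\<lambda>t. f (x + t *\<^sub>R axis i 1)) has_real_derivative partial i f (x + t *\<^sub>R axis i 1)) (at t)"
proof -
  have "((\<lambda>t. x + t *\<^sub>R axis i 1) has_derivative (\<lambda>h. h *\<^sub>R axis i 1)) (at t)"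
    by (auto intro!: derivative_eq_intros)
  from has_derivative_compose[OF this has_derivative_frechet[OF assms]]
  have "((\<lambda>t. f (x + t *\<^sub>R axis i 1)) has_derivative
      (\<lambda>h. frechet_derivative f (at (x + t *\<^sub>R axis i 1)) (h *\<^sub>R axis i 1))) (at t)" .
  moreover have "frechet_derivative f (at (x + t *\<^sub>R axis i 1)) (h *\<^sub>R axis i 1)
      = partial i f (x + t *\<^sub>R axis i 1) * h" for h
    using linear_scale[OF has_derivative_linear[OF has_derivative_frechet[OF assms]]]
    by (simp add: partial_def)
  ultimately show ?thesis by (simp add: has_field_derivative_def)
qed

text \<open>The second difference quotient of \<open>f\<close> over a small rectangle is, by the mean value theorem,
  a value of either mixed derivative; continuity then identifies the two at the corner.\<close>

lemma second_difference_mvt: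
  fixes f :: "real^2 \<Rightarrow> real"
  assumes "smooth_on UNIV f" "h > 0"
  shows "\<exists>s t. 0 < s \<and> s < h \<and> 0 < t \<and> t < h \<and>
    f (x + h *\<^sub>R axis i 1 + h *\<^sub>R axis j 1) - f (x + h *\<^sub>R axis i 1) - f (x + h *\<^sub>R axis j 1) + f x
      = h * h * partial j (partial i f) (x + s *\<^sub>R axis i 1 + t *\<^sub>R axis j 1)"
proof -
  have d: "f differentiable (at y)" "partial i f differentiable (at y)" for y
    using assms(1) by (auto intro: smooth_on_differentiable[of UNIV] smooth_on_partial)
  \<comment> \<open>\<open>g h - g 0\<close> is the second difference. The mean value theorem is
    applied to it in direction \<open>i\<close>, and then to \<open>g'\<close> in direction
    \<open>j\<close>.\<close>
  define g where "g s = f ((x + h *\<^sub>R axis j 1) + s *\<^sub>R axis i 1) - f (x + s *\<^sub>R axis i 1)" for s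
  define g' where "g' s = partial i f ((x + h *\<^sub>R axis j 1) + s *\<^sub>R axis i 1) - partial i f (x + s
      *\<^sub>R axis i 1)" for s
  have "(g has_real_derivative g' s) (at s)" for s
    unfolding g_def g'_def by (intro DERIV_diff partial_has_real_derivative d)
  then obtain s where s: "0 < s" "s < h" "g h - g 0 = (h - 0) * g' s"
    using MVT2[of 0 h g g'] assms(2) by auto
  obtain t where t: "0 < t" "t < h" "partial i f ((x + s *\<^sub>R axis i 1) + h *\<^sub>R axis j 1) - partial i
      f (x + s *\<^sub>R axis i 1 + 0 *\<^sub>R axis j 1)
      = (h - 0) * partial j (partial i f) (x + s *\<^sub>R axis i 1 + t *\<^sub>R axis j 1)"
    using MVT2[OF assms(2) partial_has_real_derivative[OF d(2)], of "x + s *\<^sub>R axis i 1" j] by auto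
  have "g' s = h * partial j (partial i f) (x + s *\<^sub>R axis i 1 + t *\<^sub>R axis j 1)"
    using t(3) by (simp add: g'_def algebra_simps)
  then have "g h - g 0 = h * h * partial j (partial i f) (x + s *\<^sub>R axis i 1 + t *\<^sub>R axis j 1)"
    using s(3) by simp
  then show ?thesis using s(1,2) t(1,2)
    by (intro exI[of _ s] exI[of _ t]) (simp add: g_def algebra_simps)
qed

lemma partial_commute:
  fixes f :: "real^2 \<Rightarrow> real"
  assumes "smooth_on UNIV f"
  shows "partial i (partial j f) = partial j (partial i f)"
proof
  fix x
  have lim: "(\<lambda>n. partial b (partial a f) (x + s n *\<^sub>R axis a 1 + t n *\<^sub>R axis b 1)) \<longlonglongrightarrow> partial b
      (partial a f) x"
    if st: "\<And>n. 0 < s n \<and> s n < 1 / Suc n \<and> 0 < t n \<and> t n < 1 / Suc n" for s t :: "nat \<Rightarrow> real" and a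
        b
  proof -
    have z: "(\<lambda>n. 1 / Suc n) \<longlonglongrightarrow> 0" by (rule LIMSEQ_Suc[OF lim_const_over_n[of 1]])
    have s: "s \<longlonglongrightarrow> 0" "t \<longlonglongrightarrow> 0"
      by (rule tendsto_sandwich[OF _ _ tendsto_const z]; use st in \<open>auto intro!: always_eventually
          less_imp_le\<close>)+
    have l: "(\<lambda>n. x + s n *\<^sub>R axis a 1 + t n *\<^sub>R axis b 1) \<longlonglongrightarrow> x + 0 *\<^sub>R axis a 1 + 0 *\<^sub>R axis b 1"
      by (intro tendsto_intros s)
    have "isCont (partial b (partial a f)) x"
      using assms by (meson UNIV_I differentiable_imp_continuous_within smooth_on_differentiable
          smooth_on_partial)
    from isCont_tendsto_compose[OF this] l show ?thesis by simp
  qed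
  \<comment> \<open>This quantity is symmetric in \<open>a\<close> and \<open>b\<close>, whereas its
    rescaled limit is one mixed derivative or the other according to the order of the
    arguments.\<close>
  define D where "D a b n = f (x + (1/Suc n) *\<^sub>R axis a 1 + (1/Suc n) *\<^sub>R axis b 1)
      - f (x + (1/Suc n) *\<^sub>R axis a 1) - f (x + (1/Suc n) *\<^sub>R axis b 1) + f x" for a b and n :: nat
  have lims: "(\<lambda>n. D a b n * (Suc n * Suc n)) \<longlonglongrightarrow> partial b (partial a f) x" for a b
  proof -
    have "\<forall>n. \<exists>s t. 0 < s \<and> s < 1 / Suc n \<and> 0 < t \<and> t < 1 / Suc n \<and>
      D a b n = (1/Suc n) * (1/Suc n) * partial b (partial a f) (x + s *\<^sub>R axis a 1 + t *\<^sub>R axis b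
          1)"
      unfolding D_def by (intro allI second_difference_mvt assms) simp
    then obtain s t where st: "\<And>n. 0 < s n \<and> s n < 1 / Suc n \<and> 0 < t n \<and> t n < 1 / Suc n"
      and D: "\<And>n. D a b n = (1/Suc n) * (1/Suc n) * partial b (partial a f) (x + s n *\<^sub>R axis a 1 +
          t n *\<^sub>R axis b 1)"
      by metis
    have "D a b n * (Suc n * Suc n) = partial b (partial a f) (x + s n *\<^sub>R axis a 1 + t n *\<^sub>R axis b
        1)" for n
    proof -
      have "1 / real (Suc n) * (1 / real (Suc n)) * z * real (Suc n * Suc n) = z" for z
        unfolding of_nat_mult by (simp add: field_simps del: of_nat_Suc)
      then show ?thesis unfolding D .
    qed
    then show ?thesis using lim[OF st] by simp
  qed
  have "D i j n = D j i n" for n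
    unfolding D_def by (simp add: algebra_simps)
  then show "partial i (partial j f) x = partial j (partial i f) x"
    using lims[of i j] lims[of j i] LIMSEQ_unique by (metis (no_types, lifting) ext)
qed

text \<open>The powers of 1/t are included because the span of the whole family is closed under
  differentiation; smoothness then follows by induction on the order, for all \<open>k\<close>
  simultaneously.\<close>

definition exp_bump :: "nat \<Rightarrow> real \<Rightarrow> real" where
  "exp_bump k t = (if t > 0 then (1/t)^k * exp (- (1/t)) else 0)"

lemma exp_bump_tendsto_0: "(exp_bump k \<longlongrightarrow> 0) (at 0)"
proof -
  have "((\<lambda>t::real. (1/t)^k * exp (- (1/t))) \<longlongrightarrow> 0) (at_right 0)"
    by real_asymp
  moreover have "\<forall>\<^sub>F t in at_right 0. (1/t)^k * exp (- (1/t)) = exp_bump k t"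
    by (auto simp: eventually_at_filter exp_bump_def)
  ultimately have "(exp_bump k \<longlongrightarrow> 0) (at_right 0)"
    by (rule Lim_transform_eventually)
  moreover have "\<forall>\<^sub>F t in at_left 0. 0 = exp_bump k t"
    by (auto simp: eventually_at_filter exp_bump_def)
  then have "(exp_bump k \<longlongrightarrow> 0) (at_left 0)"
    by (rule Lim_transform_eventually[OF tendsto_const])
  ultimately show ?thesis by (simp add: filterlim_split_at)
qed

lemma exp_bump_has_real_derivative:
  "(exp_bump k has_real_derivative exp_bump (k+2) t - k * exp_bump (k+1) t) (at t)"
proof -
  consider "t > 0" | "t < 0" | "t = 0" by linarith
  then show ?thesis
  proof cases
    case 1
    have u: "((\<lambda>t. 1/t) has_real_derivative - (1/t * (1/t))) (at t)"
      using 1 by (auto intro!: derivative_eq_intros)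
    have "((\<lambda>t. (1/t)^k * exp (- (1/t))) has_real_derivative
        (k * (1/t)^(k-1) * (- (1/t * (1/t)))) * exp (- (1/t)) + (exp (- (1/t)) * (1/t * (1/t))) *
            (1/t)^k) (at t)"
      using DERIV_mult[OF DERIV_power[OF u] DERIV_fun_exp[OF DERIV_minus[OF u]]] by simp
    also have "(k * (1/t)^(k-1) * (- (1/t * (1/t)))) * exp (- (1/t)) + (exp (- (1/t)) * (1/t *
        (1/t))) * (1/t)^k
        = exp_bump (k+2) t - k * exp_bump (k+1) t"
    proof -
      define v where "v = 1/t"
      have v: "real k * v^(k-1) * (- (v * v)) = - (real k * v^(k+1))" by (cases k) auto
      show ?thesis using 1 unfolding exp_bump_def v_def[symmetric] v
        by (simp add: algebra_simps)
    qed
    finally have "((\<lambda>t. (1/t)^k * exp (- (1/t))) has_real_derivative exp_bump (k+2) t - k * exp_bump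
        (k+1) t) (at t)" .
    then show ?thesis
      by (rule has_field_derivative_transform_within_open[where S = "{0<..}"])
         (use 1 in \<open>auto simp: exp_bump_def\<close>)
  next
    case 2
    have "((\<lambda>t. 0) has_real_derivative 0) (at t)" by simp
    then have "(exp_bump k has_real_derivative 0) (at t)"
      by (rule has_field_derivative_transform_within_open[where S = "{..<0}"])
         (use 2 in \<open>auto simp: exp_bump_def\<close>)
    then show ?thesis using 2 by (simp add: exp_bump_def)
  next
    case 3
    \<comment> \<open>At 0 the difference quotient is itself the next member of the family, whose
      limit is already known.\<close>
    have "exp_bump (Suc k) h = (exp_bump k (0 + h) - exp_bump k 0) / h" for h
      by (simp add: exp_bump_def field_simps)
    then have "((\<lambda>h. (exp_bump k (0 + h) - exp_bump k 0) / h) \<longlongrightarrow> 0) (at 0)"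
      using exp_bump_tendsto_0[of "Suc k"] by presburger
    then show ?thesis using 3 by (simp add: DERIV_def exp_bump_def)
  qed
qed

lemma smooth_on_exp_bump_compose:
  assumes "smooth_on UNIV g"
  shows "smooth_on UNIV (\<lambda>x. exp_bump k (g x))"
proof -
  have "times_differentiable_on n UNIV (\<lambda>x. exp_bump k (g x))" for n
  proof (induction n arbitrary: k)
    case (Suc n)
    have g: "(g has_derivative frechet_derivative g (at x)) (at x)" for x
      using assms by (intro has_derivative_frechet smooth_on_differentiable) auto
    have c: "(\<lambda>x. exp_bump (k+2) (g x) + (- k) * exp_bump (k+1) (g x)) = (\<lambda>x. exp_bump (k+2) (g x) -
        k * exp_bump (k+1) (g x))"
      by simp
    have "times_differentiable_on n UNIV (\<lambda>x. exp_bump (k+2) (g x) + (- k) * exp_bump (k+1) (g x))"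
      by (intro times_differentiable_on_add times_differentiable_on_mult
          times_differentiable_on_const Suc open_UNIV)
    then have "times_differentiable_on n UNIV (\<lambda>x. partial i g x * (exp_bump (k+2) (g x) - k *
        exp_bump (k+1) (g x)))" for i
      unfolding c using smooth_on_partial[OF assms]
      by (intro times_differentiable_on_mult) (auto simp: smooth_on_iff)
    then show ?case
      by (intro times_differentiable_onI[OF open_UNIV
           DERIV_compose_FDERIV[OF exp_bump_has_real_derivative g]]) (simp add: partial_def)
  qed simp
  then show ?thesis by (simp add: smooth_on_iff)
qed

section \<open>Supports and test functions\<close>

lemma fun_support_eq_0: "x \<notin> fun_support f \<Longrightarrow> f x = 0"
  using closure_subset[of "{x. f x \<noteq> 0}"] unfolding fun_support_def by auto

lemma closed_fun_support [simp]: "closed (fun_support f)"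
  by (simp add: fun_support_def)

lemma fun_support_subsetI: "closed K \<Longrightarrow> (\<And>x. x \<notin> K \<Longrightarrow> f x = 0) \<Longrightarrow> fun_support f \<subseteq> K"
  unfolding fun_support_def by (rule closure_minimal) auto

lemma partial_eq_0_off: 
  assumes "closed K" "\<And>x. x \<notin> K \<Longrightarrow> f x = 0" "x \<notin> K"
  shows "partial i f x = 0"
proof -
  have "partial i f x = partial i (\<lambda>x. 0) x"
    by (rule partial_cong_open[of "- K"]) (use assms in auto)
  then show ?thesis by simp
qed

lemma test_functionsI:
  assumes "smooth_on UNIV \<phi>" "compact K" "K \<subseteq> U" "\<And>x. x \<notin> K \<Longrightarrow> \<phi> x = 0"
  shows "\<phi> \<in> test_functions U"
proof -
  have "fun_support \<phi> \<subseteq> K"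
    using assms by (intro fun_support_subsetI compact_imp_closed)
  then show ?thesis
    using assms compact_Int_closed[OF assms(2), of "fun_support \<phi>"]
    by (auto simp: test_functions_def Int_absorb1)
qed

lemma test_functionsE:
  assumes "\<phi> \<in> test_functions U"
  obtains K where "compact K" "K \<subseteq> U" "\<And>x. x \<notin> K \<Longrightarrow> \<phi> x = 0" "smooth_on UNIV \<phi>"
  using assms fun_support_eq_0 unfolding test_functions_def by blast

lemma test_functions_smooth: "\<phi> \<in> test_functions U \<Longrightarrow> smooth_on V \<phi>"
  using smooth_on_subset unfolding test_functions_def by blast

lemma test_functions_differentiable: "\<phi> \<in> test_functions U \<Longrightarrow> \<phi> differentiable (at x)"
  using test_functions_smooth smooth_on_differentiable by blast

lemma test_functions_eq_0: "\<phi> \<in> test_functions U \<Longrightarrow> x \<notin> U \<Longrightarrow> \<phi> x = 0"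
  by (metis subsetD test_functionsE)

lemma test_functions_mono: "\<phi> \<in> test_functions U \<Longrightarrow> U \<subseteq> V \<Longrightarrow> \<phi> \<in> test_functions V"
  unfolding test_functions_def by blast

lemma test_functions_partial:
  assumes "\<phi> \<in> test_functions U"
  shows "partial i \<phi> \<in> test_functions U"
proof -
  obtain K where K: "compact K" "K \<subseteq> U" "\<And>x. x \<notin> K \<Longrightarrow> \<phi> x = 0" "smooth_on UNIV \<phi>"
    using assms by (metis test_functionsE)
  then show ?thesis
    using partial_eq_0_off[OF compact_imp_closed[OF K(1)], of \<phi>]
    by (intro test_functionsI[of _ K] smooth_on_partial) auto
qed

lemma test_functions_add:
  assumes "\<phi> \<in> test_functions U" "\<psi> \<in> test_functions U"
  shows "(\<lambda>x. \<phi> x + \<psi> x) \<in> test_functions U"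
proof -
  obtain K L where "compact K" "K \<subseteq> U" "\<And>x. x \<notin> K \<Longrightarrow> \<phi> x = 0" "smooth_on UNIV \<phi>"
    "compact L" "L \<subseteq> U" "\<And>x. x \<notin> L \<Longrightarrow> \<psi> x = 0" "smooth_on UNIV \<psi>"
    using assms by (metis test_functionsE)
  then show ?thesis
    by (intro test_functionsI[of _ "K \<union> L"] smooth_on_add) auto
qed

text \<open>The smooth factor may take arbitrary values outside \<open>U\<close>, where the product vanishes.\<close>

lemma test_functions_mult:
  assumes "open U" "smooth_on U f" "\<phi> \<in> test_functions U"
  shows "(\<lambda>x. f x * \<phi> x) \<in> test_functions U"
proof -
  obtain K where K: "compact K" "K \<subseteq> U" "\<And>x. x \<notin> K \<Longrightarrow> \<phi> x = 0" "smooth_on UNIV \<phi>"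
    using assms(3) by (metis test_functionsE)
  have "smooth_on U (\<lambda>x. f x * \<phi> x)"
    using assms K by (intro smooth_on_mult) (auto intro: smooth_on_subset[of UNIV])
  moreover have "smooth_on (- K) (\<lambda>x. f x * \<phi> x)"
    by (rule smooth_on_cong[OF _ _ smooth_on_const[of _ 0]]) (use K compact_imp_closed in auto)
  ultimately have "smooth_on (U \<union> - K) (\<lambda>x. f x * \<phi> x)" by (rule smooth_on_Un)
  moreover have "U \<union> - K = UNIV" using K(2) by auto
  ultimately show ?thesis using K by (intro test_functionsI[of _ K]) auto
qed

lemma test_functions_cmult:
  "\<phi> \<in> test_functions U \<Longrightarrow> (\<lambda>x. c * \<phi> x) \<in> test_functions U"
proof -
  assume "\<phi> \<in> test_functions U"
  then obtain K where K: "compact K" "K \<subseteq> U" "\<And>x. x \<notin> K \<Longrightarrow> \<phi> x = 0" "smooth_on UNIV \<phi>"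
    by (metis test_functionsE)
  then show "(\<lambda>x. c * \<phi> x) \<in> test_functions U"
    by (intro test_functionsI[of _ K] smooth_on_mult smooth_on_const open_UNIV) auto
qed

lemma test_functions_diff:
  assumes "\<phi> \<in> test_functions U" "\<psi> \<in> test_functions U"
  shows "(\<lambda>x. \<phi> x - \<psi> x) \<in> test_functions U"
  using test_functions_add[OF assms(1) test_functions_cmult[OF assms(2), of "-1"]] by simp

lemma test_functions_UNIV_iff:
  "\<phi> \<in> test_functions UNIV \<longleftrightarrow> smooth_on UNIV \<phi> \<and> (\<exists>R. \<forall>x. norm x > R \<longrightarrow> \<phi> x = 0)"
proof
  assume "\<phi> \<in> test_functions UNIV"
  then obtain K where K: "compact K" "\<And>x. x \<notin> K \<Longrightarrow> \<phi> x = 0" "smooth_on UNIV \<phi>"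
    by (metis test_functionsE)
  obtain R where "\<forall>x\<in>K. norm x \<le> R" using K(1) compact_imp_bounded bounded_iff by blast
  with K show "smooth_on UNIV \<phi> \<and> (\<exists>R. \<forall>x. norm x > R \<longrightarrow> \<phi> x = 0)"
    by (meson not_le)
next
  assume "smooth_on UNIV \<phi> \<and> (\<exists>R. \<forall>x. norm x > R \<longrightarrow> \<phi> x = 0)"
  then obtain R where "smooth_on UNIV \<phi>" "\<forall>x. norm x > R \<longrightarrow> \<phi> x = 0" by blast
  then show "\<phi> \<in> test_functions UNIV"
    by (intro test_functionsI[of _ "cball 0 R"]) auto
qed

lemma test_functions_affine_compose:
  assumes "\<phi> \<in> test_functions UNIV" "s \<noteq> 0"
  shows "(\<lambda>x. \<phi> (c + s *\<^sub>R x)) \<in> test_functions UNIV"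
proof -
  obtain R where R: "smooth_on UNIV \<phi>" "\<forall>x. norm x > R \<longrightarrow> \<phi> x = 0"
    using assms(1) test_functions_UNIV_iff by blast
  have "norm (c + s *\<^sub>R x) > R" if "norm x > (\<bar>R\<bar> + norm c) / \<bar>s\<bar>" for x
  proof -
    have "\<bar>R\<bar> + norm c < \<bar>s\<bar> * norm x"
      using that assms(2) by (simp add: field_simps)
    moreover have "\<bar>s\<bar> * norm x \<le> norm (c + s *\<^sub>R x) + norm c"
      using norm_triangle_ineq4[of "c + s *\<^sub>R x" c] by simp
    ultimately show ?thesis by linarith
  qed
  then show ?thesis
    using R smooth_on_affine_compose[of \<phi> c s] unfolding test_functions_UNIV_iff by blast
qed

lemma continuous_test_function: "\<phi> \<in> test_functions U \<Longrightarrow> continuous_on V \<phi>"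
  using test_functions_smooth smooth_on_continuous_on by blast

lemma test_function_bounded:
  assumes "\<phi> \<in> test_functions U"
  obtains B where "B > 0" "\<And>x. \<bar>\<phi> x\<bar> \<le> B"
proof -
  obtain K where K: "compact K" "\<And>x. x \<notin> K \<Longrightarrow> \<phi> x = 0"
    using assms by (metis test_functionsE)
  have "bounded (\<phi> ` K)"
    using K(1) continuous_test_function[OF assms] by (blast intro: compact_imp_bounded
        compact_continuous_image)
  then obtain B where "B > 0" "\<forall>x\<in>K. \<bar>\<phi> x\<bar> \<le> B" unfolding bounded_pos by auto
  then have "\<bar>\<phi> x\<bar> \<le> B" for x using K(2) by (cases "x \<in> K") auto
  then show ?thesis using \<open>B > 0\<close> that by blast
qed

section \<open>Integrability under compact support, and a mollifier\<close>

lemma integrable_compact_support_within: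
  fixes f :: "'a::euclidean_space \<Rightarrow> 'b::{banach, second_countable_topology}"
  assumes "continuous_on U f" "compact K" "K \<subseteq> U" "\<And>x. x \<notin> K \<Longrightarrow> f x = 0"
  shows "integrable lborel f"
proof -
  have "integrable lborel (\<lambda>x. indicat_real K x *\<^sub>R f x)"
    using assms by (intro borel_integrable_compact) (auto intro: continuous_on_subset)
  moreover have "(\<lambda>x. indicat_real K x *\<^sub>R f x) = f"
    using assms(4) by (force simp: indicator_def)
  ultimately show ?thesis by simp
qed

lemma integrable_compact_support:
  fixes f :: "'a::euclidean_space \<Rightarrow> real"
  assumes "continuous_on UNIV f" "compact K" "\<And>x. x \<notin> K \<Longrightarrow> f x = 0"
  shows "integrable lborel f"
  by (rule integrable_compact_support_within[OF assms(1,2) subset_UNIV assms(3)])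

lemma ex_mollifier:
  "\<exists>\<eta>\<in>test_functions UNIV. (\<forall>x. \<eta> x \<ge> 0) \<and> (\<forall>x. norm x \<ge> 1 \<longrightarrow> \<eta> x = 0) \<and> integral\<^sup>L lborel \<eta> = 1"
proof -
  define b :: "real^2 \<Rightarrow> real" where "b x = exp_bump 0 (1 - (x $ 1 * x $ 1 + x $ 2 * x $ 2))" for x
  have n: "x $ 1 * x $ 1 + x $ 2 * x $ 2 = (norm x)\<^sup>2" for x :: "real^2"
    unfolding power2_norm_eq_inner inner_vec_def sum_2 inner_real_def ..
  have sm: "smooth_on UNIV b"
    unfolding b_def
    by (intro smooth_on_exp_bump_compose smooth_on_diff smooth_on_add smooth_on_mult
        smooth_on_coordinate smooth_on_const open_UNIV)
  have b0: "b x = 0" if "norm x \<ge> 1" for x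
    using one_le_power[OF that, of 2] unfolding b_def n exp_bump_def by auto
  have bp: "b x > 0" if "norm x < 1" for x
    using power_strict_mono[OF that norm_ge_zero, of 2] unfolding b_def n exp_bump_def by auto
  have nonneg: "b x \<ge> 0" for x by (simp add: b_def exp_bump_def)
  have bt: "b \<in> test_functions UNIV"
    unfolding test_functions_UNIV_iff using sm b0 by (meson less_imp_le)
  have cont: "continuous_on UNIV b" using sm by (rule smooth_on_continuous_on)
  have int: "integrable lborel b"
    using integrable_compact_support[OF cont compact_cball[of 0 1]] b0 by simp
  have "integral\<^sup>L lborel b \<noteq> 0"
  proof
    assume "integral\<^sup>L lborel b = 0"
    then have "AE x in lborel. b x = 0"
      using integral_nonneg_eq_0_iff_AE[OF int] nonneg by simp
    then have "AE x in lborel. x \<notin> ball (0::real^2) 1" by (rule eventually_mono) (metis bp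
        less_irrefl mem_ball_0)
    then have "ball (0::real^2) 1 \<in> null_sets lborel" using AE_iff_null_sets[of "ball (0::real^2) 1"
        lborel] by simp
    then have "ball (0::real^2) 1 \<in> null_sets lebesgue" by (rule null_sets_completionI)
    then have "negligible (ball (0::real^2) 1)" by (simp add: negligible_iff_null_sets)
    then show False
      using open_not_negligible[OF open_ball, of "0::real^2" 1] by simp
  qed
  moreover have "integral\<^sup>L lborel b \<ge> 0" by (rule integral_nonneg_AE) (simp add: nonneg)
  ultimately have pos: "integral\<^sup>L lborel b > 0" by simp
  define c where "c = 1 / integral\<^sup>L lborel b"
  have "c > 0" "c * integral\<^sup>L lborel b = 1" using pos by (auto simp: c_def)
  then show ?thesis
    by (intro bexI[OF _ test_functions_cmult[OF bt, of c]]) (simp add: nonneg b0)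
qed

section \<open>Integration by parts and convolutions\<close>

lemma integral_translate:
  fixes f :: "'a::euclidean_space \<Rightarrow> real"
  assumes "f \<in> borel_measurable borel"
  shows "(\<integral>x. f (x + c) \<partial>lborel) = integral\<^sup>L lborel f"
proof -
  have "integral\<^sup>L lborel f = integral\<^sup>L (distr lborel borel ((+) c)) f"
    by (simp add: lborel_distr_plus)
  also have "\<dots> = (\<integral>x. f (c + x) \<partial>lborel)"
    using assms by (intro integral_distr) auto
  finally show ?thesis by (simp add: add.commute)
qed

lemma integrable_translate:
  fixes f :: "'a::euclidean_space \<Rightarrow> real"
  assumes "integrable lborel f"
  shows "integrable lborel (\<lambda>x. f (x + c))"
proof -
  have "integrable (distr lborel borel ((+) c)) f"
    using assms by (simp add: lborel_distr_plus)
  then have "integrable lborel (\<lambda>x. f (c + x))"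
    by (subst (asm) integrable_distr_eq) (use assms in auto)
  then show ?thesis by (simp add: add.commute)
qed

lemma lborel_reflect:
  "(lborel :: 'a::euclidean_space measure) = distr lborel borel (\<lambda>y. x - y)"
proof -
  have "(lborel :: 'a measure) = density (distr lborel borel (\<lambda>y. x + (-1) *\<^sub>R y)) (\<lambda>_.
      \<bar>-1::real\<bar>^DIM('a))"
    by (rule lborel_affine) simp
  then show ?thesis by (simp add: density_1)
qed

lemma integral_reflect:
  fixes f :: "'a::euclidean_space \<Rightarrow> real"
  assumes "f \<in> borel_measurable borel"
  shows "(\<integral>y. f (x - y) \<partial>lborel) = integral\<^sup>L lborel f"
proof -
  have "integral\<^sup>L lborel f = integral\<^sup>L (distr lborel borel (\<lambda>y. x - y)) f"
    using lborel_reflect[of x] by simp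
  also have "\<dots> = (\<integral>y. f (x - y) \<partial>lborel)"
    using assms by (intro integral_distr) auto
  finally show ?thesis by simp
qed

lemma partial_bound_difference:
  fixes f :: "real^2 \<Rightarrow> real"
  assumes "\<And>x. f differentiable (at x)" "\<And>x. \<bar>partial i f x\<bar> \<le> B" "h > 0"
  shows "\<bar>f (x + h *\<^sub>R axis i 1) - f x\<bar> \<le> B * h"
proof -
  obtain z where "f (x + h *\<^sub>R axis i 1) - f (x + 0 *\<^sub>R axis i 1) = (h - 0) * partial i f (x + z *\<^sub>R
      axis i 1)"
    using MVT2[OF assms(3) partial_has_real_derivative[OF assms(1)]] by blast
  then have "\<bar>f (x + h *\<^sub>R axis i 1) - f x\<bar> = h * \<bar>partial i f (x + z *\<^sub>R axis i 1)\<bar>"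
    using assms(3) by (simp add: abs_mult)
  also have "\<dots> \<le> h * B" using assms by (intro mult_left_mono) auto
  finally show ?thesis by (simp add: mult.commute)
qed

text \<open>The integral of every difference quotient vanishes by translation invariance.\<close>

lemma integral_partial_eq_0:
  fixes f :: "real^2 \<Rightarrow> real"
  assumes d: "\<And>x. f differentiable (at x)" and c: "continuous_on UNIV (partial i f)"
    and K: "compact K" "\<And>x. x \<notin> K \<Longrightarrow> f x = 0"
  shows "integral\<^sup>L lborel (partial i f) = 0"
proof -
  have cf: "continuous_on UNIV f"
    using d by (meson continuous_at_imp_continuous_on differentiable_imp_continuous_within)
  then have intf: "integrable lborel f" using integrable_compact_support K by blast
  have p0: "partial i f x = 0" if "x \<notin> K" for x
    using partial_eq_0_off[OF compact_imp_closed[OF K(1)] K(2) that] .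
  have "bounded (partial i f ` K)"
    using K(1) c by (meson compact_continuous_image compact_imp_bounded continuous_on_subset
        subset_UNIV)
  then obtain B where B: "B > 0" "\<forall>x\<in>K. \<bar>partial i f x\<bar> \<le> B"
    unfolding bounded_pos by auto
  have B': "\<bar>partial i f x\<bar> \<le> B" for x using B p0 by (cases "x \<in> K") auto
  obtain R where R: "\<forall>x\<in>K. norm x \<le> R" using K(1) compact_imp_bounded bounded_iff by blast
  have [measurable]: "f \<in> borel_measurable borel" using cf by (rule borel_measurable_continuous_onI)
  have [measurable]: "partial i f \<in> borel_measurable borel" using c by (rule
      borel_measurable_continuous_onI)
  define g where "g n x = (f (x + (1 / Suc n) *\<^sub>R axis i 1) - f x) * Suc n" for n :: nat and x
  have "(\<lambda>n. integral\<^sup>L lborel (g n)) \<longlonglongrightarrow> integral\<^sup>L lborel (partial i f)"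
  proof (rule integral_dominated_convergence)
    show "partial i f \<in> borel_measurable lborel" by simp
    show "g n \<in> borel_measurable lborel" for n unfolding g_def by measurable
    \<comment> \<open>The steps have length at most 1, so all difference quotients vanish outside
      the ball of radius \<open>R + 1\<close>, and the mean value theorem bounds them by
      \<open>B\<close>.\<close>
    show "integrable lborel (\<lambda>x. B * indicat_real (cball 0 (R + 1)) x)"
      by (intro integrable_mult_right integrable_real_indicator) (use emeasure_bounded_finite[OF
          bounded_cball, of 0 "R + 1"] in \<open>auto simp: infinity_ennreal_def\<close>)
    show "AE x in lborel. (\<lambda>n. g n x) \<longlonglongrightarrow> partial i f x"
    proof (intro AE_I2)
      fix x
      have "((\<lambda>t. f (x + t *\<^sub>R axis i 1)) has_real_derivative partial i f (x + 0 *\<^sub>R axis i 1)) (at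
          0)"
        by (rule partial_has_real_derivative) (rule d)
      then have "((\<lambda>h. (f (x + h *\<^sub>R axis i 1) - f x) / h) \<longlongrightarrow> partial i f x) (at 0)"
        by (simp add: DERIV_def)
      moreover have "filterlim (\<lambda>n. 1 / real (Suc n)) (at 0) sequentially"
        using LIMSEQ_Suc[OF lim_const_over_n[of 1]] by (auto simp: filterlim_at)
      ultimately have "(\<lambda>n. (f (x + (1 / real (Suc n)) *\<^sub>R axis i 1) - f x) / (1 / real (Suc n))) \<longlonglongrightarrow>
          partial i f x"
        by (rule filterlim_compose)
      then show "(\<lambda>n. g n x) \<longlonglongrightarrow> partial i f x" by (simp add: g_def)
    qed
    show "AE x in lborel. norm (g n x) \<le> B * indicat_real (cball 0 (R + 1)) x" for n
    proof (intro AE_I2)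
      fix x
      show "norm (g n x) \<le> B * indicat_real (cball 0 (R + 1)) x"
      proof (cases "norm x \<le> R + 1")
        case True
        have "norm (g n x) = \<bar>f (x + (1 / Suc n) *\<^sub>R axis i 1) - f x\<bar> * Suc n"
          by (simp add: g_def abs_mult)
        also have "\<dots> \<le> (B * (1 / Suc n)) * Suc n"
          by (intro mult_right_mono partial_bound_difference d B') auto
        finally show ?thesis using True by simp
      next
        case False
        have "norm x \<le> norm (x + (1 / Suc n) *\<^sub>R axis i 1) + norm ((1 / Suc n) *\<^sub>R axis i
            (1::real))"
          using norm_triangle_ineq4[of "x + (1 / Suc n) *\<^sub>R axis i 1" "(1 / Suc n) *\<^sub>R axis i
              (1::real)"] by simp
        moreover have "norm ((1 / Suc n) *\<^sub>R axis i (1::real) :: real^2) \<le> 1"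
          by (simp add: norm_axis_1)
        ultimately have "norm (x + (1 / Suc n) *\<^sub>R axis i 1) > R" "norm x > R" using False by
            linarith+
        then have "x + (1 / Suc n) *\<^sub>R axis i 1 \<notin> K" "x \<notin> K" using R by auto
        then show ?thesis using K(2) False by (simp add: g_def)
      qed
    qed
  qed
  moreover have "integral\<^sup>L lborel (g n) = 0" for n
  proof -
    have "integral\<^sup>L lborel (g n) = ((\<integral>x. f (x + (1 / Suc n) *\<^sub>R axis i 1) \<partial>lborel) - integral\<^sup>L
        lborel f) * Suc n"
      unfolding g_def using integrable_translate[OF intf] intf by simp
    then show ?thesis by (simp add: integral_translate)
  qed
  ultimately show ?thesis by (simp add: LIMSEQ_const_iff)
qed

lemma test_functions_integrable: "\<phi> \<in> test_functions U \<Longrightarrow> integrable lborel \<phi>"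
  by (metis continuous_test_function integrable_compact_support test_functionsE)

lemma integral_by_parts:
  assumes "open W" "smooth_on W u" "\<phi> \<in> test_functions W"
  shows "(\<integral>x. u x * partial i \<phi> x \<partial>lborel) = - (\<integral>x. partial i u x * \<phi> x \<partial>lborel)"
proof -
  define F where "F = (\<lambda>x. u x * \<phi> x)"
  have F: "F \<in> test_functions W" unfolding F_def by (rule test_functions_mult[OF assms])
  have i1: "integrable lborel (\<lambda>x. u x * partial i \<phi> x)"
    by (rule test_functions_integrable[OF test_functions_mult[OF assms(1,2)
        test_functions_partial[OF assms(3)]]])
  have i2: "integrable lborel (\<lambda>x. partial i u x * \<phi> x)"
    by (rule test_functions_integrable[OF test_functions_mult[OF assms(1) smooth_on_partial[OF
        assms(2)] assms(3)]])
  have eq: "partial i F x = u x * partial i \<phi> x + partial i u x * \<phi> x" for x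
  proof (cases "x \<in> W")
    case True
    then show ?thesis unfolding F_def
      using assms by (intro partial_mult smooth_on_differentiable test_functions_differentiable)
          auto
  next
    case False
    then show ?thesis
      using test_functions_eq_0[OF test_functions_partial[OF F] False]
        test_functions_eq_0[OF test_functions_partial[OF assms(3)] False]
        test_functions_eq_0[OF assms(3) False] by simp
  qed
  obtain K where K: "compact K" "\<And>x. x \<notin> K \<Longrightarrow> F x = 0" by (metis F test_functionsE)
  have "integral\<^sup>L lborel (partial i F) = 0"
    by (rule integral_partial_eq_0[OF test_functions_differentiable[OF F]
          continuous_test_function[OF test_functions_partial[OF F]] K])
  then have "(\<integral>x. u x * partial i \<phi> x + partial i u x * \<phi> x \<partial>lborel) = 0"
    by (simp add: eq[abs_def])
  then show ?thesis using i1 i2 by simp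
qed

section \<open>Differentiation of convolutions\<close>

lemma gradient_onorm_le:
  "onorm (\<lambda>h::real^2. h $ 1 *\<^sub>R a + h $ 2 *\<^sub>R b) \<le> \<bar>a\<bar> + \<bar>b::real\<bar>"
proof (rule onorm_le)
  fix h :: "real^2"
  have "norm (h $ 1 *\<^sub>R a + h $ 2 *\<^sub>R b) \<le> \<bar>h $ 1\<bar> * \<bar>a\<bar> + \<bar>h $ 2\<bar> * \<bar>b\<bar>"
    by (metis abs_mult abs_triangle_ineq real_norm_def real_scaleR_def)
  also have "\<dots> \<le> norm h * \<bar>a\<bar> + norm h * \<bar>b\<bar>"
    by (intro add_mono mult_right_mono component_le_norm_cart) auto
  finally show "norm (h $ 1 *\<^sub>R a + h $ 2 *\<^sub>R b) \<le> (\<bar>a\<bar> + \<bar>b\<bar>) * norm h"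
    by (simp add: algebra_simps)
qed

lemma partials_bound_imp_lipschitz:
  fixes f :: "real^2 \<Rightarrow> real"
  assumes "\<And>x. f differentiable (at x)" "\<And>i x. \<bar>partial i f x\<bar> \<le> B"
  shows "\<bar>f y - f x\<bar> \<le> 2 * B * norm (y - x)"
proof -
  have "norm (f y - f x) \<le> 2 * B * norm (y - x)"
  proof (rule differentiable_bound[OF convex_UNIV])
    fix z
    show "(f has_derivative (\<lambda>h::real^2. h $ 1 *\<^sub>R partial 1 f z + h $ 2 *\<^sub>R partial 2 f z)) (at z)"
      by (rule has_derivative_partial[OF assms(1)])
    show "onorm (\<lambda>h::real^2. h $ 1 *\<^sub>R partial 1 f z + h $ 2 *\<^sub>R partial 2 f z) \<le> 2 * B"
      using gradient_onorm_le[of "partial 1 f z" "partial 2 f z"] assms(2)[of 1 z] assms(2)[of 2 z]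
          by linarith
  qed auto
  then show ?thesis by simp
qed

text \<open>The point is that \<open>C\<close> does not depend on \<open>z\<close>: after
  multiplication by a kernel and integration the remainder is still of order |h|^2, which permits
  differentiation under the integral.\<close>

lemma test_function_taylor:
  assumes "\<phi> \<in> test_functions U"
  obtains C where "C > 0"
    "\<And>z h. \<bar>\<phi> (z + h) - \<phi> z - (h $ 1 * partial 1 \<phi> z + h $ 2 * partial 2 \<phi> z)\<bar> \<le> C * (norm h)\<^sup>2"
proof -
  have "\<forall>i j. \<exists>b. \<forall>x. \<bar>partial j (partial i \<phi>) x\<bar> \<le> b"
    by (metis test_function_bounded test_functions_partial assms)
  then obtain b where b: "\<And>i j x. \<bar>partial j (partial i \<phi>) x\<bar> \<le> b i j" by metis
  define B where "B = 1 + (\<Sum>i\<in>UNIV. \<Sum>j\<in>UNIV. \<bar>b i j\<bar>)"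
  have B: "\<bar>partial j (partial i \<phi>) x\<bar> \<le> B" for i j x
  proof -
    have "\<bar>b i j\<bar> \<le> (\<Sum>j\<in>UNIV. \<bar>b i j\<bar>)" by (rule member_le_sum) auto
    also have "\<dots> \<le> (\<Sum>i\<in>UNIV. \<Sum>j\<in>UNIV. \<bar>b i j\<bar>)" by (rule member_le_sum) (auto intro: sum_nonneg)
    finally show ?thesis using b[of j i x] unfolding B_def by linarith
  qed
  have lip: "\<bar>partial i \<phi> y - partial i \<phi> x\<bar> \<le> 2 * B * norm (y - x)" for i x y
    by (rule partials_bound_imp_lipschitz[OF test_functions_differentiable[OF
        test_functions_partial[OF assms]] B])
  have B0: "B > 0" unfolding B_def by (simp add: sum_nonneg add_pos_nonneg)
  show ?thesis
  proof (rule that[of "4 * B"])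
    show "4 * B > 0" using B0 by simp
    fix z h
    let ?D = "\<lambda>x (h::real^2). h $ 1 *\<^sub>R partial 1 \<phi> x + h $ 2 *\<^sub>R partial 2 \<phi> x"
    have "norm (\<phi> (z + h) - \<phi> z - ?D z (z + h - z)) \<le> norm (z + h - z) * (4 * B * norm h)"
    proof (rule differentiable_bound_linearization[where S = "cball z (norm h)"])
      show "z + t *\<^sub>R (z + h - z) \<in> cball z (norm h)" if "t \<in> {0..1}" for t
        using that by (simp add: dist_norm mult_left_le_one_le)
      show "(\<phi> has_derivative ?D x) (at x within cball z (norm h))" for x
        by (rule has_derivative_at_withinI[OF has_derivative_partial[OF
            test_functions_differentiable[OF assms]]])
      fix x assume x: "x \<in> cball z (norm h)"
      have "?D x - ?D z = (\<lambda>k::real^2. k $ 1 *\<^sub>R (partial 1 \<phi> x - partial 1 \<phi> z) + k $ 2 *\<^sub>R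
          (partial 2 \<phi> x - partial 2 \<phi> z))"
        by (auto simp: fun_eq_iff algebra_simps)
      then have "onorm (?D x - ?D z) \<le> \<bar>partial 1 \<phi> x - partial 1 \<phi> z\<bar> + \<bar>partial 2 \<phi> x - partial 2
          \<phi> z\<bar>"
        using gradient_onorm_le by presburger
      also have "\<dots> \<le> 2 * B * norm (x - z) + 2 * B * norm (x - z)"
        by (intro add_mono lip)
      also have "\<dots> \<le> 4 * B * norm h"
        using x B0 by (simp add: dist_norm norm_minus_commute)
      finally show "onorm (?D x - ?D z) \<le> 4 * B * norm h" .
    qed simp
    then show "\<bar>\<phi> (z + h) - \<phi> z - (h $ 1 * partial 1 \<phi> z + h $ 2 * partial 2 \<phi> z)\<bar> \<le> 4 * B * (norm
        h)\<^sup>2"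
      by (simp add: power2_eq_square mult_ac)
  qed
qed

text \<open>The convolution of \<open>\<phi>\<close> with the image under \<open>g\<close> of the
  measure with density \<open>F\<close>. With \<open>g\<close> the identity this is ordinary
  convolution in the plane; with \<open>g\<close> the parametrization of a vertical line it
  integrates along half-lines, which gives the Airy potential. Both uses share one differentiation
  theorem.\<close>

definition kernel_conv ::
    "'a measure \<Rightarrow> ('a \<Rightarrow> real^2) \<Rightarrow> ('a \<Rightarrow> real) \<Rightarrow> (real^2 \<Rightarrow> real) \<Rightarrow> real^2 \<Rightarrow> real" where
  "kernel_conv M g F \<phi> x = (\<integral>y. F y * \<phi> (x - g y) \<partial>M)"

text \<open>Local integrability of the image measure: finite mass over every ball suffices against
  compactly supported functions.\<close>

definition convolution_kernel :: "'a measure \<Rightarrow> ('a \<Rightarrow> real^2) \<Rightarrow> ('a \<Rightarrow> real) \<Rightarrow> bool" where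
  "convolution_kernel M g F \<longleftrightarrow> g \<in> borel_measurable M \<and> F \<in> borel_measurable M \<and>
     (\<forall>R. integrable M (\<lambda>y. indicat_real {y. norm (g y) \<le> R} y * F y))"

lemma kernel_conv_integrable:
  assumes k: "convolution_kernel M g F" and \<phi>: "\<phi> \<in> test_functions UNIV"
  shows "integrable M (\<lambda>y. F y * \<phi> (x - g y))"
proof -
  have [measurable]: "g \<in> borel_measurable M" "F \<in> borel_measurable M"
    using k by (auto simp: convolution_kernel_def)
  have [measurable]: "\<phi> \<in> borel_measurable borel"
    using continuous_test_function[OF \<phi>] by (rule borel_measurable_continuous_onI)
  obtain R where R: "\<forall>x. norm x > R \<longrightarrow> \<phi> x = 0" using \<phi> test_functions_UNIV_iff by blast
  obtain B where B: "B > 0" "\<And>x. \<bar>\<phi> x\<bar> \<le> B" by (metis test_function_bounded[OF \<phi>])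
  let ?G = "\<lambda>y. B * (indicat_real {y. norm (g y) \<le> R + norm x} y * F y)"
  show ?thesis
  proof (rule Bochner_Integration.integrable_bound[of _ ?G])
    show "integrable M ?G" using k by (auto simp: convolution_kernel_def)
    show "AE y in M. norm (F y * \<phi> (x - g y)) \<le> norm (?G y)"
    proof (intro AE_I2)
      fix y
      show "norm (F y * \<phi> (x - g y)) \<le> norm (?G y)"
      proof (cases "norm (g y) \<le> R + norm x")
        case True
        have "\<bar>F y\<bar> * \<bar>\<phi> (x - g y)\<bar> \<le> \<bar>F y\<bar> * B" using B by (intro mult_left_mono) auto
        then show ?thesis using True B(1) by (simp add: abs_mult mult.commute)
      next
        case False
        then have "norm (x - g y) > R" using norm_triangle_ineq2[of "g y" x] norm_minus_commute[of x
            "g y"] by linarith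
        then show ?thesis using R by simp
      qed
    qed
  qed measurable
qed

lemma kernel_conv_has_derivative:
  assumes k: "convolution_kernel M g F" and \<phi>: "\<phi> \<in> test_functions UNIV"
  shows "(kernel_conv M g F \<phi> has_derivative
    (\<lambda>h. h $ 1 * kernel_conv M g F (partial 1 \<phi>) x + h $ 2 * kernel_conv M g F (partial 2 \<phi>) x)) (at
        x)"
proof -
  have [measurable]: "g \<in> borel_measurable M" "F \<in> borel_measurable M"
    using k by (auto simp: convolution_kernel_def)
  note int = kernel_conv_integrable[OF k]
  note intp = kernel_conv_integrable[OF k test_functions_partial[OF \<phi>]]
  obtain R where R: "\<forall>x. norm x > R \<longrightarrow> \<phi> x = 0" using \<phi> test_functions_UNIV_iff by blast
  obtain C where C: "C > 0"
    "\<And>z h. \<bar>\<phi> (z + h) - \<phi> z - (h $ 1 * partial 1 \<phi> z + h $ 2 * partial 2 \<phi> z)\<bar> \<le> C * (norm h)\<^sup>2"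
    by (metis test_function_taylor[OF \<phi>])
  have R': "partial i \<phi> x = 0" if "norm x > R" for x i
    by (rule partial_eq_0_off[of "cball 0 R"]) (use R that in auto)
  \<comment> \<open>For |h| < 1 the functions at \<open>x - g y\<close> and
    \<open>x - g y + h\<close> can be nonzero only if \<open>g y\<close> has norm at most
    \<open>R + norm x + 1\<close>, so this one truncation dominates all increments.\<close>
  let ?G = "\<lambda>y. indicat_real {y. norm (g y) \<le> R + norm x + 1} y * F y"
  have G: "integrable M ?G" using k by (auto simp: convolution_kernel_def)
  define I where "I = (\<integral>y. \<bar>?G y\<bar> \<partial>M)"
  show ?thesis
  proof (rule has_derivativeI_sandwich[where e = 1 and H = "\<lambda>y. C * I * norm (y - x)"])
    show "bounded_linear (\<lambda>h. h $ 1 * kernel_conv M g F (partial 1 \<phi>) x + h $ 2 * kernel_conv M g F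
        (partial 2 \<phi>) x)"
      by (intro bounded_linear_add bounded_linear_mult_const bounded_linear_vec_nth)
    have "((\<lambda>y. C * I * norm (y - x)) \<longlongrightarrow> C * I * norm (x - x)) (at x)"
      by (intro tendsto_intros)
    then show "((\<lambda>y. C * I * norm (y - x)) \<longlongrightarrow> 0) (at x)" by simp
    fix z assume z: "z \<noteq> x" "dist z x < 1"
    define h where "h = z - x"
    have h: "norm h < 1" "h \<noteq> 0" using z by (auto simp: h_def dist_norm)
    define E where "E y = F y * (\<phi> (x - g y + h) - \<phi> (x - g y) - (h $ 1 * partial 1 \<phi> (x - g y) + h
        $ 2 * partial 2 \<phi> (x - g y)))" for y
    have eqE: "E y = F y * \<phi> ((x + h) - g y) - F y * \<phi> (x - g y) - (h $ 1 * (F y * partial 1 \<phi> (x -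
        g y)) + h $ 2 * (F y * partial 2 \<phi> (x - g y)))" for y
      by (simp add: E_def algebra_simps)
    have intE: "integrable M E"
      unfolding eqE[abs_def] using int[OF \<phi>, of x] int[OF \<phi>, of "x+h"] intp[of 1 x] intp[of 2 x] by
          simp
    have "kernel_conv M g F \<phi> z - kernel_conv M g F \<phi> x -
        ((z - x) $ 1 * kernel_conv M g F (partial 1 \<phi>) x + (z - x) $ 2 * kernel_conv M g F (partial
            2 \<phi>) x)
      = integral\<^sup>L M E"
      unfolding eqE[abs_def] kernel_conv_def h_def[symmetric]
      using int[OF \<phi>, of x] int[OF \<phi>, of "x+h"] intp[of 1 x] intp[of 2 x] by (simp add: h_def)
    moreover have "norm (integral\<^sup>L M E) \<le> (\<integral>y. C * (norm h)\<^sup>2 * \<bar>?G y\<bar> \<partial>M)"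
    proof (rule order_trans[OF integral_norm_bound integral_mono])
      show "integrable M (\<lambda>y. norm (E y))" using intE by simp
      show "integrable M (\<lambda>y. C * (norm h)\<^sup>2 * \<bar>?G y\<bar>)" using G by simp
      fix y
      show "norm (E y) \<le> C * (norm h)\<^sup>2 * \<bar>?G y\<bar>"
      proof (cases "norm (g y) \<le> R + norm x + 1")
        case True
        have "norm (E y) \<le> \<bar>F y\<bar> * (C * (norm h)\<^sup>2)"
          unfolding E_def real_norm_def abs_mult using C(2) by (intro mult_left_mono) auto
        then show ?thesis using True by (simp add: mult.commute)
      next
        case False
        have "norm (g y) \<le> norm (x - g y + h) + norm x + norm h" "norm (g y) \<le> norm (x - g y) + norm
            x"
          using norm_triangle_ineq4[of x "x - g y"] norm_triangle_ineq4[of "x + h" "x - g y + h"]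
              norm_triangle_ineq[of x h]
          by simp_all
        then have "norm (x - g y + h) > R" "norm (x - g y) > R" using False h by linarith+
        then show ?thesis using R R' C(1) by (simp add: E_def)
      qed
    qed
    moreover have "(\<integral>y. C * (norm h)\<^sup>2 * \<bar>?G y\<bar> \<partial>M) = C * I * (norm h)\<^sup>2"
      by (simp add: I_def)
    ultimately have "norm (kernel_conv M g F \<phi> z - kernel_conv M g F \<phi> x -
        ((z - x) $ 1 * kernel_conv M g F (partial 1 \<phi>) x + (z - x) $ 2 * kernel_conv M g F (partial
            2 \<phi>) x))
        \<le> C * I * (norm h)\<^sup>2" by metis
    then show "norm (kernel_conv M g F \<phi> z - kernel_conv M g F \<phi> x -
        ((z - x) $ 1 * kernel_conv M g F (partial 1 \<phi>) x + (z - x) $ 2 * kernel_conv M g F (partial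
            2 \<phi>) x))
        / norm (z - x) \<le> C * I * norm (z - x)"
      using h(2) by (simp add: h_def[symmetric] divide_le_eq power2_eq_square mult.assoc)
  qed simp
qed

lemma partial_kernel_conv:
  assumes k: "convolution_kernel M g F" and \<phi>: "\<phi> \<in> test_functions UNIV"
  shows "partial i (kernel_conv M g F \<phi>) = kernel_conv M g F (partial i \<phi>)"
proof
  fix x
  show "partial i (kernel_conv M g F \<phi>) x = kernel_conv M g F (partial i \<phi>) x"
    using partial_eqI[OF kernel_conv_has_derivative[OF assms], of i] exhaust_2[of i]
    by (auto simp: axis_def)
qed

lemma smooth_on_kernel_conv:
  assumes k: "convolution_kernel M g F" and \<phi>: "\<phi> \<in> test_functions UNIV"
  shows "smooth_on U (kernel_conv M g F \<phi>)"
proof -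
  have "times_differentiable_on n UNIV (kernel_conv M g F \<phi>)" for n
    using \<phi>
  proof (induction n arbitrary: \<phi>)
    case (Suc n)
    then show ?case
      using kernel_conv_has_derivative[OF k Suc.prems]
      by (auto simp: differentiable_def partial_kernel_conv[OF k] intro!: test_functions_partial)
  qed simp
  then have "smooth_on UNIV (kernel_conv M g F \<phi>)" by (simp add: smooth_on_iff)
  then show ?thesis by (rule smooth_on_subset) simp
qed

abbreviation locally_integrable :: "(real^2 \<Rightarrow> real) \<Rightarrow> bool" where
  "locally_integrable F \<equiv> convolution_kernel lborel (\<lambda>y. y) F"

abbreviation convolve :: "(real^2 \<Rightarrow> real) \<Rightarrow> (real^2 \<Rightarrow> real) \<Rightarrow> real^2 \<Rightarrow> real" where
  "convolve F \<phi> \<equiv> kernel_conv lborel (\<lambda>y. y) F \<phi>"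

lemma convolve_swap:
  assumes F: "F \<in> borel_measurable borel" and \<phi>: "\<phi> \<in> borel_measurable borel"
  shows "convolve F \<phi> x = (\<integral>y. F (x - y) * \<phi> y \<partial>lborel)"
proof -
  have "(\<integral>y. F y * \<phi> (x - y) \<partial>lborel) = (\<integral>y. F (x - y) * \<phi> (x - (x - y)) \<partial>lborel)"
    using assms by (intro integral_reflect[symmetric]) simp
  then show ?thesis by (simp add: kernel_conv_def)
qed

text \<open>Fubini, with evenness exchanging \<open>F (x - y)\<close> and \<open>F (y - x)\<close>.
  This self-adjointness later moves the fundamental solution from the test function onto a fixed
  function.\<close>

lemma convolve_symmetric:
  assumes F: "locally_integrable F" and even: "\<And>x. F (- x) = F x"
    and m: "m \<in> test_functions UNIV" and \<psi>: "\<psi> \<in> test_functions UNIV"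
  shows "(\<integral>x. m x * convolve F \<psi> x \<partial>lborel) = (\<integral>x. \<psi> x * convolve F m x \<partial>lborel)"
proof -
  have [measurable]: "F \<in> borel_measurable borel" using F by (simp add: convolution_kernel_def)
  have [measurable]: "m \<in> borel_measurable borel" "\<psi> \<in> borel_measurable borel"
    using continuous_test_function[OF m] continuous_test_function[OF \<psi>] by (auto intro:
        borel_measurable_continuous_onI)
  define h where "h x y = m x * (F (x - y) * \<psi> y)" for x y
  have [measurable]: "case_prod h \<in> borel_measurable (lborel \<Otimes>\<^sub>M lborel)"
    unfolding h_def by measurable
  have inner: "integrable lborel (\<lambda>y. F (x - y) * \<psi> y)" for x
  proof -
    have "integrable (distr lborel borel (\<lambda>y. x - y)) (\<lambda>y. F y * \<psi> (x - y))"
      using kernel_conv_integrable[OF F \<psi>, of x] lborel_reflect[of x] by simp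
    then show ?thesis by (subst (asm) integrable_distr_eq) simp_all
  qed
  obtain B where B: "B > 0" "\<And>x. \<bar>\<psi> x\<bar> \<le> B" by (metis test_function_bounded[OF \<psi>])
  obtain R where R: "\<forall>x. norm x > R \<longrightarrow> \<psi> x = 0" using \<psi> test_functions_UNIV_iff by blast
  obtain S where S: "\<forall>x. norm x > S \<longrightarrow> m x = 0" using m test_functions_UNIV_iff by blast
  \<comment> \<open>If \<open>m x\<close> and \<open>\<psi> (x - y)\<close> are both nonzero then
    |y| <= R + S, so a single integrable truncation of \<open>F\<close> bounds the inner integrals
    for all \<open>x\<close> in the support of \<open>m\<close>.\<close>
  let ?G = "\<lambda>y. indicat_real {y. norm y \<le> R + S} y * F y"
  have G: "integrable lborel ?G" using F by (auto simp: convolution_kernel_def)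
  define I where "I = (\<integral>y. B * \<bar>?G y\<bar> \<partial>lborel)"
  have "integrable (lborel \<Otimes>\<^sub>M lborel) (case_prod h)"
  proof (rule lborel_pair.Fubini_integrable)
    show "AE x in lborel. integrable lborel (\<lambda>y. case_prod h (x, y))"
      using inner by (simp add: h_def)
    have bd: "(\<integral>y. norm (h x y) \<partial>lborel) \<le> \<bar>m x\<bar> * I" for x
    proof (cases "norm x \<le> S")
      case True
      have "(\<integral>y. norm (h x y) \<partial>lborel) = \<bar>m x\<bar> * (\<integral>y. \<bar>F (x - y) * \<psi> y\<bar> \<partial>lborel)"
        by (simp add: h_def abs_mult)
      also have "(\<integral>y. \<bar>F (x - y) * \<psi> y\<bar> \<partial>lborel) = (\<integral>y. \<bar>F y * \<psi> (x - y)\<bar> \<partial>lborel)"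
        using integral_reflect[of "\<lambda>y. \<bar>F y * \<psi> (x - y)\<bar>" x] by simp
      also have "\<dots> \<le> I" unfolding I_def
      proof (rule integral_mono)
        show "integrable lborel (\<lambda>y. \<bar>F y * \<psi> (x - y)\<bar>)"
          using kernel_conv_integrable[OF F \<psi>, of x] by simp
        show "integrable lborel (\<lambda>y. B * \<bar>?G y\<bar>)" using G by simp
        show "\<bar>F y * \<psi> (x - y)\<bar> \<le> B * \<bar>?G y\<bar>" for y
        proof (cases "norm y \<le> R + S")
          case True
          have "\<bar>F y\<bar> * \<bar>\<psi> (x - y)\<bar> \<le> \<bar>F y\<bar> * B" using B by (intro mult_left_mono) auto
          then show ?thesis using True by (simp add: abs_mult mult.commute)
        next
          case False
          then have "norm (x - y) > R" using norm_triangle_ineq4[of x "x - y"] True by simp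
          then show ?thesis using R False by simp
        qed
      qed
      finally show ?thesis by (simp add: mult_left_mono)
    next
      case False
      then show ?thesis using S by (simp add: h_def)
    qed
    have "0 \<le> I" unfolding I_def using B(1) by (intro integral_nonneg_AE) auto
    show "integrable lborel (\<lambda>x. \<integral>y. norm (case_prod h (x, y)) \<partial>lborel)"
    proof (rule Bochner_Integration.integrable_bound)
      show "integrable lborel (\<lambda>x. \<bar>m x\<bar> * I)"
        using test_functions_integrable[OF m] by simp
      show "AE x in lborel. norm (\<integral>y. norm (case_prod h (x, y)) \<partial>lborel) \<le> norm (\<bar>m x\<bar> * I)"
        using bd \<open>0 \<le> I\<close> by (intro AE_I2) (simp add: abs_mult)
    qed measurable
  qed measurable
  then have "(\<integral>y. \<integral>x. h x y \<partial>lborel \<partial>lborel) = (\<integral>x. \<integral>y. h x y \<partial>lborel \<partial>lborel)"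
    by (rule lborel_pair.Fubini_integral)
  moreover have "(\<integral>y. h x y \<partial>lborel) = m x * convolve F \<psi> x" for x
    by (simp add: h_def convolve_swap)
  moreover have "(\<integral>x. h x y \<partial>lborel) = \<psi> y * convolve F m y" for y
  proof -
    have "F (x - y) = F (y - x)" for x using even[of "y - x"] by simp
    then show ?thesis by (simp add: h_def convolve_swap mult_ac)
  qed
  ultimately show ?thesis by simp
qed

section \<open>Mollifiers and cutoffs at a prescribed scale\<close>

lemma integral_scale:
  fixes f :: "real^2 \<Rightarrow> real"
  assumes [measurable]: "f \<in> borel_measurable borel" and e: "e > 0"
  shows "(\<integral>y. f ((1/e) *\<^sub>R y) \<partial>lborel) = e\<^sup>2 * integral\<^sup>L lborel f"
proof -
  have "(lborel :: (real^2) measure) = density (distr lborel borel (\<lambda>x. 0 + e *\<^sub>R x)) (\<lambda>_. ennreal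
      (\<bar>e\<bar>^DIM(real^2)))"
    using e by (intro lborel_affine) simp
  then have "(\<integral>y. f ((1/e) *\<^sub>R y) \<partial>lborel)
      = integral\<^sup>L (density (distr lborel borel (\<lambda>x. e *\<^sub>R x)) (\<lambda>_. ennreal (e\<^sup>2))) (\<lambda>y. f ((1/e)
          *\<^sub>R y))"
    by simp
  also have "\<dots> = integral\<^sup>L (distr lborel borel (\<lambda>x. e *\<^sub>R x)) (\<lambda>y. e\<^sup>2 * f ((1/e) *\<^sub>R y))"
    by (subst integral_density) simp_all
  also have "\<dots> = (\<integral>x. e\<^sup>2 * f ((1/e) *\<^sub>R (e *\<^sub>R x)) \<partial>lborel)"
    by (rule integral_distr) simp_all
  finally show ?thesis using e by simp
qed

text \<open>Rescaling x to x/e with the factor 1/e^2 keeps the integral, and each derivative costs a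
  factor 1/e in the L1 norm. One constant serves all scales; this uniformity is what the boundary
  layer estimate uses.\<close>

lemma ex_scaled_mollifier:
  "\<exists>C>0. \<forall>e>0. \<exists>\<eta>\<in>test_functions UNIV. (\<forall>x. \<eta> x \<ge> 0) \<and> (\<forall>x. norm x \<ge> e \<longrightarrow> \<eta> x = 0) \<and>
     integral\<^sup>L lborel \<eta> = 1 \<and> (\<forall>i. (\<integral>y. \<bar>partial i \<eta> y\<bar> \<partial>lborel) \<le> C / e) \<and>
     (\<forall>i j. (\<integral>y. \<bar>partial i (partial j \<eta>) y\<bar> \<partial>lborel) \<le> C / e\<^sup>2)"
proof -
  obtain \<eta> where \<eta>: "\<eta> \<in> test_functions UNIV" "\<And>x. \<eta> x \<ge> 0" "\<And>x. norm x \<ge> 1 \<Longrightarrow> \<eta> x = 0"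
      "integral\<^sup>L lborel \<eta> = 1"
    using ex_mollifier by blast
  let ?A = "\<lambda>i. \<integral>y. \<bar>partial i \<eta> y\<bar> \<partial>lborel"
  let ?B = "\<lambda>i j. \<integral>y. \<bar>partial i (partial j \<eta>) y\<bar> \<partial>lborel"
  define C where "C = 1 + (\<Sum>i\<in>UNIV. ?A i) + (\<Sum>i\<in>UNIV. \<Sum>j\<in>UNIV. ?B i j)"
  have nA: "?A i \<ge> 0" for i by (rule integral_nonneg_AE) simp
  have nB: "?B i j \<ge> 0" for i j by (rule integral_nonneg_AE) simp
  have sA: "?A i \<le> (\<Sum>i\<in>UNIV. ?A i)" for i by (rule member_le_sum) (auto intro: nA)
  have sB: "?B i j \<le> (\<Sum>i\<in>UNIV. \<Sum>j\<in>UNIV. ?B i j)" for i j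
  proof -
    have "?B i j \<le> (\<Sum>j\<in>UNIV. ?B i j)" by (rule member_le_sum) (auto intro: nB)
    also have "\<dots> \<le> (\<Sum>i\<in>UNIV. \<Sum>j\<in>UNIV. ?B i j)" by (rule member_le_sum) (auto intro: nB sum_nonneg)
    finally show ?thesis .
  qed
  have pos: "(\<Sum>i\<in>UNIV. ?A i) \<ge> 0" "(\<Sum>i\<in>UNIV. \<Sum>j\<in>UNIV. ?B i j) \<ge> 0"
    by (auto intro!: sum_nonneg nA nB)
  have CA: "?A i \<le> C" and CB: "?B i j \<le> C" for i j
    using sA[of i] sB[of i j] pos unfolding C_def by linarith+
  have "C > 0" using pos unfolding C_def by linarith
  have meas: "f \<in> borel_measurable borel" if "f \<in> test_functions UNIV" for f
    using continuous_test_function[OF that] by (rule borel_measurable_continuous_onI)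
  show ?thesis
  proof (intro exI[of _ C] conjI allI impI \<open>C > 0\<close>)
    fix e :: real assume e: "e > 0"
    have lin: "f differentiable (at x)" if "f \<in> test_functions UNIV" for f x
      using that by (rule test_functions_differentiable)
    have sc: "partial i (\<lambda>x. f ((1/e) *\<^sub>R x)) = (\<lambda>x. (1/e) * partial i f ((1/e) *\<^sub>R x))"
      if "f \<in> test_functions UNIV" for f :: "real^2 \<Rightarrow> real" and i
      using partial_affine_compose[OF lin[OF that], where s = "1/e" and c = 0] by (simp add:
          fun_eq_iff)
    have tf: "(\<lambda>x. f ((1/e) *\<^sub>R x)) \<in> test_functions UNIV" if "f \<in> test_functions UNIV" for f
      using test_functions_affine_compose[OF that, where s = "1/e" and c = 0] e by simp
    have cm: "partial i (\<lambda>x. c * f x) = (\<lambda>x. c * partial i f x)" if "f \<in> test_functions UNIV" for i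
        c f
      using partial_cmult[OF lin[OF that]] by (simp add: fun_eq_iff)
    define \<eta>' where "\<eta>' x = (1/e\<^sup>2) * \<eta> ((1/e) *\<^sub>R x)" for x
    have t: "\<eta>' \<in> test_functions UNIV"
      unfolding \<eta>'_def by (intro test_functions_cmult tf \<eta>)
    have p1: "partial i \<eta>' = (\<lambda>x. (1/e\<^sup>2) * ((1/e) * partial i \<eta> ((1/e) *\<^sub>R x)))" for i
      unfolding \<eta>'_def cm[OF tf[OF \<eta>(1)]] sc[OF \<eta>(1)] ..
    have p2: "partial j (partial i \<eta>') = (\<lambda>x. (1/e\<^sup>2) * ((1/e) * ((1/e) * partial j (partial i \<eta>)
        ((1/e) *\<^sub>R x))))" for i j
      unfolding p1
        cm[OF test_functions_cmult[OF tf[OF test_functions_partial[OF \<eta>(1)]]]]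
        cm[OF tf[OF test_functions_partial[OF \<eta>(1)]]] sc[OF test_functions_partial[OF \<eta>(1)]] ..
    have sint: "(\<integral>y. c * f ((1/e) *\<^sub>R y) \<partial>lborel) = c * (e\<^sup>2 * integral\<^sup>L lborel f)"
      if "f \<in> borel_measurable borel" for c and f :: "real^2 \<Rightarrow> real"
      using integral_scale[OF that e] by simp
    show "\<exists>\<eta>\<in>test_functions UNIV. (\<forall>x. \<eta> x \<ge> 0) \<and> (\<forall>x. norm x \<ge> e \<longrightarrow> \<eta> x = 0) \<and>
     integral\<^sup>L lborel \<eta> = 1 \<and> (\<forall>i. (\<integral>y. \<bar>partial i \<eta> y\<bar> \<partial>lborel) \<le> C / e) \<and>
     (\<forall>i j. (\<integral>y. \<bar>partial i (partial j \<eta>) y\<bar> \<partial>lborel) \<le> C / e\<^sup>2)"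
    proof (intro bexI[OF _ t] conjI allI impI)
      show "\<eta>' x \<ge> 0" for x using \<eta>(2) by (simp add: \<eta>'_def)
      show "\<eta>' x = 0" if "norm x \<ge> e" for x
        using that e \<eta>(3)[of "(1/e) *\<^sub>R x"] by (simp add: \<eta>'_def)
      show "integral\<^sup>L lborel \<eta>' = 1"
        unfolding \<eta>'_def sint[OF meas[OF \<eta>(1)]] \<eta>(4) using e by simp
      show "(\<integral>y. \<bar>partial i \<eta>' y\<bar> \<partial>lborel) \<le> C / e" for i
      proof -
        have "(\<integral>y. \<bar>partial i \<eta>' y\<bar> \<partial>lborel) = (\<integral>y. (1/e^3) * \<bar>partial i \<eta> ((1/e) *\<^sub>R y)\<bar> \<partial>lborel)"
          unfolding p1 using e by (simp add: abs_mult power2_eq_square power3_eq_cube mult_ac)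
        also have "\<dots> = (1/e) * ?A i"
          using sint[of "\<lambda>y. \<bar>partial i \<eta> y\<bar>" "1/e^3"] meas[OF test_functions_partial[OF \<eta>(1)]] e
          by (simp add: power2_eq_square power3_eq_cube)
        finally show ?thesis using CA[of i] e by (simp add: divide_right_mono)
      qed
      show "(\<integral>y. \<bar>partial i (partial j \<eta>') y\<bar> \<partial>lborel) \<le> C / e\<^sup>2" for i j
      proof -
        have "(\<integral>y. \<bar>partial i (partial j \<eta>') y\<bar> \<partial>lborel) = (\<integral>y. (1/e^4) * \<bar>partial i (partial j \<eta>)
            ((1/e) *\<^sub>R y)\<bar> \<partial>lborel)"
          unfolding p2 using e by (simp add: abs_mult power2_eq_square power4_eq_xxxx mult_ac)
        also have "\<dots> = (1/e\<^sup>2) * ?B i j"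
          using sint[of "\<lambda>y. \<bar>partial i (partial j \<eta>) y\<bar>" "1/e^4"]
            meas[OF test_functions_partial[OF test_functions_partial[OF \<eta>(1)]]] e
          by (simp add: power2_eq_square power4_eq_xxxx)
        finally show ?thesis using CB[of i j] e by (simp add: divide_right_mono)
      qed
    qed
  qed
qed

lemma locally_integrable_bounded:
  fixes f :: "real^2 \<Rightarrow> real"
  assumes [measurable]: "f \<in> borel_measurable borel" and "\<And>x. \<bar>f x\<bar> \<le> B"
  shows "locally_integrable f"
  unfolding convolution_kernel_def
proof (intro conjI allI)
  fix R
  have "cball 0 R = {y::real^2. norm y \<le> R}" by auto
  then have fin: "emeasure lborel {y::real^2. norm y \<le> R} < \<infinity>"
    using emeasure_bounded_finite[OF bounded_cball, of "0::real^2" R] by simp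
  show "integrable lborel (\<lambda>y. indicat_real {y. norm y \<le> R} y * f y)"
  proof (rule Bochner_Integration.integrable_bound)
    show "integrable lborel (\<lambda>y. B * indicat_real {y::real^2. norm y \<le> R} y)"
      using fin by (intro integrable_mult_right integrable_real_indicator) auto
    show "AE y in lborel. norm (indicat_real {y. norm y \<le> R} y * f y) \<le> norm (B * indicat_real {y.
        norm y \<le> R} y)"
      using assms(2) by (intro AE_I2) (auto simp: indicator_def intro: order_trans[OF _
          abs_ge_self])
  qed measurable
qed auto

lemma convolve_bound:
  assumes f: "f \<in> borel_measurable borel" "\<And>x. \<bar>f x\<bar> \<le> B" and \<phi>: "\<phi> \<in> test_functions UNIV"
  shows "\<bar>convolve f \<phi> x\<bar> \<le> B * (\<integral>y. \<bar>\<phi> y\<bar> \<partial>lborel)"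
proof -
  have [measurable]: "f \<in> borel_measurable borel" "\<phi> \<in> borel_measurable borel"
    using f continuous_test_function[OF \<phi>] by (auto intro: borel_measurable_continuous_onI)
  have "\<bar>convolve f \<phi> x\<bar> \<le> (\<integral>y. \<bar>f y * \<phi> (x - y)\<bar> \<partial>lborel)"
    unfolding kernel_conv_def using integral_norm_bound[of lborel "\<lambda>y. f y * \<phi> (x - y)"] by simp
  also have "\<dots> \<le> (\<integral>y. B * \<bar>\<phi> (x - y)\<bar> \<partial>lborel)"
  proof (rule integral_mono)
    show "integrable lborel (\<lambda>y. \<bar>f y * \<phi> (x - y)\<bar>)"
      using kernel_conv_integrable[OF locally_integrable_bounded[OF f] \<phi>] by simp
    have "integrable lborel (\<lambda>y. 1 * \<phi> (x - y))"
      by (rule kernel_conv_integrable[OF locally_integrable_bounded[of _ 1] \<phi>]) auto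
    then show "integrable lborel (\<lambda>y. B * \<bar>\<phi> (x - y)\<bar>)" by simp
    show "\<bar>f y * \<phi> (x - y)\<bar> \<le> B * \<bar>\<phi> (x - y)\<bar>" for y
      using f(2) by (simp add: abs_mult mult_right_mono)
  qed
  also have "\<dots> = B * (\<integral>y. \<bar>\<phi> y\<bar> \<partial>lborel)"
    using integral_reflect[of "\<lambda>y. \<bar>\<phi> y\<bar>" x] by simp
  finally show ?thesis .
qed

text \<open>The indicator of \<open>S\<close> convolved with a mollifier of radius \<open>e\<close>.
  As the indicator is bounded by 1, L1 bounds on the derivatives of the mollifier become sup bounds,
  with a constant independent of \<open>S\<close> and \<open>e\<close>.\<close>

lemma ex_cutoff:
  "\<exists>C>0. \<forall>e>0. \<forall>S\<in>sets borel. \<exists>\<theta>::real^2 \<Rightarrow> real. smooth_on UNIV \<theta> \<and> (\<forall>x. 0 \<le> \<theta> x \<and> \<theta> x \<le> 1) \<and>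
     (\<forall>x. ball x e \<subseteq> S \<longrightarrow> \<theta> x = 1) \<and> (\<forall>x. ball x e \<inter> S = {} \<longrightarrow> \<theta> x = 0) \<and>
     (\<forall>i x. \<bar>partial i \<theta> x\<bar> \<le> C / e) \<and> (\<forall>i j x. \<bar>partial i (partial j \<theta>) x\<bar> \<le> C / e\<^sup>2)"
proof -
  obtain C where C: "C > 0" and ex: "\<And>e. e > 0 \<Longrightarrow> \<exists>\<eta>\<in>test_functions UNIV. (\<forall>x. \<eta> x \<ge> 0) \<and> (\<forall>x. norm x
      \<ge> e \<longrightarrow> \<eta> x = 0) \<and>
     integral\<^sup>L lborel \<eta> = 1 \<and> (\<forall>i. (\<integral>y. \<bar>partial i \<eta> y\<bar> \<partial>lborel) \<le> C / e) \<and>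
     (\<forall>i j. (\<integral>y. \<bar>partial i (partial j \<eta>) y\<bar> \<partial>lborel) \<le> C / e\<^sup>2)"
    using ex_scaled_mollifier by blast
  show ?thesis
  proof (intro exI[of _ C] conjI allI impI ballI C)
    fix e :: real and S :: "(real^2) set" assume e: "e > 0" and S[measurable]: "S \<in> sets borel"
    obtain \<eta> where \<eta>: "\<eta> \<in> test_functions UNIV" "\<And>x. \<eta> x \<ge> 0" "\<And>x. norm x \<ge> e \<Longrightarrow> \<eta> x = 0"
        "integral\<^sup>L lborel \<eta> = 1" "\<And>i. (\<integral>y. \<bar>partial i \<eta> y\<bar> \<partial>lborel) \<le> C / e"
        "\<And>i j. (\<integral>y. \<bar>partial i (partial j \<eta>) y\<bar> \<partial>lborel) \<le> C / e\<^sup>2"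
      using ex[OF e] by blast
    have [measurable]: "\<eta> \<in> borel_measurable borel"
      using continuous_test_function[OF \<eta>(1)] by (rule borel_measurable_continuous_onI)
    define \<theta> where "\<theta> = convolve (indicat_real S) \<eta>"
    have m: "indicat_real S \<in> borel_measurable borel" by simp
    have b: "\<bar>indicat_real S x\<bar> \<le> 1" for x by (simp add: indicator_def)
    note li = locally_integrable_bounded[OF m b]
    have bd: "\<bar>convolve (indicat_real S) \<phi> x\<bar> \<le> (\<integral>y. \<bar>\<phi> y\<bar> \<partial>lborel)" if "\<phi> \<in> test_functions UNIV"
        for \<phi> x
      using convolve_bound[OF m b that] by simp
    have one: "(\<integral>y. \<eta> (x - y) \<partial>lborel) = 1" for x
      using integral_reflect[of \<eta> x] \<eta>(4) by simp
    have val: "\<theta> x = v" if "\<And>y. dist x y < e \<Longrightarrow> indicat_real S y = v" for x v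
    proof -
      have "indicat_real S y * \<eta> (x - y) = v * \<eta> (x - y)" for y
        using that[of y] \<eta>(3)[of "x - y"] by (cases "dist x y < e") (auto simp: dist_norm)
      then have "\<theta> x = (\<integral>y. v * \<eta> (x - y) \<partial>lborel)"
        unfolding \<theta>_def kernel_conv_def by (intro Bochner_Integration.integral_cong refl)
      then show ?thesis using one by simp
    qed
    show "\<exists>\<theta>::real^2 \<Rightarrow> real. smooth_on UNIV \<theta> \<and> (\<forall>x. 0 \<le> \<theta> x \<and> \<theta> x \<le> 1) \<and>
     (\<forall>x. ball x e \<subseteq> S \<longrightarrow> \<theta> x = 1) \<and> (\<forall>x. ball x e \<inter> S = {} \<longrightarrow> \<theta> x = 0) \<and>
     (\<forall>i x. \<bar>partial i \<theta> x\<bar> \<le> C / e) \<and> (\<forall>i j x. \<bar>partial i (partial j \<theta>) x\<bar> \<le> C / e\<^sup>2)"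
    proof (intro exI[of _ \<theta>] conjI allI impI)
      show "smooth_on UNIV \<theta>" unfolding \<theta>_def by (rule smooth_on_kernel_conv[OF li \<eta>(1)])
      show "0 \<le> \<theta> x" for x
        unfolding \<theta>_def kernel_conv_def using \<eta>(2) by (intro integral_nonneg_AE) auto
      show "\<theta> x \<le> 1" for x
        using bd[OF \<eta>(1), of x] \<eta>(2,4) by (simp add: \<theta>_def)
      show "\<theta> x = 1" if "ball x e \<subseteq> S" for x
        by (rule val) (use that in \<open>auto simp: indicator_def\<close>)
      show "\<theta> x = 0" if "ball x e \<inter> S = {}" for x
        by (rule val) (use that in \<open>auto simp: indicator_def\<close>)
      show "\<bar>partial i \<theta> x\<bar> \<le> C / e" for i x
        unfolding \<theta>_def partial_kernel_conv[OF li \<eta>(1)]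
        using bd[OF test_functions_partial[OF \<eta>(1)]] \<eta>(5) by (rule order_trans)
      show "\<bar>partial i (partial j \<theta>) x\<bar> \<le> C / e\<^sup>2" for i j x
        unfolding \<theta>_def partial_kernel_conv[OF li \<eta>(1)] partial_kernel_conv[OF li
            test_functions_partial[OF \<eta>(1)]]
        using bd[OF test_functions_partial[OF test_functions_partial[OF \<eta>(1)]]] \<eta>(6) by (rule
            order_trans)
    qed
  qed
qed

lemma ex_bump:
  fixes c :: "real^2"
  assumes "0 < r" "r < s"
  shows "\<exists>\<kappa>\<in>test_functions (ball c s). (\<forall>x. 0 \<le> \<kappa> x \<and> \<kappa> x \<le> 1) \<and> (\<forall>x\<in>ball c r. \<kappa> x = 1)"
proof -
  \<comment> \<open>The interval from \<open>r\<close> to \<open>s\<close> is split into thirds: the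
    ball of radius r + e, smoothed at scale e, gives 1 on radius r and 0 beyond r + 2e < s.\<close>
  define e where "e = (s - r) / 3"
  have e: "e > 0" using assms by (simp add: e_def)
  obtain \<theta> :: "real^2 \<Rightarrow> real" where \<theta>: "smooth_on UNIV \<theta>" "\<forall>x. 0 \<le> \<theta> x \<and> \<theta> x \<le> 1"
     "\<forall>x. ball x e \<subseteq> ball c (r + e) \<longrightarrow> \<theta> x = 1" "\<forall>x. ball x e \<inter> ball c (r + e) = {} \<longrightarrow> \<theta> x = 0"
    using ex_cutoff e by (metis open_ball borel_open)
  have "\<theta> \<in> test_functions (ball c s)"
  proof (rule test_functionsI[OF \<theta>(1) compact_cball])
    have "r + 2 * e < s" using assms by (simp add: e_def field_simps)
    then show "cball c (r + 2 * e) \<subseteq> ball c s" by auto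
    show "\<theta> x = 0" if "x \<notin> cball c (r + 2 * e)" for x
    proof -
      have "ball x e \<inter> ball c (r + e) = {}"
        using that by (intro disjoint_ballI) (auto simp: dist_commute)
      then show ?thesis using \<theta>(4) by blast
    qed
  qed
  moreover have "\<theta> x = 1" if "x \<in> ball c r" for x
  proof -
    have "ball x e \<subseteq> ball c (r + e)"
    proof
      fix y assume "y \<in> ball x e"
      then show "y \<in> ball c (r + e)" using that dist_triangle[of c y x] by simp
    qed
    then show ?thesis using \<theta>(3) by blast
  qed
  ultimately show ?thesis using \<theta>(2) by blast
qed

lemma fundamental_lemma:
  fixes f :: "real^2 \<Rightarrow> real"
  assumes W: "open W" and f: "continuous_on W f"
    and z: "\<And>\<phi>. \<phi> \<in> test_functions W \<Longrightarrow> (\<integral>x. f x * \<phi> x \<partial>lborel) = 0"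
    and int: "\<And>\<phi>. \<phi> \<in> test_functions W \<Longrightarrow> integrable lborel (\<lambda>x. f x * \<phi> x)"
    and x: "x \<in> W"
  shows "f x = 0"
proof (rule ccontr)
  assume nz: "f x \<noteq> 0"
  \<comment> \<open>Multiplying by the sign of \<open>f x\<close> makes the function positive near
    \<open>x\<close>, so that a nonnegative bump there has a contradictory integral.\<close>
  define g where "g y = f y * sgn (f x)" for y
  have gx: "g x > 0" using nz by (simp add: g_def abs_sgn[symmetric] mult.commute)
  have "continuous_on W g" unfolding g_def by (intro continuous_intros f)
  then have "isCont g x" using W x by (simp add: continuous_on_eq_continuous_at)
  then have "\<forall>\<^sub>F y in at x. g y > g x / 2"
    using gx by (intro order_tendstoD(1)[of g "g x"]) (auto simp: isCont_def)
  then have "\<forall>\<^sub>F y in nhds x. g y > g x / 2"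
    using gx by (simp add: eventually_nhds_conv_at)
  then obtain U where U: "open U" "x \<in> U" "\<And>y. y \<in> U \<Longrightarrow> g y > g x / 2"
    unfolding eventually_nhds by blast
  obtain s where s: "s > 0" "ball x s \<subseteq> U \<inter> W"
    using U W x by (meson IntI open_Int openE)
  obtain \<kappa> where \<kappa>: "\<kappa> \<in> test_functions (ball x s)" "\<And>y. 0 \<le> \<kappa> y" "\<And>y. y \<in> ball x (s/2) \<Longrightarrow> \<kappa> y = 1"
    using ex_bump[of "s/2" s x] s(1) by auto
  have \<kappa>W: "\<kappa> \<in> test_functions W" using \<kappa>(1) s(2) by (auto intro: test_functions_mono)
  have i: "integrable lborel (\<lambda>y. g y * \<kappa> y)"
    using integrable_mult_right[OF int[OF \<kappa>W], of "sgn (f x)"] by (simp add: g_def mult_ac)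
  have I: "(\<integral>y. g y * \<kappa> y \<partial>lborel) = 0"
    using z[OF \<kappa>W] integral_mult_right_zero[of lborel "sgn (f x)" "\<lambda>x. f x * \<kappa> x"] by (simp add:
        g_def mult_ac)
  have nn: "g y * \<kappa> y \<ge> 0" for y
  proof (cases "y \<in> ball x s")
    case True
    then have "g y > g x / 2" using s(2) U(3) by blast
    then have "g y > 0" using gx by linarith
    then show ?thesis using \<kappa>(2) by simp
  next
    case False then show ?thesis using test_functions_eq_0[OF \<kappa>(1)] by simp
  qed
  have ae: "AE y in lborel. g y * \<kappa> y = 0"
    using integral_nonneg_eq_0_iff_AE[OF i] nn I by simp
  have "g y * \<kappa> y \<noteq> 0" if "y \<in> ball x (s/2)" for y
  proof -
    have "y \<in> ball x s" using that s(1) by auto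
    then have "g y > g x / 2" using s(2) U(3) by blast
    then have "g y \<noteq> 0" using gx by linarith
    then show ?thesis using \<kappa>(3)[OF that] by simp
  qed
  then have "AE y in lborel. y \<notin> ball x (s/2)" using ae by (auto elim: eventually_mono)
  then have "ball x (s/2) \<in> null_sets lborel" using AE_iff_null_sets[of "ball x (s/2)" lborel] by
      simp
  then have "ball x (s/2) \<in> null_sets lebesgue" by (rule null_sets_completionI)
  then have "negligible (ball x (s/2))" by (simp add: negligible_iff_null_sets)
  then show False using open_not_negligible[OF open_ball, of x "s/2"] s(1) by simp
qed

section \<open>Second-order elliptic operators\<close>

lemma smooth_on_inverse:
  fixes g :: "real^2 \<Rightarrow> real"
  assumes U: "open U" and g: "smooth_on U g" and nz: "\<And>x. x \<in> U \<Longrightarrow> g x \<noteq> 0"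
  shows "smooth_on U (\<lambda>x. inverse (g x))"
proof -
  have "times_differentiable_on n U (\<lambda>x. inverse (g x))" for n
  proof (induction n)
    case (Suc n)
    have d: "((\<lambda>x. inverse (g x)) has_derivative
        (\<lambda>h. - (inverse (g x) * frechet_derivative g (at x) h * inverse (g x)))) (at x)" if "x \<in> U"
            for x
      using smooth_on_differentiable[OF g that] nz[OF that]
      by (intro Deriv.has_derivative_inverse has_derivative_frechet)
    have e: "(\<lambda>x. (- 1) * (inverse (g x) * partial i g x * inverse (g x)))
        = (\<lambda>x. - (inverse (g x) * frechet_derivative g (at x) (axis i 1) * inverse (g x)))" for i
      by (simp add: partial_def)
    have "times_differentiable_on n U (\<lambda>x. (- 1) * (inverse (g x) * partial i g x * inverse (g x)))"
        for i
      using Suc smooth_on_partial[OF g, of i] U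
      by (intro times_differentiable_on_mult smooth_on_const[unfolded smooth_on_iff, rule_format])
         (auto simp: smooth_on_iff)
    then show ?case using times_differentiable_onI[OF U d, of n] unfolding e by blast
  qed simp
  then show ?thesis by (simp add: smooth_on_iff)
qed

lemma has_derivative_vec_nth': "((\<lambda>x::real^2. x $ i) has_derivative (\<lambda>h. h $ i)) F"
  by (rule bounded_linear_imp_has_derivative[OF bounded_linear_vec_nth])

text \<open>The logarithmic singularity is traded for 1/sqrt y, which a factor x_1 absorbs as soon
  as y is at least a multiple of x_1^2.\<close>

lemma abs_ln_le:
  assumes "(y::real) > 0"
  shows "\<bar>ln y\<bar> \<le> y + 2 / sqrt y"
proof (cases "y \<ge> 1")
  case True
  then have "\<bar>ln y\<bar> \<le> y - 1" using ln_le_minus_one[OF assms] by simp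
  moreover have "2 / sqrt y \<ge> 0" using assms by simp
  ultimately show ?thesis by linarith
next
  case False
  have "ln (1 / sqrt y) \<le> 1 / sqrt y - 1" using assms by (intro ln_le_minus_one) simp
  moreover have "ln (1 / sqrt y) = - (ln y / 2)" using assms by (simp add: ln_div ln_sqrt)
  moreover have "\<bar>ln y\<bar> = - ln y" using False assms by simp
  ultimately show ?thesis using assms by simp
qed

definition second_order :: "real \<Rightarrow> real \<Rightarrow> real \<Rightarrow> (real^2 \<Rightarrow> real) \<Rightarrow> real^2 \<Rightarrow> real" where
  "second_order a b c f x =
     a * partial 1 (partial 1 f) x + 2 * b * partial 1 (partial 2 f) x + c * partial 2 (partial 2 f)
         x"

lemma test_functions_second_order:
  "\<phi> \<in> test_functions U \<Longrightarrow> second_order a b c \<phi> \<in> test_functions U"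
  unfolding second_order_def
  by (intro test_functions_add test_functions_cmult test_functions_partial)

lemma smooth_on_second_order: "open U \<Longrightarrow> smooth_on U f \<Longrightarrow> smooth_on U (second_order a b c f)"
  unfolding second_order_def
  by (intro smooth_on_add smooth_on_mult smooth_on_const smooth_on_partial)

lemma second_order_cong_open:
  assumes "open U" "x \<in> U" "\<And>y. y \<in> U \<Longrightarrow> f y = g y"
  shows "second_order a b c f x = second_order a b c g x"
proof -
  have p: "partial i f y = partial i g y" if "y \<in> U" for i y
    using partial_cong_open[OF assms(1) that assms(3)] .
  have "partial j (partial i f) x = partial j (partial i g) x" for i j
    using partial_cong_open[OF assms(1,2) p] .
  then show ?thesis by (simp add: second_order_def)
qed

lemma second_order_by_parts:
  assumes W: "open W" and u: "smooth_on W u" and \<phi>: "\<phi> \<in> test_functions W"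
  shows "(\<integral>x. u x * second_order a b c \<phi> x \<partial>lborel) = (\<integral>x. second_order a b c u x * \<phi> x \<partial>lborel)"
proof -
  have 1: "(\<integral>x. u x * partial i (partial j \<phi>) x \<partial>lborel) = (\<integral>x. partial j (partial i u) x * \<phi> x
      \<partial>lborel)" for i j
    using integral_by_parts[OF W u test_functions_partial[OF \<phi>]] integral_by_parts[OF W
        smooth_on_partial[OF u] \<phi>]
    by simp
  have i1: "integrable lborel (\<lambda>x. u x * partial i (partial j \<phi>) x)" for i j
    by (intro test_functions_integrable[where U = W] test_functions_mult[OF W u]
        test_functions_partial \<phi>)
  have i2: "integrable lborel (\<lambda>x. partial i (partial j u) x * \<phi> x)" for i j
    by (intro test_functions_integrable[where U = W] test_functions_mult[OF W] smooth_on_partial u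
        \<phi>)
  have c: "partial 1 (partial 2 \<phi>) = partial 2 (partial 1 \<phi>)"
    using partial_commute test_functions_smooth[OF \<phi>] by blast
  have "(\<integral>x. u x * second_order a b c \<phi> x \<partial>lborel) = a * (\<integral>x. u x * partial 1 (partial 1 \<phi>) x
      \<partial>lborel)
      + 2 * b * (\<integral>x. u x * partial 2 (partial 1 \<phi>) x \<partial>lborel) + c * (\<integral>x. u x * partial 2 (partial 2
          \<phi>) x \<partial>lborel)"
    unfolding second_order_def c using i1[of 1 1] i1[of 2 1] i1[of 2 2]
    by (simp add: distrib_left mult.left_commute[of "u _"])
  also have "\<dots> = (\<integral>x. second_order a b c u x * \<phi> x \<partial>lborel)"
    unfolding second_order_def 1 using i2[of 1 1] i2[of 1 2] i2[of 2 2]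
    by (simp add: distrib_right mult.assoc)
  finally show ?thesis .
qed

lemma locally_integrable_mult_test:
  assumes F: "locally_integrable F" and \<phi>: "\<phi> \<in> test_functions UNIV"
  shows "integrable lborel (\<lambda>y. F y * \<phi> y)"
proof -
  have "(\<lambda>y. \<phi> (0 + (-1) *\<^sub>R y)) \<in> test_functions UNIV"
    by (rule test_functions_affine_compose[OF \<phi>]) simp
  from kernel_conv_integrable[OF F this, of 0] show ?thesis by simp
qed

section \<open>The regularized logarithm of the adjugate form\<close>

locale elliptic_operator =
  fixes a b c :: real
  assumes a_pos: "a > 0" and det_pos: "a * c - b\<^sup>2 > 0"
begin

definition "D = a * c - b\<^sup>2"
text \<open>Determinant over trace, a lower bound for the smaller eigenvalue of the form
  \<open>q\<close>; \<open>K\<close> bounds the larger one from above.\<close>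

definition "k = D / (a + c)"
definition "K = a + c + \<bar>b\<bar>"

text \<open>The form of the adjugate of the coefficient matrix. A linear change of variables that
  turns the operator into the Laplacian turns \<open>q\<close> into a multiple of |x|^2, so ln q
  plays the part of ln |x|^2.\<close>

definition q :: "real^2 \<Rightarrow> real" where
  "q x = c * (x $ 1 * x $ 1) - 2 * b * (x $ 1 * x $ 2) + a * (x $ 2 * x $ 2)"

lemma D_pos: "D > 0" using det_pos by (simp add: D_def)

lemma c_pos: "c > 0"
proof -
  have "a * c > 0" using det_pos by (smt (verit) zero_le_power2)
  then show ?thesis using a_pos zero_less_mult_pos by blast
qed

lemma k_pos: "k > 0" using a_pos c_pos D_pos by (simp add: k_def)
lemma K_pos: "K > 0" using a_pos c_pos by (simp add: K_def add_pos_nonneg)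

lemma norm_square: "(norm (x::real^2))\<^sup>2 = x $ 1 * x $ 1 + x $ 2 * x $ 2"
  unfolding power2_norm_eq_inner inner_vec_def sum_2 inner_real_def ..

lemma q_lower: "k * (norm x)\<^sup>2 \<le> q x"
proof -
  \<comment> \<open>Cayley-Hamilton for the adjugate: trace times the form equals the squared norm
    of the image of x plus the determinant times |x|^2.\<close>
  have "(a + c) * q x = (a * x $ 2 - b * x $ 1)\<^sup>2 + (c * x $ 1 - b * x $ 2)\<^sup>2 + D * (norm x)\<^sup>2"
    unfolding norm_square unfolding q_def D_def power2_eq_square by algebra
  then have "(a + c) * q x \<ge> D * (norm x)\<^sup>2" by simp
  then show ?thesis using a_pos c_pos by (simp add: k_def field_simps)
qed

lemma q_upper: "q x \<le> K * (norm x)\<^sup>2"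
proof -
  have "- (2 * (x $ 1 * x $ 2)) * b \<le> \<bar>2 * (x $ 1 * x $ 2)\<bar> * \<bar>b\<bar>"
    by (metis abs_ge_self abs_minus_cancel abs_mult)
  also have "\<dots> \<le> (norm x)\<^sup>2 * \<bar>b\<bar>"
  proof (rule mult_right_mono)
    have "(\<bar>x $ 1\<bar> - \<bar>x $ 2\<bar>)\<^sup>2 \<ge> 0" by simp
    then show "\<bar>2 * (x $ 1 * x $ 2)\<bar> \<le> (norm x)\<^sup>2"
      unfolding norm_square by (simp add: power2_eq_square algebra_simps abs_mult)
  qed simp
  finally have 1: "- (2 * (x $ 1 * x $ 2)) * b \<le> (norm x)\<^sup>2 * \<bar>b\<bar>" .
  have 2: "c * (x $ 1 * x $ 1) \<le> c * (norm x)\<^sup>2" "a * (x $ 2 * x $ 2) \<le> a * (norm x)\<^sup>2"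
    using a_pos c_pos unfolding norm_square by (intro mult_left_mono; simp)+
  show ?thesis using 1 2 unfolding q_def K_def by (simp add: algebra_simps)
qed

lemma q_nonneg: "q x \<ge> 0"
  using q_lower[of x] k_pos by (smt (verit) mult_nonneg_nonneg zero_le_power2)

lemma q_pos: "x \<noteq> 0 \<Longrightarrow> q x > 0"
  using q_lower[of x] k_pos by (smt (verit) mult_pos_pos zero_less_norm_iff zero_less_power)

lemma smooth_q: "smooth_on U q"
proof -
  have "smooth_on UNIV q"
    unfolding q_def
    by (intro smooth_on_add smooth_on_diff smooth_on_mult smooth_on_const smooth_on_coordinate
        open_UNIV)
  then show ?thesis by (rule smooth_on_subset) simp
qed

lemma q_has_derivative:
  "(q has_derivative (\<lambda>h. (2 * c * x $ 1 - 2 * b * x $ 2) * h $ 1 + (2 * a * x $ 2 - 2 * b * x $ 1)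
      * h $ 2)) (at x)"
  unfolding q_def
  by (rule derivative_eq_intros has_derivative_vec_nth' refl)+ (simp add: fun_eq_iff algebra_simps)

lemma partial_q:
  "partial 1 q = (\<lambda>x. 2 * c * x $ 1 - 2 * b * x $ 2)"
  "partial 2 q = (\<lambda>x. 2 * a * x $ 2 - 2 * b * x $ 1)"
  using partial_eqI[OF q_has_derivative] by (simp_all add: fun_eq_iff axis_def)

text \<open>\<open>F e\<close> is the smooth replacement of ln q, and \<open>G e\<close> is what the
  operator makes of it. Since \<open>G e x\<close> equals e^(-2) times \<open>G 1\<close> at x/e, it
  behaves like an approximate identity, up to a constant factor.\<close>

definition F where "F e x = ln (q x + e\<^sup>2)"
definition r where "r e x = inverse (q x + e\<^sup>2)"
definition G where "G e x = 4 * D * e\<^sup>2 * (r e x * r e x)"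

context
  fixes e :: real assumes e: "e > 0"
begin

lemma qe_pos: "q x + e\<^sup>2 > 0"
  using q_nonneg[of x] e by (simp add: add_nonneg_pos)

lemma smooth_r: "smooth_on UNIV (r e)"
  unfolding r_def
  using qe_pos by (intro smooth_on_inverse smooth_on_add smooth_q smooth_on_const) (auto simp:
      less_imp_neq[symmetric])

lemma partial_r: "partial i (r e) x = - partial i q x * (r e x * r e x)"
proof -
  have "(r e has_derivative (\<lambda>h. - (inverse (q x + e\<^sup>2) * (frechet_derivative q (at x) h + 0) *
      inverse (q x + e\<^sup>2)))) (at x)"
    unfolding r_def
    by (intro Deriv.has_derivative_inverse has_derivative_add has_derivative_const
        has_derivative_frechet
          smooth_on_differentiable[OF smooth_q UNIV_I] less_imp_neq[OF qe_pos, symmetric])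
  from partial_eqI[OF this, of i] show ?thesis by (simp add: r_def partial_def)
qed

lemma F_has_derivative:
  "(F e has_derivative (\<lambda>h. r e x * frechet_derivative q (at x) h)) (at x)"
proof -
  have "((\<lambda>x. q x + e\<^sup>2) has_derivative (\<lambda>h. frechet_derivative q (at x) h + 0)) (at x)"
    by (intro has_derivative_add has_derivative_const has_derivative_frechet
        smooth_on_differentiable[OF smooth_q UNIV_I])
  from has_derivative_ln[OF qe_pos this]
  show ?thesis unfolding F_def r_def by (simp add: divide_inverse mult.commute)
qed

lemma partial_F: "partial i (F e) = (\<lambda>x. r e x * partial i q x)"
  using partial_eqI[OF F_has_derivative] by (simp add: partial_def fun_eq_iff)

lemma smooth_F: "smooth_on UNIV (F e)"
proof -
  have "times_differentiable_on (Suc n) UNIV (F e)" for n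
  proof -
    have "smooth_on UNIV (\<lambda>x. r e x * partial i q x)" for i
      by (intro smooth_on_mult smooth_r smooth_on_partial smooth_q open_UNIV)
    then show ?thesis
      using F_has_derivative by (auto simp: partial_F differentiable_def smooth_on_iff)
  qed
  then have "times_differentiable_on n UNIV (F e)" for n
    using times_differentiable_on_mono_nat[of "Suc n" UNIV "F e" n] by simp
  then show ?thesis by (simp add: smooth_on_iff)
qed

lemma partial_linear: "partial i (\<lambda>x::real^2. \<alpha> * x $ 1 - \<beta> * x $ 2) x = (if i = 1 then \<alpha> else - \<beta>)"
proof -
  have "((\<lambda>x::real^2. \<alpha> * x $ 1 - \<beta> * x $ 2) has_derivative (\<lambda>h. \<alpha> * h $ 1 - \<beta> * h $ 2)) (at x)"
    by (rule derivative_eq_intros has_derivative_vec_nth' refl)+ simp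
  from partial_eqI[OF this, of i] show ?thesis using exhaust_2[of i] by (auto simp: axis_def)
qed

lemma second_order_F: "second_order a b c (F e) = G e"
proof
  fix x
  have p2: "partial 2 q = (\<lambda>x. - (2 * b) * x $ 1 - (- (2 * a)) * x $ 2)"
    unfolding partial_q by auto
  have qq: "partial 1 (partial 1 q) x = 2 * c" "partial 1 (partial 2 q) x = - 2 * b" "partial 2
      (partial 2 q) x = 2 * a"
    unfolding p2 partial_q(1) partial_linear by simp_all
  have pp: "partial i (partial j (F e)) x = r e x * partial i (partial j q) x - partial i q x *
      partial j q x * (r e x * r e x)" for i j
    unfolding partial_F
    by (subst partial_mult)
       (auto intro: smooth_on_differentiable[OF smooth_r] smooth_on_differentiable[OF
           smooth_on_partial[OF smooth_q]] simp: partial_r)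
  \<comment> \<open>The gradient of q, measured by the coefficient matrix, has squared length 4 D q.
    In the next identity this cancels all of 4 D r except the part carrying e^2, which is the reason
    for choosing q.\<close>
  have "a * (partial 1 q x * partial 1 q x) + 2 * b * (partial 1 q x * partial 2 q x) + c * (partial
      2 q x * partial 2 q x) = 4 * D * q x"
    unfolding partial_q D_def q_def power2_eq_square by algebra
  moreover have "second_order a b c (F e) x = 4 * D * r e x
      - (a * (partial 1 q x * partial 1 q x) + 2 * b * (partial 1 q x * partial 2 q x) + c *
          (partial 2 q x * partial 2 q x)) * (r e x * r e x)"
    unfolding second_order_def pp qq D_def power2_eq_square by algebra
  moreover have "r e x = (q x + e\<^sup>2) * (r e x * r e x)"
    using qe_pos[of x] by (simp add: r_def)
  ultimately show "second_order a b c (F e) x = G e x"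
    unfolding G_def by algebra
qed

lemma G_nonneg: "G e x \<ge> 0"
  unfolding G_def using D_pos by simp

lemma smooth_G: "smooth_on UNIV (G e)"
  unfolding G_def by (intro smooth_on_mult smooth_on_const smooth_r open_UNIV)

text \<open>A majorant independent of \<open>e\<close>, for dominated convergence as e tends to
  0.\<close>

lemma abs_F_le: "x \<noteq> 0 \<Longrightarrow> e \<le> 1 \<Longrightarrow> \<bar>F e x\<bar> \<le> \<bar>ln (q x)\<bar> + q x"
proof -
  assume x: "x \<noteq> 0" "e \<le> 1"
  have e1: "e\<^sup>2 \<le> 1" using x e by (simp add: power_le_one)
  have "ln (q x) \<le> F e x" unfolding F_def using q_pos[OF x(1)] qe_pos[of x]
    by (subst ln_le_cancel_iff) auto
  moreover have "F e x \<le> ln (1 + q x)"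
    unfolding F_def using qe_pos e1 by (subst ln_le_cancel_iff) (auto intro: add_pos_nonneg
        q_nonneg)
  moreover have "ln (1 + q x) \<le> q x" using q_nonneg by (rule ln_add_one_self_le_self)
  ultimately show ?thesis using q_nonneg[of x] by linarith
qed

end

end

section \<open>The fundamental solution as a limit\<close>

lemma AE_lborel_neq: "AE x in lborel. x \<noteq> (c::real^2)"
  by (rule AE_lborel_singleton)

lemma integral_bounded_ball:
  fixes f :: "real^2 \<Rightarrow> real"
  assumes "\<And>x. norm x \<le> R \<Longrightarrow> \<bar>f x\<bar> \<le> B" "\<And>x. norm x > R \<Longrightarrow> f x = 0" "B \<ge> 0"
  shows "\<bar>integral\<^sup>L lborel f\<bar> \<le> B * measure lborel (cball (0::real^2) R)"
proof -
  have fin: "emeasure lborel (cball (0::real^2) R) < \<infinity>"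
    using emeasure_bounded_finite[OF bounded_cball] by simp
  have "\<bar>integral\<^sup>L lborel f\<bar> \<le> (\<integral>x. B * indicat_real (cball (0::real^2) R) x \<partial>lborel)"
  proof (cases "integrable lborel f")
    case True
    have "\<bar>integral\<^sup>L lborel f\<bar> \<le> (\<integral>x. \<bar>f x\<bar> \<partial>lborel)"
      using integral_norm_bound[of lborel f] by simp
    also have "\<dots> \<le> (\<integral>x. B * indicat_real (cball (0::real^2) R) x \<partial>lborel)"
    proof (rule integral_mono)
      show "integrable lborel (\<lambda>x. B * indicat_real (cball (0::real^2) R) x)"
        using fin by (intro integrable_mult_right integrable_real_indicator) auto
      show "\<bar>f x\<bar> \<le> B * indicat_real (cball 0 R) x" for x
        using assms(1)[of x] assms(2)[of x] by (cases "norm x \<le> R") auto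
    qed (use True in simp)
    finally show ?thesis .
  next
    case False
    then show ?thesis using assms(3) by (simp add: not_integrable_integral_eq)
  qed
  then show ?thesis by simp
qed

context elliptic_operator
begin

lemma continuous_q: "continuous_on U q"
  using smooth_q by (rule smooth_on_continuous_on)

lemma q_borel[measurable]: "q \<in> borel_measurable borel"
  using continuous_q by (rule borel_measurable_continuous_onI)

definition F0 where "F0 x = ln (q x)"

lemma F0_borel[measurable]: "F0 \<in> borel_measurable borel"
  unfolding F0_def by measurable

lemma F_borel[measurable]: "F e \<in> borel_measurable borel"
  unfolding F_def by measurable

lemma F_tendsto_F0:
  assumes "x \<noteq> 0"
  shows "(\<lambda>n. F (1 / Suc n) x) \<longlonglongrightarrow> F0 x"
proof -
  have "(\<lambda>n. ln (q x + (1 / Suc n)\<^sup>2)) \<longlonglongrightarrow> ln (q x + 0\<^sup>2)"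
    using q_pos[OF assms] by (intro tendsto_intros LIMSEQ_Suc[OF lim_const_over_n[of 1]]) simp
  then show ?thesis by (simp add: F_def F0_def)
qed

lemma F_mono:
  assumes "0 < d" "d \<le> e"
  shows "F d x \<le> F e x"
proof -
  have "d\<^sup>2 \<le> e\<^sup>2" using assms by (intro power_mono) auto
  then show ?thesis
    unfolding F_def using qe_pos[of d x] qe_pos[of e x] assms by (subst ln_le_cancel_iff) auto
qed

text \<open>Integrating \<open>\<partial>\<^sub>1 (x\<^sub>1 F) = F + x\<^sub>1 \<partial>\<^sub>1 F\<close> against a cutoff bounds the mass of the
  logarithmic singularity, since \<open>x\<^sub>1 F\<close> and \<open>x\<^sub>1 \<partial>\<^sub>1 F\<close> are bounded uniformly in \<open>e\<close>.\<close>

lemma F_integral_bound: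
  assumes \<phi>: "\<phi> \<in> test_functions UNIV" "\<And>x. \<phi> x \<ge> 0"
  shows "\<exists>C. \<forall>e>0. e \<le> 1 \<longrightarrow> \<bar>\<integral>x. F e x * \<phi> x \<partial>lborel\<bar> \<le> C"
proof -
  obtain B where B: "B > 0" "\<And>x. \<bar>\<phi> x\<bar> \<le> B" by (metis test_function_bounded[OF \<phi>(1)])
  obtain B' where B': "B' > 0" "\<And>x. \<bar>partial 1 \<phi> x\<bar> \<le> B'"
    by (metis test_function_bounded[OF test_functions_partial[OF \<phi>(1)]])
  obtain R0 where R0: "\<And>x. norm x > R0 \<Longrightarrow> \<phi> x = 0" using \<phi>(1) test_functions_UNIV_iff by blast
  define R where "R = \<bar>R0\<bar>"
  have R: "\<phi> x = 0" if "norm x > R" for x using R0[of x] that by (simp add: R_def)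
  have R': "partial i \<phi> x = 0" if "norm x > R" for x i
    by (rule partial_eq_0_off[of "cball 0 R"]) (use R that in auto)
  have Rn: "R \<ge> 0" by (simp add: R_def)
  \<comment> \<open>\<open>C1\<close> bounds x_1 F by \<open>abs_ln_le\<close> with y = q + e^2 <= K
    R^2 + 1 and |x_1| / sqrt y <= 1 / sqrt k. \<open>C2\<close> bounds x_1 times the derivative of
    F: numerator and denominator are both quadratic in |x|.\<close>
  define C1 where "C1 = R * (K * R\<^sup>2 + 1) + 2 / sqrt k"
  define C2 where "C2 = 2 * (c + \<bar>b\<bar>) / k"
  have C1: "C1 \<ge> 0" and C2: "C2 \<ge> 0" using Rn K_pos k_pos c_pos by (auto simp: C1_def C2_def)
  have sq: "x $ 1 * x $ 1 \<le> (norm x)\<^sup>2" for x :: "real^2" by (simp add: norm_square)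
  have xF: "\<bar>x $ 1 * F e x\<bar> \<le> C1" if x: "norm x \<le> R" and e: "0 < e" "e \<le> 1" for e x
  proof (cases "x $ 1 = 0")
    case False
    define y where "y = q x + e\<^sup>2"
    have e1: "e\<^sup>2 \<le> 1" using e by (simp add: power_le_one)
    have y: "y > 0" "y \<le> q x + 1" unfolding y_def using qe_pos[OF e(1)] e1 by auto
    have n2: "(norm x)\<^sup>2 \<le> R\<^sup>2" using x by (intro power_mono) auto
    have "k * (x $ 1 * x $ 1) \<le> k * (norm x)\<^sup>2" using sq k_pos by (intro mult_left_mono) auto
    also have "\<dots> \<le> y" using q_lower[of x] by (simp add: y_def add_increasing2)
    finally have "sqrt k * \<bar>x $ 1\<bar> \<le> sqrt y"
      by (metis power2_eq_square real_sqrt_abs real_sqrt_le_mono real_sqrt_mult)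
    then have s: "\<bar>x $ 1\<bar> / sqrt y \<le> 1 / sqrt k"
      using y(1) k_pos by (simp add: field_simps)
    have "\<bar>x $ 1 * F e x\<bar> \<le> \<bar>x $ 1\<bar> * (y + 2 / sqrt y)"
      unfolding F_def y_def[symmetric] abs_mult by (intro mult_left_mono abs_ln_le y) auto
    also have "\<dots> = \<bar>x $ 1\<bar> * y + 2 * (\<bar>x $ 1\<bar> / sqrt y)" by (simp add: algebra_simps)
    also have "\<dots> \<le> R * (K * R\<^sup>2 + 1) + 2 * (1 / sqrt k)"
    proof (intro add_mono mult_mono s order_refl)
      show "\<bar>x $ 1\<bar> \<le> R" using component_le_norm_cart[of x 1] x by linarith
      have "q x \<le> K * R\<^sup>2" using q_upper[of x] mult_left_mono[OF n2, of K] K_pos by linarith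
      then show "y \<le> K * R\<^sup>2 + 1" using y(2) by linarith
    qed (use Rn y in auto)
    finally show ?thesis by (simp add: C1_def)
  qed (use C1 in simp)
  have xr: "\<bar>x $ 1 * (r e x * partial 1 q x)\<bar> \<le> C2" if e: "0 < e" for e x
  proof (cases "x = 0")
    case False
    have n: "norm x > 0" using False by simp
    have "\<bar>x $ 1\<bar> * \<bar>partial 1 q x\<bar> \<le> norm x * (2 * (c + \<bar>b\<bar>) * norm x)"
    proof (intro mult_mono component_le_norm_cart)
      have "\<bar>partial 1 q x\<bar> \<le> 2 * c * \<bar>x $ 1\<bar> + 2 * \<bar>b\<bar> * \<bar>x $ 2\<bar>"
        unfolding partial_q using c_pos abs_triangle_ineq4[of "2 * c * x $ 1" "2 * b * x $ 2"] by
            (simp add: abs_mult)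
      also have "\<dots> \<le> 2 * c * norm x + 2 * \<bar>b\<bar> * norm x"
        using c_pos by (intro add_mono mult_left_mono component_le_norm_cart) auto
      finally show "\<bar>partial 1 q x\<bar> \<le> 2 * (c + \<bar>b\<bar>) * norm x" by (simp add: algebra_simps)
    qed auto
    moreover have "\<bar>r e x\<bar> \<le> inverse (k * (norm x)\<^sup>2)"
    proof -
      have "k * (norm x)\<^sup>2 > 0" using n k_pos by simp
      moreover have "k * (norm x)\<^sup>2 \<le> q x + e\<^sup>2" using q_lower[of x] by (simp add: add_increasing2)
      ultimately have "inverse (q x + e\<^sup>2) \<le> inverse (k * (norm x)\<^sup>2)" by (rule
          le_imp_inverse_le[rotated])
      moreover have "inverse (q x + e\<^sup>2) \<ge> 0" using qe_pos[OF e, of x] by simp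
      ultimately show ?thesis unfolding r_def by (simp only: abs_of_nonneg)
    qed
    moreover have "0 \<le> norm x * (2 * (c + \<bar>b\<bar>) * norm x)" using c_pos by simp
    ultimately have "(\<bar>x $ 1\<bar> * \<bar>partial 1 q x\<bar>) * \<bar>r e x\<bar> \<le> (norm x * (2 * (c + \<bar>b\<bar>) * norm x)) *
        inverse (k * (norm x)\<^sup>2)"
      by (rule mult_mono[OF _ _ _ abs_ge_zero])
    also have "\<dots> = C2" using n k_pos by (simp add: C2_def field_simps power2_eq_square)
    finally show ?thesis by (simp add: abs_mult mult_ac)
  qed (use C2 in simp)
  show ?thesis
  proof (intro exI allI impI)
    fix e :: real assume e: "0 < e" "e \<le> 1"
    let ?u = "\<lambda>x. x $ 1 * F e x"
    have su: "smooth_on UNIV ?u" by (intro smooth_on_mult smooth_on_coordinate smooth_F e open_UNIV)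
    have pu: "partial 1 ?u x = F e x + x $ 1 * (r e x * partial 1 q x)" for x
    proof -
      have "partial 1 (\<lambda>x::real^2. x $ 1) x = 1"
        using partial_eqI[OF has_derivative_vec_nth', of 1 1 x] by (simp add: axis_def)
      then show ?thesis
        by (subst partial_mult)
           (auto intro: smooth_on_differentiable[OF smooth_on_coordinate]
               smooth_on_differentiable[OF smooth_F[OF e(1)]]
             simp: partial_F[OF e(1)])
    qed
    have "smooth_on UNIV (\<lambda>x. x $ 1 * (r e x * partial 1 q x))"
      by (intro smooth_on_mult smooth_on_coordinate smooth_r e smooth_on_partial smooth_q open_UNIV)
    then have i2: "integrable lborel (\<lambda>x. x $ 1 * (r e x * partial 1 q x) * \<phi> x)"
      by (intro test_functions_integrable[where U = UNIV] test_functions_mult \<phi> open_UNIV)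
    have i1: "integrable lborel (\<lambda>x. F e x * \<phi> x)"
      by (intro test_functions_integrable[where U = UNIV] test_functions_mult \<phi> open_UNIV smooth_F
          e)
    have "(\<integral>x. ?u x * partial 1 \<phi> x \<partial>lborel) = - (\<integral>x. partial 1 ?u x * \<phi> x \<partial>lborel)"
      by (rule integral_by_parts[OF open_UNIV su \<phi>(1)])
    also have "(\<integral>x. partial 1 ?u x * \<phi> x \<partial>lborel) = (\<integral>x. F e x * \<phi> x \<partial>lborel) + (\<integral>x. x $ 1 * (r e x
        * partial 1 q x) * \<phi> x \<partial>lborel)"
      unfolding pu distrib_right using i1 i2 by simp
    finally have eq: "(\<integral>x. F e x * \<phi> x \<partial>lborel) = - (\<integral>x. ?u x * partial 1 \<phi> x \<partial>lborel) - (\<integral>x. x $ 1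
        * (r e x * partial 1 q x) * \<phi> x \<partial>lborel)"
      by simp
    have "\<bar>\<integral>x. ?u x * partial 1 \<phi> x \<partial>lborel\<bar> \<le> (C1 * B') * measure lborel (cball (0::real^2) R)"
      by (rule integral_bounded_ball) (use C1 B' R' xF e in \<open>auto simp: abs_mult intro!: mult_mono\<close>)
    moreover have "\<bar>\<integral>x. x $ 1 * (r e x * partial 1 q x) * \<phi> x \<partial>lborel\<bar> \<le> (C2 * B) * measure lborel
        (cball (0::real^2) R)"
    proof (rule integral_bounded_ball)
      show "\<bar>x $ 1 * (r e x * partial 1 q x) * \<phi> x\<bar> \<le> C2 * B" for x
        unfolding abs_mult[of _ "\<phi> x"] using xr[OF e(1)] B C2 by (intro mult_mono) auto
    qed (use C2 B R in auto)
    ultimately show "\<bar>\<integral>x. F e x * \<phi> x \<partial>lborel\<bar> \<le> (C1 * B') * measure lborel (cball (0::real^2) R) +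
        (C2 * B) * measure lborel (cball (0::real^2) R)"
      unfolding eq by linarith
  qed
qed

text \<open>Against a nonnegative bump, -F(e) increases as e decreases, and its integrals are
  bounded by \<open>F_integral_bound\<close>; monotone convergence carries integrability over to the
  limit.\<close>

lemma locally_integrable_F0: "locally_integrable F0"
  unfolding convolution_kernel_def
proof (intro conjI allI)
  fix R0 :: real
  define R where "R = \<bar>R0\<bar> + 1"
  have Rp: "0 < R" "R < R + 1" by (auto simp: R_def)
  obtain \<kappa> :: "real^2 \<Rightarrow> real" where \<kappa>': "\<kappa> \<in> test_functions (ball 0 (R + 1))" "\<And>x. 0 \<le> \<kappa> x" "\<And>x. x \<in>
      ball 0 R \<Longrightarrow> \<kappa> x = 1"
    using ex_bump[OF Rp, of 0] by blast
  have \<kappa>: "\<kappa> \<in> test_functions UNIV" using \<kappa>'(1) by (rule test_functions_mono) simp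
  have [measurable]: "\<kappa> \<in> borel_measurable borel"
    using continuous_test_function[OF \<kappa>] by (rule borel_measurable_continuous_onI)
  obtain C where C: "\<And>e. 0 < e \<Longrightarrow> e \<le> 1 \<Longrightarrow> \<bar>\<integral>x. F e x * \<kappa> x \<partial>lborel\<bar> \<le> C"
    using F_integral_bound[OF \<kappa> \<kappa>'(2)] by blast
  define f where "f n x = - F (1 / Suc n) x * \<kappa> x" for n :: nat and x
  have fi: "integrable lborel (f n)" for n
  proof -
    have "integrable lborel (\<lambda>x. F (1 / Suc n) x * \<kappa> x)"
      by (intro test_functions_integrable[where U = UNIV] test_functions_mult \<kappa> open_UNIV smooth_F)
          simp
    then show ?thesis unfolding f_def by simp
  qed
  have inc: "f m x \<le> f n x" if "m \<le> n" for m n x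
    using F_mono[of "1 / Suc n" "1 / Suc m" x] that \<kappa>'(2)[of x] unfolding f_def
    by (intro mult_right_mono) (auto simp: frac_le)
  have incs: "incseq (\<lambda>n. integral\<^sup>L lborel (f n))"
    unfolding incseq_def using fi inc by (auto intro: integral_mono)
  have bdd: "integral\<^sup>L lborel (f n) \<le> C" for n
  proof -
    have "integral\<^sup>L lborel (f n) = - (\<integral>x. F (1 / Suc n) x * \<kappa> x \<partial>lborel)"
      unfolding f_def by simp
    then show ?thesis using C[of "1 / Suc n"] by simp
  qed
  obtain L where L: "(\<lambda>n. integral\<^sup>L lborel (f n)) \<longlonglongrightarrow> L"
    using incseq_convergent[OF incs, of C] bdd by blast
  have "integrable lborel (\<lambda>x. - F0 x * \<kappa> x)"
  proof (rule integrable_monotone_convergence)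
    show "integrable lborel (f n)" for n by (rule fi)
    show "AE x in lborel. mono (\<lambda>n. f n x)" using inc by (intro AE_I2) (auto simp: mono_def)
    show "AE x in lborel. (\<lambda>n. f n x) \<longlonglongrightarrow> - F0 x * \<kappa> x"
      using AE_lborel_neq[of 0]
    proof (rule eventually_mono)
      fix x :: "real^2" assume "x \<noteq> 0"
      then show "(\<lambda>n. f n x) \<longlonglongrightarrow> - F0 x * \<kappa> x"
        unfolding f_def by (intro tendsto_intros F_tendsto_F0)
    qed
    show "(\<lambda>n. integral\<^sup>L lborel (f n)) \<longlonglongrightarrow> L" by (rule L)
  qed measurable
  then have i: "integrable lborel (\<lambda>x. F0 x * \<kappa> x)" by simp
  show "integrable lborel (\<lambda>y. indicat_real {y. norm y \<le> R0} y * F0 y)"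
  proof (rule Bochner_Integration.integrable_bound[OF i])
    show "AE x in lborel. norm (indicat_real {y. norm y \<le> R0} x * F0 x) \<le> norm (F0 x * \<kappa> x)"
    proof (intro AE_I2)
      fix x
      show "norm (indicat_real {y. norm y \<le> R0} x * F0 x) \<le> norm (F0 x * \<kappa> x)"
        using \<kappa>'(3)[of x] by (cases "norm x \<le> R0") (auto simp: R_def)
    qed
  qed measurable
qed auto

text \<open>The distribution obtained by applying the operator to ln q. It will turn out to be a
  positive multiple of the point mass at the origin.\<close>

definition pairing where "pairing \<psi> = (\<integral>x. F0 x * second_order a b c \<psi> x \<partial>lborel)"

text \<open>With the operator moved onto \<open>\<psi>\<close>, the limit concerns only the
  logarithms, which have an integrable majorant; the kernels \<open>G e\<close> themselves
  concentrate and have none that is integrable near 0.\<close>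

lemma G_tendsto_pairing:
  assumes \<psi>: "\<psi> \<in> test_functions UNIV"
  shows "(\<lambda>n. \<integral>x. G (1 / Suc n) x * \<psi> x \<partial>lborel) \<longlonglongrightarrow> pairing \<psi>"
proof -
  let ?L = "second_order a b c \<psi>"
  have L: "?L \<in> test_functions UNIV" using \<psi> by (rule test_functions_second_order)
  have [measurable]: "?L \<in> borel_measurable borel"
    using continuous_test_function[OF L] by (rule borel_measurable_continuous_onI)
  have "(\<lambda>n. \<integral>x. F (1 / Suc n) x * ?L x \<partial>lborel) \<longlonglongrightarrow> (\<integral>x. F0 x * ?L x \<partial>lborel)"
  proof (rule integral_dominated_convergence)
    have "integrable lborel (\<lambda>x. F0 x * ?L x)"
      by (rule locally_integrable_mult_test[OF locally_integrable_F0 L])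
    moreover have "integrable lborel (\<lambda>x. q x * ?L x)"
      by (intro test_functions_integrable[where U = UNIV] test_functions_mult L open_UNIV smooth_q)
    ultimately show "integrable lborel (\<lambda>x. \<bar>F0 x * ?L x\<bar> + \<bar>q x * ?L x\<bar>)" by simp
    show "AE x in lborel. (\<lambda>n. F (1 / Suc n) x * ?L x) \<longlonglongrightarrow> F0 x * ?L x"
      using AE_lborel_neq[of 0] by (rule eventually_mono) (intro tendsto_intros F_tendsto_F0)
    show "AE x in lborel. norm (F (1 / Suc n) x * ?L x) \<le> \<bar>F0 x * ?L x\<bar> + \<bar>q x * ?L x\<bar>" for n
      using AE_lborel_neq[of 0]
    proof (rule eventually_mono)
      fix x :: "real^2" assume "x \<noteq> 0"
      then have "\<bar>F (1 / Suc n) x\<bar> \<le> \<bar>F0 x\<bar> + \<bar>q x\<bar>"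
        using abs_F_le[of "1 / Suc n" x] q_nonneg[of x] by (simp add: F0_def)
      then have "\<bar>F (1 / Suc n) x\<bar> * \<bar>?L x\<bar> \<le> (\<bar>F0 x\<bar> + \<bar>q x\<bar>) * \<bar>?L x\<bar>" by (intro mult_right_mono)
          auto
      then show "norm (F (1 / Suc n) x * ?L x) \<le> \<bar>F0 x * ?L x\<bar> + \<bar>q x * ?L x\<bar>"
        by (simp add: abs_mult distrib_right)
    qed
  qed measurable
  moreover have "(\<integral>x. F (1 / Suc n) x * ?L x \<partial>lborel) = (\<integral>x. G (1 / Suc n) x * \<psi> x \<partial>lborel)" for n
    using second_order_by_parts[OF open_UNIV smooth_F[of "1 / Suc n"] \<psi>, of a b c] second_order_F[of
        "1 / Suc n"] by simp
  ultimately show ?thesis by (simp add: pairing_def)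
qed

lemma G_le_off_origin:
  assumes "e > 0" "\<delta> > 0" "norm x \<ge> \<delta>"
  shows "G e x \<le> 4 * D / (k * \<delta>\<^sup>2)\<^sup>2 * e\<^sup>2"
proof -
  have "k * \<delta>\<^sup>2 \<le> k * (norm x)\<^sup>2" using assms k_pos by (intro mult_left_mono power_mono) auto
  also have "\<dots> \<le> q x + e\<^sup>2" using q_lower[of x] by (simp add: add_increasing2)
  finally have "r e x \<le> inverse (k * \<delta>\<^sup>2)" unfolding r_def
    using assms k_pos by (intro le_imp_inverse_le) auto
  moreover have "r e x \<ge> 0" unfolding r_def using qe_pos[OF assms(1), of x] by simp
  ultimately have "r e x * r e x \<le> inverse (k * \<delta>\<^sup>2) * inverse (k * \<delta>\<^sup>2)" by (intro mult_mono) auto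
  then have "4 * D * e\<^sup>2 * (r e x * r e x) \<le> 4 * D * e\<^sup>2 * (inverse (k * \<delta>\<^sup>2) * inverse (k * \<delta>\<^sup>2))"
    using D_pos by (intro mult_left_mono) auto
  then show ?thesis by (simp add: G_def field_simps power2_eq_square)
qed

text \<open>Near the origin \<open>\<psi>\<close> is at most \<open>\<eta>\<close> in absolute value
  and the mass of the kernel there is controlled by its integral against \<open>\<kappa>\<close>;
  away from the origin the kernel is of order e^2. In the limit only
  \<open>\<eta> * pairing \<kappa>\<close> remains, with \<open>\<eta>\<close> arbitrary.\<close>

lemma pairing_eq_0:
  assumes \<psi>: "\<psi> \<in> test_functions UNIV" and z: "\<psi> 0 = 0"
  shows "pairing \<psi> = 0"
proof -
  obtain R0 where R0: "\<And>x. norm x > R0 \<Longrightarrow> \<psi> x = 0" using \<psi> test_functions_UNIV_iff by blast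
  define R where "R = \<bar>R0\<bar> + 1"
  have R: "\<psi> x = 0" if "norm x \<ge> R" for x using R0[of x] that by (simp add: R_def)
  have Rp: "0 < R" "R < R + 1" by (auto simp: R_def)
  obtain \<kappa> :: "real^2 \<Rightarrow> real" where \<kappa>': "\<kappa> \<in> test_functions (ball 0 (R + 1))" "\<And>x. 0 \<le> \<kappa> x" "\<And>x. x \<in>
      ball 0 R \<Longrightarrow> \<kappa> x = 1"
    using ex_bump[OF Rp, of 0] by blast
  have \<kappa>: "\<kappa> \<in> test_functions UNIV" using \<kappa>'(1) by (rule test_functions_mono) simp
  obtain B where B: "B > 0" "\<And>x. \<bar>\<psi> x\<bar> \<le> B" by (metis test_function_bounded[OF \<psi>])
  have "isCont \<psi> 0"
    using continuous_test_function[OF \<psi>, of UNIV] by (simp add: continuous_on_eq_continuous_at)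
  define M where "M = measure lborel (cball (0::real^2) R)"
  have small: "\<bar>pairing \<psi>\<bar> \<le> \<eta> * pairing \<kappa>" if \<eta>: "\<eta> > 0" for \<eta>
  proof -
    obtain \<delta> where \<delta>: "\<delta> > 0" "\<And>x. dist x 0 < \<delta> \<Longrightarrow> dist (\<psi> x) (\<psi> 0) < \<eta>"
      using \<open>isCont \<psi> 0\<close> \<eta> unfolding continuous_at_eps_delta by blast
    define A where "A = 4 * D / (k * \<delta>\<^sup>2)\<^sup>2"
    have A: "A \<ge> 0" using D_pos by (simp add: A_def)
    have step: "\<bar>\<integral>x. G (1 / Suc n) x * \<psi> x \<partial>lborel\<bar> \<le> \<eta> * (\<integral>x. G (1 / Suc n) x * \<kappa> x \<partial>lborel) + (A *
        (1 / Suc n)\<^sup>2 * B) * M" for n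
    proof -
      define e where "e = 1 / real (Suc n)"
      have e: "e > 0" by (simp add: e_def)
      have iG: "integrable lborel (\<lambda>x. G e x * \<phi> x)" if "\<phi> \<in> test_functions UNIV" for \<phi>
        by (intro test_functions_integrable[where U = UNIV] test_functions_mult that open_UNIV
            smooth_G e)
      have fin: "emeasure lborel (cball (0::real^2) R) < \<infinity>"
        using emeasure_bounded_finite[OF bounded_cball] by simp
      have "\<bar>\<integral>x. G e x * \<psi> x \<partial>lborel\<bar> \<le> (\<integral>x. \<bar>G e x * \<psi> x\<bar> \<partial>lborel)"
        using integral_norm_bound[of lborel "\<lambda>x. G e x * \<psi> x"] by simp
      also have "\<dots> \<le> (\<integral>x. \<eta> * (G e x * \<kappa> x) + (A * e\<^sup>2 * B) * indicat_real (cball 0 R) x \<partial>lborel)"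
      proof (rule integral_mono)
        show "integrable lborel (\<lambda>x. \<bar>G e x * \<psi> x\<bar>)" using iG[OF \<psi>] by simp
        show "integrable lborel (\<lambda>x. \<eta> * (G e x * \<kappa> x) + (A * e\<^sup>2 * B) * indicat_real (cball 0 R)
            x)"
          using iG[OF \<kappa>] fin by (intro Bochner_Integration.integrable_add integrable_mult_right
              integrable_real_indicator) auto
        fix x
        show "\<bar>G e x * \<psi> x\<bar> \<le> \<eta> * (G e x * \<kappa> x) + (A * e\<^sup>2 * B) * indicat_real (cball 0 R) x"
        proof (cases "norm x < R")
          case True
          have k1: "\<kappa> x = 1" using \<kappa>'(3) True by simp
          show ?thesis
          proof (cases "norm x < \<delta>")
            case True
            then have "\<bar>\<psi> x\<bar> \<le> \<eta>" using \<delta>(2)[of x] z by (simp add: dist_norm)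
            then have "G e x * \<bar>\<psi> x\<bar> \<le> G e x * \<eta>" using G_nonneg[OF e] by (intro mult_left_mono)
                auto
            moreover have "(A * e\<^sup>2 * B) * indicat_real (cball 0 R) x \<ge> 0" using A B by simp
            ultimately show ?thesis using G_nonneg[OF e, of x] k1 by (simp add: abs_mult
                mult.commute)
          next
            case False
            then have "G e x \<le> A * e\<^sup>2" using G_le_off_origin[OF e \<delta>(1), of x] by (simp add: A_def)
            then have "G e x * \<bar>\<psi> x\<bar> \<le> (A * e\<^sup>2) * B" using B A by (intro mult_mono) auto
            moreover have "\<eta> * (G e x * \<kappa> x) \<ge> 0" using \<eta> G_nonneg[OF e] \<kappa>'(2) by simp
            ultimately show ?thesis using \<open>norm x < R\<close> G_nonneg[OF e, of x] by (simp add: abs_mult)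
          qed
        next
          case False
          then show ?thesis using R[of x] \<eta> A B G_nonneg[OF e] \<kappa>'(2) by simp
        qed
      qed
      also have "\<dots> = \<eta> * (\<integral>x. G e x * \<kappa> x \<partial>lborel) + (A * e\<^sup>2 * B) * M"
        using iG[OF \<kappa>] fin by (subst Bochner_Integration.integral_add) (auto simp: M_def)
      finally show ?thesis by (simp add: e_def)
    qed
    have "(\<lambda>n. \<eta> * (\<integral>x. G (1 / Suc n) x * \<kappa> x \<partial>lborel) + (A * (1 / Suc n)\<^sup>2 * B) * M) \<longlonglongrightarrow> \<eta> * pairing
        \<kappa> + (A * 0\<^sup>2 * B) * M"
      by (intro tendsto_intros G_tendsto_pairing[OF \<kappa>] LIMSEQ_Suc[OF lim_const_over_n[of 1]])
    moreover have "(\<lambda>n. \<bar>\<integral>x. G (1 / Suc n) x * \<psi> x \<partial>lborel\<bar>) \<longlonglongrightarrow> \<bar>pairing \<psi>\<bar>"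
      by (intro tendsto_intros G_tendsto_pairing[OF \<psi>])
    ultimately have "\<bar>pairing \<psi>\<bar> \<le> \<eta> * pairing \<kappa> + (A * 0\<^sup>2 * B) * M"
      using step by (intro LIMSEQ_le) auto
    then show ?thesis by simp
  qed
  have "((\<lambda>\<eta>. \<eta> * pairing \<kappa>) \<longlongrightarrow> 0 * pairing \<kappa>) (at_right 0)"
    by (intro tendsto_intros)
  then have "\<bar>pairing \<psi>\<bar> \<le> 0 * pairing \<kappa>"
    by (rule tendsto_lowerbound) (auto simp: eventually_at_filter small)
  then show ?thesis by simp
qed

text \<open>Subtracting \<open>\<psi> 0 * \<kappa>\<close> reduces to functions vanishing at 0, so
  \<open>pairing\<close> is evaluation at 0 times the constant \<open>pairing \<kappa>\<close>.
  Dividing ln q by this constant normalizes it; its positivity is enough, and its value is never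
  computed.\<close>

lemma ex_fundamental_solution:
  "\<exists>E. locally_integrable E \<and> (\<forall>x. E (- x) = E x) \<and>
     (\<forall>\<psi>\<in>test_functions UNIV. \<forall>x. convolve E (second_order a b c \<psi>) x = \<psi> x)"
proof -
  have dif: "partial i \<phi> differentiable (at x)" "\<phi> differentiable (at x)" if "\<phi> \<in> test_functions
      UNIV" for i \<phi> x
    using that by (auto intro: test_functions_differentiable test_functions_partial)
  obtain \<kappa> :: "real^2 \<Rightarrow> real" where \<kappa>': "\<kappa> \<in> test_functions (ball 0 2)" "\<And>x. 0 \<le> \<kappa> x" "\<And>x. x \<in> ball
      0 1 \<Longrightarrow> \<kappa> x = 1"
    using ex_bump[of 1 2 0] by auto
  have \<kappa>: "\<kappa> \<in> test_functions UNIV" using \<kappa>'(1) by (rule test_functions_mono) simp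
  \<comment> \<open>On the ball of radius e one has q + e^2 <= (K + 1) e^2, hence \<open>G e\<close>
    is at least 4 D / ((K + 1)^2 e^2) there. Multiplied by the area of the ball this is
    \<open>m\<close>, independent of e.\<close>
  define m where "m = 4 * D / (K + 1)\<^sup>2 * measure lborel (ball (0::real^2) 1)"
  have mb: "measure lborel (ball (0::real^2) e) = e\<^sup>2 * measure lborel (ball (0::real^2) 1)" if "e >
      0" for e
    using content_ball[of e "0::real^2"] content_ball[of 1 "0::real^2"] that by simp
  have m: "m > 0"
    unfolding m_def using D_pos K_pos content_ball_pos[of 1 "0::real^2"] by (intro mult_pos_pos
        divide_pos_pos) auto
  have "m \<le> (\<integral>x. G (1 / Suc n) x * \<kappa> x \<partial>lborel)" for n
  proof -
    define e where "e = 1 / real (Suc n)"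
    have e: "e > 0" "e \<le> 1" by (auto simp: e_def)
    have fin: "emeasure lborel (ball (0::real^2) e) < \<infinity>"
      using emeasure_bounded_finite[OF bounded_ball] by simp
    have "m = (\<integral>x. 4 * D * e\<^sup>2 / ((K + 1) * e\<^sup>2)\<^sup>2 * indicat_real (ball (0::real^2) e) x \<partial>lborel)"
    proof -
      have "4 * D * v / (w * v)\<^sup>2 * (v * \<mu>) = 4 * D / w\<^sup>2 * \<mu>" if "v > 0" "w > 0" for v w \<mu> :: real
        using that by (simp add: power_mult_distrib power2_eq_square)
      from this[of "e\<^sup>2" "K + 1" "measure lborel (ball (0::real^2) 1)"] show ?thesis
        using e K_pos unfolding m_def by (simp add: mb[OF e(1)])
    qed
    also have "\<dots> \<le> (\<integral>x. G e x * \<kappa> x \<partial>lborel)"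
    proof (rule integral_mono)
      show "integrable lborel (\<lambda>x. 4 * D * e\<^sup>2 / ((K + 1) * e\<^sup>2)\<^sup>2 * indicat_real (ball (0::real^2)
          e) x)"
        using fin by (intro integrable_mult_right integrable_real_indicator) auto
      show "integrable lborel (\<lambda>x. G e x * \<kappa> x)"
        by (intro test_functions_integrable[where U = UNIV] test_functions_mult \<kappa> open_UNIV smooth_G
            e)
      fix x :: "real^2"
      show "4 * D * e\<^sup>2 / ((K + 1) * e\<^sup>2)\<^sup>2 * indicat_real (ball 0 e) x \<le> G e x * \<kappa> x"
      proof (cases "norm x < e")
        case True
        then have k1: "\<kappa> x = 1" using \<kappa>'(3) e by simp
        have "(norm x)\<^sup>2 \<le> e\<^sup>2" using True by (intro power_mono) auto
        then have "K * (norm x)\<^sup>2 \<le> K * e\<^sup>2" using K_pos by (intro mult_left_mono) auto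
        then have "q x + e\<^sup>2 \<le> (K + 1) * e\<^sup>2" using q_upper[of x] by (simp add: algebra_simps)
        then have "inverse ((K + 1) * e\<^sup>2) \<le> r e x"
          unfolding r_def using qe_pos[OF e(1), of x] by (intro le_imp_inverse_le) auto
        then have "inverse ((K + 1) * e\<^sup>2) * inverse ((K + 1) * e\<^sup>2) \<le> r e x * r e x"
          using K_pos by (intro mult_mono) (auto intro: order_trans[rotated])
        then have "4 * D * e\<^sup>2 * (inverse ((K + 1) * e\<^sup>2) * inverse ((K + 1) * e\<^sup>2)) \<le> G e x"
          unfolding G_def using D_pos by (intro mult_left_mono) auto
        then show ?thesis using True k1 by (simp add: power2_eq_square divide_inverse)
      next
        case False
        then show ?thesis using G_nonneg[OF e(1), of x] \<kappa>'(2)[of x] by simp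
      qed
    qed
    finally show ?thesis by (simp add: e_def)
  qed
  then have "m \<le> pairing \<kappa>" using G_tendsto_pairing[OF \<kappa>] by (intro LIMSEQ_le_const) auto
  then have pk: "pairing \<kappa> > 0" using m by simp
  have pr: "pairing \<psi> = \<psi> 0 * pairing \<kappa>" if \<psi>: "\<psi> \<in> test_functions UNIV" for \<psi>
  proof -
    let ?d = "\<lambda>x. \<psi> x + (- \<psi> 0) * \<kappa> x"
    have d: "?d \<in> test_functions UNIV" by (intro test_functions_add test_functions_cmult \<psi> \<kappa>)
    have p: "partial i ?d = (\<lambda>x. partial i \<psi> x + (- \<psi> 0) * partial i \<kappa> x)" for i
      by (rule ext) (simp only: partial_add[OF dif(2)[OF \<psi>] dif(2)[OF test_functions_cmult[OF \<kappa>]]]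
          partial_cmult[OF dif(2)[OF \<kappa>]])
    have pp: "partial j (partial i ?d) = (\<lambda>x. partial j (partial i \<psi>) x + (- \<psi> 0) * partial j
        (partial i \<kappa>) x)" for i j
      unfolding p by (rule ext) (simp only: partial_add[OF dif(1)[OF \<psi>] dif(2)[OF
          test_functions_cmult[OF test_functions_partial[OF \<kappa>]]]] partial_cmult[OF dif(1)[OF \<kappa>]])
    have so: "second_order a b c ?d x = second_order a b c \<psi> x - \<psi> 0 * second_order a b c \<kappa> x" for x
      unfolding second_order_def pp by (simp add: algebra_simps)
    have "pairing ?d = pairing \<psi> - \<psi> 0 * pairing \<kappa>"
      unfolding pairing_def so right_diff_distrib mult.left_commute[of _ "\<psi> 0"]
      using locally_integrable_mult_test[OF locally_integrable_F0 test_functions_second_order[OF \<psi>]]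
        locally_integrable_mult_test[OF locally_integrable_F0 test_functions_second_order[OF \<kappa>]] by
            simp
    moreover have "?d 0 = 0" using \<kappa>'(3)[of 0] by simp
    ultimately show ?thesis using pairing_eq_0[OF d] by simp
  qed
  define E where "E x = F0 x / pairing \<kappa>" for x
  show ?thesis
  proof (intro exI[of _ E] conjI allI ballI)
    show "locally_integrable E"
      using locally_integrable_F0 unfolding convolution_kernel_def E_def by auto
    show "E (- x) = E x" for x by (simp add: E_def F0_def q_def)
    fix \<psi> x assume \<psi>: "\<psi> \<in> test_functions UNIV"
    \<comment> \<open>Translation and reflection move the evaluation from 0 to \<open>x\<close>;
      second derivatives keep their sign.\<close>
    define \<psi>' where "\<psi>' = (\<lambda>y. \<psi> (x + (-1) *\<^sub>R y))"
    have \<psi>': "\<psi>' \<in> test_functions UNIV" unfolding \<psi>'_def by (rule test_functions_affine_compose[OF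
        \<psi>]) simp
    have p: "partial i \<psi>' = (\<lambda>y. (-1) * partial i \<psi> (x + (-1) *\<^sub>R y))" for i
      unfolding \<psi>'_def by (rule ext) (simp only: partial_affine_compose[OF dif(2)[OF \<psi>]]
          real_scaleR_def)
    have pp: "partial j (partial i \<psi>') y = partial j (partial i \<psi>) (x - y)" for i j y
    proof -
      have "(\<lambda>y. partial i \<psi> (x + (-1) *\<^sub>R y)) differentiable (at y)"
        by (rule test_functions_differentiable[OF test_functions_affine_compose[OF
            test_functions_partial[OF \<psi>]]]) simp
      from partial_cmult[OF this, of j "-1"] show ?thesis
        unfolding p partial_affine_compose[OF dif(1)[OF \<psi>]] by simp
    qed
    have "second_order a b c \<psi>' y = second_order a b c \<psi> (x - y)" for y
      unfolding second_order_def pp ..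
    then have "pairing \<psi>' = (\<integral>y. F0 y * second_order a b c \<psi> (x - y) \<partial>lborel)"
      by (simp add: pairing_def)
    then show "convolve E (second_order a b c \<psi>) x = \<psi> x"
      using pr[OF \<psi>'] pk by (simp add: kernel_conv_def E_def \<psi>'_def)
  qed
qed

end

section \<open>Removal of an isolated singularity\<close>

lemma smooth_on_cut_origin:
  fixes u \<kappa> :: "real^2 \<Rightarrow> real"
  assumes W: "open W" and u: "smooth_on (W - {0}) u" and \<kappa>: "smooth_on UNIV \<kappa>"
    and r: "r > 0" "\<And>x. x \<in> ball 0 r \<Longrightarrow> \<kappa> x = 1" "ball 0 r \<subseteq> W"
  shows "smooth_on W (\<lambda>x. (1 - \<kappa> x) * u x)"
proof -
  have "smooth_on (W - {0}) (\<lambda>x. (1 - \<kappa> x) * u x)"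
    using W u smooth_on_subset[OF \<kappa>, of "W - {0}"]
    by (intro smooth_on_mult smooth_on_diff smooth_on_const) auto
  moreover have "smooth_on (ball 0 r) (\<lambda>x. (1 - \<kappa> x) * u x)"
    by (rule smooth_on_cong[OF open_ball _ smooth_on_const[of _ 0]]) (use r in auto)
  ultimately have "smooth_on ((W - {0}) \<union> ball 0 r) (\<lambda>x. (1 - \<kappa> x) * u x)" by (rule smooth_on_Un)
  moreover have "(W - {0}) \<union> ball 0 r = W" using r by auto
  ultimately show ?thesis by simp
qed

lemma test_functions_off_ball:
  assumes \<phi>: "\<phi> \<in> test_functions W" and r: "r > 0" "\<And>x. x \<in> ball 0 r \<Longrightarrow> \<phi> x = 0"
  shows "\<phi> \<in> test_functions (W - {0})"
proof -
  obtain K where K: "compact K" "K \<subseteq> W" "\<And>x. x \<notin> K \<Longrightarrow> \<phi> x = 0" "smooth_on UNIV \<phi>"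
    using \<phi> by (metis test_functionsE)
  show ?thesis
    by (rule test_functionsI[of _ "K - ball 0 r"]) (use K r in \<open>auto intro: compact_diff\<close>)
qed

text \<open>Let \<open>E\<close> be an even fundamental solution of the operator \<open>L\<close>. For \<open>\<psi>\<close> supported near the
  origin, \<open>\<psi>\<close> differs from \<open>L (\<theta> (E * \<psi>))\<close>, \<open>\<theta>\<close> a cutoff, only by a test function vanishing near
  the origin. Hence \<open>T \<psi>\<close> is the integral of \<open>E * \<psi>\<close> against some test function \<open>m\<close>, that is, of
  \<open>\<psi>\<close> against the smooth function \<open>E * m\<close>.\<close>

lemma (in elliptic_operator) elliptic_regularity:
  assumes W: "open W" "0 \<in> W"
    and add: "\<And>\<phi> \<psi>. \<phi> \<in> test_functions W \<Longrightarrow> \<psi> \<in> test_functions W \<Longrightarrow> T (\<lambda>x. \<phi> x + \<psi> x) = T \<phi> + T \<psi>"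
    and u: "smooth_on (W - {0}) u" "\<And>\<phi>. \<phi> \<in> test_functions (W - {0}) \<Longrightarrow> T \<phi> = (\<integral>x. u x * \<phi> x
        \<partial>lborel)"
    and f: "smooth_on W f" "\<And>\<phi>. \<phi> \<in> test_functions W \<Longrightarrow> T (second_order a b c \<phi>) = (\<integral>x. f x * \<phi> x
        \<partial>lborel)"
  shows "\<exists>s. smooth_on W s \<and> (\<forall>\<phi>\<in>test_functions W. T \<phi> = (\<integral>x. s x * \<phi> x \<partial>lborel))"
proof -
  obtain R where R: "R > 0" "ball 0 R \<subseteq> W" using W openE by blast
  define d where "d = R / 4"
  have d: "d > 0" "ball 0 (3 * d) \<subseteq> W" using R by (auto simp: d_def)
  \<comment> \<open>The cutoffs are nested: \<open>\<theta>\<close> is 1 where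
    \<open>\<kappa>\<close> lives, and \<open>\<kappa>\<close> is 1 where \<open>\<psi>\<close>
    lives. So \<open>h\<close> vanishes on the ball of radius 2d, where \<open>u\<close> and
    \<open>u1\<close> may differ, and \<open>u * h\<close> equals \<open>u1\<close> times the
    operator applied to \<open>w\<close> everywhere.\<close>
  obtain \<theta> where \<theta>: "\<theta> \<in> test_functions (ball 0 (3 * d))" "\<And>x. x \<in> ball 0 (2 * d) \<Longrightarrow> \<theta> x = 1"
    using ex_bump[of "2 * d" "3 * d" 0] d by auto
  obtain \<kappa> where \<kappa>: "\<kappa> \<in> test_functions (ball 0 (2 * d))" "\<And>x. x \<in> ball 0 d \<Longrightarrow> \<kappa> x = 1"
    using ex_bump[of d "2 * d" 0] d by auto
  obtain \<kappa>' where \<kappa>': "\<kappa>' \<in> test_functions (ball 0 d)" "\<And>x. x \<in> ball 0 (d / 2) \<Longrightarrow> \<kappa>' x = 1"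
    using ex_bump[of "d / 2" d 0] d by auto
  obtain E where E: "locally_integrable E" "\<And>x. E (- x) = E x"
      "\<And>\<psi> x. \<psi> \<in> test_functions UNIV \<Longrightarrow> convolve E (second_order a b c \<psi>) x = \<psi> x"
    using ex_fundamental_solution by blast
  have \<theta>W: "\<theta> \<in> test_functions W" using \<theta>(1) d(2) by (rule test_functions_mono)
  define u1 where "u1 = (\<lambda>x. (1 - \<kappa> x) * u x)"
  have u1: "smooth_on W u1"
    unfolding u1_def using d W \<kappa>
    by (intro smooth_on_cut_origin[where r = d] u test_functions_smooth[OF \<kappa>(1)]) auto
  \<comment> \<open>Solving T(L w) = T(psi) + T(h) for T(psi), with T(h) integrated by parts, leaves
    f - L u1 paired with w. As w is \<open>p * \<theta>\<close>, the factor \<open>\<theta>\<close>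
    is moved onto this function, which makes \<open>m\<close> compactly supported and independent of
    \<open>\<psi>\<close>.\<close>
  define m where "m = (\<lambda>x. (f x - second_order a b c u1 x) * \<theta> x)"
  have mW: "m \<in> test_functions W"
    unfolding m_def by (intro test_functions_mult W smooth_on_diff f smooth_on_second_order u1 \<theta>W)
  then have m: "m \<in> test_functions UNIV" by (rule test_functions_mono) simp
  define g where "g = convolve E m"
  have g: "smooth_on U g" for U unfolding g_def by (rule smooth_on_kernel_conv[OF E(1) m])
  have near: "T \<psi> = (\<integral>x. g x * \<psi> x \<partial>lborel)" if \<psi>': "\<psi> \<in> test_functions (ball 0 d)" for \<psi>
  proof -
    have \<psi>: "\<psi> \<in> test_functions UNIV" using \<psi>' by (rule test_functions_mono) simp
    have \<psi>W: "\<psi> \<in> test_functions W" using \<psi>' by (rule test_functions_mono) (use d in auto)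
    have \<psi>0: "\<psi> x = 0" if "norm x \<ge> d" for x using test_functions_eq_0[OF \<psi>', of x] that by simp
    define p where "p = convolve E \<psi>"
    have p: "smooth_on U p" for U unfolding p_def by (rule smooth_on_kernel_conv[OF E(1) \<psi>])
    have Lp: "second_order a b c p x = \<psi> x" for x
    proof -
      have pk: "partial j (partial i p) = convolve E (partial j (partial i \<psi>))" for i j
        unfolding p_def partial_kernel_conv[OF E(1) \<psi>] partial_kernel_conv[OF E(1)
            test_functions_partial[OF \<psi>]] ..
      have i: "integrable lborel (\<lambda>y. E y * partial j (partial i \<psi>) (x - y))" for i j
        by (rule kernel_conv_integrable[OF E(1) test_functions_partial[OF test_functions_partial[OF
            \<psi>]]])
      have "second_order a b c p x = convolve E (second_order a b c \<psi>) x"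
        unfolding second_order_def[of a b c p] pk kernel_conv_def second_order_def
        using i[of 1 1] i[of 1 2] i[of 2 2]
        by (simp add: distrib_left mult.left_commute[of "E _"])
      then show ?thesis using E(3)[OF \<psi>] by simp
    qed
    define w where "w = (\<lambda>x. p x * \<theta> x)"
    have w: "w \<in> test_functions W" unfolding w_def by (intro test_functions_mult W p \<theta>W)
    let ?L = "second_order a b c w"
    have L: "?L \<in> test_functions W" using w by (rule test_functions_second_order)
    define h where "h = (\<lambda>x. ?L x - \<psi> x)"
    have hW: "h \<in> test_functions W" unfolding h_def by (intro test_functions_diff L \<psi>W)
    have h0: "h x = 0" if "x \<in> ball 0 (2 * d)" for x
    proof -
      have "?L x = second_order a b c p x"
        by (rule second_order_cong_open[OF open_ball that]) (simp add: w_def \<theta>(2))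
      then show ?thesis using Lp by (simp add: h_def)
    qed
    have h: "h \<in> test_functions (W - {0})"
      by (rule test_functions_off_ball[OF hW, of "2 * d"]) (use d h0 in auto)
    have "T ?L = T \<psi> + T h"
      using add[OF \<psi>W hW] by (simp add: h_def)
    moreover have "T ?L = (\<integral>x. f x * w x \<partial>lborel)" by (rule f(2)[OF w])
    moreover have "T h = (\<integral>x. second_order a b c u1 x * w x \<partial>lborel)"
    proof -
      have "u x * h x = u1 x * ?L x" for x
      proof (cases "x \<in> ball 0 (2 * d)")
        case True
        show ?thesis
        proof (cases "x \<in> ball 0 d")
          case True
          then show ?thesis using \<open>x \<in> ball 0 (2 * d)\<close> h0 \<kappa>(2)[of x] by (simp add: u1_def)
        next
          case False
          then have "\<psi> x = 0" using \<psi>0 by simp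
          then show ?thesis using True h0[of x] by (simp add: h_def)
        qed
      next
        case False
        then have "\<kappa> x = 0" "\<psi> x = 0" using test_functions_eq_0[OF \<kappa>(1), of x] \<psi>0[of x] d by auto
        then show ?thesis by (simp add: u1_def h_def)
      qed
      then have "T h = (\<integral>x. u1 x * ?L x \<partial>lborel)" using u(2)[OF h] by simp
      then show ?thesis using second_order_by_parts[OF W(1) u1 w] by simp
    qed
    moreover have "integrable lborel (\<lambda>x. f x * w x)" "integrable lborel (\<lambda>x. second_order a b c u1
        x * w x)"
      by (intro test_functions_integrable[where U = W] test_functions_mult W f w
          smooth_on_second_order u1)+
    ultimately have "T \<psi> = (\<integral>x. f x * w x - second_order a b c u1 x * w x \<partial>lborel)" by simp
    also have "\<dots> = (\<integral>x. m x * p x \<partial>lborel)" by (simp add: m_def w_def algebra_simps)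
    also have "\<dots> = (\<integral>x. \<psi> x * g x \<partial>lborel)" unfolding p_def g_def by (rule convolve_symmetric[OF
        E(1,2) m \<psi>])
    finally show ?thesis by (simp add: mult.commute)
  qed
  \<comment> \<open>The local representative near the origin is glued to \<open>u\<close>, which is
    used only where it is known to be smooth.\<close>
  define s where "s = (\<lambda>x. g x * \<kappa>' x + (1 - \<kappa>' x) * u x)"
  have "smooth_on W s"
    unfolding s_def using d W \<kappa>' g
    by (intro smooth_on_add smooth_on_mult smooth_on_cut_origin[where r = "d / 2"] u
        test_functions_smooth[OF \<kappa>'(1)]) auto
  moreover have "T \<phi> = (\<integral>x. s x * \<phi> x \<partial>lborel)" if \<phi>: "\<phi> \<in> test_functions W" for \<phi>
  proof -
    have k1: "(\<lambda>x. \<phi> x * \<kappa>' x) \<in> test_functions (ball 0 d)"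
      by (intro test_functions_mult open_ball \<kappa>' test_functions_smooth[OF \<phi>])
    then have k1': "(\<lambda>x. \<phi> x * \<kappa>' x) \<in> test_functions W" by (rule test_functions_mono) (use d in
        auto)
    have k2': "(\<lambda>x. (1 - \<kappa>' x) * \<phi> x) \<in> test_functions W"
      by (intro test_functions_mult W \<phi> smooth_on_diff smooth_on_const test_functions_smooth[OF
          \<kappa>'(1)])
    have k2: "(\<lambda>x. (1 - \<kappa>' x) * \<phi> x) \<in> test_functions (W - {0})"
      by (rule test_functions_off_ball[OF k2', of "d / 2"]) (use d \<kappa>' in auto)
    have "T \<phi> = T (\<lambda>x. \<phi> x * \<kappa>' x) + T (\<lambda>x. (1 - \<kappa>' x) * \<phi> x)"
      using add[OF k1' k2'] by (simp add: algebra_simps)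
    also have "\<dots> = (\<integral>x. g x * (\<phi> x * \<kappa>' x) \<partial>lborel) + (\<integral>x. u x * ((1 - \<kappa>' x) * \<phi> x) \<partial>lborel)"
      using near[OF k1] u(2)[OF k2] by simp
    also have "\<dots> = (\<integral>x. g x * (\<phi> x * \<kappa>' x) + u x * ((1 - \<kappa>' x) * \<phi> x) \<partial>lborel)"
    proof (rule Bochner_Integration.integral_add[symmetric])
      show "integrable lborel (\<lambda>x. g x * (\<phi> x * \<kappa>' x))"
        by (intro test_functions_integrable[where U = W] test_functions_mult[OF W(1)] g k1')
      show "integrable lborel (\<lambda>x. u x * ((1 - \<kappa>' x) * \<phi> x))"
        by (rule test_functions_integrable[OF test_functions_mult[OF _ u(1) k2]]) (use W in auto)
    qed
    finally show ?thesis by (simp add: s_def algebra_simps)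
  qed
  ultimately show ?thesis by blast
qed

section \<open>The elasticity tensor\<close>

text \<open>Positivity excludes real roots of the polynomial obtained by setting x = 1, so some
  complex root is not real, and the real quadratic with this root and its conjugate divides the
  polynomial. The first factor is positive definite by construction; the second inherits positivity
  from the product.\<close>

lemma positive_quartic_factorization:
  fixes p0 p1 p2 p3 p4 :: real
  assumes pos: "\<And>x y. x \<noteq> 0 \<or> y \<noteq> 0 \<Longrightarrow> p0 * x^4 + p1 * x^3 * y + p2 * x^2 * y^2 + p3 * x * y^3 + p4 *
      y^4 > 0"
  obtains a1 b1 c1 a2 b2 c2 where "elliptic_operator a1 b1 c1" "elliptic_operator a2 b2 c2"
    "p0 = a1 * a2" "p1 = 2 * (a1 * b2 + b1 * a2)" "p2 = a1 * c2 + 4 * b1 * b2 + c1 * a2"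
    "p3 = 2 * (b1 * c2 + c1 * b2)" "p4 = c1 * c2"
proof -
  have p4: "p4 > 0" using pos[of 0 1] by simp
  let ?p = "[:complex_of_real p0, of_real p1, of_real p2, of_real p3, of_real p4:]"
  have "degree ?p = 4" using p4 by simp
  then have "\<not> constant (poly ?p)" using constant_degree[of ?p] by linarith
  then obtain \<mu> where \<mu>: "poly ?p \<mu> = 0" using fundamental_theorem_of_algebra by blast
  define s t where "s = Re \<mu>" and "t = Im \<mu>"
  have mu: "\<mu> = Complex s t" by (simp add: s_def t_def)
  have nz: "t \<noteq> 0"
  proof
    assume "t = 0"
    then have "\<mu> = of_real s" by (simp add: mu complex_of_real_def)
    then have "complex_of_real (p0 * 1^4 + p1 * 1^3 * s + p2 * 1^2 * s^2 + p3 * 1 * s^3 + p4 * s^4)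
        = 0"
      using \<mu> by (simp add: algebra_simps eval_nat_numeral)
    then show False using pos[of 1 s] by (simp only: of_real_eq_0_iff) simp
  qed
  define m where "m = s\<^sup>2 + t\<^sup>2"
  \<comment> \<open>Long division by the quadratic with roots \<mu> and its conjugate:
    \<open>p4\<close>, \<open>q1\<close>, \<open>q0\<close> are the coefficients of the quotient,
    \<open>\<alpha>\<close> and \<open>\<beta>\<close> those of the remainder. A real linear
    polynomial vanishing at a nonreal number is 0.\<close>
  define q1 where "q1 = p3 + 2 * s * p4"
  define q0 where "q0 = p2 - m * p4 + 2 * s * q1"
  define \<alpha> where "\<alpha> = p1 - m * q1 + 2 * s * q0"
  define \<beta> where "\<beta> = p0 - m * q0"
  have quad: "\<mu>\<^sup>2 - 2 * of_real s * \<mu> + of_real m = 0"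
    by (simp add: mu m_def complex_eq_iff power2_eq_square)
  have "poly ?p \<mu> = (\<mu>\<^sup>2 - 2 * of_real s * \<mu> + of_real m) * (of_real p4 * \<mu>\<^sup>2 + of_real q1 * \<mu> +
      of_real q0) + of_real \<alpha> * \<mu> + of_real \<beta>"
    unfolding \<alpha>_def \<beta>_def q0_def q1_def by (simp add: algebra_simps power2_eq_square)
  then have "of_real \<alpha> * \<mu> + of_real \<beta> = 0" using \<mu> quad by simp
  then have "\<alpha> * t = 0" "\<alpha> * s + \<beta> = 0" by (simp_all add: mu complex_eq_iff)
  then have ab: "\<alpha> = 0" "\<beta> = 0" using nz by auto
  have m: "m > 0" unfolding m_def using nz by (simp add: add_nonneg_pos)
  have e1: "p0 = m * q0" "p1 = 2 * (m * (q1 / 2) + (- s) * q0)" "p4 = 1 * p4"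
    using ab unfolding \<alpha>_def \<beta>_def by (simp_all add: algebra_simps)
  have e2: "p2 = m * p4 + 4 * (- s) * (q1 / 2) + 1 * q0" "p3 = 2 * ((- s) * p4 + 1 * (q1 / 2))"
    by (simp_all add: q0_def) (simp add: q1_def)
  have fac: "p0 * x^4 + p1 * x^3 * y + p2 * x^2 * y^2 + p3 * x * y^3 + p4 * y^4 =
      (m * x\<^sup>2 - 2 * s * x * y + y\<^sup>2) * (q0 * x\<^sup>2 + q1 * x * y + p4 * y\<^sup>2)" for x y
  proof -
    have p: "p1 = m * q1 - 2 * s * q0" "p2 = m * p4 - 2 * s * q1 + q0" "p3 = q1 - 2 * s * p4"
      using e1(2) by (simp_all add: q0_def) (simp add: q1_def)
    have "m * q0 * x^4 + (m * q1 - 2 * s * q0) * x^3 * y + (m * p4 - 2 * s * q1 + q0) * x^2 * y^2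
        + (q1 - 2 * s * p4) * x * y^3 + p4 * y^4
      = (m * x\<^sup>2 - 2 * s * x * y + y\<^sup>2) * (q0 * x\<^sup>2 + q1 * x * y + p4 * y\<^sup>2)"
      by (simp add: eval_nat_numeral algebra_simps)
    then show ?thesis by (simp only: e1(1)[symmetric] p[symmetric])
  qed
  have first: "m * x\<^sup>2 - 2 * s * x * y + y\<^sup>2 \<ge> 0" for x y
  proof -
    have "m * x\<^sup>2 - 2 * s * x * y + y\<^sup>2 = (y - s * x)\<^sup>2 + (t * x)\<^sup>2"
      unfolding m_def power2_eq_square by (simp add: algebra_simps)
    then show ?thesis by simp
  qed
  have second: "q0 * x\<^sup>2 + q1 * x * y + p4 * y\<^sup>2 > 0" if "x \<noteq> 0 \<or> y \<noteq> 0" for x y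
    using pos[OF that] first[of x y] unfolding fac by (simp add: zero_less_mult_iff)
  have q0: "q0 > 0" using second[of 1 0] by simp
  \<comment> \<open>At (q1/2, -q0) the form takes the value q0 times its determinant.\<close>
  have "q0 * (q1 / 2)\<^sup>2 + q1 * (q1 / 2) * (- q0) + p4 * (- q0)\<^sup>2 > 0"
    by (rule second) (use q0 in simp)
  then have "q0 * (q0 * p4 - (q1 / 2)\<^sup>2) > 0" by (simp add: power2_eq_square algebra_simps)
  then have "q0 * p4 - (q1 / 2)\<^sup>2 > 0" using q0 by (simp add: zero_less_mult_iff)
  then have "elliptic_operator q0 (q1 / 2) p4" using q0 by unfold_locales
  moreover have "elliptic_operator m (- s) 1"
    using m nz by unfold_locales (auto simp: m_def)
  ultimately show ?thesis using that e1 e2 by blast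
qed

section \<open>Symmetric matrices and the inverse of the elasticity tensor\<close>

definition sym_mat :: "real \<Rightarrow> real \<Rightarrow> real \<Rightarrow> real^2^2" where
  "sym_mat p q r = vector [vector [p, q], vector [q, r]]"

lemma sym_mat_nth [simp]:
  "sym_mat p q r $ 1 $ 1 = p" "sym_mat p q r $ 1 $ 2 = q"
  "sym_mat p q r $ 2 $ 1 = q" "sym_mat p q r $ 2 $ 2 = r"
  by (simp_all add: sym_mat_def)

lemma Sym_iff: "V \<in> Sym \<longleftrightarrow> V $ 1 $ 2 = V $ 2 $ 1"
  by (auto simp: Sym_def transpose_def vec_eq_iff forall_2)

lemma sym_mat_Sym [simp]: "sym_mat p q r \<in> Sym"
  by (simp add: Sym_iff)

lemma Sym_eq_sym_mat: "V \<in> Sym \<Longrightarrow> V = sym_mat (V $ 1 $ 1) (V $ 1 $ 2) (V $ 2 $ 2)"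
  by (simp add: Sym_iff vec_eq_iff forall_2)

lemma inner_sym_mat: "V \<bullet> sym_mat p q r = V $ 1 $ 1 * p + (V $ 1 $ 2 + V $ 2 $ 1) * q + V $ 2 $ 2 *
    r"
  by (simp add: inner_vec_def sum_2 algebra_simps)

lemma Sym_closed: "V \<in> Sym \<Longrightarrow> W \<in> Sym \<Longrightarrow> V + W \<in> Sym" "V \<in> Sym \<Longrightarrow> a *\<^sub>R V \<in> Sym" "0 \<in> Sym"
  by (auto simp: Sym_iff)

text \<open>\<open>C\<close> is specified only on the subspace \<open>Sym\<close>. Extending it by
  the identity on the skew part yields a linear map of the whole matrix space, for which injectivity
  implies surjectivity; positive definiteness gives injectivity.\<close>

lemma elasticity_tensor_bij:
  assumes "elasticity_tensor C"
  shows "inj_on C Sym" "C ` Sym = Sym"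
proof -
  have C: "\<And>V. V \<in> Sym \<Longrightarrow> C V \<in> Sym" "\<And>V W. V \<in> Sym \<Longrightarrow> W \<in> Sym \<Longrightarrow> C (V + W) = C V + C W"
    "\<And>a V. V \<in> Sym \<Longrightarrow> C (a *\<^sub>R V) = a *\<^sub>R C V" "\<And>V. V \<in> Sym \<Longrightarrow> V \<noteq> 0 \<Longrightarrow> C V \<bullet> V > 0"
    using assms unfolding elasticity_tensor_def by blast+
  define S where "S V = (1/2) *\<^sub>R (V + transpose V)" for V :: "real^2^2"
  define C' where "C' V = C (S V) + (V - S V)" for V
  have tr: "transpose (V + W) = transpose V + transpose W" "transpose (a *\<^sub>R V) = a *\<^sub>R transpose V"
      for a and V W :: "real^2^2"
    by (simp_all add: transpose_def vec_eq_iff)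
  have S: "S V \<in> Sym" "S (V + W) = S V + S W" "S (a *\<^sub>R V) = a *\<^sub>R S V" for V W a
    unfolding S_def by (simp_all add: Sym_iff transpose_def vec_eq_iff algebra_simps)
  have SS: "S V = V" if "V \<in> Sym" for V
    using that unfolding S_def by (simp add: Sym_iff transpose_def vec_eq_iff forall_2)
  have C0: "C 0 = 0" using C(3)[of 0 0] Sym_closed(3) by simp
  have lin: "linear C'"
    by (rule linearI) (simp_all add: C'_def S C algebra_simps)
  have z: "V = 0" if "C' V = 0" for V
  proof -
    have eq: "V - S V = - C (S V)" using that by (simp add: C'_def add_eq_0_iff)
    have "- C (S V) \<in> Sym" using Sym_closed(2)[OF C(1)[OF S(1)], of "-1"] by simp
    then have "S V + (V - S V) \<in> Sym" unfolding eq by (intro Sym_closed S)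
    then have VS: "S V = V" using SS by simp
    then have "C V = 0" "V \<in> Sym" using eq S(1)[of V] by simp_all
    then show ?thesis using C(4)[of V] by force
  qed
  have inj: "inj C'" using lin z by (simp add: linear_injective_0)
  then have "surj C'" using lin by (simp add: linear_injective_imp_surjective)
  have onS: "C' V = C V" if "V \<in> Sym" for V using SS[OF that] by (simp add: C'_def)
  show "inj_on C Sym" using inj onS by (metis inj_on_def injD)
  have "W \<in> C ` Sym" if W: "W \<in> Sym" for W
  proof -
    obtain V where V: "W = C' V" using \<open>surj C'\<close> by blast
    then have eq: "V - S V = W + (-1) *\<^sub>R C (S V)" by (simp add: C'_def)
    have "S V + (V - S V) \<in> Sym" unfolding eq by (intro Sym_closed S W C)
    then have "V \<in> Sym" by simp
    then show ?thesis using V onS by blast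
  qed
  then show "C ` Sym = Sym" using C(1) by blast
qed

text \<open>The coefficients of \<open>C\<^sup>-\<^sup>1\<close> in the coordinates \<open>(V\<^sub>1\<^sub>1, V\<^sub>1\<^sub>2, V\<^sub>2\<^sub>2)\<close>; the factor 2 accounts
    for the
  double occurrence of the off-diagonal entry in the inner product.\<close>

lemma compliance_coefficients:
  assumes C: "elasticity_tensor C"
  obtains a11 a12 a13 a22 a23 a33 :: real where
    "\<And>p q r. inv_into Sym C (sym_mat p q r) \<in> Sym"
    "\<And>p q r. inv_into Sym C (sym_mat p q r) $ 1 $ 1 = a11 * p + a12 * q + a13 * r"
    "\<And>p q r. 2 * inv_into Sym C (sym_mat p q r) $ 1 $ 2 = a12 * p + a22 * q + a23 * r"
    "\<And>p q r. inv_into Sym C (sym_mat p q r) $ 2 $ 2 = a13 * p + a23 * q + a33 * r"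
    "\<And>p q r. p \<noteq> 0 \<or> q \<noteq> 0 \<or> r \<noteq> 0 \<Longrightarrow>
       a11 * p * p + a22 * q * q + a33 * r * r + 2 * a12 * p * q + 2 * a13 * p * r + 2 * a23 * q * r
           > 0"
proof -
  let ?A = "inv_into Sym C"
  note bij = elasticity_tensor_bij[OF C]
  have C1: "\<And>V. V \<in> Sym \<Longrightarrow> C V \<in> Sym" "\<And>V W. V \<in> Sym \<Longrightarrow> W \<in> Sym \<Longrightarrow> C (V + W) = C V + C W"
    "\<And>a V. V \<in> Sym \<Longrightarrow> C (a *\<^sub>R V) = a *\<^sub>R C V" "\<And>V. V \<in> Sym \<Longrightarrow> V \<noteq> 0 \<Longrightarrow> C V \<bullet> V > 0"
    "\<And>V W. V \<in> Sym \<Longrightarrow> W \<in> Sym \<Longrightarrow> C V \<bullet> W = C W \<bullet> V"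
    using C unfolding elasticity_tensor_def by blast+
  have A: "?A V \<in> Sym" "C (?A V) = V" if "V \<in> Sym" for V
    using that bij(2) by (auto intro: inv_into_into f_inv_into_f)
  have AI: "?A V = W" if "W \<in> Sym" "C W = V" for V W
    using that inv_into_f_f[OF bij(1)] by blast
  have add: "?A (V + W) = ?A V + ?A W" if "V \<in> Sym" "W \<in> Sym" for V W
    by (rule AI) (use A that C1 Sym_closed in auto)
  have scale: "?A (a *\<^sub>R V) = a *\<^sub>R ?A V" if "V \<in> Sym" for V a
    by (rule AI) (use A that C1 Sym_closed in auto)
  have sym: "?A V \<bullet> W = ?A W \<bullet> V" if "V \<in> Sym" "W \<in> Sym" for V W
    using C1(5)[OF A(1)[OF that(1)] A(1)[OF that(2)]] A(2) that by (simp add: inner_commute)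
  have pos: "?A V \<bullet> V > 0" if "V \<in> Sym" "V \<noteq> 0" for V
  proof -
    have "?A V \<noteq> 0" using A(2)[OF that(1)] C1(3)[OF Sym_closed(3), of 0] that(2) by auto
    then show ?thesis using C1(4)[OF A(1)[OF that(1)]] A(2) that by (simp add: inner_commute)
  qed
  define e1 e2 e3 where "e1 = sym_mat 1 0 0" and "e2 = sym_mat 0 1 0" and "e3 = sym_mat 0 0 1"
  have eS: "e1 \<in> Sym" "e2 \<in> Sym" "e3 \<in> Sym" by (simp_all add: e1_def e2_def e3_def)
  have dec: "sym_mat p q r = p *\<^sub>R e1 + q *\<^sub>R e2 + r *\<^sub>R e3" for p q r
    by (simp add: e1_def e2_def e3_def vec_eq_iff forall_2)
  have Adec: "?A (sym_mat p q r) = p *\<^sub>R ?A e1 + q *\<^sub>R ?A e2 + r *\<^sub>R ?A e3" for p q r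
    unfolding dec by (simp add: add scale eS Sym_closed)
  have i1: "V \<bullet> e1 = V $ 1 $ 1" "V \<bullet> e3 = V $ 2 $ 2" for V
    by (simp_all add: e1_def e3_def inner_sym_mat)
  have i2: "V \<bullet> e2 = 2 * V $ 1 $ 2" if "V \<in> Sym" for V
    using that by (simp add: e2_def inner_sym_mat Sym_iff)
  have AS: "?A (sym_mat p q r) \<in> Sym" for p q r by (rule A) simp
  have ip: "?A (sym_mat p q r) \<bullet> W = p * (?A e1 \<bullet> W) + q * (?A e2 \<bullet> W) + r * (?A e3 \<bullet> W)" for p q r
      W
    unfolding Adec by (simp add: inner_left_distrib)
  show ?thesis
  proof (rule that[of "?A e1 \<bullet> e1" "?A e1 \<bullet> e2" "?A e1 \<bullet> e3" "?A e2 \<bullet> e2" "?A e2 \<bullet> e3" "?A e3 \<bullet>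
      e3"])
    fix p q r
    show "?A (sym_mat p q r) \<in> Sym" by (rule AS)
    show "?A (sym_mat p q r) $ 1 $ 1 = (?A e1 \<bullet> e1) * p + (?A e1 \<bullet> e2) * q + (?A e1 \<bullet> e3) * r"
      using ip[of p q r e1] sym[OF eS(2,1)] sym[OF eS(3,1)] unfolding i1 by (simp add: i1
          mult.commute)
    show "2 * ?A (sym_mat p q r) $ 1 $ 2 = (?A e1 \<bullet> e2) * p + (?A e2 \<bullet> e2) * q + (?A e2 \<bullet> e3) * r"
      using ip[of p q r e2] sym[OF eS(3,2)] i2[OF AS] by (simp add: mult.commute)
    show "?A (sym_mat p q r) $ 2 $ 2 = (?A e1 \<bullet> e3) * p + (?A e2 \<bullet> e3) * q + (?A e3 \<bullet> e3) * r"
      using ip[of p q r e3] unfolding i1 by (simp add: i1 mult.commute)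
    assume "p \<noteq> 0 \<or> q \<noteq> 0 \<or> r \<noteq> 0"
    then have "sym_mat p q r \<noteq> 0"
      by (metis sym_mat_nth(1,2,4) zero_index)
    then have "?A (sym_mat p q r) \<bullet> sym_mat p q r > 0" by (intro pos) simp_all
    then have "?A (sym_mat p q r) \<bullet> (p *\<^sub>R e1 + q *\<^sub>R e2 + r *\<^sub>R e3) > 0" by (simp only: dec)
    then show "(?A e1 \<bullet> e1) * p * p + (?A e2 \<bullet> e2) * q * q + (?A e3 \<bullet> e3) * r * r + 2 * (?A e1 \<bullet> e2)
        * p * q
        + 2 * (?A e1 \<bullet> e3) * p * r + 2 * (?A e2 \<bullet> e3) * q * r > 0"
      unfolding inner_right_distrib inner_scaleR_right ip
      using sym[OF eS(2,1)] sym[OF eS(3,1)] sym[OF eS(3,2)] by (simp add: algebra_simps)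
  qed
qed

section \<open>Fields with vanishing normal trace\<close>

text \<open>\<open>outward_unit_normal\<close> ties \<open>n p\<close> to a defining function chosen
  for that \<open>p\<close> alone. What is needed is one function near \<open>p\<close> whose
  gradient has the direction of \<open>n\<close> at all nearby boundary points, so gradients of two
  defining functions of the same set must be shown to be parallel.\<close>

lemma local_defining_function:
  assumes \<Omega>: "open \<Omega>" and n: "outward_unit_normal \<Omega> n" and p: "p \<in> frontier \<Omega>"
  obtains U \<rho> G where "open U" "p \<in> U" "\<And>x. x \<in> U \<Longrightarrow> (\<rho> has_derivative (\<lambda>h. G x \<bullet> h)) (at x)"
    "continuous_on U G" "\<And>x. x \<in> U \<Longrightarrow> G x \<noteq> 0" "\<Omega> \<inter> U = {x \<in> U. \<rho> x < (0::real)}"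
    "\<And>x. x \<in> frontier \<Omega> \<Longrightarrow> x \<in> U \<Longrightarrow> G x = norm (G x) *\<^sub>R n x"
    "\<And>x. x \<in> frontier \<Omega> \<Longrightarrow> x \<in> U \<Longrightarrow> \<rho> x = 0"
proof -
  have line: "((\<lambda>t. \<rho> (x + t *\<^sub>R h)) has_real_derivative g \<bullet> h) (at 0)"
    if "(\<rho> has_derivative (\<lambda>h. g \<bullet> h)) (at x)" for \<rho> :: "real^2 \<Rightarrow> real" and g x h
  proof -
    have "((\<lambda>t. x + t *\<^sub>R h) has_derivative (\<lambda>t. t *\<^sub>R h)) (at 0)"
      by (auto intro!: derivative_eq_intros)
    moreover have "(\<rho> has_derivative (\<lambda>h. g \<bullet> h)) (at (x + 0 *\<^sub>R h))" using that by simp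
    ultimately have "((\<lambda>t. \<rho> (x + t *\<^sub>R h)) has_derivative (\<lambda>t. g \<bullet> (t *\<^sub>R h))) (at 0)"
      by (rule has_derivative_compose)
    moreover have "(\<lambda>t. g \<bullet> (t *\<^sub>R h)) = (*) (g \<bullet> h)" by (auto simp: fun_eq_iff)
    ultimately show ?thesis by (simp only: has_field_derivative_def)
  qed
  have loc: "\<exists>U \<rho> G. open U \<and> p \<in> U \<and> (\<forall>x\<in>U. (\<rho> has_derivative (\<lambda>h. G x \<bullet> h)) (at x)) \<and>
      continuous_on U G \<and> (\<forall>x\<in>U. G x \<noteq> 0) \<and> \<Omega> \<inter> U = {x \<in> U. \<rho> x < (0::real)} \<and>
      n p = G p /\<^sub>R norm (G p)" if "p \<in> frontier \<Omega>" for p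
    using n[unfolded outward_unit_normal_def] that by (rule bspec)
  obtain U \<rho> G where U0: "open U \<and> p \<in> U \<and> (\<forall>x\<in>U. (\<rho> has_derivative (\<lambda>h. G x \<bullet> h)) (at x)) \<and>
      continuous_on U G \<and> (\<forall>x\<in>U. G x \<noteq> 0) \<and> \<Omega> \<inter> U = {x \<in> U. \<rho> x < (0::real)} \<and>
      n p = G p /\<^sub>R norm (G p)"
    using loc[OF p] by (elim exE) (rule that)
  note U = U0[THEN conjunct1]
    U0[THEN conjunct2, THEN conjunct1]
    U0[THEN conjunct2, THEN conjunct2, THEN conjunct1]
    U0[THEN conjunct2, THEN conjunct2, THEN conjunct2, THEN conjunct1]
    U0[THEN conjunct2, THEN conjunct2, THEN conjunct2, THEN conjunct2, THEN conjunct1]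
    U0[THEN conjunct2, THEN conjunct2, THEN conjunct2, THEN conjunct2, THEN conjunct2, THEN
        conjunct1]
  have zero: "\<rho> x = 0" if x: "x \<in> frontier \<Omega>" "x \<in> U" and U: "open U" "\<Omega> \<inter> U = {x \<in> U. \<rho> x < 0}"
     "\<forall>x\<in>U. (\<rho> has_derivative (\<lambda>h. G x \<bullet> h)) (at x)" for x U and \<rho> :: "real^2 \<Rightarrow> real" and G
  proof (rule ccontr)
    assume "\<rho> x \<noteq> 0"
    moreover have "x \<notin> \<Omega>" using x(1) \<Omega> frontier_disjoint_eq by blast
    then have "\<rho> x \<ge> 0" using x(2) U(2) by (metis (mono_tags, lifting) Int_iff linorder_not_less
        mem_Collect_eq)
    ultimately have pos: "\<rho> x > 0" by simp
    have "continuous_on U \<rho>"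
      using U(3) by (meson continuous_at_imp_continuous_on has_derivative_continuous)
    then have "open (U \<inter> \<rho> -` {0<..})" using U(1) by (simp add: continuous_on_open_vimage
        Int_commute)
    moreover have "x \<in> U \<inter> \<rho> -` {0<..}" using x(2) pos by simp
    moreover have "x \<in> closure \<Omega>" using x(1) by (simp add: frontier_def)
    ultimately obtain y where "y \<in> U \<inter> \<rho> -` {0<..}" "y \<in> \<Omega>"
      using open_Int_closure_eq_empty by blast
    then have "y \<in> \<Omega> \<inter> U" "\<not> \<rho> y < 0" by auto
    then show False using U(2) by blast
  qed
  have dir: "G x = norm (G x) *\<^sub>R n x" if x: "x \<in> frontier \<Omega>" "x \<in> U" for x
  proof -
    obtain U' \<rho>' G' where U0': "open U' \<and> x \<in> U' \<and> (\<forall>x\<in>U'. (\<rho>' has_derivative (\<lambda>h. G' x \<bullet> h)) (at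
        x)) \<and>
      continuous_on U' G' \<and> (\<forall>x\<in>U'. G' x \<noteq> 0) \<and> \<Omega> \<inter> U' = {x \<in> U'. \<rho>' x < (0::real)} \<and>
      n x = G' x /\<^sub>R norm (G' x)"
      using loc[OF x(1)] by (elim exE) (rule that)
    note U' = U0'[THEN conjunct1]
      U0'[THEN conjunct2, THEN conjunct1]
      U0'[THEN conjunct2, THEN conjunct2, THEN conjunct1]
      U0'[THEN conjunct2, THEN conjunct2, THEN conjunct2, THEN conjunct2, THEN conjunct1]
      U0'[THEN conjunct2, THEN conjunct2, THEN conjunct2, THEN conjunct2, THEN conjunct2, THEN
          conjunct1]
      U0'[THEN conjunct2, THEN conjunct2, THEN conjunct2, THEN conjunct2, THEN conjunct2, THEN
          conjunct2]
    define a b where "a = G x" and "b = G' x"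
    have nz: "a \<noteq> 0" "b \<noteq> 0" using U(5) U'(2,4) x(2) by (auto simp: a_def b_def)
    have z: "\<rho> x = 0" "\<rho>' x = 0" using zero[OF x U(1,6,3)] zero[OF x(1) U'(2,1,5,3)] by auto
    have "a \<bullet> b = norm a * norm b"
    proof (rule ccontr)
      assume ne: "a \<bullet> b \<noteq> norm a * norm b"
      then have lt: "a \<bullet> b < norm a * norm b" using norm_cauchy_schwarz[of a b] by simp
      \<comment> \<open>If the unit gradients differ, moving along their difference decreases one
        defining function and increases the other, so a nearby point would lie both inside and
        outside \<Omega>.\<close>
      define h where "h = b /\<^sub>R norm b - a /\<^sub>R norm a"
      have aa: "a \<bullet> a = norm a * norm a" "b \<bullet> b = norm b * norm b" by (simp_all add: dot_square_norm
          power2_eq_square)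
      have "a \<bullet> h = (a \<bullet> b) / norm b - norm a"
        using nz by (simp add: h_def inner_diff_right aa field_simps)
      moreover have "(a \<bullet> b) / norm b < norm a" using lt nz by (simp add: pos_divide_less_eq)
      ultimately have ah: "a \<bullet> h < 0" by linarith
      have "b \<bullet> h = norm b - (a \<bullet> b) / norm a"
        using nz by (simp add: h_def inner_diff_right aa inner_commute field_simps)
      moreover have "(a \<bullet> b) / norm a < norm b" using lt nz by (simp add: pos_divide_less_eq
          mult.commute)
      ultimately have bh: "b \<bullet> h > 0" by linarith
      have d1: "((\<lambda>t. \<rho> (x + t *\<^sub>R h)) has_real_derivative a \<bullet> h) (at 0)"
        using U(3) x(2) by (intro line) (auto simp: a_def)
      have d2: "((\<lambda>t. \<rho>' (x + t *\<^sub>R h)) has_real_derivative b \<bullet> h) (at 0)"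
        using U'(2,3) by (intro line) (auto simp: b_def)
      obtain e1 where e1: "e1 > 0" "\<And>t. 0 < t \<Longrightarrow> t < e1 \<Longrightarrow> \<rho> (x + t *\<^sub>R h) < 0"
        using DERIV_neg_dec_right[OF d1 ah] z by auto
      obtain e2 where e2: "e2 > 0" "\<And>t. 0 < t \<Longrightarrow> t < e2 \<Longrightarrow> \<rho>' (x + t *\<^sub>R h) > 0"
        using DERIV_pos_inc_right[OF d2 bh] z by auto
      obtain e3 where e3: "e3 > 0" "ball x e3 \<subseteq> U \<inter> U'"
        using U(1) U'(1,2) x(2) by (meson IntI open_Int openE)
      define M where "M = min (min e1 e2) (e3 / (norm h + 1))"
      define t where "t = M / 2"
      have "e3 / (norm h + 1) > 0" using e3(1) by (intro divide_pos_pos add_nonneg_pos) auto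
      then have M: "0 < M" "M \<le> e1" "M \<le> e2" "M \<le> e3 / (norm h + 1)"
        using e1(1) e2(1) by (auto simp: M_def)
      then have t: "0 < t" "t < e1" "t < e2" "t < e3 / (norm h + 1)"
        using e1(1) e2(1) M unfolding t_def by linarith+
      have "t < e3 / (norm h + 1)" by (rule t)
      then have "t * (norm h + 1) < e3" by (subst (asm) pos_less_divide_eq) (auto intro:
          add_nonneg_pos)
      then have "t * norm h < e3" using t(1) by (simp add: distrib_left)
      then have "x + t *\<^sub>R h \<in> ball x e3" using t(1) by (simp add: dist_norm)
      then have "x + t *\<^sub>R h \<in> U" "x + t *\<^sub>R h \<in> U'" using e3(2) by auto
      moreover have "\<rho> (x + t *\<^sub>R h) < 0" "\<rho>' (x + t *\<^sub>R h) > 0" using e1(2) e2(2) t by auto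
      ultimately have "x + t *\<^sub>R h \<in> \<Omega> \<inter> U" "x + t *\<^sub>R h \<notin> \<Omega> \<inter> U'" unfolding U(6) U'(5) by simp_all
      then show False using \<open>x + t *\<^sub>R h \<in> U'\<close> by simp
    qed
    then have "norm a *\<^sub>R b = norm b *\<^sub>R a" by (simp add: norm_cauchy_schwarz_eq)
    then have "(1 / norm b) *\<^sub>R (norm b *\<^sub>R a) = (1 / norm b) *\<^sub>R (norm a *\<^sub>R b)" by simp
    then have "a = norm a *\<^sub>R (b /\<^sub>R norm b)" using nz by (simp add: divide_inverse mult.commute)
    then show ?thesis using U'(6) by (simp add: a_def b_def)
  qed
  show ?thesis
  proof (rule that[of U \<rho> G])
    show "G x = norm (G x) *\<^sub>R n x" if "x \<in> frontier \<Omega>" "x \<in> U" for x using dir that .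
    show "\<rho> x = 0" if "x \<in> frontier \<Omega>" "x \<in> U" for x using zero[OF that U(1,6,3)] .
  qed (use U in \<open>blast+\<close>)
qed

text \<open>Limits at the individual boundary points suffice: every value of the extension is
  approximated by values of \<open>f\<close> at nearby points of \<Omega>, so the estimate at
  \<open>x\<close> passes from \<Omega> to all of the closure.\<close>

lemma continuous_extension_closure:
  fixes f :: "'a::metric_space \<Rightarrow> 'b::metric_space"
  assumes \<Omega>: "open \<Omega>" and f: "continuous_on \<Omega> f"
    and lim: "\<And>p. p \<in> frontier \<Omega> \<Longrightarrow> \<exists>l. (f \<longlongrightarrow> l) (at p within \<Omega>)"
  obtains g where "continuous_on (closure \<Omega>) g" "\<And>x. x \<in> \<Omega> \<Longrightarrow> g x = f x"
    "\<And>p. p \<in> frontier \<Omega> \<Longrightarrow> (f \<longlongrightarrow> g p) (at p within \<Omega>)"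
proof -
  obtain l where l: "\<And>p. p \<in> frontier \<Omega> \<Longrightarrow> (f \<longlongrightarrow> l p) (at p within \<Omega>)" using lim by metis
  define g where "g x = (if x \<in> \<Omega> then f x else l x)" for x
  have fr: "x \<in> frontier \<Omega>" if "x \<in> closure \<Omega>" "x \<notin> \<Omega>" for x
    using that \<Omega> by (simp add: frontier_def interior_open)
  have gl: "(f \<longlongrightarrow> g x) (at x within \<Omega>)" if "x \<in> closure \<Omega>" for x
    using that f l fr by (cases "x \<in> \<Omega>") (auto simp: g_def continuous_on_def)
  have near: "\<exists>y\<in>\<Omega>. dist y z < d \<and> dist (f y) (g z) < e" if z: "z \<in> closure \<Omega>" and "d > 0" "e > 0"
      for z d e
  proof (cases "z \<in> \<Omega>")
    case True
    then show ?thesis using that by (intro bexI[of _ z]) (auto simp: g_def)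
  next
    case False
    have "z islimpt \<Omega>" using z False by (auto simp: closure_def)
    then have nt: "at z within \<Omega> \<noteq> bot" by (simp add: trivial_limit_within)
    have "\<forall>\<^sub>F y in at z within \<Omega>. dist (f y) (g z) < e" using gl[OF z] \<open>e > 0\<close> by (rule tendstoD)
    moreover have "\<forall>\<^sub>F y in at z within \<Omega>. y \<in> \<Omega> \<and> dist y z < d"
      using \<open>d > 0\<close> by (auto simp: eventually_at)
    ultimately have "\<forall>\<^sub>F y in at z within \<Omega>. y \<in> \<Omega> \<and> dist y z < d \<and> dist (f y) (g z) < e"
      by eventually_elim auto
    then show ?thesis using eventually_happens'[OF nt] by blast
  qed
  have "continuous_on (closure \<Omega>) g"
    unfolding continuous_on_iff
  proof (intro ballI allI impI)
    fix x e assume x: "x \<in> closure \<Omega>" and e: "(0::real) < e"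
    have "\<forall>\<^sub>F y in at x within \<Omega>. dist (f y) (g x) < e / 2" using gl[OF x] e by (intro tendstoD)
        auto
    then obtain d where d: "d > 0" "\<And>y. y \<in> \<Omega> \<Longrightarrow> y \<noteq> x \<Longrightarrow> dist y x < d \<Longrightarrow> dist (f y) (g x) < e / 2"
      unfolding eventually_at by blast
    have "dist (g z) (g x) < e" if z: "z \<in> closure \<Omega>" "dist z x < d / 2" for z
    proof -
      obtain y where y: "y \<in> \<Omega>" "dist y z < d / 2" "dist (f y) (g z) < e / 2"
        using near[OF z(1), of "d / 2" "e / 2"] d e by auto
      have "dist y x < d" using y(2) z(2) dist_triangle[of y x z] by linarith
      then have "dist (f y) (g x) < e / 2"
        using d(2)[OF y(1)] y(1) e by (cases "y = x") (auto simp: g_def)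
      then show ?thesis using y(3) dist_triangle3[of "g z" "g x" "f y"] by linarith
    qed
    then show "\<exists>d>0. \<forall>x'\<in>closure \<Omega>. dist x' x < d \<longrightarrow> dist (g x') (g x) < e"
      using d(1) by (intro exI[of _ "d / 2"]) auto
  qed
  moreover have "g x = f x" if "x \<in> \<Omega>" for x using that by (simp add: g_def)
  moreover have "(f \<longlongrightarrow> g p) (at p within \<Omega>)" if "p \<in> frontier \<Omega>" for p
    using gl that by (simp add: frontier_def)
  ultimately show ?thesis using that by blast
qed

text \<open>The transition lies between -2 and -1, strictly below 0: composed with a defining
  function divided by e, the step vanishes before the boundary is reached. Monotonicity gives its
  derivative a sign, so that the mass of the derivative can be bounded by a plain integral.\<close>

lemma ex_smooth_step:
  obtains H H' :: "real \<Rightarrow> real" where "\<And>s. (H has_real_derivative H' s) (at s)" "continuous_on UNIV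
      H'"
    "\<And>s. H' s \<le> 0" "\<And>s. 0 \<le> H s" "\<And>s. H s \<le> 1" "\<And>s. s \<le> -2 \<Longrightarrow> H s = 1" "\<And>s. s \<ge> -1 \<Longrightarrow> H s = 0"
    "\<And>s. s \<le> -2 \<Longrightarrow> H' s = 0" "\<And>s. s \<ge> -1 \<Longrightarrow> H' s = 0"
proof -
  define A B where "A s = exp_bump 0 (- s - 1)" and "B s = exp_bump 0 (s + 2)" for s
  define A' B' where "A' s = - exp_bump 2 (- s - 1)" and "B' s = exp_bump 2 (s + 2)" for s
  have n: "exp_bump k t \<ge> 0" for k t by (simp add: exp_bump_def)
  have e: "(exp_bump 0 has_real_derivative exp_bump 2 t) (at t)" for t
    using exp_bump_has_real_derivative[of 0 t] by (simp add: numeral_2_eq_2)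
  have dA: "(A has_real_derivative A' s) (at s)" for s
    unfolding A_def A'_def by (rule DERIV_cong[OF DERIV_chain2[OF e]]) (auto intro!:
        derivative_eq_intros)
  have dB: "(B has_real_derivative B' s) (at s)" for s
    unfolding B_def B'_def by (rule DERIV_cong[OF DERIV_chain2[OF e]]) (auto intro!:
        derivative_eq_intros)
  have pos: "A s + B s > 0" for s
    unfolding A_def B_def by (cases "s < -1") (auto simp: exp_bump_def intro: add_pos_nonneg
        add_nonneg_pos)
  have nn: "A s \<ge> 0" "B s \<ge> 0" "A' s \<le> 0" "B' s \<ge> 0" for s by (simp_all add: A_def B_def A'_def
      B'_def n)
  define H where "H s = A s / (A s + B s)" for s
  define H' where "H' s = (A' s * B s - A s * B' s) / ((A s + B s) * (A s + B s))" for s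
  have ceb: "continuous_on UNIV (exp_bump k)" for k
    using exp_bump_has_real_derivative by (meson DERIV_isCont continuous_at_imp_continuous_on)
  have cA: "continuous_on UNIV A'" "continuous_on UNIV B'"
    unfolding A'_def B'_def by (intro continuous_intros continuous_on_compose2[OF ceb]; simp)+
  have cB: "continuous_on UNIV A" "continuous_on UNIV B"
    using dA dB by (meson DERIV_isCont continuous_at_imp_continuous_on)+
  show ?thesis
  proof (rule that[of H H'])
    show "(H has_real_derivative H' s) (at s)" for s
    proof -
      have "((\<lambda>s. A s / (A s + B s)) has_real_derivative
          (A' s * (A s + B s) - A s * (A' s + B' s)) / ((A s + B s) * (A s + B s))) (at s)"
        using pos[of s] by (intro DERIV_divide DERIV_add dA dB) simp
      then show ?thesis unfolding H_def H'_def by (simp add: algebra_simps)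
    qed
    show "continuous_on UNIV H'"
      unfolding H'_def using pos by (intro continuous_intros cA cB) (auto simp:
          less_imp_neq[symmetric])
    show "H' s \<le> 0" for s
    proof -
      have "A' s * B s \<le> 0" "A s * B' s \<ge> 0" using nn[of s] by (auto simp: mult_nonpos_nonneg)
      then have "A' s * B s - A s * B' s \<le> 0" by linarith
      then show ?thesis unfolding H'_def using pos[of s] by (intro divide_nonpos_nonneg) auto
    qed
    show "0 \<le> H s" for s unfolding H_def using nn by simp
    show "H s \<le> 1" for s unfolding H_def using nn[of s] pos[of s] by (simp add: divide_le_eq)
    show "H s = 1" if "s \<le> -2" for s
      using that pos[of s] unfolding H_def by (simp add: B_def exp_bump_def)
    show "H s = 0" if "s \<ge> -1" for s
      using that unfolding H_def by (simp add: A_def exp_bump_def)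
    show "H' s = 0" if "s \<le> -2" for s
      using that unfolding H'_def by (simp add: B_def B'_def exp_bump_def)
    show "H' s = 0" if "s \<ge> -1" for s
      using that unfolding H'_def by (simp add: A_def A'_def exp_bump_def)
  qed
qed

text \<open>For products whose factors are regular only inside the domain or near one boundary
  point; off the compact set the product is 0, whatever its factors do.\<close>

lemma integral_partial_eq_0_open:
  fixes f :: "real^2 \<Rightarrow> real"
  assumes O: "open V" and K: "compact K" "K \<subseteq> V" and d: "\<And>x. x \<in> V \<Longrightarrow> f differentiable (at x)"
    and c: "continuous_on V (partial i f)" and z: "\<And>x. x \<notin> K \<Longrightarrow> f x = 0"
  shows "integral\<^sup>L lborel (partial i f) = 0" "continuous_on UNIV (partial i f)" "\<And>x. x \<notin> K \<Longrightarrow>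
      partial i f x = 0"
proof -
  have oK: "open (- K)" using K(1) compact_imp_closed by blast
  have p0: "partial i f x = 0" if "x \<notin> K" for x
    using partial_eq_0_off[OF compact_imp_closed[OF K(1)] z that] .
  then show "\<And>x. x \<notin> K \<Longrightarrow> partial i f x = 0" .
  have "f differentiable (at x)" for x
  proof (cases "x \<in> V")
    case False
    then have "x \<in> - K" using K(2) by auto
    then show ?thesis
      by (rule differentiable_cong_open[OF oK, of _ "\<lambda>_. 0"]) (simp_all add: z)
  qed (rule d)
  moreover have "continuous_on (V \<union> - K) (partial i f)"
  proof (rule continuous_on_open_Un[OF O oK c])
    show "continuous_on (- K) (partial i f)"
      using continuous_on_const[of "- K" "0::real"] by (rule continuous_on_eq) (use p0 in auto)
  qed
  moreover have "V \<union> - K = UNIV" using K(2) by auto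
  ultimately show "integral\<^sup>L lborel (partial i f) = 0" "continuous_on UNIV (partial i f)"
    using integral_partial_eq_0[OF _ _ K(1) z] by auto
qed

section \<open>Zero normal trace as a weak identity\<close>

definition directional :: "(real^2 \<Rightarrow> real^2) \<Rightarrow> (real^2 \<Rightarrow> real) \<Rightarrow> real^2 \<Rightarrow> real" where
  "directional v w x = v x $ 1 * partial 1 w x + v x $ 2 * partial 2 w x"

lemma integrable_indicator_mult:
  fixes f \<phi> :: "real^2 \<Rightarrow> real"
  assumes "open \<Omega>" "continuous_on \<Omega> f" "\<And>x. x \<in> \<Omega> \<Longrightarrow> \<bar>f x\<bar> \<le> B" "\<phi> \<in> test_functions UNIV"
  shows "integrable lborel (\<lambda>x. indicat_real \<Omega> x * (f x * \<phi> x))"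
proof -
  have "(\<lambda>x. indicat_real \<Omega> x *\<^sub>R f x) \<in> borel_measurable borel"
    using assms by (intro borel_measurable_continuous_on_indicator) auto
  then have "locally_integrable (\<lambda>x. indicat_real \<Omega> x *\<^sub>R f x)"
    by (rule locally_integrable_bounded[where B = "\<bar>B\<bar>"]) (use assms(3) in \<open>fastforce simp:
        indicator_def\<close>)
  from locally_integrable_mult_test[OF this assms(4)] show ?thesis by (simp add: mult.assoc)
qed

text \<open>With \<open>\<Omega> = {\<rho> < 0}\<close> near \<open>p\<close>, cut off by \<open>H (\<rho> / e)\<close>. The error term contains
  \<open>\<nabla>(H (\<rho> / e)) \<bullet> v\<close>; its total mass is controlled by integrating the derivative of
  \<open>H (\<rho> / e)\<close> in the fixed direction \<open>G p\<close>, in which \<open>\<rho>\<close> is strictly increasing, and the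
  normal component of \<open>v\<close> is small on the layer where \<open>H'\<close> does not vanish.\<close>

lemma weak_divergence_boundary_local:
  assumes \<Omega>: "open \<Omega>" "bounded \<Omega>" and n: "outward_unit_normal \<Omega> n" and p: "p \<in> frontier \<Omega>"
    and sm: "\<And>i. smooth_on \<Omega> (\<lambda>x. v x $ i)"
    and div: "\<And>x. x \<in> \<Omega> \<Longrightarrow> partial 1 (\<lambda>x. v x $ 1) x + partial 2 (\<lambda>x. v x $ 2) x = 0"
    and V: "continuous_on (closure \<Omega>) V" "\<And>x. x \<in> \<Omega> \<Longrightarrow> V x = v x" "\<And>q. q \<in> frontier \<Omega> \<Longrightarrow> V q \<bullet> n q =
        0"
  shows "\<exists>r>0. \<forall>w\<in>test_functions (ball p r). (\<integral>x. indicat_real \<Omega> x * directional v w x \<partial>lborel) = 0"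
proof -
  obtain U \<rho> G where U: "open U" "p \<in> U" and \<rho>: "\<And>x. x \<in> U \<Longrightarrow> (\<rho> has_derivative (\<lambda>h. G x \<bullet> h)) (at
      x)"
    and G: "continuous_on U G" "\<And>x. x \<in> U \<Longrightarrow> G x \<noteq> 0" and \<Omega>U: "\<Omega> \<inter> U = {x \<in> U. \<rho> x < (0::real)}"
    and Gn: "\<And>x. x \<in> frontier \<Omega> \<Longrightarrow> x \<in> U \<Longrightarrow> G x = norm (G x) *\<^sub>R n x"
    and \<rho>0: "\<And>x. x \<in> frontier \<Omega> \<Longrightarrow> x \<in> U \<Longrightarrow> \<rho> x = 0"
    using local_defining_function[OF \<Omega>(1) n p] by blast
  obtain H H' :: "real \<Rightarrow> real" where H: "\<And>s. (H has_real_derivative H' s) (at s)" "continuous_on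
      UNIV H'"
    "\<And>s. H' s \<le> 0" "\<And>s. 0 \<le> H s" "\<And>s. H s \<le> 1" "\<And>s. s \<le> -2 \<Longrightarrow> H s = 1" "\<And>s. s \<ge> -1 \<Longrightarrow> H s = 0"
    "\<And>s. s \<le> -2 \<Longrightarrow> H' s = 0" "\<And>s. s \<ge> -1 \<Longrightarrow> H' s = 0"
    by (rule ex_smooth_step) blast
  have c\<rho>: "continuous_on U \<rho>"
    using \<rho> by (meson continuous_at_imp_continuous_on has_derivative_continuous)
  have cH: "continuous_on UNIV H"
    using H(1) by (meson DERIV_isCont continuous_at_imp_continuous_on)
  \<comment> \<open>A constant direction is essential: integrating along \<open>G\<close> itself
    would produce its divergence, and \<open>G\<close> is only continuous. By continuity
    \<open>G x \<bullet> g0\<close> stays above half of its value at \<open>p\<close>.\<close>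
  define g0 where "g0 = G p"
  have g0: "g0 \<bullet> g0 > 0" using G(2)[OF U(2)] by (simp add: g0_def)
  have "continuous_on U (\<lambda>x. G x \<bullet> g0)" by (intro continuous_intros G)
  then have ic: "isCont (\<lambda>x. G x \<bullet> g0) p" using U by (simp add: continuous_on_eq_continuous_at)
  have gp: "G p \<bullet> g0 > g0 \<bullet> g0 / 2" using g0 by (simp add: g0_def[symmetric])
  have "\<forall>\<^sub>F x in at p. G x \<bullet> g0 > g0 \<bullet> g0 / 2"
    by (rule order_tendstoD(1)[OF ic[unfolded isCont_def] gp])
  then have "\<forall>\<^sub>F x in nhds p. G x \<bullet> g0 > g0 \<bullet> g0 / 2"
    using gp by (simp add: eventually_nhds_conv_at)
  then obtain U' where U': "open U'" "p \<in> U'" "\<And>x. x \<in> U' \<Longrightarrow> G x \<bullet> g0 > g0 \<bullet> g0 / 2"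
    unfolding eventually_nhds by blast
  obtain s where s: "s > 0" "ball p s \<subseteq> U \<inter> U'" using U U' by (meson IntI open_Int openE)
  define r where "r = s / 2"
  have r: "r > 0" "r < s" using s by (auto simp: r_def)
  obtain b where b: "b \<in> test_functions (ball p s)" "\<And>x. 0 \<le> b x \<and> b x \<le> 1" "\<And>x. x \<in> ball p r \<Longrightarrow> b x
      = 1"
    using ex_bump[OF r, of p] by blast
  define k where "k e x = H (\<rho> x / e)" for e x
  define m where "m e x = H' (\<rho> x / e) / e" for e x
  have k_der: "(k e has_derivative (\<lambda>h. m e x * (G x \<bullet> h))) (at x)" if "x \<in> U" for e x
  proof -
    have "((\<lambda>x. \<rho> x / e) has_derivative (\<lambda>h. (G x \<bullet> h) / e)) (at x)"
      using bounded_linear.has_derivative[OF bounded_linear_divide \<rho>[OF that]] by simp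
    from DERIV_compose_FDERIV[OF H(1) this] show ?thesis
      unfolding k_def m_def by (simp add: mult.commute)
  qed
  have k_diff: "k e differentiable (at x)" if "x \<in> U" for e x
    using k_der[OF that] by (auto simp: differentiable_def)
  have k_partial: "partial i (k e) x = m e x * G x $ i" if "x \<in> U" for e x i
    using partial_eqI[OF k_der[OF that]] by (simp add: inner_axis)
  have cm: "continuous_on U (m e)" and ck: "continuous_on U (k e)" for e
    unfolding m_def k_def divide_inverse
    by (intro continuous_intros c\<rho> continuous_on_compose2[OF H(2)] continuous_on_compose2[OF cH];
        simp)+
  have cGi: "continuous_on U (\<lambda>x. G x $ i)" for i
    by (intro continuous_intros G)
  have m_nonpos: "m e x \<le> 0" if "e > 0" for e x
    unfolding m_def using H(3) that by (simp add: divide_nonpos_pos)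
  obtain Cb where Cb: "Cb > 0" "\<And>x. \<bar>directional (\<lambda>_. g0) b x\<bar> \<le> Cb"
  proof -
    have "(\<lambda>x. directional (\<lambda>_. g0) b x) \<in> test_functions UNIV"
      unfolding directional_def using b(1)
      by (intro test_functions_add test_functions_cmult test_functions_partial) (auto intro:
          test_functions_mono)
    then show ?thesis using that by (metis test_function_bounded)
  qed
  have bt: "b \<in> test_functions UNIV" using b(1) by (rule test_functions_mono) simp
  have bs: "b x = 0" if "x \<notin> ball p s" for x using test_functions_eq_0[OF b(1) that] .
  have pbs: "partial i b x = 0" if "x \<notin> ball p s" for x i
    using test_functions_eq_0[OF test_functions_partial[OF b(1)] that] .
  \<comment> \<open>\<open>C0\<close> bounds the integral of the cutoff times the derivative of
    \<open>b\<close> along \<open>g0\<close>, and \<open>C1\<close> divides it by the lower bound of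
    \<open>G x \<bullet> g0\<close>. Neither depends on the width e.\<close>
  define C0 where "C0 = Cb * measure lborel (cball (0::real^2) (norm p + s))"
  define C1 where "C1 = C0 / (g0 \<bullet> g0 / 2)"
  have mass_int: "integrable lborel (\<lambda>x. m e x * b x)" for e
  proof -
    obtain K where K: "compact K" "K \<subseteq> ball p s" "\<And>x. x \<notin> K \<Longrightarrow> b x = 0" by (metis b(1)
        test_functionsE)
    have "continuous_on U (\<lambda>x. m e x * b x)"
      by (intro continuous_intros cm continuous_test_function[OF b(1)])
    then show ?thesis
      by (rule integrable_compact_support_within[OF _ K(1)]) (use K s in auto)
  qed
  have mass: "(\<integral>x. - m e x * b x \<partial>lborel) \<le> C1" if e: "e > 0" for e
  proof -
    define f where "f = (\<lambda>x. k e x * b x)"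
    obtain K where K: "compact K" "K \<subseteq> ball p s" "\<And>x. x \<notin> K \<Longrightarrow> b x = 0" by (metis b(1)
        test_functionsE)
    have KU: "K \<subseteq> U" using K(2) s by auto
    have pf: "partial i f x = k e x * partial i b x + m e x * G x $ i * b x" if "x \<in> U" for i x
      unfolding f_def using partial_mult[OF k_diff[OF that] test_functions_differentiable[OF b(1)],
          of i e]
        k_partial[OF that] by simp
    have df: "f differentiable (at x)" if "x \<in> U" for x
      unfolding f_def by (intro differentiable_mult k_diff that test_functions_differentiable[OF
          b(1)])
    have cf: "continuous_on U (partial i f)" for i
    proof (rule continuous_on_eq)
      show "continuous_on U (\<lambda>x. k e x * partial i b x + m e x * G x $ i * b x)"
        by (intro continuous_intros ck cm cGi continuous_test_function[OF b(1)]
            continuous_test_function[OF test_functions_partial[OF b(1)]])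
    qed (use pf in auto)
    have z: "f x = 0" if "x \<notin> K" for x using K(3)[OF that] by (simp add: f_def)
    note I = integral_partial_eq_0_open[OF U(1) K(1) KU df cf z]
    have Ii: "integrable lborel (partial i f)" for i
      using integrable_compact_support[OF I(2) K(1) I(3)] .
    have eq: "g0 $ 1 * partial 1 f x + g0 $ 2 * partial 2 f x
        = k e x * directional (\<lambda>_. g0) b x + m e x * b x * (G x \<bullet> g0)" for x
    proof (cases "x \<in> U")
      case True
      then show ?thesis unfolding pf[OF True] directional_def inner_vec_def sum_2 by (simp add:
          algebra_simps)
    next
      case False
      then have "x \<notin> K" "x \<notin> ball p s" using KU s by auto
      then show ?thesis using I(3)[of x] bs pbs by (simp add: directional_def)
    qed
    have kd: "\<bar>\<integral>x. k e x * directional (\<lambda>_. g0) b x \<partial>lborel\<bar> \<le> C0"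
      unfolding C0_def
    proof (rule integral_bounded_ball)
      show "\<bar>k e x * directional (\<lambda>_. g0) b x\<bar> \<le> Cb" for x
        unfolding abs_mult using H(4,5) mult_mono[of "\<bar>k e x\<bar>" 1 "\<bar>directional (\<lambda>_. g0) b x\<bar>" Cb] Cb
            by (simp add: k_def)
      show "k e x * directional (\<lambda>_. g0) b x = 0" if "norm x > norm p + s" for x
      proof -
        have "x \<notin> ball p s" using that norm_triangle_ineq2[of x p] by (auto simp: dist_norm
            norm_minus_commute)
        then show ?thesis using pbs by (simp add: directional_def)
      qed
    qed (use Cb in simp)
    have ik: "integrable lborel (\<lambda>x. k e x * directional (\<lambda>_. g0) b x)"
    proof -
      have t: "directional (\<lambda>_. g0) b \<in> test_functions (ball p s)"
        unfolding directional_def by (intro test_functions_add test_functions_cmult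
            test_functions_partial b)
      obtain L where L: "compact L" "L \<subseteq> ball p s" "\<And>x. x \<notin> L \<Longrightarrow> directional (\<lambda>_. g0) b x = 0" by
          (metis t test_functionsE)
      have "continuous_on U (\<lambda>x. k e x * directional (\<lambda>_. g0) b x)"
        by (intro continuous_intros ck continuous_test_function[OF t])
      then show ?thesis
        by (rule integrable_compact_support_within[OF _ L(1)]) (use L s in auto)
    qed
    have i2: "integrable lborel (\<lambda>x. g0 $ 1 * partial 1 f x + g0 $ 2 * partial 2 f x - k e x *
        directional (\<lambda>_. g0) b x)"
      using Ii ik by simp
    then have imG: "integrable lborel (\<lambda>x. m e x * b x * (G x \<bullet> g0))" unfolding eq by simp
    have "(\<integral>x. g0 $ 1 * partial 1 f x + g0 $ 2 * partial 2 f x \<partial>lborel) = 0"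
      using Ii I(1) by simp
    then have "(\<integral>x. k e x * directional (\<lambda>_. g0) b x \<partial>lborel) + (\<integral>x. m e x * b x * (G x \<bullet> g0)
        \<partial>lborel) = 0"
      unfolding eq using ik imG by simp
    then have up: "(\<integral>x. - (m e x * b x * (G x \<bullet> g0)) \<partial>lborel) \<le> C0" using kd by simp
    have "(g0 \<bullet> g0 / 2) * (\<integral>x. - m e x * b x \<partial>lborel) = (\<integral>x. (g0 \<bullet> g0 / 2) * (- m e x * b x)
        \<partial>lborel)" by simp
    also have "\<dots> \<le> (\<integral>x. - (m e x * b x * (G x \<bullet> g0)) \<partial>lborel)"
    proof (rule integral_mono)
      show "integrable lborel (\<lambda>x. (g0 \<bullet> g0 / 2) * (- m e x * b x))" using mass_int[of e] by simp
      show "integrable lborel (\<lambda>x. - (m e x * b x * (G x \<bullet> g0)))" using imG by simp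
      fix x
      show "(g0 \<bullet> g0 / 2) * (- m e x * b x) \<le> - (m e x * b x * (G x \<bullet> g0))"
      proof (cases "x \<in> ball p s")
        case True
        then have "x \<in> U'" using s by auto
        then have "g0 \<bullet> g0 / 2 \<le> G x \<bullet> g0" using U'(3) by (intro less_imp_le)
        moreover have "0 \<le> - m e x * b x" using m_nonpos[OF e] b(2) by (simp add:
            mult_nonpos_nonneg)
        ultimately have "(- m e x * b x) * (g0 \<bullet> g0 / 2) \<le> (- m e x * b x) * (G x \<bullet> g0)" by (rule
            mult_left_mono)
        then show ?thesis by (simp add: mult_ac)
      qed (simp add: bs)
    qed
    finally show ?thesis using up g0 by (simp add: C1_def field_simps)
  qed
  have clU: "x \<in> frontier \<Omega>" if "x \<in> closure \<Omega>" "x \<notin> \<Omega>" for x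
    using that \<Omega> by (simp add: frontier_def interior_open)
  have "compact (closure \<Omega>)" using \<Omega> by simp
  then have "bounded (V ` closure \<Omega>)" using V(1) by (intro compact_imp_bounded
      compact_continuous_image)
  then obtain Bv where Bv: "Bv > 0" "\<And>x. x \<in> closure \<Omega> \<Longrightarrow> norm (V x) \<le> Bv" unfolding bounded_pos by
      auto
  have Bvi: "\<bar>v x $ i\<bar> \<le> Bv" if "x \<in> \<Omega>" for x i
  proof -
    have "x \<in> closure \<Omega>" using that closure_subset[of \<Omega>] by blast
    then show ?thesis using Bv(2)[of x] V(2)[OF that] component_le_norm_cart[of "v x" i] by simp
  qed
  show ?thesis
  proof (intro exI[of _ r] conjI ballI r)
    fix w assume w: "w \<in> test_functions (ball p r)"
    have wt: "w \<in> test_functions UNIV" using w by (rule test_functions_mono) simp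
    obtain S where S: "compact S" "S \<subseteq> ball p r" "\<And>x. x \<notin> S \<Longrightarrow> w x = 0" by (metis w test_functionsE)
    have "ball p r \<subseteq> ball p s" using r by auto
    then have SU: "S \<subseteq> U" using S(2) s(2) by blast
    have pw: "partial i w x = 0" if "x \<notin> S" for i x
      by (rule partial_eq_0_off[OF compact_imp_closed[OF S(1)] S(3) that])
    obtain Bw where Bw: "Bw > 0" "\<And>x. \<bar>w x\<bar> \<le> Bw" by (metis test_function_bounded[OF w])
    have wb: "\<bar>w x\<bar> \<le> Bw * b x" for x
      using Bw b(2,3)[of x] S(2,3) by (cases "x \<in> S") (force, simp)
    define I where "I = (\<integral>x. indicat_real \<Omega> x * directional v w x \<partial>lborel)"
    have iv: "integrable lborel (\<lambda>x. indicat_real \<Omega> x * (v x $ i * partial i w x))" for i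
      using \<Omega>(1) smooth_on_continuous_on[OF sm] Bvi test_functions_partial[OF wt]
      by (intro integrable_indicator_mult[where B = Bv]) auto
    have ivd: "integrable lborel (\<lambda>x. indicat_real \<Omega> x * directional v w x)"
      unfolding directional_def distrib_left using iv by simp
    have identity: "(\<integral>x. k e x * directional v w x \<partial>lborel) = - (\<integral>x. w x * m e x * (v x \<bullet> G x)
        \<partial>lborel)"
        "integrable lborel (\<lambda>x. k e x * directional v w x)" "integrable lborel (\<lambda>x. w x * m e x * (v
            x \<bullet> G x))" if e: "e > 0" for e
    proof -
      \<comment> \<open>The cutoff and its derivative vanish for \<rho> >= -e, so the products below
        are supported in this compact subset of \<Omega>, where \<open>v\<close> is smooth.\<close>
      define K where "K = S \<inter> \<rho> -` {..- e}"
      have "closed K" unfolding K_def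
        by (rule continuous_closed_preimage[OF continuous_on_subset[OF c\<rho> SU] compact_imp_closed[OF
            S(1)] closed_atMost])
      then have K: "compact K" using S(1) by (metis K_def compact_Int_closed inf.absorb_iff1
          inf.cobounded1 inf_commute)
      have neg: "x \<in> \<Omega> \<inter> U" if "x \<in> K" for x unfolding \<Omega>U using that e SU by (auto simp: K_def)
      have koff: "k e x = 0" "m e x = 0" if "x \<in> S" "x \<notin> K" for x
      proof -
        have "\<rho> x / e \<ge> - 1" using that e by (simp add: K_def field_simps)
        then show "k e x = 0" "m e x = 0" using H(7,9) by (auto simp: k_def m_def)
      qed
      define f where "f i x = v x $ i * k e x * w x" for i x
      have O: "open (\<Omega> \<inter> U)" using \<Omega> U by blast
      have pf: "partial i (f i) x = (v x $ i * k e x) * partial i w x + (v x $ i * (m e x * G x $ i)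
          + partial i (\<lambda>x. v x $ i) x * k e x) * w x"
        and df: "f i differentiable (at x)" if "x \<in> \<Omega> \<inter> U" for i x
      proof -
        have dv: "(\<lambda>x. v x $ i) differentiable (at x)" using sm that by (intro
            smooth_on_differentiable) auto
        have dk: "k e differentiable (at x)" using that by (intro k_diff) auto
        have dw: "w differentiable (at x)" by (rule test_functions_differentiable[OF w])
        have dvk: "(\<lambda>x. v x $ i * k e x) differentiable (at x)" by (rule differentiable_mult[OF dv
            dk])
        show "f i differentiable (at x)" unfolding f_def by (rule differentiable_mult[OF dvk dw])
        show "partial i (f i) x = (v x $ i * k e x) * partial i w x + (v x $ i * (m e x * G x $ i) +
            partial i (\<lambda>x. v x $ i) x * k e x) * w x"
          unfolding f_def partial_mult[OF dvk dw] partial_mult[OF dv dk] using k_partial that by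
              simp
      qed
      have cv: "continuous_on (\<Omega> \<inter> U) (\<lambda>x. v x $ i)" "continuous_on (\<Omega> \<inter> U) (partial i (\<lambda>x. v x $
          i))" for i
        using smooth_on_continuous_on[OF sm] smooth_on_continuous_on[OF smooth_on_partial[OF sm]]
        by (auto intro: continuous_on_subset)
      have cf: "continuous_on (\<Omega> \<inter> U) (partial i (f i))" for i
      proof (rule continuous_on_eq)
        show "continuous_on (\<Omega> \<inter> U) (\<lambda>x. (v x $ i * k e x) * partial i w x + (v x $ i * (m e x * G x
            $ i) + partial i (\<lambda>x. v x $ i) x * k e x) * w x)"
          by (intro continuous_intros cv continuous_on_subset[OF ck] continuous_on_subset[OF cm]
              continuous_on_subset[OF cGi]
              continuous_test_function[OF w] continuous_test_function[OF test_functions_partial[OF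
                  w]]) auto
      qed (use pf in auto)
      have z: "f i x = 0" if "x \<notin> K" for i x
        using koff[of x] S(3)[of x] that by (cases "x \<in> S") (auto simp: f_def)
      have KO: "K \<subseteq> \<Omega> \<inter> U" using neg by blast
      note J = integral_partial_eq_0_open[OF O K KO df cf z]
      have J3: "partial i (f i) x = 0" if "x \<notin> K" for i x by (rule J(3)) (use that in auto)
      have Ji: "integrable lborel (partial i (f i))" for i
        using integrable_compact_support[OF J(2) K J(3)] .
      have eq: "partial 1 (f 1) x + partial 2 (f 2) x = k e x * directional v w x + w x * m e x * (v
          x \<bullet> G x)" for x
      proof (cases "x \<in> K")
        case True
        then have x: "x \<in> \<Omega> \<inter> U" by (rule neg)
        have d: "partial 1 (\<lambda>x. v x $ 1) x = - partial 2 (\<lambda>x. v x $ 2) x" using div[of x] x by auto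
        show ?thesis unfolding pf[OF x] d directional_def inner_vec_def sum_2 by (simp add:
            algebra_simps)
      next
        case False
        have c: "k e x * directional v w x = 0 \<and> w x * m e x * (v x \<bullet> G x) = 0"
          using koff[of x] S(3)[of x] pw[of x] False by (cases "x \<in> S") (auto simp: directional_def)
        show ?thesis using J3[OF False] by (simp only: add_0_right conjunct1[OF c] conjunct2[OF c])
      qed
      have cd: "continuous_on (\<Omega> \<inter> U) (directional v w)"
        unfolding directional_def by (intro continuous_intros cv continuous_test_function[OF
            test_functions_partial[OF w]])
      have kz: "k e x * directional v w x = 0" if "x \<notin> K" for x
        using koff[of x] pw[of x] that by (cases "x \<in> S") (auto simp: directional_def)
      have "continuous_on (\<Omega> \<inter> U) (\<lambda>x. k e x * directional v w x)"
        by (intro continuous_intros cd continuous_on_subset[OF ck]) auto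
      then show ik: "integrable lborel (\<lambda>x. k e x * directional v w x)"
        by (rule integrable_compact_support_within[OF _ K KO kz])
      have "integrable lborel (\<lambda>x. partial 1 (f 1) x + partial 2 (f 2) x - k e x * directional v w
          x)" using Ji ik by simp
      then show im: "integrable lborel (\<lambda>x. w x * m e x * (v x \<bullet> G x))" unfolding eq by simp
      have "(\<integral>x. partial 1 (f 1) x + partial 2 (f 2) x \<partial>lborel) = 0" using Ji J(1) by simp
      then show "(\<integral>x. k e x * directional v w x \<partial>lborel) = - (\<integral>x. w x * m e x * (v x \<bullet> G x)
          \<partial>lborel)"
        unfolding eq using ik im by simp
    qed
    have small: "\<bar>I\<bar> \<le> \<eta> * (Bw * C1)" if \<eta>: "\<eta> > 0" for \<eta>
    proof -
      \<comment> \<open>The part of the closure where the normal component is not small. It is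
        compact and misses the boundary because \<open>V \<bullet> n\<close> vanishes there, so
        \<rho> has a negative upper bound on it, and the layer -2e < \<rho> < -e avoids it once e is
        small.\<close>
      define K2 where "K2 = (S \<inter> closure \<Omega>) \<inter> (\<lambda>x. \<bar>V x \<bullet> G x\<bar>) -` {\<eta>..}"
      have SC: "compact (S \<inter> closure \<Omega>)" using S(1) by (simp add: compact_Int_closed)
      have cVG: "continuous_on (S \<inter> closure \<Omega>) (\<lambda>x. \<bar>V x \<bullet> G x\<bar>)"
        by (intro continuous_intros continuous_on_subset[OF V(1)] continuous_on_subset[OF G(1)])
            (use SU in auto)
      have "closed K2" unfolding K2_def
        by (rule continuous_closed_preimage[OF cVG compact_imp_closed[OF SC] closed_atLeast])
      moreover have "K2 \<subseteq> S \<inter> closure \<Omega>" unfolding K2_def by blast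
      ultimately have K2: "compact K2" using SC by (metis compact_Int_closed inf.absorb_iff2)
      have neg: "\<rho> x < 0" if x: "x \<in> K2" for x
      proof -
        have xU: "x \<in> U" "x \<in> closure \<Omega>" using x SU by (auto simp: K2_def)
        have "x \<in> \<Omega>"
        proof (rule ccontr)
          assume "x \<notin> \<Omega>"
          then have fr: "x \<in> frontier \<Omega>" using clU xU by blast
          have "V x \<bullet> G x = norm (G x) * (V x \<bullet> n x)" by (subst Gn[OF fr xU(1)]) simp
          then have "V x \<bullet> G x = 0" using V(3)[OF fr] by simp
          then show False using x \<eta> by (simp add: K2_def)
        qed
        then have "x \<in> \<Omega> \<inter> U" using xU by simp
        then show ?thesis unfolding \<Omega>U by simp
      qed
      obtain e0 where e0: "e0 > 0" "\<And>x. x \<in> K2 \<Longrightarrow> \<rho> x \<le> - e0"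
      proof (cases "K2 = {}")
        case False
        obtain y where y: "y \<in> K2" "\<And>x. x \<in> K2 \<Longrightarrow> \<rho> x \<le> \<rho> y"
        proof -
          have "continuous_on K2 \<rho>" by (rule continuous_on_subset[OF c\<rho>]) (use SU in \<open>auto simp:
              K2_def\<close>)
          from continuous_attains_sup[OF K2 False this] show ?thesis using that by blast
        qed
        show ?thesis by (rule that[of "- \<rho> y"]) (use y neg in auto)
      qed (use that[of 1] in auto)
      have est: "\<bar>\<integral>x. k e x * directional v w x \<partial>lborel\<bar> \<le> \<eta> * (Bw * C1)" if e: "e > 0" "2 * e < e0"
          for e
      proof -
        have "\<bar>\<integral>x. k e x * directional v w x \<partial>lborel\<bar> \<le> (\<integral>x. \<bar>w x * m e x * (v x \<bullet> G x)\<bar> \<partial>lborel)"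
          unfolding identity(1)[OF e(1)] using integral_norm_bound[of lborel "\<lambda>x. w x * m e x * (v x
              \<bullet> G x)"] by simp
        also have "\<dots> \<le> (\<integral>x. (\<eta> * Bw) * (- m e x * b x) \<partial>lborel)"
        proof (rule integral_mono)
          show "integrable lborel (\<lambda>x. \<bar>w x * m e x * (v x \<bullet> G x)\<bar>)" using identity(3)[OF e(1)] by
              simp
          show "integrable lborel (\<lambda>x. (\<eta> * Bw) * (- m e x * b x))" using mass_int[of e] by simp
          fix x
          have nn: "- m e x * b x \<ge> 0" using m_nonpos[OF e(1)] b(2) by (simp add:
              mult_nonpos_nonneg)
          show "\<bar>w x * m e x * (v x \<bullet> G x)\<bar> \<le> (\<eta> * Bw) * (- m e x * b x)"
          proof (cases "w x = 0 \<or> m e x = 0")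
            case True
            then have "\<bar>w x * m e x * (v x \<bullet> G x)\<bar> = 0" by auto
            moreover have "0 \<le> (\<eta> * Bw) * (- m e x * b x)" by (rule mult_nonneg_nonneg[OF _ nn])
                (use \<eta> Bw(1) in simp)
            ultimately show ?thesis by linarith
          next
            case False
            then have xS: "x \<in> S" using S(3) by blast
            have "H' (\<rho> x / e) \<noteq> 0" using False by (simp add: m_def)
            then have rr: "- 2 < \<rho> x / e" "\<rho> x / e < - 1" using H(8,9) by (meson not_le)+
            then have rb: "\<rho> x > - 2 * e" "\<rho> x < 0" using e by (auto simp: field_simps)
            have x\<Omega>: "x \<in> \<Omega>"
            proof -
              have "x \<in> {x \<in> U. \<rho> x < 0}" using xS SU rb by auto
              then show ?thesis unfolding \<Omega>U[symmetric] by simp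
            qed
            have "x \<notin> K2" using e0(2)[of x] rb e by fastforce
            then have "\<bar>V x \<bullet> G x\<bar> < \<eta>" using xS x\<Omega> closure_subset[of \<Omega>] by (auto simp: K2_def)
            then have vg: "\<bar>v x \<bullet> G x\<bar> \<le> \<eta>" using V(2)[OF x\<Omega>] by simp
            have "\<bar>w x\<bar> * \<bar>m e x\<bar> \<le> (Bw * b x) * (- m e x)"
              using wb m_nonpos[OF e(1), of x] by (intro mult_mono) (use Bw b(2) in auto)
            moreover have "0 \<le> (Bw * b x) * (- m e x)"
              using Bw(1) b(2)[of x] m_nonpos[OF e(1), of x] by (intro mult_nonneg_nonneg) auto
            ultimately have "(\<bar>w x\<bar> * \<bar>m e x\<bar>) * \<bar>v x \<bullet> G x\<bar> \<le> ((Bw * b x) * (- m e x)) * \<eta>"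
              by (rule mult_mono[OF _ vg _ abs_ge_zero])
            then show ?thesis by (simp add: abs_mult mult_ac)
          qed
        qed
        also have "\<dots> = (\<eta> * Bw) * (\<integral>x. - m e x * b x \<partial>lborel)" by simp
        also have "\<dots> \<le> (\<eta> * Bw) * C1" using mass[OF e(1)] \<eta> Bw(1) by (intro mult_left_mono) auto
        finally show ?thesis by (simp add: mult.assoc)
      qed
      \<comment> \<open>As e tends to 0 the cutoff tends to the indicator of \<Omega> on the support
        of \<open>w\<close>, so the uniform smallness passes to \<open>I\<close>.\<close>
      have "(\<lambda>j. \<integral>x. k (1 / Suc j) x * directional v w x \<partial>lborel) \<longlonglongrightarrow> I"
        unfolding I_def
      proof (rule integral_dominated_convergence)
        show "(\<lambda>x. indicat_real \<Omega> x * directional v w x) \<in> borel_measurable lborel" using ivd by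
            simp
        show "(\<lambda>x. k (1 / Suc j) x * directional v w x) \<in> borel_measurable lborel" for j
          using identity(2)[of "1 / Suc j"] by simp
        show "integrable lborel (\<lambda>x. \<bar>indicat_real \<Omega> x * directional v w x\<bar>)" using ivd by simp
        have outside: "k e x * directional v w x = 0" if "x \<notin> \<Omega>" "e > 0" for x e
        proof (cases "x \<in> S")
          case True
          then have "x \<in> U" "\<not> \<rho> x < 0" using SU \<Omega>U that by auto
          then have "\<rho> x / e \<ge> 0" using that by simp
          then show ?thesis using H(7)[of "\<rho> x / e"] by (simp add: k_def)
        qed (simp add: directional_def pw)
        show "AE x in lborel. (\<lambda>j. k (1 / Suc j) x * directional v w x) \<longlonglongrightarrow> indicat_real \<Omega> x *
            directional v w x"
        proof (intro AE_I2)
          fix x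
          show "(\<lambda>j. k (1 / Suc j) x * directional v w x) \<longlonglongrightarrow> indicat_real \<Omega> x * directional v w x"
          proof (cases "x \<in> \<Omega> \<and> x \<in> S")
            case True
            then have neg: "\<rho> x < 0" using SU \<Omega>U by auto
            obtain N :: nat where N: "2 / (- \<rho> x) < real N" using reals_Archimedean2 by blast
            have "k (1 / Suc j) x = 1" if "j \<ge> N" for j
            proof -
              have "2 < real N * (- \<rho> x)" using N neg by (simp add: field_simps)
              also have "\<dots> \<le> real (Suc j) * (- \<rho> x)" using neg that by (intro mult_right_mono) auto
              finally have "\<rho> x / (1 / real (Suc j)) \<le> -2" by (simp add: mult.commute)
              then show ?thesis unfolding k_def by (rule H(6))
            qed
            then have "\<forall>\<^sub>F j in sequentially. indicat_real \<Omega> x * directional v w x = k (1 / Suc j) x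
                * directional v w x"
              using True by (auto simp: eventually_sequentially)
            then show ?thesis by (rule Lim_transform_eventually[OF tendsto_const])
          next
            case False
            then have c: "k (1 / Suc j) x * directional v w x = 0 \<and> indicat_real \<Omega> x * directional v
                w x = 0" for j
              using outside[of x "1 / Suc j"] pw[of x] by (cases "x \<in> \<Omega>") (auto simp:
                  directional_def)
            show ?thesis by (simp only: conjunct1[OF c] conjunct2[OF c] tendsto_const)
          qed
        qed
        show "AE x in lborel. norm (k (1 / Suc j) x * directional v w x) \<le> \<bar>indicat_real \<Omega> x *
            directional v w x\<bar>" for j
        proof (intro AE_I2)
          fix x
          show "norm (k (1 / Suc j) x * directional v w x) \<le> \<bar>indicat_real \<Omega> x * directional v w x\<bar>"
          proof (cases "x \<in> \<Omega>")
            case True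
            have "\<bar>k (1 / Suc j) x\<bar> \<le> 1" using H(4,5) by (simp add: k_def)
            then show ?thesis using True mult_right_mono[of "\<bar>k (1 / Suc j) x\<bar>" 1 "\<bar>directional v w
                x\<bar>"] by (simp add: abs_mult)
          qed (use outside[of x "1 / Suc j"] in simp)
        qed
      qed
      then have lim: "(\<lambda>j. \<bar>\<integral>x. k (1 / Suc j) x * directional v w x \<partial>lborel\<bar>) \<longlonglongrightarrow> \<bar>I\<bar>" by (rule
          tendsto_rabs)
      obtain N :: nat where N: "2 / e0 < real N" using reals_Archimedean2 by blast
      show ?thesis
      proof (rule LIMSEQ_le_const2[OF lim], intro exI[of _ N] allI impI)
        fix j assume j: "j \<ge> N"
        have "2 < real N * e0" using N e0(1) by (simp add: field_simps)
        also have "\<dots> \<le> real (Suc j) * e0" using e0(1) j by (intro mult_right_mono) auto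
        finally have "2 * (1 / real (Suc j)) < e0" by (simp add: field_simps)
        then show "\<bar>\<integral>x. k (1 / Suc j) x * directional v w x \<partial>lborel\<bar> \<le> \<eta> * (Bw * C1)" by (intro est)
            auto
      qed
    qed
    have "((\<lambda>\<eta>. \<eta> * (Bw * C1)) \<longlongrightarrow> 0 * (Bw * C1)) (at_right 0)" by (intro tendsto_intros)
    then have "\<bar>I\<bar> \<le> 0 * (Bw * C1)"
      by (rule tendsto_lowerbound) (auto simp: eventually_at_filter small)
    then show "(\<integral>x. indicat_real \<Omega> x * directional v w x \<partial>lborel) = 0" by (simp add: I_def)
  qed
qed

text \<open>In place of a partition of unity, \<open>w\<close> is multiplied successively by 1 - b_p
  over a finite cover of the closure. Each step removes a function supported in a small ball, on
  which the integral vanishes by the local result, and the final product is 0 throughout the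
  cover.\<close>

lemma weak_divergence:
  assumes \<Omega>: "open \<Omega>" "bounded \<Omega>" and n: "outward_unit_normal \<Omega> n"
    and sm: "\<And>i. smooth_on \<Omega> (\<lambda>x. v x $ i)"
    and div: "\<And>x. x \<in> \<Omega> \<Longrightarrow> partial 1 (\<lambda>x. v x $ 1) x + partial 2 (\<lambda>x. v x $ 2) x = 0"
    and V: "continuous_on (closure \<Omega>) V" "\<And>x. x \<in> \<Omega> \<Longrightarrow> V x = v x" "\<And>q. q \<in> frontier \<Omega> \<Longrightarrow> V q \<bullet> n q =
        0"
    and w: "w \<in> test_functions UNIV"
  shows "(\<integral>x. indicat_real \<Omega> x * directional v w x \<partial>lborel) = 0"
proof -
  define I where "I w = (\<integral>x. indicat_real \<Omega> x * directional v w x \<partial>lborel)" for w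
  have C: "compact (closure \<Omega>)" using \<Omega> by simp
  then have "bounded (V ` closure \<Omega>)" using V(1) by (intro compact_imp_bounded
      compact_continuous_image)
  then obtain B where B: "\<And>x. x \<in> closure \<Omega> \<Longrightarrow> norm (V x) \<le> B" unfolding bounded_pos by auto
  have Bi: "\<bar>v x $ i\<bar> \<le> B" if "x \<in> \<Omega>" for x i
  proof -
    have "x \<in> closure \<Omega>" using that closure_subset[of \<Omega>] by blast
    then show ?thesis using B[of x] V(2)[OF that] component_le_norm_cart[of "v x" i] by simp
  qed
  have iv: "integrable lborel (\<lambda>x. indicat_real \<Omega> x * (v x $ i * partial i w x))" if "w \<in>
      test_functions UNIV" for i w
    using \<Omega>(1) smooth_on_continuous_on[OF sm] Bi test_functions_partial[OF that]
    by (intro integrable_indicator_mult[where B = B]) auto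
  have I_add: "I (\<lambda>x. f x + g x) = I f + I g" if "f \<in> test_functions UNIV" "g \<in> test_functions UNIV"
      for f g
  proof -
    have "indicat_real \<Omega> x * directional v (\<lambda>x. f x + g x) x = indicat_real \<Omega> x * directional v f x
        + indicat_real \<Omega> x * directional v g x" for x
      unfolding directional_def
      using partial_add[OF test_functions_differentiable[OF that(1)]
          test_functions_differentiable[OF that(2)]]
      by (simp add: algebra_simps)
    moreover have "integrable lborel (\<lambda>x. indicat_real \<Omega> x * directional v f x)" if "f \<in>
        test_functions UNIV" for f
      unfolding directional_def distrib_left using iv[OF that] by simp
    ultimately show ?thesis unfolding I_def using that by simp
  qed
  have loc: "\<exists>r>0. \<forall>w\<in>test_functions (ball p r). I w = 0" if p: "p \<in> closure \<Omega>" for p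
  proof (cases "p \<in> \<Omega>")
    case True
    then obtain r where r: "r > 0" "ball p r \<subseteq> \<Omega>" using \<Omega>(1) openE by blast
    have "I w = 0" if w: "w \<in> test_functions (ball p r)" for w
    proof -
      have w\<Omega>: "w \<in> test_functions \<Omega>" using w r(2) by (rule test_functions_mono)
      have "indicat_real \<Omega> x * directional v w x = v x $ 1 * partial 1 w x + v x $ 2 * partial 2 w
          x" for x
        using test_functions_eq_0[OF test_functions_partial[OF w\<Omega>], of x]
        by (cases "x \<in> \<Omega>") (auto simp: directional_def)
      then have "I w = (\<integral>x. v x $ 1 * partial 1 w x + v x $ 2 * partial 2 w x \<partial>lborel)" by (simp
          add: I_def)
      also have "\<dots> = (\<integral>x. v x $ 1 * partial 1 w x \<partial>lborel) + (\<integral>x. v x $ 2 * partial 2 w x \<partial>lborel)"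
        by (intro Bochner_Integration.integral_add test_functions_integrable[where U = \<Omega>]
            test_functions_mult \<Omega> sm test_functions_partial w\<Omega>)
      also have "\<dots> = - ((\<integral>x. partial 1 (\<lambda>x. v x $ 1) x * w x \<partial>lborel) + (\<integral>x. partial 2 (\<lambda>x. v x $ 2)
          x * w x \<partial>lborel))"
        using integral_by_parts[OF \<Omega>(1) sm w\<Omega>] by simp
      also have "\<dots> = - (\<integral>x. partial 1 (\<lambda>x. v x $ 1) x * w x + partial 2 (\<lambda>x. v x $ 2) x * w x
          \<partial>lborel)"
        by (subst Bochner_Integration.integral_add)
           (intro refl test_functions_integrable[where U = \<Omega>] test_functions_mult \<Omega>
               smooth_on_partial sm w\<Omega>)+
      also have "\<dots> = 0"
      proof -
        have "partial 1 (\<lambda>x. v x $ 1) x * w x + partial 2 (\<lambda>x. v x $ 2) x * w x = 0" for x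
          using div[of x] test_functions_eq_0[OF w\<Omega>, of x] by (cases "x \<in> \<Omega>") (auto simp:
              distrib_right[symmetric])
        then show ?thesis by simp
      qed
      finally show ?thesis .
    qed
    then show ?thesis using r(1) by blast
  next
    case False
    then have "p \<in> frontier \<Omega>" using p \<Omega> by (simp add: frontier_def interior_open)
    from weak_divergence_boundary_local[OF \<Omega> n this sm div V] show ?thesis unfolding I_def by blast
  qed
  then obtain r where r: "\<And>p. p \<in> closure \<Omega> \<Longrightarrow> r p > 0"
    "\<And>p w. p \<in> closure \<Omega> \<Longrightarrow> w \<in> test_functions (ball p (r p)) \<Longrightarrow> I w = 0" by metis
  have "\<exists>b\<in>test_functions (ball p (r p)). \<forall>x\<in>ball p (r p / 2). b x = 1" if "p \<in> closure \<Omega>" for p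
    using ex_bump[of "r p / 2" "r p" p] r(1)[OF that] by auto
  then obtain b where b: "\<And>p. p \<in> closure \<Omega> \<Longrightarrow> b p \<in> test_functions (ball p (r p))"
    "\<And>p x. p \<in> closure \<Omega> \<Longrightarrow> x \<in> ball p (r p / 2) \<Longrightarrow> b p x = 1" by metis
  have "closure \<Omega> \<subseteq> (\<Union>p\<in>closure \<Omega>. ball p (r p / 2))" using r(1) by force
  then obtain P where P: "P \<subseteq> closure \<Omega>" "finite P" "closure \<Omega> \<subseteq> (\<Union>p\<in>P. ball p (r p / 2))"
    using compactE_image[OF C, of "closure \<Omega>" "\<lambda>p. ball p (r p / 2)"] by auto
  define w' where "w' Q x = (\<Prod>p\<in>Q. 1 - b p x) * w x" for Q x
  have red: "w' Q \<in> test_functions UNIV \<and> I (w' Q) = I w" if "finite Q" "Q \<subseteq> closure \<Omega>" for Q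
    using that
  proof (induction Q rule: finite_induct)
    case empty
    then show ?case using w by (simp add: w'_def)
  next
    case (insert p Q)
    then have IH: "w' Q \<in> test_functions UNIV" "I (w' Q) = I w" and p: "p \<in> closure \<Omega>" by auto
    have 1: "(\<lambda>x. w' Q x * b p x) \<in> test_functions (ball p (r p))"
      by (intro test_functions_mult open_ball b p test_functions_smooth[OF IH(1)])
    have k1': "(\<lambda>x. w' Q x * b p x) \<in> test_functions UNIV" using 1 by (rule test_functions_mono)
        simp
    have e: "w' (insert p Q) = (\<lambda>x. (1 - b p x) * w' Q x)"
      using insert.hyps by (auto simp: w'_def)
    have 2: "w' (insert p Q) \<in> test_functions UNIV"
      unfolding e by (intro test_functions_mult open_UNIV IH smooth_on_diff smooth_on_const
          test_functions_smooth[OF b(1)[OF p]])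
    have "w' Q = (\<lambda>x. w' Q x * b p x + w' (insert p Q) x)" unfolding e by (simp add: algebra_simps)
    then have "I (w' Q) = I (\<lambda>x. w' Q x * b p x) + I (w' (insert p Q))" using I_add[OF k1' 2] by
        simp
    then show ?case using 2 r(2)[OF p 1] IH by simp
  qed
  have fin: "w' P \<in> test_functions UNIV" "I (w' P) = I w" using red[OF P(2,1)] by auto
  define Q where "Q = (\<Union>p\<in>P. ball p (r p / 2))"
  have "w' P x = 0" if x: "x \<in> Q" for x
  proof -
    obtain p where p: "p \<in> P" "x \<in> ball p (r p / 2)" using x by (auto simp: Q_def)
    then have "1 - b p x = 0" using b(2)[of p x] P(1) by auto
    then have "(\<Prod>p\<in>P. 1 - b p x) = 0" using p P(2) by (auto simp: prod_zero_iff)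
    then show ?thesis by (simp add: w'_def)
  qed
  moreover have "open Q" by (auto simp: Q_def)
  ultimately have "partial i (w' P) x = 0" if "x \<in> Q" for i x
    using partial_cong_open[of Q x "w' P" "\<lambda>x. 0"] that by simp
  then have z: "indicat_real \<Omega> x * directional v (w' P) x = 0" for x
    using P(3) closure_subset[of \<Omega>] by (cases "x \<in> \<Omega>") (auto simp: directional_def Q_def subset_iff)
  have "I (w' P) = 0" by (simp only: I_def z Bochner_Integration.integral_zero)
  then show ?thesis using fin by (simp add: I_def)
qed

section \<open>The exterior of the domain\<close>

text \<open>For bounded open sets of complex numbers the library characterizes simple connectedness
  through the complement; the coordinate homeomorphism transfers this to
  \<open>real^2\<close>.\<close>

lemma connected_complement:
  fixes \<Omega> :: "(real^2) set"
  assumes "open \<Omega>" "bounded \<Omega>" "simply_connected \<Omega>"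
  shows "connected (- \<Omega>)"
proof -
  define f where "f x = Complex (x $ 1) (x $ 2)" for x :: "real^2"
  define g where "g z = (vector [Re z, Im z] :: real^2)" for z
  have gf: "g (f x) = x" for x by (simp add: f_def g_def vec_eq_iff forall_2)
  have fg: "f (g z) = z" for z by (simp add: f_def g_def)
  have cf: "continuous_on S f" for S unfolding f_def by (intro continuous_intros)
  have cg: "continuous_on S g" for S
  proof -
    have "g = (\<lambda>z. Re z *\<^sub>R axis 1 1 + Im z *\<^sub>R axis 2 1)"
      by (auto simp: g_def fun_eq_iff vec_eq_iff forall_2 axis_def)
    then show ?thesis by (simp add: continuous_intros)
  qed
  have hom: "homeomorphism S (f ` S) f g" for S
    by (rule homeomorphismI) (use cf cg gf fg in auto)
  have vim: "f ` S = g -` S" for S by (auto simp: gf) (metis fg imageI)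
  have op: "open (f ` \<Omega>)"
    unfolding vim using assms(1) cg[of UNIV] by (simp add: open_vimage continuous_on_open_vimage)
  have bd: "bounded (f ` \<Omega>)"
  proof -
    have "compact (f ` closure \<Omega>)" using assms(2) cf by (intro compact_continuous_image) auto
    then show ?thesis by (meson bounded_subset closure_subset compact_imp_bounded image_mono)
  qed
  have "simply_connected (f ` \<Omega>)"
    using assms(3) hom[of \<Omega>] homeomorphic_simply_connected_eq homeomorphic_def by blast
  then have "connected (- f ` \<Omega>)" using simply_connected_iff_simple[OF op bd] by blast
  then have "connected (g ` (- f ` \<Omega>))" using cg by (rule connected_continuous_image[rotated])
  moreover have "g ` (- f ` \<Omega>) = - \<Omega>"
    unfolding vim vimage_Compl[symmetric] by (rule surj_image_vimage_eq[OF surjI[of g f, OF gf]])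
  ultimately show ?thesis by simp
qed

text \<open>Near \<open>p\<close> the exterior is the set where the defining function is positive.
  Each such point is joined to the common point \<open>z\<close> by two segments: first a shift by
  r/2 along the normal direction, then a nearly tangential move at that height. Both stay in the
  exterior, so \<open>N\<close>, the union of these paths, is connected.\<close>

lemma exterior_near_boundary:
  assumes \<Omega>: "open \<Omega>" and n: "outward_unit_normal \<Omega> n" and p: "p \<in> frontier \<Omega>"
  shows "\<exists>N d. d > 0 \<and> connected N \<and> N \<subseteq> - closure \<Omega> \<and> ball p d - closure \<Omega> \<subseteq> N \<and> p \<in> closure N"
proof -
  obtain U \<rho> G where U: "open U" "p \<in> U" and \<rho>: "\<And>x. x \<in> U \<Longrightarrow> (\<rho> has_derivative (\<lambda>h. G x \<bullet> h)) (at
      x)"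
    and G: "continuous_on U G" "\<And>x. x \<in> U \<Longrightarrow> G x \<noteq> 0" and \<Omega>U: "\<Omega> \<inter> U = {x \<in> U. \<rho> x < (0::real)}"
    and "\<And>x. x \<in> frontier \<Omega> \<Longrightarrow> x \<in> U \<Longrightarrow> G x = norm (G x) *\<^sub>R n x"
    and \<rho>0: "\<And>x. x \<in> frontier \<Omega> \<Longrightarrow> x \<in> U \<Longrightarrow> \<rho> x = 0"
    using local_defining_function[OF \<Omega> n p] by blast
  have c\<rho>: "continuous_on U \<rho>"
    using \<rho> by (meson continuous_at_imp_continuous_on has_derivative_continuous)
  define \<gamma> where "\<gamma> = norm (G p)"
  have \<gamma>: "\<gamma> > 0" using G(2)[OF U(2)] by (simp add: \<gamma>_def)
  define \<nu> where "\<nu> = G p /\<^sub>R \<gamma>"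
  have \<nu>: "norm \<nu> = 1" "G p \<bullet> \<nu> = \<gamma>" using \<gamma> by (simp_all add: \<nu>_def \<gamma>_def dot_square_norm
      power2_eq_square)
  have "isCont G p" using G(1) U by (simp add: continuous_on_eq_continuous_at)
  then obtain r1 where r1: "r1 > 0" "\<And>x. dist x p < r1 \<Longrightarrow> dist (G x) (G p) < \<gamma> / 4"
    unfolding continuous_at_eps_delta using \<gamma> by (metis zero_less_divide_iff zero_less_numeral)
  obtain r2 where r2: "r2 > 0" "ball p r2 \<subseteq> U" using U openE by blast
  define r where "r = min r1 r2"
  have r: "r > 0" "ball p r \<subseteq> U" using r1 r2 by (auto simp: r_def)
  have Gn: "norm (G x - G p) \<le> \<gamma> / 4" if "x \<in> ball p r" for x
    using r1(2)[of x] that by (simp add: dist_norm norm_minus_commute r_def)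
  have inc: "\<rho> y \<ge> \<rho> x + G p \<bullet> (y - x) - \<gamma> / 4 * norm (y - x)" if x: "x \<in> ball p r" and y: "y \<in> ball
      p r" for x y
  proof -
    have "norm (\<rho> y - \<rho> x - G p \<bullet> (y - x)) \<le> norm (y - x) * (\<gamma> / 4)"
    proof (rule differentiable_bound_linearization[where f' = "\<lambda>x h. G x \<bullet> h" and ?x0.0 = p and S =
        "ball p r"])
      show "x + t *\<^sub>R (y - x) \<in> ball p r" if "t \<in> {0..1}" for t
      proof -
        have "(1 - t) *\<^sub>R x + t *\<^sub>R y \<in> ball p r"
          using convexD[OF convex_ball x y, of "1 - t" t] that by auto
        then show ?thesis by (simp add: algebra_simps)
      qed
      show "(\<rho> has_derivative (\<lambda>h. G z \<bullet> h)) (at z within ball p r)" if "z \<in> ball p r" for z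
        by (rule has_derivative_at_withinI[OF \<rho>]) (use r(2) that in blast)
      show "onorm ((\<lambda>h. G z \<bullet> h) - (\<lambda>h. G p \<bullet> h)) \<le> \<gamma> / 4" if "z \<in> ball p r" for z
      proof (rule onorm_le)
        fix h
        have "((\<lambda>h. G z \<bullet> h) - (\<lambda>h. G p \<bullet> h)) h = (G z - G p) \<bullet> h" by (simp add: inner_diff_left)
        also have "norm \<dots> \<le> norm (G z - G p) * norm h" using Cauchy_Schwarz_ineq2[of "G z - G p" h]
            by simp
        also have "\<dots> \<le> \<gamma> / 4 * norm h" using Gn[OF that] by (intro mult_right_mono) auto
        finally show "norm (((\<lambda>h. G z \<bullet> h) - (\<lambda>h. G p \<bullet> h)) h) \<le> \<gamma> / 4 * norm h" .
      qed
      show "p \<in> ball p r" using r by simp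
    qed
    then have "\<rho> y - \<rho> x - G p \<bullet> (y - x) \<ge> - (norm (y - x) * (\<gamma> / 4))" unfolding real_norm_def by
        linarith
    then show ?thesis by (simp add: mult.commute)
  qed
  have up: "\<rho> (x + t *\<^sub>R \<nu>) \<ge> \<rho> x + 3 / 4 * \<gamma> * t" if "x \<in> ball p r" "x + t *\<^sub>R \<nu> \<in> ball p r" "t \<ge>
      0" for x t
    using inc[OF that(1,2)] that(3) \<nu> by (simp add: algebra_simps)
  have ext: "x \<in> - closure \<Omega> \<longleftrightarrow> \<rho> x > 0" if x: "x \<in> ball p r" for x
  proof
    have xU: "x \<in> U" using x r by blast
    assume "x \<in> - closure \<Omega>"
    then have xc: "x \<notin> closure \<Omega>" "x \<notin> \<Omega>" using closure_subset by auto
    then have "\<not> \<rho> x < 0" using xU \<Omega>U by blast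
    moreover have "\<rho> x \<noteq> 0"
    proof
      assume z: "\<rho> x = 0"
      have "open (ball p r \<inter> - closure \<Omega>)" by (intro open_Int open_Compl) auto
      moreover have "x \<in> ball p r \<inter> - closure \<Omega>" using x xc by blast
      ultimately obtain e where e: "e > 0" "ball x e \<subseteq> ball p r \<inter> - closure \<Omega>" by (rule openE)
      \<comment> \<open>From an exterior zero of \<rho>, a small step against \<open>\<nu>\<close>
        would land in \<Omega>.\<close>
      define y where "y = x + (- e / 2) *\<^sub>R \<nu>"
      have y: "y \<in> ball x e" using e \<nu> by (simp add: y_def dist_norm)
      have yr: "y \<in> ball p r" using y e by blast
      have xx: "y + (e / 2) *\<^sub>R \<nu> = x" by (simp add: y_def)
      have "\<rho> y \<le> - (3 / 4 * \<gamma> * (e / 2))" using up[OF yr, of "e / 2", unfolded xx, OF x] e z by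
          simp
      moreover have "3 / 4 * \<gamma> * (e / 2) > 0" using \<gamma> e by simp
      ultimately have "\<rho> y < 0" by linarith
      moreover have "y \<in> U" using y e r by blast
      ultimately have "y \<in> \<Omega>" using \<Omega>U by blast
      then show False using y e(2) closure_subset[of \<Omega>] by blast
    qed
    ultimately show "\<rho> x > 0" by simp
  next
    have xU: "x \<in> U" using x r by blast
    assume pos: "\<rho> x > 0"
    then have "x \<notin> \<Omega>" using xU \<Omega>U by (metis (mono_tags, lifting) Int_iff less_asym mem_Collect_eq)
    moreover have "x \<notin> frontier \<Omega>" using \<rho>0[OF _ xU] pos by auto
    ultimately show "x \<in> - closure \<Omega>" using \<Omega> by (simp add: frontier_def interior_open)
  qed
  define z where "z = p + (r / 2) *\<^sub>R \<nu>"
  define A where "A x = closed_segment x (x + (r / 2) *\<^sub>R \<nu>) \<union> closed_segment z (x + (r / 2) *\<^sub>R \<nu>)"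
      for x
  define X where "X = {x \<in> ball p (r / 8). \<rho> x > 0}"
  define N where "N = (\<Union>x\<in>X. A x)"
  have \<rho>p: "\<rho> p = 0" by (rule \<rho>0[OF p U(2)])
  have AB: "A x \<subseteq> - closure \<Omega>" if "x \<in> X" for x
  proof
    fix y assume y: "y \<in> A x"
    have xb: "norm (x - p) < r / 8" "\<rho> x > 0" using that by (auto simp: X_def dist_norm
        norm_minus_commute)
    have xr: "x \<in> ball p r" using xb r by (simp add: dist_norm norm_minus_commute)
    show "y \<in> - closure \<Omega>"
    proof (cases "y \<in> closed_segment x (x + (r / 2) *\<^sub>R \<nu>)")
      case True
      then obtain u where u: "0 \<le> u" "u \<le> 1" "y = (1 - u) *\<^sub>R x + u *\<^sub>R (x + (r / 2) *\<^sub>R \<nu>)" by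
          (auto simp: in_segment)
      then have y': "y = x + (u * (r / 2)) *\<^sub>R \<nu>" by (simp add: algebra_simps)
      have ur: "0 \<le> u * (r / 2)" "u * (r / 2) \<le> r / 2" using u r by (auto simp: mult_left_le_one_le)
      have "norm (y - p) \<le> norm (x - p) + u * (r / 2)"
        using norm_triangle_ineq[of "x - p" "(u * (r / 2)) *\<^sub>R \<nu>"] ur \<nu> by (simp add: y'
            algebra_simps)
      then have "norm (y - p) < r" using xb(1) ur r(1) by linarith
      then have yr: "y \<in> ball p r" by (simp add: dist_norm norm_minus_commute)
      have "0 \<le> 3 / 4 * \<gamma> * (u * (r / 2))" using ur(1) \<gamma> by simp
      moreover have "\<rho> x + 3 / 4 * \<gamma> * (u * (r / 2)) \<le> \<rho> y"
        using up[OF xr, of "u * (r / 2)", folded y', OF yr ur(1)] .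
      ultimately have "\<rho> y > 0" using xb(2) by linarith
      then show ?thesis using ext[OF yr] by simp
    next
      case False
      then have "y \<in> closed_segment z (x + (r / 2) *\<^sub>R \<nu>)" using y by (simp add: A_def)
      then obtain u where u: "0 \<le> u" "u \<le> 1" "y = (1 - u) *\<^sub>R z + u *\<^sub>R (x + (r / 2) *\<^sub>R \<nu>)" by
          (auto simp: in_segment)
      define w where "w = u *\<^sub>R (x - p)"
      have "(1 - u) *\<^sub>R (p + h) + u *\<^sub>R (x + h) - p = u *\<^sub>R (x - p) + h" for h
        by (simp add: algebra_simps)
      then have y': "y - p = w + (r / 2) *\<^sub>R \<nu>" by (simp only: u(3) w_def z_def)
      have nw: "norm w \<le> r / 8" using u xb mult_left_le_one_le[of "norm (x - p)" u] by (simp add: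
          w_def)
      have ny: "norm (y - p) \<le> r / 8 + r / 2"
        using norm_triangle_ineq[of w "(r / 2) *\<^sub>R \<nu>"] nw \<nu> r by (simp add: y')
      then have "norm (y - p) < r" using r(1) by linarith
      then have yr: "y \<in> ball p r" by (simp add: dist_norm norm_minus_commute)
      \<comment> \<open>At height r/2 the linear part of \<rho> is at least \<gamma> r/2 - \<gamma>
        r/8, and the error at most (\<gamma>/4)(5r/8); the difference is 7\<gamma>r/32. The quarter
        in the choice of the ball and the radius r/8 leave this margin.\<close>
      have "G p \<bullet> w \<ge> - (\<gamma> * (r / 8))"
      proof -
        have "\<bar>G p \<bullet> w\<bar> \<le> \<gamma> * norm w" using Cauchy_Schwarz_ineq2[of "G p" w] by (simp add: \<gamma>_def)
        also have "\<dots> \<le> \<gamma> * (r / 8)" using nw \<gamma> by (intro mult_left_mono) auto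
        finally show ?thesis by linarith
      qed
      moreover have "G p \<bullet> (y - p) = G p \<bullet> w + (r / 2) * \<gamma>" unfolding y' using \<nu> by (simp add:
          inner_add_right)
      moreover have "\<gamma> / 4 * norm (y - p) \<le> \<gamma> / 4 * (r / 8 + r / 2)" using ny \<gamma> by (intro
          mult_left_mono) auto
      moreover have "\<rho> y \<ge> \<rho> p + G p \<bullet> (y - p) - \<gamma> / 4 * norm (y - p)" using r yr by (intro inc)
          auto
      moreover have "\<gamma> * r > 0" using \<gamma> r by simp
      ultimately have "\<rho> y > 0" using \<rho>p by (simp add: field_simps)
      then show ?thesis using ext[OF yr] by simp
    qed
  qed
  show ?thesis
  proof (intro exI[of _ N] exI[of _ "r / 8"] conjI)
    show "r / 8 > 0" using r by simp
    show "connected N"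
      unfolding N_def
    proof (rule connected_Union)
      show "connected s" if "s \<in> A ` X" for s
        using that by (auto simp: A_def intro!: connected_Un)
      have "z \<in> \<Inter> (A ` X)" by (auto simp: A_def)
      then show "\<Inter> (A ` X) \<noteq> {}" by blast
    qed
    show "N \<subseteq> - closure \<Omega>" using AB by (auto simp: N_def)
    show sub: "ball p (r / 8) - closure \<Omega> \<subseteq> N"
    proof
      fix x assume x: "x \<in> ball p (r / 8) - closure \<Omega>"
      then have "x \<in> ball p r" using r by auto
      then have "x \<in> X" using x ext[of x] by (auto simp: X_def)
      then show "x \<in> N" by (auto simp: N_def A_def)
    qed
    show "p \<in> closure N"
      unfolding closure_approachable
    proof (intro allI impI)
      fix e :: real assume e: "0 < e"
      define t where "t = min e r / 16"
      have t: "0 < t" "t < e" "t < r / 8" using e r by (auto simp: t_def)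
      define y where "y = p + t *\<^sub>R \<nu>"
      have d: "dist y p = t" using t \<nu> by (simp add: y_def dist_norm)
      have yr: "y \<in> ball p r" using d t r by (simp add: dist_commute)
      have "\<rho> y \<ge> \<rho> p + 3 / 4 * \<gamma> * t" unfolding y_def using yr r t by (intro up) (auto simp: y_def)
      moreover have "3 / 4 * \<gamma> * t > 0" using \<gamma> t by simp
      ultimately have "y \<in> - closure \<Omega>" using ext[OF yr] \<rho>p by linarith
      then have "y \<in> ball p (r / 8) - closure \<Omega>" using d t by (simp add: dist_commute)
      then have "y \<in> N" using sub by blast
      then show "\<exists>y\<in>N. dist y p < e" using d t by auto
    qed
  qed
qed

text \<open>Connectedness of the complement of \<Omega> does not by itself survive the removal of
  the boundary. If the exterior split into two open parts, their closures would cover the connected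
  complement and meet, necessarily at a boundary point; but near that point the exterior lies in one
  connected piece.\<close>

lemma connected_exterior:
  assumes \<Omega>: "open \<Omega>" "bounded \<Omega>" "simply_connected \<Omega>" and n: "outward_unit_normal \<Omega> n"
  shows "connected (- closure \<Omega>)" "frontier \<Omega> \<subseteq> closure (- closure \<Omega>)"
proof -
  show fr: "frontier \<Omega> \<subseteq> closure (- closure \<Omega>)"
    using exterior_near_boundary[OF \<Omega>(1) n] closure_mono by blast
  show "connected (- closure \<Omega>)"
  proof (rule ccontr)
    assume "\<not> connected (- closure \<Omega>)"
    then obtain A' B' where AB': "open A'" "open B'" "- closure \<Omega> \<subseteq> A' \<union> B'" "A' \<inter> B' \<inter> - closure \<Omega>
        = {}"
        "A' \<inter> - closure \<Omega> \<noteq> {}" "B' \<inter> - closure \<Omega> \<noteq> {}"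
      unfolding connected_def by blast
    define A B where "A = A' \<inter> - closure \<Omega>" and "B = B' \<inter> - closure \<Omega>"
    have "open A" "open B" unfolding A_def B_def using AB'(1,2) by (auto intro!: open_Int
        open_Compl)
    moreover have "A \<noteq> {}" "B \<noteq> {}" "A \<inter> B = {}" "A \<union> B = - closure \<Omega>"
      unfolding A_def B_def using AB'(3-6) by auto
    ultimately have AB: "open A" "open B" "A \<noteq> {}" "B \<noteq> {}" "A \<inter> B = {}" "A \<union> B = - closure \<Omega>" .
    have sub: "- \<Omega> \<subseteq> closure A \<union> closure B"
    proof
      fix x assume x: "x \<in> - \<Omega>"
      show "x \<in> closure A \<union> closure B"
      proof (cases "x \<in> closure \<Omega>")
        case True
        then have "x \<in> frontier \<Omega>" using x \<Omega> by (simp add: frontier_def interior_open)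
        then have "x \<in> closure (A \<union> B)" using fr AB(6) by auto
        then show ?thesis by (simp add: closure_Un)
      next
        case False
        then have "x \<in> A \<union> B" using AB(6) by blast
        then show ?thesis using closure_subset by blast
      qed
    qed
    have in\<Omega>: "closure A \<subseteq> - \<Omega>" "closure B \<subseteq> - \<Omega>"
    proof -
      have "A \<subseteq> - \<Omega>" "B \<subseteq> - \<Omega>" using AB(6) closure_subset[of \<Omega>] by blast+
      then show "closure A \<subseteq> - \<Omega>" "closure B \<subseteq> - \<Omega>" using closure_minimal[of A "- \<Omega>"]
          closure_minimal[of B "- \<Omega>"] \<Omega>(1) by (auto simp: closed_def)
    qed
    have "connected (- \<Omega>)" by (rule connected_complement[OF \<Omega>])
    then have "closure A \<inter> closure B \<inter> - \<Omega> \<noteq> {}"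
    proof -
      have "closure A \<inter> - \<Omega> \<noteq> {}" "closure B \<inter> - \<Omega> \<noteq> {}"
        using AB(3,4) in\<Omega> closure_subset[of A] closure_subset[of B] by blast+
      with connected_closedD[OF \<open>connected (- \<Omega>)\<close> _ sub closed_closure closed_closure]
      show ?thesis by blast
    qed
    then obtain p where p: "p \<in> closure A" "p \<in> closure B" "p \<in> - \<Omega>" by blast
    have pn: "p \<notin> A" "p \<notin> B"
      using p AB(1,2,5) open_Int_closure_eq_empty by blast+
    then have "p \<in> closure \<Omega>" using AB(6) by blast
    then have "p \<in> frontier \<Omega>" using p(3) \<Omega> by (simp add: frontier_def interior_open)
    then obtain N d where N: "d > 0" "connected N" "N \<subseteq> - closure \<Omega>" "ball p d - closure \<Omega> \<subseteq> N"
      using exterior_near_boundary[OF \<Omega>(1) n] by blast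
    obtain a where a: "a \<in> A" "dist a p < d" using p(1) N(1) closure_approachable by blast
    obtain b where b: "b \<in> B" "dist b p < d" using p(2) N(1) closure_approachable by blast
    have "a \<in> N" using a N(4) AB(6) by (auto simp: dist_commute)
    moreover have "b \<in> N" using b N(4) AB(6) by (auto simp: dist_commute)
    ultimately have "A \<inter> N \<noteq> {}" "B \<inter> N \<noteq> {}" using a b by auto
    moreover have "N \<subseteq> A \<union> B" "A \<inter> B \<inter> N = {}" using N(3) AB(5,6) by auto
    ultimately show False using N(2) AB(1,2) unfolding connected_def by blast
  qed
qed

section \<open>Smoothness of equilibrated compatible stresses\<close>

definition test_linear :: "(real^2) set \<Rightarrow> ((real^2 \<Rightarrow> real) \<Rightarrow> real) \<Rightarrow> bool" where
  "test_linear W T \<longleftrightarrow> (\<forall>\<phi>\<in>test_functions W. \<forall>\<psi>\<in>test_functions W. \<forall>a b.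
     T (\<lambda>x. a * \<phi> x + b * \<psi> x) = a * T \<phi> + b * T \<psi>)"

lemma test_linear_add:
  assumes "test_linear W T" "\<phi> \<in> test_functions W" "\<psi> \<in> test_functions W"
  shows "T (\<lambda>x. \<phi> x + \<psi> x) = T \<phi> + T \<psi>"
proof -
  have "T (\<lambda>x. 1 * \<phi> x + 1 * \<psi> x) = 1 * T \<phi> + 1 * T \<psi>"
    using assms unfolding test_linear_def by blast
  then show ?thesis by simp
qed

lemma test_linear_second_order:
  assumes T: "test_linear W T" and \<phi>: "\<phi> \<in> test_functions W"
  shows "T (second_order a b c \<phi>) =
    a * T (partial 1 (partial 1 \<phi>)) + 2 * b * T (partial 1 (partial 2 \<phi>)) + c * T (partial 2
        (partial 2 \<phi>))"
proof -
  have t: "partial i (partial j \<phi>) \<in> test_functions W" for i j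
    by (intro test_functions_partial \<phi>)
  have D: "T (\<lambda>x. \<alpha> * f x + \<beta> * g x) = \<alpha> * T f + \<beta> * T g" if "f \<in> test_functions W" "g \<in>
      test_functions W" for \<alpha> \<beta> f g
    using T that unfolding test_linear_def by blast
  have t2: "(\<lambda>x. a * partial 1 (partial 1 \<phi>) x + 2 * b * partial 1 (partial 2 \<phi>) x) \<in> test_functions
      W"
    by (intro test_functions_add test_functions_cmult t)
  note 1 = D[OF t2 t, of 1 c 2 2] and 2 = D[OF t t, of a 1 1 "2 * b" 1 2]
  have "second_order a b c \<phi> = (\<lambda>x. 1 * (a * partial 1 (partial 1 \<phi>) x + 2 * b * partial 1 (partial
      2 \<phi>) x) + c * partial 2 (partial 2 \<phi>) x)"
    by (simp add: second_order_def fun_eq_iff)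
  then show ?thesis using 1 2 by simp
qed

lemma test_partial_commute: "\<phi> \<in> test_functions W \<Longrightarrow> partial 2 (partial 1 \<phi>) = partial 1 (partial 2
    \<phi>)"
  using partial_commute test_functions_smooth by blast

lemma partial_second_order:
  assumes \<phi>: "\<phi> \<in> test_functions W"
  shows "partial i (second_order a b c \<phi>) = second_order a b c (partial i \<phi>)"
proof
  fix x
  have d: "partial j (partial k \<phi>) differentiable (at x)" for j k
    by (intro test_functions_differentiable[where U = W] test_functions_partial \<phi>)
  have dm: "(\<lambda>x. c * partial j (partial k \<phi>) x) differentiable (at x)" for c j k
    by (intro differentiable_mult differentiable_const d)
  have pc: "partial i (partial j (partial k \<phi>)) = partial j (partial k (partial i \<phi>))" for j k
  proof -
    have "partial i (partial j (partial k \<phi>)) = partial j (partial i (partial k \<phi>))"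
      by (rule partial_commute) (rule test_functions_smooth[OF test_functions_partial[OF \<phi>]])
    also have "partial i (partial k \<phi>) = partial k (partial i \<phi>)"
      by (rule partial_commute) (rule test_functions_smooth[OF \<phi>])
    finally show ?thesis .
  qed
  have "partial i (second_order a b c \<phi>) x = a * partial i (partial 1 (partial 1 \<phi>)) x
      + 2 * b * partial i (partial 1 (partial 2 \<phi>)) x + c * partial i (partial 2 (partial 2 \<phi>)) x"
    unfolding second_order_def[abs_def]
    by (simp only: partial_add[OF differentiable_add[OF dm dm] dm] partial_add[OF dm dm]
        partial_cmult[OF d])
  then show "partial i (second_order a b c \<phi>) x = second_order a b c (partial i \<phi>) x"
    by (simp only: second_order_def pc)
qed

text \<open>The distribution obtained by applying the second operator to \<open>T\<close> is
  annihilated by the first, hence smooth; then \<open>T\<close> solves a second-order equation with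
  smooth right-hand side. This is why \<open>elliptic_regularity\<close> admits a nonzero
  \<open>f\<close>.\<close>

lemma quartic_regularity:
  assumes W: "open W" "0 \<in> W" and T: "test_linear W T"
    and u: "smooth_on (W - {0}) u" "\<And>\<phi>. \<phi> \<in> test_functions (W - {0}) \<Longrightarrow> T \<phi> = (\<integral>x. u x * \<phi> x
        \<partial>lborel)"
    and L1: "elliptic_operator a1 b1 c1" and L2: "elliptic_operator a2 b2 c2"
    and z: "\<And>\<phi>. \<phi> \<in> test_functions W \<Longrightarrow> T (second_order a2 b2 c2 (second_order a1 b1 c1 \<phi>)) = 0"
  shows "\<exists>s. smooth_on W s \<and> (\<forall>\<phi>\<in>test_functions W. T \<phi> = (\<integral>x. s x * \<phi> x \<partial>lborel))"
proof -
  define S where "S \<phi> = T (second_order a2 b2 c2 \<phi>)" for \<phi>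
  have W0: "open (W - {0})" using W by auto
  have "\<exists>f. smooth_on W f \<and> (\<forall>\<phi>\<in>test_functions W. S \<phi> = (\<integral>x. f x * \<phi> x \<partial>lborel))"
  proof (rule elliptic_operator.elliptic_regularity[OF L1 W])
    fix \<phi> \<psi> assume \<phi>: "\<phi> \<in> test_functions W" and \<psi>: "\<psi> \<in> test_functions W"
    have d: "\<phi> differentiable (at x)" "\<psi> differentiable (at x)" "partial i \<phi> differentiable (at x)"
        "partial i \<psi> differentiable (at x)" for x i
      by (intro test_functions_differentiable[of _ W] test_functions_partial \<phi> \<psi>)+
    have p: "partial i (\<lambda>x. \<phi> x + \<psi> x) = (\<lambda>x. partial i \<phi> x + partial i \<psi> x)" for i
      by (rule ext) (rule partial_add[OF d(1,2)])
    have "partial j (partial i (\<lambda>x. \<phi> x + \<psi> x)) = (\<lambda>x. partial j (partial i \<phi>) x + partial j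
        (partial i \<psi>) x)" for i j
      unfolding p by (rule ext) (rule partial_add[OF d(3,4)])
    then have "second_order a2 b2 c2 (\<lambda>x. \<phi> x + \<psi> x) = (\<lambda>x. second_order a2 b2 c2 \<phi> x + second_order
        a2 b2 c2 \<psi> x)"
      by (simp add: second_order_def fun_eq_iff algebra_simps)
    then show "S (\<lambda>x. \<phi> x + \<psi> x) = S \<phi> + S \<psi>"
      unfolding S_def by (simp add: test_linear_add[OF T test_functions_second_order[OF \<phi>]
          test_functions_second_order[OF \<psi>]])
  next
    show "smooth_on (W - {0}) (second_order a2 b2 c2 u)" by (rule smooth_on_second_order[OF W0
        u(1)])
    show "S \<phi> = (\<integral>x. second_order a2 b2 c2 u x * \<phi> x \<partial>lborel)" if "\<phi> \<in> test_functions (W - {0})" for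
        \<phi>
      unfolding S_def u(2)[OF test_functions_second_order[OF that]] by (rule
          second_order_by_parts[OF W0 u(1) that])
    show "smooth_on W (\<lambda>x. 0)" by simp
    show "S (second_order a1 b1 c1 \<phi>) = (\<integral>x. 0 * \<phi> x \<partial>lborel)" if "\<phi> \<in> test_functions W" for \<phi>
      using z[OF that] by (simp add: S_def)
  qed
  then obtain f where f: "smooth_on W f" "\<And>\<phi>. \<phi> \<in> test_functions W \<Longrightarrow> T (second_order a2 b2 c2 \<phi>) =
      (\<integral>x. f x * \<phi> x \<partial>lborel)"
    unfolding S_def by blast
  show ?thesis
    by (rule elliptic_operator.elliptic_regularity[OF L2 W test_linear_add[OF T] u f])
qed

text \<open>On the level of symbols, equilibrium makes \<open>\<sigma>\<close> proportional to \<open>(\<xi>\<^sub>2\<^sup>2, -\<xi>\<^sub>1\<xi>\<^sub>2, \<xi>\<^sub>1\<^sup>2)\<close>.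
    Compatibility then
  makes every component satisfy the scalar equation whose symbol is the quartic \<open>\<langle>C\<^sup>-\<^sup>1 V, V\<rangle>\<close>,
  \<open>V = (\<xi>\<^sub>2\<^sup>2, -\<xi>\<^sub>1\<xi>\<^sub>2, \<xi>\<^sub>1\<^sup>2)\<close>.\<close>

lemma stress_regularity:
  fixes a11 a12 a13 a22 a23 a33 :: real
  assumes W: "open W" "0 \<in> W" and lin: "test_linear W p" "test_linear W q" "test_linear W r"
    and rep: "smooth_on (W - {0}) up" "\<And>\<phi>. \<phi> \<in> test_functions (W - {0}) \<Longrightarrow> p \<phi> = (\<integral>x. up x * \<phi> x
        \<partial>lborel)"
      "smooth_on (W - {0}) uq" "\<And>\<phi>. \<phi> \<in> test_functions (W - {0}) \<Longrightarrow> q \<phi> = (\<integral>x. uq x * \<phi> x \<partial>lborel)"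
      "smooth_on (W - {0}) ur" "\<And>\<phi>. \<phi> \<in> test_functions (W - {0}) \<Longrightarrow> r \<phi> = (\<integral>x. ur x * \<phi> x \<partial>lborel)"
    and div: "\<And>\<phi>. \<phi> \<in> test_functions W \<Longrightarrow> p (partial 1 \<phi>) + q (partial 2 \<phi>) = 0"
      "\<And>\<phi>. \<phi> \<in> test_functions W \<Longrightarrow> q (partial 1 \<phi>) + r (partial 2 \<phi>) = 0"
    and cc: "\<And>\<phi>. \<phi> \<in> test_functions W \<Longrightarrow>
      (a11 * p (partial 2 (partial 2 \<phi>)) + a12 * q (partial 2 (partial 2 \<phi>)) + a13 * r (partial 2
          (partial 2 \<phi>)))
      - (a12 * p (partial 1 (partial 2 \<phi>)) + a22 * q (partial 1 (partial 2 \<phi>)) + a23 * r (partial 1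
          (partial 2 \<phi>)))
      + (a13 * p (partial 1 (partial 1 \<phi>)) + a23 * q (partial 1 (partial 1 \<phi>)) + a33 * r (partial 1
          (partial 1 \<phi>))) = 0"
    and pos: "\<And>p q r. p \<noteq> 0 \<or> q \<noteq> 0 \<or> r \<noteq> 0 \<Longrightarrow>
       a11 * p * p + a22 * q * q + a33 * r * r + 2 * a12 * p * q + 2 * a13 * p * r + 2 * a23 * q * r
           > 0"
  shows "\<exists>s. smooth_on W s \<and> (\<forall>\<phi>\<in>test_functions W. p \<phi> = (\<integral>x. s x * \<phi> x \<partial>lborel))"
    "\<exists>s. smooth_on W s \<and> (\<forall>\<phi>\<in>test_functions W. q \<phi> = (\<integral>x. s x * \<phi> x \<partial>lborel))"
    "\<exists>s. smooth_on W s \<and> (\<forall>\<phi>\<in>test_functions W. r \<phi> = (\<integral>x. s x * \<phi> x \<partial>lborel))"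
proof -
  have "a33 * x^4 + (- 2 * a23) * x^3 * y + (a22 + 2 * a13) * x^2 * y^2 + (- 2 * a12) * x * y^3 +
      a11 * y^4 > 0"
    if "x \<noteq> 0 \<or> y \<noteq> 0" for x y :: real
  proof -
    have "y * y \<noteq> 0 \<or> - (x * y) \<noteq> 0 \<or> x * x \<noteq> 0" using that by auto
    from pos[OF this] show ?thesis by (simp add: eval_nat_numeral algebra_simps)
  qed
  then obtain a1 b1 c1 a2 b2 c2 where L: "elliptic_operator a1 b1 c1" "elliptic_operator a2 b2 c2"
    and co: "a33 = a1 * a2" "- 2 * a23 = 2 * (a1 * b2 + b1 * a2)" "a22 + 2 * a13 = a1 * c2 + 4 * b1
        * b2 + c1 * a2"
    "- 2 * a12 = 2 * (b1 * c2 + c1 * b2)" "a11 = c1 * c2"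
    by (rule positive_quartic_factorization)
  have expand: "T (second_order a2 b2 c2 (second_order a1 b1 c1 \<phi>)) =
      a33 * T (partial 1 (partial 1 (partial 1 (partial 1 \<phi>)))) - 2 * a23 * T (partial 1 (partial 1
          (partial 1 (partial 2 \<phi>))))
      + (a22 + 2 * a13) * T (partial 1 (partial 1 (partial 2 (partial 2 \<phi>)))) - 2 * a12 * T (partial
          1 (partial 2 (partial 2 (partial 2 \<phi>))))
      + a11 * T (partial 2 (partial 2 (partial 2 (partial 2 \<phi>))))" if T: "test_linear W T" and \<phi>: "\<phi>
          \<in> test_functions W" for T \<phi>
  proof -
    have t: "partial i (partial j \<phi>) \<in> test_functions W" "partial i \<phi> \<in> test_functions W" for i j
      by (intro test_functions_partial \<phi>)+
    have pp: "partial i (partial j (second_order a1 b1 c1 \<phi>)) = second_order a1 b1 c1 (partial i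
        (partial j \<phi>))" for i j
      using partial_second_order[OF \<phi>] partial_second_order[OF t(2)] by simp
    have c: "partial 2 (partial 1 \<phi>) = partial 1 (partial 2 \<phi>)" "partial 2 (partial 1 (partial i \<phi>))
        = partial 1 (partial 2 (partial i \<phi>))"
      "partial 2 (partial 1 (partial i (partial j \<phi>))) = partial 1 (partial 2 (partial i (partial j
          \<phi>)))" for i j
      by (intro test_partial_commute[where W = W] t \<phi>)+
    show ?thesis
      unfolding test_linear_second_order[OF T test_functions_second_order[OF \<phi>]] pp
          test_linear_second_order[OF T t(1)] c
      using co by algebra
  qed
  have zero: "p (second_order a2 b2 c2 (second_order a1 b1 c1 \<phi>)) = 0"
      "q (second_order a2 b2 c2 (second_order a1 b1 c1 \<phi>)) = 0"
      "r (second_order a2 b2 c2 (second_order a1 b1 c1 \<phi>)) = 0" if \<phi>: "\<phi> \<in> test_functions W" for \<phi>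
  proof -
    have t: "partial i \<phi> \<in> test_functions W" "partial i (partial j \<phi>) \<in> test_functions W" "partial i
        (partial j (partial k \<phi>)) \<in> test_functions W" for i j k
      by (intro test_functions_partial \<phi>)+
    have c: "partial 2 (partial 1 \<phi>) = partial 1 (partial 2 \<phi>)" "partial 2 (partial 1 (partial i \<phi>))
        = partial 1 (partial 2 (partial i \<phi>))"
      "partial 2 (partial 1 (partial i (partial j \<phi>))) = partial 1 (partial 2 (partial i (partial j
          \<phi>)))" for i j
      by (intro test_partial_commute[where W = W] t \<phi>)+
    note d1 = div(1)[OF t(3)] and d2 = div(2)[OF t(3)]
    note D = d1[of 1 1 1] d1[of 1 1 2] d1[of 1 2 2] d1[of 2 2 2] d2[of 1 1 1] d2[of 1 1 2] d2[of 1 2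
        2] d2[of 2 2 2]
    \<comment> \<open>On symbols, multiplying the compatibility equation by \<xi>_2^2, \<xi>_1
      \<xi>_2 and \<xi>_1^2 isolates \<open>p\<close>, \<open>q\<close> and \<open>r\<close>
      respectively; the equilibrium equations applied to third derivatives exchange the
      components.\<close>
    note E = cc[OF t(2), of 2 2] cc[OF t(2), of 1 2] cc[OF t(2), of 1 1]
    show "p (second_order a2 b2 c2 (second_order a1 b1 c1 \<phi>)) = 0"
      "q (second_order a2 b2 c2 (second_order a1 b1 c1 \<phi>)) = 0"
      "r (second_order a2 b2 c2 (second_order a1 b1 c1 \<phi>)) = 0"
      unfolding expand[OF lin(1) \<phi>] expand[OF lin(2) \<phi>] expand[OF lin(3) \<phi>]
      using D[unfolded c] E[unfolded c] by algebra+
  qed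
  show "\<exists>s. smooth_on W s \<and> (\<forall>\<phi>\<in>test_functions W. p \<phi> = (\<integral>x. s x * \<phi> x \<partial>lborel))"
    by (rule quartic_regularity[OF W lin(1) rep(1,2) L zero(1)])
  show "\<exists>s. smooth_on W s \<and> (\<forall>\<phi>\<in>test_functions W. q \<phi> = (\<integral>x. s x * \<phi> x \<partial>lborel))"
    by (rule quartic_regularity[OF W lin(2) rep(3,4) L zero(2)])
  show "\<exists>s. smooth_on W s \<and> (\<forall>\<phi>\<in>test_functions W. r \<phi> = (\<integral>x. s x * \<phi> x \<partial>lborel))"
    by (rule quartic_regularity[OF W lin(3) rep(5,6) L zero(3)])
qed

lemma integral_test_zero_imp_eq:
  fixes f g :: "real^2 \<Rightarrow> real"
  assumes W: "open W" and f: "smooth_on W f" and g: "smooth_on W g"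
    and eq: "\<And>\<phi>. \<phi> \<in> test_functions W \<Longrightarrow> (\<integral>x. f x * \<phi> x \<partial>lborel) = (\<integral>x. g x * \<phi> x \<partial>lborel)"
    and x: "x \<in> W"
  shows "f x = g x"
proof -
  have fg: "smooth_on W (\<lambda>x. f x - g x)" by (intro smooth_on_diff W f g)
  have i: "integrable lborel (\<lambda>x. h x * \<phi> x)" if "smooth_on W h" "\<phi> \<in> test_functions W" for h \<phi>
    by (rule test_functions_integrable[OF test_functions_mult[OF W that]])
  have "f x - g x = 0"
  proof (rule fundamental_lemma[OF W smooth_on_continuous_on[OF fg] _ _ x])
    fix \<phi> assume \<phi>: "\<phi> \<in> test_functions W"
    show "(\<integral>x. (f x - g x) * \<phi> x \<partial>lborel) = 0"
      unfolding left_diff_distrib using i[OF f \<phi>] i[OF g \<phi>] eq[OF \<phi>] by simp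
    show "integrable lborel (\<lambda>x. (f x - g x) * \<phi> x)" by (rule i[OF fg \<phi>])
  qed
  then show ?thesis by simp
qed

lemma weak_div_imp_div:
  assumes W: "open W" and f: "smooth_on W f" and g: "smooth_on W g"
    and eq: "\<And>\<phi>. \<phi> \<in> test_functions W \<Longrightarrow> (\<integral>x. f x * partial 1 \<phi> x \<partial>lborel) + (\<integral>x. g x * partial 2 \<phi> x
        \<partial>lborel) = 0"
    and x: "x \<in> W"
  shows "partial 1 f x + partial 2 g x = 0"
proof -
  have "partial 1 f x = - partial 2 g x"
  proof (rule integral_test_zero_imp_eq[OF W _ _ _ x])
    show "smooth_on W (partial 1 f)" by (rule smooth_on_partial[OF f])
    show "smooth_on W (\<lambda>x. - partial 2 g x)" by (intro smooth_on_minus W smooth_on_partial g)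
    show "(\<integral>x. partial 1 f x * \<phi> x \<partial>lborel) = (\<integral>x. - partial 2 g x * \<phi> x \<partial>lborel)" if "\<phi> \<in>
        test_functions W" for \<phi>
      using eq[OF that] integral_by_parts[OF W f that] integral_by_parts[OF W g that] by simp
  qed
  then show ?thesis by simp
qed

section \<open>Airy potentials\<close>

definition vline :: "real \<Rightarrow> real^2" where "vline t = t *\<^sub>R axis 2 1"

lemma convolution_kernel_vline:
  fixes F :: "real \<Rightarrow> real"
  assumes "continuous_on {0..} F"
  shows "convolution_kernel lborel vline (\<lambda>t. indicat_real {0..} t * F t)"
  unfolding convolution_kernel_def
proof (intro conjI allI)
  have "continuous_on UNIV vline" unfolding vline_def by (intro continuous_intros)
  then show "vline \<in> borel_measurable lborel" by (simp add: borel_measurable_continuous_onI)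
  have "(\<lambda>t. indicat_real {0..} t *\<^sub>R F t) \<in> borel_measurable borel"
    using assms by (intro borel_measurable_continuous_on_indicator) auto
  then show "(\<lambda>t. indicat_real {0..} t * F t) \<in> borel_measurable lborel" by simp
  fix R
  have "integrable lborel (\<lambda>t. indicat_real {0..R} t *\<^sub>R F t)"
    using assms by (intro borel_integrable_compact) (auto intro: continuous_on_subset)
  moreover have eq: "indicat_real {0..R} t *\<^sub>R F t = indicat_real {t. norm (vline t) \<le> R} t *
      (indicat_real {0..} t * F t)" for t
    by (auto simp: vline_def norm_axis_1 indicator_def)
  ultimately show "integrable lborel (\<lambda>t. indicat_real {t. norm (vline t) \<le> R} t * (indicat_real
      {0..} t * F t))"
    by (simp only: eq)
qed

lemma vline_partial_has_real_derivative:
  assumes "f \<in> test_functions UNIV"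
  shows "((\<lambda>t. f (x - vline t)) has_real_derivative - partial 2 f (x - vline t)) (at t)"
proof -
  have "((\<lambda>s. f (x + s *\<^sub>R axis 2 1)) has_real_derivative partial 2 f (x + (- t) *\<^sub>R axis 2 1)) (at
      (- t))"
    by (rule partial_has_real_derivative[OF test_functions_differentiable[OF assms]])
  moreover have "(uminus has_real_derivative -1) (at t)" by (auto intro!: derivative_eq_intros)
  ultimately have "((\<lambda>t. f (x + (- t) *\<^sub>R axis 2 1)) has_real_derivative partial 2 f (x + (- t) *\<^sub>R
      axis 2 1) * -1) (at t)"
    by (rule DERIV_chain2)
  then show ?thesis by (simp add: vline_def)
qed

text \<open>Integration from minus infinity along the vertical line up to x, the inverse of the
  second partial derivative on test functions.\<close>

definition half_line :: "(real^2 \<Rightarrow> real) \<Rightarrow> real^2 \<Rightarrow> real" where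
  "half_line = kernel_conv lborel vline (\<lambda>t. indicat_real {0..} t * 1)"

text \<open>Cauchy's formula for the twofold repeated integral: the weight t inverts the second
  partial derivative applied twice.\<close>

definition half_line_moment :: "(real^2 \<Rightarrow> real) \<Rightarrow> real^2 \<Rightarrow> real" where
  "half_line_moment = kernel_conv lborel vline (\<lambda>t. indicat_real {0..} t * t)"

lemma half_line_kernels:
  "convolution_kernel lborel vline (\<lambda>t. indicat_real {0..} t * 1)"
  "convolution_kernel lborel vline (\<lambda>t. indicat_real {0..} t * t)"
  by (intro convolution_kernel_vline continuous_intros)+

lemma vline_large:
  assumes "f \<in> test_functions UNIV"
  obtains b where "b \<ge> 0" "\<And>t. t \<ge> b \<Longrightarrow> f (x - vline t) = 0"
proof -
  obtain R where R: "\<forall>x. norm x > R \<longrightarrow> f x = 0" using assms test_functions_UNIV_iff by blast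
  show ?thesis
  proof (rule that[of "\<bar>R\<bar> + norm x + 1"])
    fix t assume t: "\<bar>R\<bar> + norm x + 1 \<le> t"
    have "0 \<le> t" using t norm_ge_zero[of x] by linarith
    then have "norm (vline t) = t" by (simp add: vline_def norm_axis_1)
    then have "norm (x - vline t) > R" using t norm_triangle_ineq2[of "vline t" x] by (simp add:
        norm_minus_commute)
    then show "f (x - vline t) = 0" using R by blast
  qed auto
qed

lemma continuous_vline_compose: "f \<in> test_functions UNIV \<Longrightarrow> continuous_on UNIV (\<lambda>t. f (x - vline t))"
  unfolding vline_def by (intro continuous_on_compose2[OF continuous_test_function]
      continuous_intros) auto

lemma half_line_partial:
  assumes f: "f \<in> test_functions UNIV"
  shows "half_line (partial 2 f) x = f x"
proof -
  obtain b where b: "b \<ge> 0" "\<And>t. t \<ge> b \<Longrightarrow> f (x - vline t) = 0" by (metis vline_large[OF f])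
  obtain b' where b': "b' \<ge> 0" "\<And>t. t \<ge> b' \<Longrightarrow> partial 2 f (x - vline t) = 0" by (metis vline_large[OF
      test_functions_partial[OF f]])
  define c where "c = max b b'"
  have c: "c \<ge> 0" "\<And>t. t \<ge> c \<Longrightarrow> f (x - vline t) = 0 \<and> partial 2 f (x - vline t) = 0"
    using b b' by (auto simp: c_def)
  have "half_line (partial 2 f) x = (\<integral>t. partial 2 f (x - vline t) * indicat_real {0..c} t \<partial>lborel)"
    unfolding half_line_def kernel_conv_def
    by (intro Bochner_Integration.integral_cong refl) (use c(2) in \<open>force simp: indicator_def\<close>)
  also have "\<dots> = - f (x - vline c) - - f (x - vline 0)"
  proof (rule integral_FTC_Icc_real[OF c(1)])
    show "((\<lambda>t. - f (x - vline t)) has_real_derivative partial 2 f (x - vline t)) (at t)" for t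
      using DERIV_minus[OF vline_partial_has_real_derivative[OF f]] by simp
    show "isCont (\<lambda>t. partial 2 f (x - vline t)) t" for t
      using continuous_vline_compose[OF test_functions_partial[OF f]] by (simp add:
          continuous_on_eq_continuous_at)
  qed
  also have "\<dots> = f x" using c(2)[of c] by (simp add: vline_def)
  finally show ?thesis .
qed

lemma half_line_moment_partial:
  assumes f: "f \<in> test_functions UNIV"
  shows "half_line_moment (partial 2 f) = half_line f"
proof
  fix x
  obtain b where b: "b \<ge> 0" "\<And>t. t \<ge> b \<Longrightarrow> f (x - vline t) = 0" by (metis vline_large[OF f])
  obtain b' where b': "b' \<ge> 0" "\<And>t. t \<ge> b' \<Longrightarrow> partial 2 f (x - vline t) = 0" by (metis vline_large[OF
      test_functions_partial[OF f]])
  define c where "c = max b b'"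
  have c: "c \<ge> 0" "\<And>t. t \<ge> c \<Longrightarrow> f (x - vline t) = 0 \<and> partial 2 f (x - vline t) = 0"
    using b b' by (auto simp: c_def)
  have i: "integrable lborel (\<lambda>t. (indicat_real {0..} t * t) * partial 2 f (x - vline t))"
    "integrable lborel (\<lambda>t. (indicat_real {0..} t * 1) * f (x - vline t))"
    by (intro kernel_conv_integrable half_line_kernels f test_functions_partial)+
  have "half_line_moment (partial 2 f) x - half_line f x
      = (\<integral>t. (indicat_real {0..} t * t) * partial 2 f (x - vline t) - (indicat_real {0..} t * 1) * f
          (x - vline t) \<partial>lborel)"
    unfolding half_line_def half_line_moment_def kernel_conv_def
    by (rule Bochner_Integration.integral_diff[OF i, symmetric])
  also have "\<dots> = (\<integral>t. (t * partial 2 f (x - vline t) - f (x - vline t)) * indicat_real {0..c} t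
      \<partial>lborel)"
    by (intro Bochner_Integration.integral_cong refl) (use c(2) in \<open>force simp: indicator_def\<close>)
  also have "\<dots> = - (c * f (x - vline c)) - - (0 * f (x - vline 0))"
  proof (rule integral_FTC_Icc_real[OF c(1)])
    show "((\<lambda>t. - (t * f (x - vline t))) has_real_derivative t * partial 2 f (x - vline t) - f (x -
        vline t)) (at t)" for t
      using DERIV_minus[OF DERIV_mult[OF DERIV_ident vline_partial_has_real_derivative[OF f, of x
          t]]]
      by (simp add: algebra_simps)
    show "isCont (\<lambda>t. t * partial 2 f (x - vline t) - f (x - vline t)) t" for t
      using continuous_vline_compose[OF test_functions_partial[OF f]] continuous_vline_compose[OF f]
      by (intro continuous_intros) (simp_all add: continuous_on_eq_continuous_at)
  qed
  also have "\<dots> = 0" using c(2)[of c] by simp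
  finally show "half_line_moment (partial 2 f) x = half_line f x" by simp
qed

lemma kernel_conv_uminus: "kernel_conv M g F (\<lambda>x. - f x) x = - kernel_conv M g F f x"
  by (simp add: kernel_conv_def)

text \<open>Integrating \<open>f11\<close> twice in the vertical variable gives the first equation
  at once. The divergence equations write the other second derivatives of \<open>f11\<close> as
  vertical second derivatives of \<open>f12\<close> and \<open>f22\<close>, which the same
  integration undoes. Since integration starts from below, the potential vanishes below the support
  of \<open>f11\<close>.\<close>

lemma ex_airy_potential:
  assumes t: "f11 \<in> test_functions UNIV" "f12 \<in> test_functions UNIV" "f22 \<in> test_functions UNIV"
    and R: "\<And>x. norm x > R \<Longrightarrow> f11 x = 0"
    and div: "\<And>x. partial 1 f11 x + partial 2 f12 x = 0" "\<And>x. partial 1 f12 x + partial 2 f22 x = 0"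
  shows "\<exists>\<phi>. smooth_on UNIV \<phi> \<and> (\<forall>x. partial 2 (partial 2 \<phi>) x = f11 x \<and> partial 1 (partial 2 \<phi>) x =
      - f12 x \<and>
     partial 2 (partial 1 \<phi>) x = - f12 x \<and> partial 1 (partial 1 \<phi>) x = f22 x) \<and> (\<forall>x. x $ 2 < - R \<longrightarrow> \<phi>
         x = 0)"
proof -
  have ut: "(\<lambda>x. - f x) \<in> test_functions UNIV" if "f \<in> test_functions UNIV" for f
    using test_functions_cmult[OF that, of "-1"] by simp
  have d1: "partial 1 f11 = (\<lambda>x. - partial 2 f12 x)" and d2: "partial 1 f12 = (\<lambda>x. - partial 2 f22
      x)"
    using div by (auto simp: fun_eq_iff eq_neg_iff_add_eq_0)
  have um: "partial i (\<lambda>x. - f x) = (\<lambda>x. - partial i f x)" if "f \<in> test_functions UNIV" for i f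
    using partial_cmult[OF test_functions_differentiable[OF that], of i "-1"] by (auto simp:
        fun_eq_iff)
  define \<phi> where "\<phi> = half_line_moment f11"
  have pK: "partial i (half_line_moment f) = half_line_moment (partial i f)" if "f \<in> test_functions
      UNIV" for i f
    unfolding half_line_moment_def by (rule partial_kernel_conv[OF half_line_kernels(2) that])
  have sm: "smooth_on UNIV \<phi>" unfolding \<phi>_def half_line_moment_def by (rule smooth_on_kernel_conv[OF
      half_line_kernels(2) t(1)])
  have K22: "half_line_moment (partial 2 (partial 2 f)) x = f x" if "f \<in> test_functions UNIV" for f
      x
    unfolding half_line_moment_partial[OF test_functions_partial[OF that]] half_line_partial[OF
        that] ..
  have p: "partial j (partial i \<phi>) = half_line_moment (partial j (partial i f11))" for i j
    unfolding \<phi>_def pK[OF t(1)] pK[OF test_functions_partial[OF t(1)]] ..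
  have c: "partial 2 (partial 1 f) = partial 1 (partial 2 f)" if "f \<in> test_functions UNIV" for f
    by (rule test_partial_commute[OF that])
  have "partial 2 (partial 2 \<phi>) x = f11 x" for x unfolding p K22[OF t(1)] ..
  moreover have p12: "partial 2 (partial 1 \<phi>) x = - f12 x" for x
  proof -
    have "partial 2 (partial 1 f11) = (\<lambda>x. - partial 2 (partial 2 f12) x)"
      unfolding d1 um[OF test_functions_partial[OF t(2)]] ..
    then show ?thesis unfolding p half_line_moment_def
      using K22[OF t(2)] by (simp add: kernel_conv_uminus half_line_moment_def)
  qed
  moreover have "partial 1 (partial 2 \<phi>) x = - f12 x" for x
    using p12 partial_commute[OF sm, of 1 2] by simp
  moreover have "partial 1 (partial 1 \<phi>) x = f22 x" for x
  proof -
    have "partial 1 (partial 1 f11) = (\<lambda>x. - partial 1 (partial 2 f12) x)"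
      unfolding d1 um[OF test_functions_partial[OF t(2)]] ..
    also have "partial 1 (partial 2 f12) = partial 2 (partial 1 f12)" using c[OF t(2)] by simp
    also have "partial 2 (partial 1 f12) = (\<lambda>x. - partial 2 (partial 2 f22) x)"
      unfolding d2 um[OF test_functions_partial[OF t(3)]] ..
    finally have "partial 1 (partial 1 f11) = partial 2 (partial 2 f22)" by (simp add: fun_eq_iff)
    then show ?thesis unfolding p using K22[OF t(3)] by simp
  qed
  moreover have "\<phi> x = 0" if "x $ 2 < - R" for x
  proof -
    have z: "(indicat_real {0..} s * s) * f11 (x - vline s) = 0" for s
    proof (cases "s \<ge> 0")
      case True
      have "\<bar>(x - vline s) $ 2\<bar> \<le> norm (x - vline s)" by (rule component_le_norm_cart)
      then have "norm (x - vline s) > R" using that True by (simp add: vline_def axis_def)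
      then show ?thesis using R by simp
    qed simp
    show ?thesis by (simp only: \<phi>_def half_line_moment_def kernel_conv_def z
        Bochner_Integration.integral_zero)
  qed
  ultimately show ?thesis using sm by blast
qed

section \<open>Vanishing of the potential in the exterior, and the boundary layer\<close>

lemma zero_partials_imp_const:
  fixes f :: "real^2 \<Rightarrow> real"
  assumes "open S" "connected S" "\<And>x. x \<in> S \<Longrightarrow> f differentiable (at x)"
    and z: "\<And>i x. x \<in> S \<Longrightarrow> partial i f x = 0" and xy: "x \<in> S" "y \<in> S"
  shows "f x = f y"
proof (rule has_derivative_zero_unique_connected[OF assms(1,2) _ xy])
  show "(f has_derivative (\<lambda>h. 0)) (at x)" if "x \<in> S" for x
    using has_derivative_partial[OF assms(3)[OF that]] z[OF that] by simp
qed

text \<open>On the component of \<open>V\<close> containing \<open>z\<close> the gradient is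
  constant, hence 0, and then the function is constant. The connected set \<open>P\<close> merely
  certifies that \<open>y\<close> lies in that component.\<close>

lemma zero_second_partials:
  fixes \<phi> :: "real^2 \<Rightarrow> real"
  assumes sm: "smooth_on UNIV \<phi>" and V: "open V" and P: "connected P" "P \<subseteq> V" "y \<in> P" "z \<in> P"
    and zero: "\<And>i j x. x \<in> V \<Longrightarrow> partial i (partial j \<phi>) x = 0"
    and z: "\<phi> z = 0" "\<And>i. partial i \<phi> z = 0"
  shows "\<phi> y = 0" "\<And>i. partial i \<phi> y = 0"
proof -
  define S where "S = connected_component_set V z"
  have S: "open S" "connected S" "S \<subseteq> V" "z \<in> S" "y \<in> S"
  proof -
    show "open S" unfolding S_def by (rule open_connected_component[OF V])
    show "connected S" "S \<subseteq> V" unfolding S_def by (simp_all add: connected_component_subset)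
    have "P \<subseteq> S" unfolding S_def by (rule connected_component_maximal[OF P(4,1,2)])
    then show "z \<in> S" "y \<in> S" using P(3,4) by auto
  qed
  have d: "partial i \<phi> differentiable (at x)" "\<phi> differentiable (at x)" for i x
    using sm by (auto intro: smooth_on_differentiable[of UNIV] smooth_on_partial)
  have p: "partial i \<phi> x = 0" if "x \<in> S" for i x
    using zero_partials_imp_const[OF S(1,2) d(1)[of i], of x z] zero S that z by auto
  then show "\<And>i. partial i \<phi> y = 0" using S by blast
  show "\<phi> y = 0" using zero_partials_imp_const[OF S(1,2) d(2), of y z] p S z by auto
qed

text \<open>Such cutoffs exist for every open set, whatever its boundary, with one constant for all
  widths: a set determined by the distance to the complement is smoothed at the scale of that
  distance.\<close>

lemma ex_interior_cutoff:
  assumes \<Omega>: "open \<Omega>" "bounded \<Omega>"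
  shows "\<exists>C>0. \<forall>e>0. \<exists>\<theta>\<in>test_functions \<Omega>. (\<forall>x. 0 \<le> \<theta> x \<and> \<theta> x \<le> 1) \<and> (\<forall>i x. \<bar>partial i \<theta> x\<bar> \<le> C / e)
      \<and>
     (\<forall>i j x. \<bar>partial i (partial j \<theta>) x\<bar> \<le> C / e\<^sup>2) \<and>
     (\<forall>x. ball x (4 * e) \<subseteq> \<Omega> \<longrightarrow> \<theta> x = 1 \<and> (\<forall>i. partial i \<theta> x = 0) \<and> (\<forall>i j. partial i (partial j \<theta>) x
         = 0))"
proof -
  obtain C where C0: "C > 0 \<and> (\<forall>e>0. \<forall>S\<in>sets borel. \<exists>\<theta>::real^2 \<Rightarrow> real. smooth_on UNIV \<theta> \<and> (\<forall>x. 0 \<le> \<theta>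
      x \<and> \<theta> x \<le> 1) \<and>
     (\<forall>x. ball x e \<subseteq> S \<longrightarrow> \<theta> x = 1) \<and> (\<forall>x. ball x e \<inter> S = {} \<longrightarrow> \<theta> x = 0) \<and>
     (\<forall>i x. \<bar>partial i \<theta> x\<bar> \<le> C / e) \<and> (\<forall>i j x. \<bar>partial i (partial j \<theta>) x\<bar> \<le> C / e\<^sup>2))"
    using ex_cutoff by (rule exE)
  note C = conjunct1[OF C0] and ex = conjunct2[OF C0, rule_format]
  show ?thesis
  proof (intro exI[of _ C] conjI allI impI C)
    fix e :: real assume e: "e > 0"
    \<comment> \<open>Points at distance at least 2e from the complement. Smoothing at scale e gives
      0 within e of the complement, 1 where the ball of radius 3e fits into \<Omega>, and vanishing
      derivatives one further e inside.\<close>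
    define S where "S = - (\<Union>z\<in>- \<Omega>. ball z (2 * e))"
    have "closed S" unfolding S_def by (intro closed_Compl open_UN ballI open_ball)
    then have "S \<in> sets borel" by simp
    from ex[OF e this] obtain \<theta> :: "real^2 \<Rightarrow> real" where \<theta>0: "smooth_on UNIV \<theta> \<and> (\<forall>x. 0 \<le> \<theta> x \<and> \<theta> x
        \<le> 1) \<and>
     (\<forall>x. ball x e \<subseteq> S \<longrightarrow> \<theta> x = 1) \<and> (\<forall>x. ball x e \<inter> S = {} \<longrightarrow> \<theta> x = 0) \<and>
     (\<forall>i x. \<bar>partial i \<theta> x\<bar> \<le> C / e) \<and> (\<forall>i j x. \<bar>partial i (partial j \<theta>) x\<bar> \<le> C / e\<^sup>2)"
      by (rule exE)
    note \<theta> = \<theta>0[THEN conjunct1, rule_format]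
      \<theta>0[THEN conjunct2, THEN conjunct1, rule_format]
      \<theta>0[THEN conjunct2, THEN conjunct2, THEN conjunct1, rule_format]
      \<theta>0[THEN conjunct2, THEN conjunct2, THEN conjunct2, THEN conjunct1, rule_format]
      \<theta>0[THEN conjunct2, THEN conjunct2, THEN conjunct2, THEN conjunct2, THEN conjunct1,
          rule_format]
      \<theta>0[THEN conjunct2, THEN conjunct2, THEN conjunct2, THEN conjunct2, THEN conjunct2,
          rule_format]
    have t: "\<theta> \<in> test_functions \<Omega>"
    proof (rule test_functionsI[OF \<theta>(1)])
      let ?K = "- (\<Union>z\<in>- \<Omega>. ball z e)"
      have sub: "?K \<subseteq> \<Omega>" using e by force
      have "closed ?K" by (intro closed_Compl open_UN ballI open_ball)
      then show "compact ?K" using bounded_subset[OF \<Omega>(2) sub] by (simp add: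
          compact_eq_bounded_closed)
      show "?K \<subseteq> \<Omega>" by (rule sub)
      show "\<theta> x = 0" if nK: "x \<notin> ?K" for x
      proof (rule \<theta>(4))
        obtain z where z: "z \<notin> \<Omega>" "dist z x < e" using nK by auto
        have "dist z y < 2 * e" if "dist x y < e" for y using z(2) that dist_triangle[of z y x] by
            linarith
        then have "y \<notin> S" if "dist x y < e" for y using that z(1) unfolding S_def by auto
        then show "ball x e \<inter> S = {}" by auto
      qed
    qed
    have one: "\<theta> x = 1" if "ball x (3 * e) \<subseteq> \<Omega>" for x
    proof (rule \<theta>(3), rule subsetI)
      fix y assume y: "y \<in> ball x e"
      show "y \<in> S"
      proof (rule ccontr)
        assume "y \<notin> S"
        then obtain z where z: "z \<notin> \<Omega>" "dist z y < 2 * e" by (auto simp: S_def)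
        have "dist x z < 3 * e" using y z(2) dist_triangle[of x z y] by (simp add: dist_commute)
        then show False using that z(1) by auto
      qed
    qed
    have one': "\<theta> x = 1 \<and> (\<forall>i. partial i \<theta> x = 0) \<and> (\<forall>i j. partial i (partial j \<theta>) x = 0)" if x:
        "ball x (4 * e) \<subseteq> \<Omega>" for x
    proof -
      have o: "\<theta> y = 1" if "y \<in> ball x e" for y
      proof (rule one, rule subsetI)
        fix u assume "u \<in> ball y (3 * e)"
        then have "u \<in> ball x (4 * e)" using that dist_triangle[of x u y] by simp
        then show "u \<in> \<Omega>" using x by blast
      qed
      have p: "partial i \<theta> y = 0" if "y \<in> ball x e" for i y
        using partial_cong_open[OF open_ball that, of \<theta> "\<lambda>_. 1" i] o by simp
      have "partial i (partial j \<theta>) y = 0" if "y \<in> ball x e" for i j y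
        using partial_cong_open[OF open_ball that, of "partial j \<theta>" "\<lambda>_. 0" i] p by simp
      then show ?thesis using o p e by simp
    qed
    show "\<exists>\<theta>\<in>test_functions \<Omega>. (\<forall>x. 0 \<le> \<theta> x \<and> \<theta> x \<le> 1) \<and> (\<forall>i x. \<bar>partial i \<theta> x\<bar> \<le> C / e) \<and>
     (\<forall>i j x. \<bar>partial i (partial j \<theta>) x\<bar> \<le> C / e\<^sup>2) \<and>
     (\<forall>x. ball x (4 * e) \<subseteq> \<Omega> \<longrightarrow> \<theta> x = 1 \<and> (\<forall>i. partial i \<theta> x = 0) \<and> (\<forall>i j. partial i (partial j \<theta>) x
         = 0))"
      using t \<theta>(2,5,6) one' by blast
  qed
qed

text \<open>A layer point is within 4e of the boundary, and the boundary within e of the net. The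
  net is finite because an approximate potential vanishes at a given exterior point only from some
  index on; finitely many points share one index.\<close>

lemma ex_exterior_net:
  fixes \<Omega> :: "(real^2) set"
  assumes \<Omega>: "open \<Omega>" "bounded \<Omega>" and fr: "frontier \<Omega> \<subseteq> closure (- closure \<Omega>)" and e: "e > 0"
  obtains Y where "finite Y" "Y \<subseteq> - closure \<Omega>" "\<And>x. x \<in> \<Omega> \<Longrightarrow> \<not> ball x (4 * e) \<subseteq> \<Omega> \<Longrightarrow> \<exists>y\<in>Y. dist x y <
      5 * e"
proof -
  have "compact (frontier \<Omega>)" using \<Omega> by (simp add: compact_frontier_bounded)
  moreover have "frontier \<Omega> \<subseteq> (\<Union>y\<in>- closure \<Omega>. ball y e)"
  proof
    fix p assume "p \<in> frontier \<Omega>"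
    then have "p \<in> closure (- closure \<Omega>)" using fr by blast
    then obtain y where "y \<in> - closure \<Omega>" "dist y p < e" using e closure_approachable by blast
    then show "p \<in> (\<Union>y\<in>- closure \<Omega>. ball y e)" by auto
  qed
  ultimately obtain Y where Y: "Y \<subseteq> - closure \<Omega>" "finite Y" "frontier \<Omega> \<subseteq> (\<Union>y\<in>Y. ball y e)"
    using compactE_image[of "frontier \<Omega>" "- closure \<Omega>" "\<lambda>y. ball y e"] by auto
  show ?thesis
  proof (rule that[OF Y(2,1)])
    fix x assume x: "x \<in> \<Omega>" "\<not> ball x (4 * e) \<subseteq> \<Omega>"
    have "ball x (4 * e) \<inter> frontier \<Omega> \<noteq> {}"
    proof (rule connected_Int_frontier[OF connected_ball])
      show "ball x (4 * e) \<inter> \<Omega> \<noteq> {}" using x(1) e by force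
      show "ball x (4 * e) - \<Omega> \<noteq> {}" using x(2) by blast
    qed
    then obtain p where p: "dist x p < 4 * e" "p \<in> frontier \<Omega>" by auto
    obtain y where y: "y \<in> Y" "dist y p < e" using p(2) Y(3) by auto
    have "dist x y < 5 * e" using p(1) y(2) dist_triangle[of x y p] by (simp add: dist_commute)
    then show "\<exists>y\<in>Y. dist x y < 5 * e" using y(1) by blast
  qed
qed

text \<open>A path to \<open>z\<close> in the exterior is compact, hence at positive distance from
  the closure of \<Omega>. Mollification at a smaller scale therefore leaves the field zero along
  the whole path, which propagates the vanishing of the potential from \<open>z\<close>.\<close>

lemma ex_exterior_chains:
  fixes \<Omega> :: "(real^2) set"
  assumes \<Omega>: "bounded \<Omega>" and c: "connected (- closure \<Omega>)" and z: "z \<in> - closure \<Omega>"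
    and Y: "finite Y" "Y \<subseteq> - closure \<Omega>"
  obtains d where "d > 0" "\<And>y. y \<in> Y \<Longrightarrow> \<exists>P. connected P \<and> y \<in> P \<and> z \<in> P \<and> (\<forall>u\<in>P. \<forall>w\<in>\<Omega>. d \<le> dist u w)"
proof -
  have pc: "path_connected (- closure \<Omega>)"
    using c by (intro connected_open_path_connected) auto
  define Q where "Q y d \<longleftrightarrow> (\<exists>P. connected P \<and> y \<in> P \<and> z \<in> P \<and> (\<forall>u\<in>P. \<forall>w\<in>\<Omega>. d \<le> dist u w))" for y and
      d :: real
  have "\<exists>d>0. Q y d" if y: "y \<in> Y" for y
  proof -
    have "y \<in> - closure \<Omega>" using y Y(2) by blast
    then obtain g where g: "path g" "path_image g \<subseteq> - closure \<Omega>" "pathstart g = y" "pathfinish g =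
        z"
      using pc z unfolding path_connected_def by blast
    have "path_image g \<inter> closure \<Omega> = {}" using g(2) by blast
    from separate_compact_closed[OF compact_path_image[OF g(1)] closed_closure this]
    obtain d where d: "d > 0" "\<forall>u\<in>path_image g. \<forall>w\<in>closure \<Omega>. d \<le> dist u w" by (elim exE conjE)
        (rule that)
    have "connected (path_image g)" by (rule connected_path_image[OF g(1)])
    moreover have "y \<in> path_image g" "z \<in> path_image g" using g(3,4) pathstart_in_path_image
        pathfinish_in_path_image by metis+
    moreover have "\<forall>u\<in>path_image g. \<forall>w\<in>\<Omega>. d \<le> dist u w" using d(2) closure_subset[of \<Omega>] by blast
    ultimately have "Q y d" unfolding Q_def by (intro exI[of _ "path_image g"] conjI)
    then show ?thesis using d(1) by blast
  qed
  then obtain D where D: "\<And>y. y \<in> Y \<Longrightarrow> D y > 0 \<and> Q y (D y)" by metis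
  define d where "d = Min (insert 1 (D ` Y))"
  have "d > 0" using Y(1) D by (auto simp: d_def)
  moreover have "\<exists>P. connected P \<and> y \<in> P \<and> z \<in> P \<and> (\<forall>u\<in>P. \<forall>w\<in>\<Omega>. d \<le> dist u w)" if y: "y \<in> Y" for y
  proof -
    have dD: "d \<le> D y" using y Y(1) by (auto simp: d_def)
    obtain P where P: "connected P" "y \<in> P" "z \<in> P" "\<forall>u\<in>P. \<forall>w\<in>\<Omega>. D y \<le> dist u w"
      using D[OF y] unfolding Q_def by (elim conjE exE) (rule that)
    have "\<forall>u\<in>P. \<forall>w\<in>\<Omega>. d \<le> dist u w" using P(4) dD by (meson order_trans)
    then show ?thesis using P(1-3) by (intro exI[of _ P] conjI)
  qed
  ultimately show ?thesis by (rule that)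
qed

section \<open>The energy argument\<close>

text \<open>Mollifying the weakly divergence-free extension by zero gives smooth, compactly
  supported, divergence-free fields, to which \<open>ex_airy_potential\<close> applies. The bound
  \<open>M\<close> survives averaging for every \<open>d\<close>, so the second derivatives of the
  potentials are bounded uniformly.\<close>

lemma mollified_airy_potential:
  assumes \<Omega>: "open \<Omega>" "\<Omega> \<subseteq> ball 0 R0"
    and cs: "continuous_on \<Omega> s11" "continuous_on \<Omega> s12" "continuous_on \<Omega> s22"
    and bs: "\<And>x. x \<in> \<Omega> \<Longrightarrow> \<bar>s11 x\<bar> \<le> M" "\<And>x. x \<in> \<Omega> \<Longrightarrow> \<bar>s12 x\<bar> \<le> M" "\<And>x. x \<in> \<Omega> \<Longrightarrow> \<bar>s22 x\<bar> \<le> M" "M \<ge> 0"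
    and wd: "\<And>w. w \<in> test_functions UNIV \<Longrightarrow> (\<integral>x. indicat_real \<Omega> x * (s11 x * partial 1 w x + s12 x *
        partial 2 w x) \<partial>lborel) = 0"
      "\<And>w. w \<in> test_functions UNIV \<Longrightarrow> (\<integral>x. indicat_real \<Omega> x * (s12 x * partial 1 w x + s22 x *
          partial 2 w x) \<partial>lborel) = 0"
    and d: "0 < d" "d \<le> 1"
  shows "\<exists>f11 f12 f22 \<phi>. smooth_on UNIV \<phi> \<and> (\<forall>x. partial 2 (partial 2 \<phi>) x = f11 x \<and> partial 1
      (partial 2 \<phi>) x = - f12 x \<and>
     partial 2 (partial 1 \<phi>) x = - f12 x \<and> partial 1 (partial 1 \<phi>) x = f22 x) \<and> (\<forall>x. x $ 2 < - (R0 +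
         1) \<longrightarrow> \<phi> x = 0) \<and>
     (\<forall>x. \<bar>f11 x\<bar> \<le> M \<and> \<bar>f12 x\<bar> \<le> M \<and> \<bar>f22 x\<bar> \<le> M) \<and>
     (\<forall>x. ball x d \<inter> \<Omega> = {} \<longrightarrow> f11 x = 0 \<and> f12 x = 0 \<and> f22 x = 0) \<and>
     (\<forall>x \<eta>. ball x d \<subseteq> \<Omega> \<and> (\<forall>y\<in>ball x d. \<bar>s11 y - s11 x\<bar> \<le> \<eta> \<and> \<bar>s12 y - s12 x\<bar> \<le> \<eta> \<and> \<bar>s22 y - s22 x\<bar>
         \<le> \<eta>) \<longrightarrow>
        \<bar>f11 x - s11 x\<bar> \<le> \<eta> \<and> \<bar>f12 x - s12 x\<bar> \<le> \<eta> \<and> \<bar>f22 x - s22 x\<bar> \<le> \<eta>)"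
proof -
  obtain \<eta> where \<eta>: "\<eta> \<in> test_functions UNIV" "\<And>x. \<eta> x \<ge> 0" "\<And>x. norm x \<ge> d \<Longrightarrow> \<eta> x = 0"
        "integral\<^sup>L lborel \<eta> = 1"
    using ex_scaled_mollifier d(1) by metis
  have [measurable]: "\<eta> \<in> borel_measurable borel"
    using continuous_test_function[OF \<eta>(1)] by (rule borel_measurable_continuous_onI)
  have one: "(\<integral>y. \<eta> (x - y) \<partial>lborel) = 1" for x
    using integral_reflect[of \<eta> x] \<eta>(4) by simp
  have \<eta>i: "integrable lborel (\<lambda>y. 1 * \<eta> (x - y))" for x
    by (rule kernel_conv_integrable[OF locally_integrable_bounded[of _ 1] \<eta>(1)]) auto
  define t where "t s x = indicat_real \<Omega> x * s x" for s x
  define m where "m s = convolve (t s) \<eta>" for s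
  have tm: "t s \<in> borel_measurable borel" if "continuous_on \<Omega> s" for s
  proof -
    have "(\<lambda>x. indicat_real \<Omega> x *\<^sub>R s x) \<in> borel_measurable borel"
      using \<Omega>(1) that by (intro borel_measurable_continuous_on_indicator) auto
    then show ?thesis by (simp add: t_def[abs_def])
  qed
  have tb: "\<bar>t s x\<bar> \<le> M" if "\<And>x. x \<in> \<Omega> \<Longrightarrow> \<bar>s x\<bar> \<le> M" for s x
    using that bs(4) by (simp add: t_def indicator_def)
  have mb: "\<bar>m s x\<bar> \<le> M" if "continuous_on \<Omega> s" "\<And>x. x \<in> \<Omega> \<Longrightarrow> \<bar>s x\<bar> \<le> M" for s x
    using convolve_bound[OF tm[OF that(1)] tb[OF that(2)] \<eta>(1), of x] \<eta>(2,4) by (simp add: m_def)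
  have mz: "m s x = 0" if x: "ball x d \<inter> \<Omega> = {}" for s x
  proof -
    have "t s y * \<eta> (x - y) = 0" for y
    proof (cases "dist x y < d")
      case True
      then have "y \<notin> \<Omega>" using x by auto
      then show ?thesis by (simp add: t_def)
    qed (simp add: \<eta>(3) dist_norm)
    then show ?thesis unfolding m_def kernel_conv_def by (simp only:
        Bochner_Integration.integral_zero)
  qed
  have mz': "m s x = 0" if "norm x > R0 + 1" for s x
  proof (rule mz)
    have "dist x y \<ge> d" if "norm y < R0" for y
      using norm_triangle_ineq2[of x y] \<open>norm x > R0 + 1\<close> that d(2) by (simp add: dist_norm)
    then show "ball x d \<inter> \<Omega> = {}" using \<Omega>(2) by (fastforce simp: subset_iff)
  qed
  have li: "locally_integrable (t s)" if "continuous_on \<Omega> s" "\<And>x. x \<in> \<Omega> \<Longrightarrow> \<bar>s x\<bar> \<le> M" for s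
    using locally_integrable_bounded[OF tm[OF that(1)] tb[OF that(2)]] .
  have mt: "m s \<in> test_functions UNIV" if "continuous_on \<Omega> s" "\<And>x. x \<in> \<Omega> \<Longrightarrow> \<bar>s x\<bar> \<le> M" for s
    unfolding test_functions_UNIV_iff using smooth_on_kernel_conv[OF li[OF that] \<eta>(1)] mz' by (auto
        simp: m_def[symmetric])
  have ma: "\<bar>m s x - s x\<bar> \<le> h" if s: "continuous_on \<Omega> s" "\<And>x. x \<in> \<Omega> \<Longrightarrow> \<bar>s x\<bar> \<le> M"
      and x: "ball x d \<subseteq> \<Omega>" "\<And>y. y \<in> ball x d \<Longrightarrow> \<bar>s y - s x\<bar> \<le> h" for s x h
  proof -
    have i: "integrable lborel (\<lambda>y. t s y * \<eta> (x - y))" by (rule kernel_conv_integrable[OF li[OF s]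
        \<eta>(1)])
    have i2: "integrable lborel (\<lambda>y. s x * \<eta> (x - y))" "integrable lborel (\<lambda>y. h * \<eta> (x - y))" using
        \<eta>i[of x] by simp_all
    have "m s x - s x = (\<integral>y. t s y * \<eta> (x - y) \<partial>lborel) - (\<integral>y. s x * \<eta> (x - y) \<partial>lborel)"
      by (simp add: m_def kernel_conv_def one)
    also have "\<dots> = (\<integral>y. t s y * \<eta> (x - y) - s x * \<eta> (x - y) \<partial>lborel)"
      by (rule Bochner_Integration.integral_diff[OF i i2(1), symmetric])
    finally have "\<bar>m s x - s x\<bar> \<le> (\<integral>y. \<bar>t s y * \<eta> (x - y) - s x * \<eta> (x - y)\<bar> \<partial>lborel)"
      using integral_norm_bound[of lborel "\<lambda>y. t s y * \<eta> (x - y) - s x * \<eta> (x - y)"] by simp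
    also have "\<dots> \<le> (\<integral>y. h * \<eta> (x - y) \<partial>lborel)"
    proof (rule integral_mono)
      show "integrable lborel (\<lambda>y. \<bar>t s y * \<eta> (x - y) - s x * \<eta> (x - y)\<bar>)" using i i2 by simp
      show "integrable lborel (\<lambda>y. h * \<eta> (x - y))" by (rule i2)
      fix y
      show "\<bar>t s y * \<eta> (x - y) - s x * \<eta> (x - y)\<bar> \<le> h * \<eta> (x - y)"
      proof (cases "dist x y < d")
        case True
        then have y: "y \<in> ball x d" by simp
        then have "t s y = s y" using x(1) by (auto simp: t_def)
        moreover have "\<bar>s y - s x\<bar> * \<eta> (x - y) \<le> h * \<eta> (x - y)" using x(2)[OF y] \<eta>(2) by (intro
            mult_right_mono) auto
        ultimately show ?thesis using \<eta>(2)[of "x - y"] by (simp add: left_diff_distrib[symmetric]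
            abs_mult)
      qed (simp add: \<eta>(3) dist_norm)
    qed
    also have "\<dots> = h" by (simp add: one)
    finally show ?thesis .
  qed
  have divm: "partial 1 (m s) x + partial 2 (m s') x = 0"
    if s: "continuous_on \<Omega> s" "\<And>x. x \<in> \<Omega> \<Longrightarrow> \<bar>s x\<bar> \<le> M" and s': "continuous_on \<Omega> s'" "\<And>x. x \<in> \<Omega> \<Longrightarrow> \<bar>s'
        x\<bar> \<le> M"
      and w: "\<And>w. w \<in> test_functions UNIV \<Longrightarrow> (\<integral>x. indicat_real \<Omega> x * (s x * partial 1 w x + s' x *
          partial 2 w x) \<partial>lborel) = 0" for s s' x
  proof -
    \<comment> \<open>Testing the weak identity with this translate of the reflected mollifier
      yields minus the divergence of the mollified field at \<open>x\<close>.\<close>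
    define v where "v = (\<lambda>y. \<eta> (x + (-1) *\<^sub>R y))"
    have v: "v \<in> test_functions UNIV" unfolding v_def by (rule test_functions_affine_compose[OF
        \<eta>(1)]) simp
    have pv: "partial i v y = - partial i \<eta> (x - y)" for i y
      unfolding v_def using partial_affine_compose[OF test_functions_differentiable[OF \<eta>(1)], where
          c = x and s = "-1" and x = y] by simp
    have l1: "locally_integrable (t s)" using s by (rule li)
    have l2: "locally_integrable (t s')" using s' by (rule li)
    have i: "integrable lborel (\<lambda>y. t s y * partial 1 \<eta> (x - y))" "integrable lborel (\<lambda>y. t s' y *
        partial 2 \<eta> (x - y))"
      by (rule kernel_conv_integrable[OF l1 test_functions_partial[OF \<eta>(1)]]
          kernel_conv_integrable[OF l2 test_functions_partial[OF \<eta>(1)]])+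
    have "partial 1 (m s) x + partial 2 (m s') x = (\<integral>y. t s y * partial 1 \<eta> (x - y) \<partial>lborel) + (\<integral>y.
        t s' y * partial 2 \<eta> (x - y) \<partial>lborel)"
      unfolding m_def partial_kernel_conv[OF l1 \<eta>(1)] partial_kernel_conv[OF l2 \<eta>(1)]
      unfolding kernel_conv_def ..
    also have "\<dots> = (\<integral>y. t s y * partial 1 \<eta> (x - y) + t s' y * partial 2 \<eta> (x - y) \<partial>lborel)"
      by (rule Bochner_Integration.integral_add[OF i, symmetric])
    also have "\<dots> = - (\<integral>y. indicat_real \<Omega> y * (s y * partial 1 v y + s' y * partial 2 v y) \<partial>lborel)"
      unfolding pv Bochner_Integration.integral_minus[symmetric]
      by (intro Bochner_Integration.integral_cong refl) (simp add: t_def algebra_simps)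
    finally show ?thesis using w[OF v] by simp
  qed
  obtain \<phi> where \<phi>: "smooth_on UNIV \<phi>" "\<forall>x. partial 2 (partial 2 \<phi>) x = m s11 x \<and> partial 1 (partial
      2 \<phi>) x = - m s12 x \<and>
     partial 2 (partial 1 \<phi>) x = - m s12 x \<and> partial 1 (partial 1 \<phi>) x = m s22 x" "\<forall>x. x $ 2 < - (R0
         + 1) \<longrightarrow> \<phi> x = 0"
  proof -
    have "\<exists>\<phi>. smooth_on UNIV \<phi> \<and> (\<forall>x. partial 2 (partial 2 \<phi>) x = m s11 x \<and> partial 1 (partial 2 \<phi>)
        x = - m s12 x \<and>
     partial 2 (partial 1 \<phi>) x = - m s12 x \<and> partial 1 (partial 1 \<phi>) x = m s22 x) \<and> (\<forall>x. x $ 2 < -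
         (R0 + 1) \<longrightarrow> \<phi> x = 0)"
    proof (rule ex_airy_potential)
      show "m s11 \<in> test_functions UNIV" using cs(1) bs(1) by (rule mt)
      show "m s12 \<in> test_functions UNIV" using cs(2) bs(2) by (rule mt)
      show "m s22 \<in> test_functions UNIV" using cs(3) bs(3) by (rule mt)
      show "m s11 x = 0" if "norm x > R0 + 1" for x using that by (rule mz')
      show "partial 1 (m s11) x + partial 2 (m s12) x = 0" for x using cs(1) bs(1) cs(2) bs(2) wd(1)
          by (rule divm)
      show "partial 1 (m s12) x + partial 2 (m s22) x = 0" for x using cs(2) bs(2) cs(3) bs(3) wd(2)
          by (rule divm)
    qed
    then show ?thesis by (elim exE conjE) (rule that)
  qed
  show ?thesis
  proof (rule exI[of _ "m s11"], rule exI[of _ "m s12"], rule exI[of _ "m s22"], rule exI[of _ \<phi>],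
      intro conjI)
    show "smooth_on UNIV \<phi>" by (rule \<phi>(1))
    show "\<forall>x. partial 2 (partial 2 \<phi>) x = m s11 x \<and> partial 1 (partial 2 \<phi>) x = - m s12 x \<and>
     partial 2 (partial 1 \<phi>) x = - m s12 x \<and> partial 1 (partial 1 \<phi>) x = m s22 x" by (rule \<phi>(2))
    show "\<forall>x. x $ 2 < - (R0 + 1) \<longrightarrow> \<phi> x = 0" by (rule \<phi>(3))
    show "\<forall>x. \<bar>m s11 x\<bar> \<le> M \<and> \<bar>m s12 x\<bar> \<le> M \<and> \<bar>m s22 x\<bar> \<le> M"
      by (intro allI conjI mb cs bs)
    show "\<forall>x. ball x d \<inter> \<Omega> = {} \<longrightarrow> m s11 x = 0 \<and> m s12 x = 0 \<and> m s22 x = 0"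
      using mz by blast
    show "\<forall>x \<eta>. ball x d \<subseteq> \<Omega> \<and> (\<forall>y\<in>ball x d. \<bar>s11 y - s11 x\<bar> \<le> \<eta> \<and> \<bar>s12 y - s12 x\<bar> \<le> \<eta> \<and> \<bar>s22 y -
        s22 x\<bar> \<le> \<eta>) \<longrightarrow>
        \<bar>m s11 x - s11 x\<bar> \<le> \<eta> \<and> \<bar>m s12 x - s12 x\<bar> \<le> \<eta> \<and> \<bar>m s22 x - s22 x\<bar> \<le> \<eta>"
    proof (intro allI impI, elim conjE)
      fix x h assume x: "ball x d \<subseteq> \<Omega>" "\<forall>y\<in>ball x d. \<bar>s11 y - s11 x\<bar> \<le> h \<and> \<bar>s12 y - s12 x\<bar> \<le> h \<and>
          \<bar>s22 y - s22 x\<bar> \<le> h"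
      show "\<bar>m s11 x - s11 x\<bar> \<le> h \<and> \<bar>m s12 x - s12 x\<bar> \<le> h \<and> \<bar>m s22 x - s22 x\<bar> \<le> h"
        by (intro conjI ma[OF cs(1) bs(1) x(1)] ma[OF cs(2) bs(2) x(1)] ma[OF cs(3) bs(3) x(1)])
            (use x(2) in blast)+
    qed
  qed
qed

lemma partial_partial_mult:
  fixes f g :: "real^2 \<Rightarrow> real"
  assumes "smooth_on UNIV f" "smooth_on UNIV g"
  shows "partial i (partial j (\<lambda>x. f x * g x)) x = f x * partial i (partial j g) x + partial i f x *
      partial j g x
     + (partial j f x * partial i g x + partial i (partial j f) x * g x)"
proof -
  have d: "f differentiable (at x)" "g differentiable (at x)" "partial j f differentiable (at x)"
      "partial j g differentiable (at x)" for x
    using assms by (auto intro: smooth_on_differentiable[of UNIV] smooth_on_partial)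
  have "partial j (\<lambda>x. f x * g x) = (\<lambda>x. f x * partial j g x + partial j f x * g x)"
    by (rule ext) (rule partial_mult[OF d(1,2)])
  then show ?thesis
    using partial_add[OF differentiable_mult[OF d(1,4)] differentiable_mult[OF d(3,2)], of i x]
    by (simp only: partial_mult[OF d(1,4)] partial_mult[OF d(3,2)])
qed

text \<open>Two integrations from \<open>y\<close>: each component of the gradient is Lipschitz with
  constant 2M, and the two components together bound the derivative of the function by 4Mr on the
  ball.\<close>

lemma gradient_bound_near_zero:
  fixes \<phi> :: "real^2 \<Rightarrow> real"
  assumes sm: "smooth_on UNIV \<phi>" and b: "\<And>i j x. \<bar>partial i (partial j \<phi>) x\<bar> \<le> M"
    and y: "\<phi> y = 0" "\<And>i. partial i \<phi> y = 0" and x: "dist x y < r" and M: "M \<ge> 0"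
  shows "\<bar>partial i \<phi> x\<bar> \<le> 2 * M * r" "\<bar>\<phi> x\<bar> \<le> 4 * M * r\<^sup>2"
proof -
  have r: "r > 0" using x zero_le_dist[of x y] by linarith
  have d: "\<phi> differentiable (at x)" "partial i \<phi> differentiable (at x)" for i x
    using sm by (auto intro: smooth_on_differentiable[of UNIV] smooth_on_partial)
  have p: "\<bar>partial i \<phi> z\<bar> \<le> 2 * M * r" if "dist z y < r" for i z
  proof -
    have "\<bar>partial i \<phi> z - partial i \<phi> y\<bar> \<le> 2 * M * norm (z - y)"
      by (rule partials_bound_imp_lipschitz[OF d(2) b])
    also have "\<dots> \<le> 2 * M * r" using that M by (intro mult_left_mono) (auto simp: dist_norm)
    finally show ?thesis using y(2) by simp
  qed
  then show "\<bar>partial i \<phi> x\<bar> \<le> 2 * M * r" using x by blast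
  have "norm (\<phi> x - \<phi> y) \<le> (4 * M * r) * norm (x - y)"
  proof (rule differentiable_bound[OF convex_ball[of y r]])
    fix z assume z: "z \<in> ball y r"
    show "(\<phi> has_derivative (\<lambda>h::real^2. h $ 1 *\<^sub>R partial 1 \<phi> z + h $ 2 *\<^sub>R partial 2 \<phi> z)) (at z
        within ball y r)"
      by (rule has_derivative_at_withinI[OF has_derivative_partial[OF d(1)]])
    show "onorm (\<lambda>h::real^2. h $ 1 *\<^sub>R partial 1 \<phi> z + h $ 2 *\<^sub>R partial 2 \<phi> z) \<le> 4 * M * r"
      using gradient_onorm_le[of "partial 1 \<phi> z" "partial 2 \<phi> z"] p[of z 1] p[of z 2] z by (simp
          add: dist_commute)
  qed (use x r in \<open>auto simp: dist_commute\<close>)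
  also have "\<dots> \<le> (4 * M * r) * r" using x M r by (intro mult_left_mono) (auto simp: dist_norm)
  finally show "\<bar>\<phi> x\<bar> \<le> 4 * M * r\<^sup>2" using y(1) by (simp add: power2_eq_square mult.assoc)
qed

text \<open>Let \<open>\<phi>\<^sub>k\<close> be the Airy potential of the mollified stress extended by zero, vanishing far below
    the
  domain. The exterior of the domain being connected, \<open>\<phi>\<^sub>k\<close> and its gradient vanish at any given
      finite
  set of exterior points for large \<open>k\<close>, so on the layer of width \<open>e\<close> one has \<open>\<nabla>\<phi>\<^sub>k = O(e)\<close> and
  \<open>\<phi>\<^sub>k = O(e\<^sup>2)\<close>. This compensates the derivatives of the cutoff in the compatibility equation
      tested
  with \<open>\<theta> \<phi>\<^sub>k\<close>.\<close>

lemma compatible_stress_eq_0: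
  fixes a11 a12 a13 a22 a23 a33 :: real
  assumes \<Omega>: "open \<Omega>" "bounded \<Omega>" and ext: "connected (- closure \<Omega>)" "frontier \<Omega> \<subseteq> closure (-
      closure \<Omega>)"
    and sm: "smooth_on \<Omega> s11" "smooth_on \<Omega> s12" "smooth_on \<Omega> s22"
    and bs: "\<And>x. x \<in> \<Omega> \<Longrightarrow> \<bar>s11 x\<bar> \<le> M" "\<And>x. x \<in> \<Omega> \<Longrightarrow> \<bar>s12 x\<bar> \<le> M" "\<And>x. x \<in> \<Omega> \<Longrightarrow> \<bar>s22 x\<bar> \<le> M" "M \<ge> 0"
    and wd: "\<And>w. w \<in> test_functions UNIV \<Longrightarrow> (\<integral>x. indicat_real \<Omega> x * (s11 x * partial 1 w x + s12 x *
        partial 2 w x) \<partial>lborel) = 0"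
      "\<And>w. w \<in> test_functions UNIV \<Longrightarrow> (\<integral>x. indicat_real \<Omega> x * (s12 x * partial 1 w x + s22 x *
          partial 2 w x) \<partial>lborel) = 0"
    and cc: "\<And>w. w \<in> test_functions \<Omega> \<Longrightarrow>
      (\<integral>x. (a11 * s11 x + a12 * s12 x + a13 * s22 x) * partial 2 (partial 2 w) x
        - (a12 * s11 x + a22 * s12 x + a23 * s22 x) * partial 1 (partial 2 w) x
        + (a13 * s11 x + a23 * s12 x + a33 * s22 x) * partial 1 (partial 1 w) x \<partial>lborel) = 0"
    and pos: "\<And>p q r. p \<noteq> 0 \<or> q \<noteq> 0 \<or> r \<noteq> 0 \<Longrightarrow>
       a11 * p * p + a22 * q * q + a33 * r * r + 2 * a12 * p * q + 2 * a13 * p * r + 2 * a23 * q * r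
           > 0"
    and x: "x \<in> \<Omega>"
  shows "s11 x = 0 \<and> s12 x = 0 \<and> s22 x = 0"
proof -
  define E1 E2 E3 where "E1 x = a11 * s11 x + a12 * s12 x + a13 * s22 x"
    and "E2 x = a12 * s11 x + a22 * s12 x + a23 * s22 x" and "E3 x = a13 * s11 x + a23 * s12 x + a33
        * s22 x" for x
  define Q where "Q x = E1 x * s11 x + E2 x * s12 x + E3 x * s22 x" for x
  define A where "A = \<bar>a11\<bar> + \<bar>a12\<bar> + \<bar>a13\<bar> + \<bar>a22\<bar> + \<bar>a23\<bar> + \<bar>a33\<bar>"
  have A0: "A \<ge> 0" by (simp add: A_def)
  have sE: "smooth_on \<Omega> E1" "smooth_on \<Omega> E2" "smooth_on \<Omega> E3"
    unfolding E1_def E2_def E3_def by (intro smooth_on_add smooth_on_mult smooth_on_const sm \<Omega>)+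
  have sQ: "smooth_on \<Omega> Q"
    unfolding Q_def by (intro smooth_on_add smooth_on_mult sE sm \<Omega>)
  have lin3: "\<bar>b * u + c * v + d * w\<bar> \<le> A * M"
    if "\<bar>b\<bar> + \<bar>c\<bar> + \<bar>d\<bar> \<le> A" "\<bar>u\<bar> \<le> M" "\<bar>v\<bar> \<le> M" "\<bar>w\<bar> \<le> M" for b c d u v w
  proof -
    have "\<bar>b * u + c * v + d * w\<bar> \<le> \<bar>b\<bar> * \<bar>u\<bar> + \<bar>c\<bar> * \<bar>v\<bar> + \<bar>d\<bar> * \<bar>w\<bar>"
      unfolding abs_mult[symmetric] by linarith
    also have "\<dots> \<le> \<bar>b\<bar> * M + \<bar>c\<bar> * M + \<bar>d\<bar> * M" using that by (intro add_mono mult_left_mono) auto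
    also have "\<dots> = (\<bar>b\<bar> + \<bar>c\<bar> + \<bar>d\<bar>) * M" by (simp add: algebra_simps)
    also have "\<dots> \<le> A * M" using that(1) bs(4) by (intro mult_right_mono) auto
    finally show ?thesis .
  qed
  have EB: "\<bar>E1 x\<bar> \<le> A * M" "\<bar>E2 x\<bar> \<le> A * M" "\<bar>E3 x\<bar> \<le> A * M" if "x \<in> \<Omega>" for x
    unfolding E1_def E2_def E3_def using bs(1)[OF that] bs(2)[OF that] bs(3)[OF that] by (intro
        lin3; simp add: A_def)+
  have prod3: "\<bar>e1 * u + e2 * v + e3 * w\<bar> \<le> 3 * (A * M) * N"
    if "\<bar>e1\<bar> \<le> A * M" "\<bar>e2\<bar> \<le> A * M" "\<bar>e3\<bar> \<le> A * M" "\<bar>u\<bar> \<le> N" "\<bar>v\<bar> \<le> N" "\<bar>w\<bar> \<le> N" for e1 e2 e3 u v w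
        N
  proof -
    have N: "N \<ge> 0" using that(4) by linarith
    have "\<bar>e1 * u + e2 * v + e3 * w\<bar> \<le> \<bar>e1\<bar> * \<bar>u\<bar> + \<bar>e2\<bar> * \<bar>v\<bar> + \<bar>e3\<bar> * \<bar>w\<bar>"
      unfolding abs_mult[symmetric] by linarith
    also have "\<dots> \<le> (A * M) * N + (A * M) * N + (A * M) * N"
      using that A0 bs(4) by (intro add_mono mult_mono) auto
    finally show ?thesis by simp
  qed
  obtain R0 where R0: "R0 > 0" "\<Omega> \<subseteq> ball 0 R0"
    using bounded_subset_ballD[OF \<Omega>(2), of 0] by auto
  define P where "P k f11 f12 f22 \<phi> \<longleftrightarrow> smooth_on UNIV \<phi> \<and> (\<forall>x. partial 2 (partial 2 \<phi>) x = f11 x \<and>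
      partial 1 (partial 2 \<phi>) x = - f12 x \<and>
     partial 2 (partial 1 \<phi>) x = - f12 x \<and> partial 1 (partial 1 \<phi>) x = f22 x) \<and> (\<forall>x. x $ 2 < - (R0 +
         1) \<longrightarrow> \<phi> x = 0) \<and>
     (\<forall>x. \<bar>f11 x\<bar> \<le> M \<and> \<bar>f12 x\<bar> \<le> M \<and> \<bar>f22 x\<bar> \<le> M) \<and>
     (\<forall>x. ball x (1 / Suc k) \<inter> \<Omega> = {} \<longrightarrow> f11 x = 0 \<and> f12 x = 0 \<and> f22 x = 0) \<and>
     (\<forall>x \<eta>. ball x (1 / Suc k) \<subseteq> \<Omega> \<and> (\<forall>y\<in>ball x (1 / Suc k). \<bar>s11 y - s11 x\<bar> \<le> \<eta> \<and> \<bar>s12 y - s12 x\<bar> \<le>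
         \<eta> \<and> \<bar>s22 y - s22 x\<bar> \<le> \<eta>) \<longrightarrow>
        \<bar>f11 x - s11 x\<bar> \<le> \<eta> \<and> \<bar>f12 x - s12 x\<bar> \<le> \<eta> \<and> \<bar>f22 x - s22 x\<bar> \<le> \<eta>)"
    for k :: nat and f11 f12 f22 \<phi> :: "real^2 \<Rightarrow> real"
  have "\<exists>f11 f12 f22 \<phi>. P k f11 f12 f22 \<phi>" for k
    unfolding P_def using smooth_on_continuous_on[OF sm(1)] smooth_on_continuous_on[OF sm(2)]
        smooth_on_continuous_on[OF sm(3)]
    by (intro mollified_airy_potential[OF \<Omega>(1) R0(2) _ _ _ bs wd]) auto
  then obtain f1 f2 f3 \<phi> where PP: "\<And>k. P k (f1 k) (f2 k) (f3 k) (\<phi> k)" by metis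
  note P' = PP[unfolded P_def]
  note \<phi>s = P'[THEN conjunct1]
    and \<phi>p = P'[THEN conjunct2, THEN conjunct1, rule_format]
    and \<phi>z = P'[THEN conjunct2, THEN conjunct2, THEN conjunct1, rule_format]
    and fM = P'[THEN conjunct2, THEN conjunct2, THEN conjunct2, THEN conjunct1, rule_format]
    and fz = P'[THEN conjunct2, THEN conjunct2, THEN conjunct2, THEN conjunct2, THEN conjunct1,
        rule_format]
    and fa = P'[THEN conjunct2, THEN conjunct2, THEN conjunct2, THEN conjunct2, THEN conjunct2,
        rule_format]
  have fs: "smooth_on UNIV (f1 k)" "smooth_on UNIV (f2 k)" "smooth_on UNIV (f3 k)" for k
  proof -
    have "f1 k = partial 2 (partial 2 (\<phi> k))" "f3 k = partial 1 (partial 1 (\<phi> k))" using \<phi>p[of k] by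
        (auto simp: fun_eq_iff)
    then show "smooth_on UNIV (f1 k)" "smooth_on UNIV (f3 k)" using \<phi>s by (simp_all add:
        smooth_on_partial)
    have "f2 k = (\<lambda>x. - partial 1 (partial 2 (\<phi> k)) x)" using \<phi>p[of k] by (auto simp: fun_eq_iff)
    then show "smooth_on UNIV (f2 k)" using \<phi>s by (simp add: smooth_on_minus smooth_on_partial)
  qed
  have \<phi>M: "\<bar>partial i (partial j (\<phi> k)) x\<bar> \<le> M" for i j k x
    using \<phi>p[of k x] fM[of k x] exhaust_2[of i] exhaust_2[of j] by auto
  have flim: "(\<lambda>k. f1 k x) \<longlonglongrightarrow> s11 x \<and> (\<lambda>k. f2 k x) \<longlonglongrightarrow> s12 x \<and> (\<lambda>k. f3 k x) \<longlonglongrightarrow> s22 x" if x: "x \<in> \<Omega>" for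
      x
  proof -
    have ev: "\<exists>N. \<forall>k\<ge>N. \<bar>f1 k x - s11 x\<bar> \<le> \<eta> \<and> \<bar>f2 k x - s12 x\<bar> \<le> \<eta> \<and> \<bar>f3 k x - s22 x\<bar> \<le> \<eta>" if \<eta>: "\<eta>
        > 0" for \<eta>
    proof -
      have near: "\<exists>r>0. \<forall>y\<in>ball x r. \<bar>s y - s x\<bar> \<le> \<eta>" if "smooth_on \<Omega> s" for s :: "real^2 \<Rightarrow> real"
      proof -
        have "isCont s x" using smooth_on_continuous_on[OF that] x \<Omega>(1) by (simp add:
            continuous_on_eq_continuous_at)
        then obtain r where "r > 0" "\<And>y. dist y x < r \<Longrightarrow> dist (s y) (s x) < \<eta>"
          unfolding continuous_at_eps_delta using \<eta> by blast
        then show ?thesis by (intro exI[of _ r]) (auto simp: dist_commute dist_real_def less_imp_le)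
      qed
      obtain r1 where r1: "r1 > 0" "\<forall>y\<in>ball x r1. \<bar>s11 y - s11 x\<bar> \<le> \<eta>" using near[OF sm(1)] by blast
      obtain r2 where r2: "r2 > 0" "\<forall>y\<in>ball x r2. \<bar>s12 y - s12 x\<bar> \<le> \<eta>" using near[OF sm(2)] by blast
      obtain r3 where r3: "r3 > 0" "\<forall>y\<in>ball x r3. \<bar>s22 y - s22 x\<bar> \<le> \<eta>" using near[OF sm(3)] by blast
      obtain r4 where r4: "r4 > 0" "ball x r4 \<subseteq> \<Omega>" using \<Omega>(1) x openE by blast
      define r where "r = min (min r1 r2) (min r3 r4)"
      have r: "r > 0" "r \<le> r1" "r \<le> r2" "r \<le> r3" "r \<le> r4" using r1 r2 r3 r4 by (auto simp: r_def)
      obtain N :: nat where N: "1 / r < real N" using reals_Archimedean2 by blast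
      have "\<bar>f1 k x - s11 x\<bar> \<le> \<eta> \<and> \<bar>f2 k x - s12 x\<bar> \<le> \<eta> \<and> \<bar>f3 k x - s22 x\<bar> \<le> \<eta>" if k: "k \<ge> N" for k
      proof (rule fa, intro conjI ballI)
        have "1 / r < real (Suc k)" using N k by simp
        then have kr: "1 / real (Suc k) < r" using r(1) by (simp add: field_simps)
        show "ball x (1 / real (Suc k)) \<subseteq> \<Omega>" using kr r(5) r4(2) by (auto simp: subset_iff)
        fix y assume "y \<in> ball x (1 / real (Suc k))"
        then have "dist x y < r" using kr by simp
        then show "\<bar>s11 y - s11 x\<bar> \<le> \<eta>" "\<bar>s12 y - s12 x\<bar> \<le> \<eta>" "\<bar>s22 y - s22 x\<bar> \<le> \<eta>"
          using r1(2) r2(2) r3(2) r by auto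
      qed
      then show ?thesis by blast
    qed
    have lims: "g \<longlonglongrightarrow> l" if h: "\<And>\<eta>. \<eta> > 0 \<Longrightarrow> \<exists>N. \<forall>k\<ge>N. \<bar>g k - l\<bar> \<le> \<eta>" for g :: "nat \<Rightarrow> real" and l
    proof (rule LIMSEQ_I)
      fix r :: real assume "0 < r"
      then obtain N where "\<forall>k\<ge>N. \<bar>g k - l\<bar> \<le> r / 2" using h[of "r / 2"] by auto
      then show "\<exists>no. \<forall>n\<ge>no. norm (g n - l) < r" using \<open>0 < r\<close> by (intro exI[of _ N]) fastforce
    qed
    show ?thesis
      by (intro conjI lims) (use ev in blast)+
  qed
  obtain C where C0: "C > 0 \<and> (\<forall>e>0. \<exists>\<theta>\<in>test_functions \<Omega>. (\<forall>x. 0 \<le> \<theta> x \<and> \<theta> x \<le> 1) \<and> (\<forall>i x. \<bar>partial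
      i \<theta> x\<bar> \<le> C / e) \<and>
     (\<forall>i j x. \<bar>partial i (partial j \<theta>) x\<bar> \<le> C / e\<^sup>2) \<and>
     (\<forall>x. ball x (4 * e) \<subseteq> \<Omega> \<longrightarrow> \<theta> x = 1 \<and> (\<forall>i. partial i \<theta> x = 0) \<and> (\<forall>i j. partial i (partial j \<theta>) x
         = 0)))"
    using ex_interior_cutoff[OF \<Omega>] by (rule exE)
  note C = conjunct1[OF C0]
  \<comment> \<open>The layer outside of which the cutoff is 1 with vanishing derivatives.\<close>
  define L where "L e = {x \<in> \<Omega>. \<not> ball x (4 * e) \<subseteq> \<Omega>}" for e
  have L: "open (L e)" for e
  proof -
    have "L e = \<Omega> \<inter> (\<Union>z\<in>- \<Omega>. ball z (4 * e))" by (auto simp: L_def dist_commute subset_iff)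
    then show ?thesis using \<Omega>(1) by auto
  qed
  have fin: "emeasure lborel S < \<infinity>" if "S \<subseteq> \<Omega>" for S
    using emeasure_bounded_finite[OF bounded_subset[OF \<Omega>(2) that]] .
  have iL: "integrable lborel (\<lambda>x. c * indicat_real (L e) x)" for c e
    using L[of e] fin[of "L e"] by (intro integrable_mult_right integrable_real_indicator) (auto
        simp: L_def)
  have i\<Omega>: "integrable lborel (\<lambda>x. c * indicat_real \<Omega> x)" for c
    using \<Omega>(1) fin[of \<Omega>] by (intro integrable_mult_right integrable_real_indicator) auto
  \<comment> \<open>Layer points are within 5e of a zero of the potential and its gradient, so the
    gradient is at most 2M(5e) and the potential at most 4M(5e)^2. Against the cutoff bounds C/e and
    C/e^2 the three error terms contribute (10 + 10 + 100) C M; each of the three strains is at most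
    A M.\<close>
  define \<kappa> where "\<kappa> = 3 * (A * M) * (120 * C * M)"
  have key: "\<exists>\<theta>\<in>test_functions \<Omega>. (\<forall>x. 0 \<le> \<theta> x \<and> \<theta> x \<le> 1) \<and> (\<forall>x. ball x (4 * e) \<subseteq> \<Omega> \<longrightarrow> \<theta> x = 1) \<and>
      \<bar>\<integral>x. \<theta> x * Q x \<partial>lborel\<bar> \<le> \<kappa> * measure lborel (L e)" if e: "e > 0" for e
  proof -
    obtain \<theta> where T: "\<theta> \<in> test_functions \<Omega>" "\<forall>x. 0 \<le> \<theta> x \<and> \<theta> x \<le> 1" "\<forall>i x. \<bar>partial i \<theta> x\<bar> \<le> C / e"
     "\<forall>i j x. \<bar>partial i (partial j \<theta>) x\<bar> \<le> C / e\<^sup>2"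
     "\<forall>x. ball x (4 * e) \<subseteq> \<Omega> \<longrightarrow> \<theta> x = 1 \<and> (\<forall>i. partial i \<theta> x = 0) \<and> (\<forall>i j. partial i (partial j \<theta>) x
         = 0)"
      using conjunct2[OF C0, rule_format, OF e] by (elim bexE conjE) (rule that)
    note \<theta> = T(1) T(2-5)[rule_format]
    have \<theta>s: "smooth_on UNIV \<theta>" by (rule test_functions_smooth[OF \<theta>(1)])
    have \<theta>0: "\<theta> x = 0" "partial i \<theta> x = 0" "partial i (partial j \<theta>) x = 0" if "x \<notin> \<Omega>" for x i j
      using test_functions_eq_0[OF \<theta>(1) that] test_functions_eq_0[OF test_functions_partial[OF \<theta>(1)]
          that]
        test_functions_eq_0[OF test_functions_partial[OF test_functions_partial[OF \<theta>(1)]] that] by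
            auto
    obtain Y where Y: "finite Y" "Y \<subseteq> - closure \<Omega>" "\<And>x. x \<in> \<Omega> \<Longrightarrow> \<not> ball x (4 * e) \<subseteq> \<Omega> \<Longrightarrow> \<exists>y\<in>Y. dist x
        y < 5 * e"
      by (rule ex_exterior_net[OF \<Omega> ext(2) e]) blast
    \<comment> \<open>A point below the support of all mollified stresses, around which every
      potential vanishes identically.\<close>
    define z0 where "z0 = (- (R0 + 2)) *\<^sub>R (axis 2 1 :: real^2)"
    have z02: "z0 $ 2 = - (R0 + 2)" by (simp add: z0_def axis_def)
    have "closure \<Omega> \<subseteq> cball 0 R0" using closure_mono[OF R0(2)] R0(1) by simp
    moreover have "norm z0 = R0 + 2" using R0(1) by (simp add: z0_def norm_axis_1)
    ultimately have z0: "z0 \<in> - closure \<Omega>" by auto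
    obtain D where D: "D > 0" "\<And>y. y \<in> Y \<Longrightarrow> \<exists>P. connected P \<and> y \<in> P \<and> z0 \<in> P \<and> (\<forall>u\<in>P. \<forall>w\<in>\<Omega>. D \<le> dist
        u w)"
      by (rule ex_exterior_chains[OF \<Omega>(2) ext(1) z0 Y(1,2)]) blast
    have vanish: "\<phi> k y = 0 \<and> (\<forall>i. partial i (\<phi> k) y = 0)" if y: "y \<in> Y" and k: "1 / Suc k < D" for
        y k
    proof -
      obtain P where P: "connected P" "y \<in> P" "z0 \<in> P" "\<forall>u\<in>P. \<forall>w\<in>\<Omega>. D \<le> dist u w"
        using D(2)[OF y] by (elim exE conjE) (rule that)
      \<comment> \<open>The path is thickened by as much as keeps balls of the mollification radius
        around points of \<open>V\<close> disjoint from \<Omega>.\<close>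
      define V where "V = (\<Union>u\<in>P. ball u (D - 1 / Suc k))"
      have V: "open V" unfolding V_def by (intro open_UN ballI open_ball)
      have PV: "P \<subseteq> V" using k by (force simp: V_def)
      have zero: "partial i (partial j (\<phi> k)) x = 0" if "x \<in> V" for i j x
      proof -
        obtain u where u: "u \<in> P" "dist u x < D - 1 / Suc k" using \<open>x \<in> V\<close> by (auto simp: V_def)
        have "\<not> dist x w < 1 / Suc k" if "w \<in> \<Omega>" for w
        proof -
          have "D \<le> dist u w" using P(4) u(1) that by blast
          then show ?thesis using u(2) dist_triangle[of u w x] by linarith
        qed
        then have "ball x (1 / Suc k) \<inter> \<Omega> = {}" by auto
        from fz[OF this] show ?thesis using \<phi>p[of k x] exhaust_2[of i] exhaust_2[of j] by auto
      qed
      define H where "H = {x::real^2. x $ 2 < - (R0 + 1)}"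
      have H: "open H" unfolding H_def by (intro open_Collect_less continuous_intros)
      have zH: "z0 \<in> H" by (simp add: H_def z02)
      have "\<phi> k z0 = 0" using zH \<phi>z by (simp add: H_def)
      moreover have "partial i (\<phi> k) z0 = 0" for i
        using partial_cong_open[OF H zH, of "\<phi> k" "\<lambda>_. 0" i] \<phi>z by (simp add: H_def)
      ultimately show ?thesis using zero_second_partials[OF \<phi>s V P(1) PV P(2,3) zero] by blast
    qed
    define W where "W k = (\<lambda>x. \<theta> x * \<phi> k x)" for k
    have Wt: "W k \<in> test_functions \<Omega>" for k
      using test_functions_mult[OF \<Omega>(1) smooth_on_subset[OF \<phi>s[of k]] \<theta>(1)] by (simp add: W_def
          mult.commute)
    \<comment> \<open>The terms of the product rule in which a derivative falls on the cutoff; they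
      live in the layer only.\<close>
    define rem where "rem k i j x = partial i \<theta> x * partial j (\<phi> k) x + (partial j \<theta> x * partial i
        (\<phi> k) x + partial i (partial j \<theta>) x * \<phi> k x)" for k i j x
    have WW: "partial i (partial j (W k)) x = \<theta> x * partial i (partial j (\<phi> k)) x + rem k i j x" for
        i j k x
      unfolding W_def rem_def
      using partial_partial_mult[OF \<theta>s \<phi>s[of k], of i j x] partial_commute[OF \<theta>s] by (simp add:
          algebra_simps)
    define I where "I k x = \<theta> x * (E1 x * f1 k x + E2 x * f2 k x + E3 x * f3 k x)" for k x
    have It: "I k \<in> test_functions \<Omega>" for k
    proof -
      have "smooth_on \<Omega> (\<lambda>x. E1 x * f1 k x + E2 x * f2 k x + E3 x * f3 k x)"
        by (intro smooth_on_add smooth_on_mult \<Omega> sE smooth_on_subset[OF fs(1)] smooth_on_subset[OF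
            fs(2)] smooth_on_subset[OF fs(3)]) auto
      from test_functions_mult[OF \<Omega>(1) this \<theta>(1)] show ?thesis by (simp add: I_def[abs_def]
          mult.commute)
    qed
    have est: "\<bar>\<integral>x. I k x \<partial>lborel\<bar> \<le> \<kappa> * measure lborel (L e)" if k: "1 / Suc k < D" for k
    proof -
      define Rm where "Rm x = E1 x * rem k 2 2 x + (- E2 x) * rem k 1 2 x + E3 x * rem k 1 1 x" for
          x
      have eq: "E1 x * partial 2 (partial 2 (W k)) x - E2 x * partial 1 (partial 2 (W k)) x + E3 x *
          partial 1 (partial 1 (W k)) x
          = I k x + Rm x" for x
        unfolding WW I_def Rm_def using \<phi>p[of k x] by (simp add: algebra_simps)
      have tot: "(\<integral>x. I k x + Rm x \<partial>lborel) = 0"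
        using cc[OF Wt[of k]] unfolding E1_def[symmetric] E2_def[symmetric] E3_def[symmetric] eq .
      have ii: "integrable lborel (\<lambda>x. E1 x * partial 2 (partial 2 (W k)) x - E2 x * partial 1
          (partial 2 (W k)) x + E3 x * partial 1 (partial 1 (W k)) x)"
        by (intro Bochner_Integration.integrable_add Bochner_Integration.integrable_diff
            test_functions_integrable[where U = \<Omega>]
            test_functions_mult \<Omega> sE test_functions_partial Wt)
      have iI: "integrable lborel (I k)" by (rule test_functions_integrable[OF It])
      have iR: "integrable lborel Rm"
      proof -
        have "integrable lborel (\<lambda>x. (I k x + Rm x) - I k x)" using ii[unfolded eq] iI by (rule
            Bochner_Integration.integrable_diff)
        then show ?thesis by simp
      qed
      have "(\<integral>x. I k x \<partial>lborel) + (\<integral>x. Rm x \<partial>lborel) = 0" using tot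
          Bochner_Integration.integral_add[OF iI iR] by simp
      then have "\<bar>\<integral>x. I k x \<partial>lborel\<bar> = \<bar>\<integral>x. Rm x \<partial>lborel\<bar>" by linarith
      also have "\<dots> \<le> (\<integral>x. \<bar>Rm x\<bar> \<partial>lborel)" using integral_norm_bound[of lborel Rm] by simp
      also have "\<dots> \<le> (\<integral>x. \<kappa> * indicat_real (L e) x \<partial>lborel)"
      proof (rule integral_mono)
        show "integrable lborel (\<lambda>x. \<bar>Rm x\<bar>)" using iR by simp
        show "integrable lborel (\<lambda>x. \<kappa> * indicat_real (L e) x)" by (rule iL)
        fix x
        show "\<bar>Rm x\<bar> \<le> \<kappa> * indicat_real (L e) x"
        proof (cases "x \<in> L e")
          case True
          then have x: "x \<in> \<Omega>" "\<not> ball x (4 * e) \<subseteq> \<Omega>" by (auto simp: L_def)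
          obtain y where y: "y \<in> Y" "dist x y < 5 * e" using Y(3)[OF x] by blast
          have v: "\<phi> k y = 0" "\<And>i. partial i (\<phi> k) y = 0" using vanish[OF y(1) k] by auto
          have g: "\<bar>partial i (\<phi> k) x\<bar> \<le> 10 * M * e" for i
            using gradient_bound_near_zero(1)[OF \<phi>s \<phi>M v y(2) bs(4), of i] by simp
          have h: "\<bar>\<phi> k x\<bar> \<le> 100 * M * e\<^sup>2"
            using gradient_bound_near_zero(2)[OF \<phi>s \<phi>M v y(2) bs(4)] by (simp add:
                power_mult_distrib)
          have rb: "\<bar>rem k i j x\<bar> \<le> 120 * C * M" for i j
          proof -
            have m1: "\<bar>partial i \<theta> x * partial j (\<phi> k) x\<bar> \<le> (C / e) * (10 * M * e)" for i j
              unfolding abs_mult using \<theta>(3) g C e by (intro mult_mono) auto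
            have m2: "\<bar>partial i (partial j \<theta>) x * \<phi> k x\<bar> \<le> (C / e\<^sup>2) * (100 * M * e\<^sup>2)"
              unfolding abs_mult using \<theta>(4) h C e by (intro mult_mono) auto
            have "(C / e) * (10 * M * e) = 10 * C * M" "(C / e\<^sup>2) * (100 * M * e\<^sup>2) = 100 * C * M"
                using e by simp_all
            then show ?thesis using m1[of i j] m1[of j i] m2 unfolding rem_def by linarith
          qed
          have "\<bar>- E2 x\<bar> \<le> A * M" using EB[OF x(1)] by simp
          then have "\<bar>Rm x\<bar> \<le> \<kappa>" unfolding Rm_def \<kappa>_def
            by (intro prod3 rb EB x)
          then show ?thesis using True by simp
        next
          case False
          have "rem k i j x = 0" for i j
          proof (cases "x \<in> \<Omega>")
            case True
            then have "ball x (4 * e) \<subseteq> \<Omega>" using False by (auto simp: L_def)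
            from \<theta>(5)[OF this] show ?thesis by (simp add: rem_def)
          qed (simp add: rem_def \<theta>0)
          then show ?thesis using False by (simp add: Rm_def)
        qed
      qed
      finally show ?thesis by simp
    qed
    \<comment> \<open>First k tends to infinity with e fixed. The index from which the error bound
      holds depends on the net and hence on e, but the bound itself does not depend on k.\<close>
    have "(\<lambda>k. \<integral>x. I k x \<partial>lborel) \<longlonglongrightarrow> (\<integral>x. \<theta> x * Q x \<partial>lborel)"
    proof (rule integral_dominated_convergence)
      have "(\<lambda>x. Q x * \<theta> x) \<in> test_functions \<Omega>" by (rule test_functions_mult[OF \<Omega>(1) sQ \<theta>(1)])
      then show "(\<lambda>x. \<theta> x * Q x) \<in> borel_measurable lborel"
        using test_functions_integrable[of "\<lambda>x. Q x * \<theta> x"] by (simp add: mult.commute)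
      show "I k \<in> borel_measurable lborel" for k using test_functions_integrable[OF It] by simp
      show "integrable lborel (\<lambda>x. (3 * (A * M) * M) * indicat_real \<Omega> x)" by (rule i\<Omega>)
      show "AE x in lborel. (\<lambda>k. I k x) \<longlonglongrightarrow> \<theta> x * Q x"
      proof (intro AE_I2)
        fix x
        show "(\<lambda>k. I k x) \<longlonglongrightarrow> \<theta> x * Q x"
        proof (cases "x \<in> \<Omega>")
          case True
          then show ?thesis unfolding I_def Q_def using flim[OF True] by (intro tendsto_intros) auto
        qed (simp add: I_def \<theta>0)
      qed
      show "AE x in lborel. norm (I k x) \<le> (3 * (A * M) * M) * indicat_real \<Omega> x" for k
      proof (intro AE_I2)
        fix x
        show "norm (I k x) \<le> (3 * (A * M) * M) * indicat_real \<Omega> x"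
        proof (cases "x \<in> \<Omega>")
          case True
          have "\<bar>E1 x * f1 k x + E2 x * f2 k x + E3 x * f3 k x\<bar> \<le> 3 * (A * M) * M"
            using fM[of k x] by (intro prod3 EB True) auto
          then have "\<bar>\<theta> x\<bar> * \<bar>E1 x * f1 k x + E2 x * f2 k x + E3 x * f3 k x\<bar> \<le> 1 * (3 * (A * M) *
              M)"
            using \<theta>(2)[of x] by (intro mult_mono) auto
          then show ?thesis using True by (simp add: I_def abs_mult)
        qed (simp add: I_def \<theta>0)
      qed
    qed
    then have lim: "(\<lambda>k. \<bar>\<integral>x. I k x \<partial>lborel\<bar>) \<longlonglongrightarrow> \<bar>\<integral>x. \<theta> x * Q x \<partial>lborel\<bar>" by (rule tendsto_rabs)
    obtain N :: nat where N: "1 / D < real N" using reals_Archimedean2 by blast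
    have "\<bar>\<integral>x. \<theta> x * Q x \<partial>lborel\<bar> \<le> \<kappa> * measure lborel (L e)"
    proof (rule LIMSEQ_le_const2[OF lim], intro exI[of _ N] allI impI)
      fix k assume "N \<le> k"
      then have "1 / D < real (Suc k)" using N by simp
      then have "1 / real (Suc k) < D" using D(1) by (simp add: field_simps)
      then show "\<bar>\<integral>x. I k x \<partial>lborel\<bar> \<le> \<kappa> * measure lborel (L e)" by (rule est)
    qed
    then show ?thesis using \<theta>(1,2,5) by blast
  qed
  define K where "K j \<theta> \<longleftrightarrow> \<theta> \<in> test_functions \<Omega> \<and> (\<forall>x. 0 \<le> \<theta> x \<and> \<theta> x \<le> 1) \<and> (\<forall>x. ball x (4 * (1 / Suc
      j)) \<subseteq> \<Omega> \<longrightarrow> \<theta> x = 1) \<and>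
      \<bar>\<integral>x. \<theta> x * Q x \<partial>lborel\<bar> \<le> \<kappa> * measure lborel (L (1 / Suc j))" for j :: nat and \<theta>
  have "\<exists>\<theta>. K j \<theta>" for j unfolding K_def using key[of "1 / Suc j"] by (simp add: Bex_def)
  then obtain \<theta> where \<theta>K: "\<And>j. K j (\<theta> j)" by metis
  have \<theta>: "\<theta> j \<in> test_functions \<Omega>" "0 \<le> \<theta> j x" "\<theta> j x \<le> 1" "ball x (4 * (1 / Suc j)) \<subseteq> \<Omega> \<Longrightarrow> \<theta> j x =
      1"
      "\<bar>\<integral>x. \<theta> j x * Q x \<partial>lborel\<bar> \<le> \<kappa> * measure lborel (L (1 / Suc j))" for j x
    using \<theta>K[of j] unfolding K_def by blast+
  have QB: "\<bar>Q x\<bar> \<le> 3 * (A * M) * M" if "x \<in> \<Omega>" for x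
    unfolding Q_def by (intro prod3 EB bs that)
  have mQ: "(\<lambda>x. indicat_real \<Omega> x * Q x) \<in> borel_measurable borel"
  proof -
    have "(\<lambda>x. indicat_real \<Omega> x *\<^sub>R Q x) \<in> borel_measurable borel"
      using \<Omega>(1) smooth_on_continuous_on[OF sQ] by (intro borel_measurable_continuous_on_indicator)
          auto
    then show ?thesis by simp
  qed
  have deep: "\<exists>N. \<forall>j\<ge>N. ball x (4 * (1 / real (Suc j))) \<subseteq> \<Omega>" if "x \<in> \<Omega>" for x
  proof -
    obtain r where r: "r > 0" "ball x r \<subseteq> \<Omega>" using \<Omega>(1) \<open>x \<in> \<Omega>\<close> openE by blast
    obtain N :: nat where N: "4 / r < real N" using reals_Archimedean2 by blast
    have "ball x (4 * (1 / real (Suc j))) \<subseteq> \<Omega>" if "j \<ge> N" for j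
    proof -
      have "4 / r < real (Suc j)" using N that by simp
      then have "4 * (1 / real (Suc j)) < r" using r(1) by (simp add: field_simps)
      then show ?thesis using r(2) by (auto simp: subset_iff)
    qed
    then show ?thesis by blast
  qed
  have "(\<lambda>j. \<integral>x. \<theta> j x * Q x \<partial>lborel) \<longlonglongrightarrow> (\<integral>x. indicat_real \<Omega> x * Q x \<partial>lborel)"
  proof (rule integral_dominated_convergence)
    show "(\<lambda>x. indicat_real \<Omega> x * Q x) \<in> borel_measurable lborel" using mQ by simp
    show "(\<lambda>x. \<theta> j x * Q x) \<in> borel_measurable lborel" for j
      using test_functions_integrable[OF test_functions_mult[OF \<Omega>(1) sQ \<theta>(1)[of j]]] by (simp add:
          mult.commute)
    show "integrable lborel (\<lambda>x. (3 * (A * M) * M) * indicat_real \<Omega> x)" by (rule i\<Omega>)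
    show "AE x in lborel. (\<lambda>j. \<theta> j x * Q x) \<longlonglongrightarrow> indicat_real \<Omega> x * Q x"
    proof (intro AE_I2)
      fix x
      show "(\<lambda>j. \<theta> j x * Q x) \<longlonglongrightarrow> indicat_real \<Omega> x * Q x"
      proof (cases "x \<in> \<Omega>")
        case True
        obtain N where N: "\<forall>j\<ge>N. ball x (4 * (1 / real (Suc j))) \<subseteq> \<Omega>" using deep[OF True] by blast
        have "\<forall>j\<ge>N. indicat_real \<Omega> x * Q x = \<theta> j x * Q x" using N \<theta>(4) True by simp
        then have "\<forall>\<^sub>F j in sequentially. indicat_real \<Omega> x * Q x = \<theta> j x * Q x"
          unfolding eventually_sequentially by blast
        then show ?thesis by (rule Lim_transform_eventually[OF tendsto_const])
      next
        case False
        then show ?thesis using test_functions_eq_0[OF \<theta>(1) False] by simp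
      qed
    qed
    show "AE x in lborel. norm (\<theta> j x * Q x) \<le> (3 * (A * M) * M) * indicat_real \<Omega> x" for j
    proof (intro AE_I2)
      fix x
      show "norm (\<theta> j x * Q x) \<le> (3 * (A * M) * M) * indicat_real \<Omega> x"
      proof (cases "x \<in> \<Omega>")
        case True
        have "\<bar>\<theta> j x\<bar> * \<bar>Q x\<bar> \<le> 1 * (3 * (A * M) * M)" using \<theta>(2,3)[of j x] QB[OF True] by (intro
            mult_mono) auto
        then show ?thesis using True by (simp add: abs_mult)
      qed (simp add: test_functions_eq_0[OF \<theta>(1)])
    qed
  qed
  then have lim1: "(\<lambda>j. \<bar>\<integral>x. \<theta> j x * Q x \<partial>lborel\<bar>) \<longlonglongrightarrow> \<bar>\<integral>x. indicat_real \<Omega> x * Q x \<partial>lborel\<bar>" by (rule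
      tendsto_rabs)
  \<comment> \<open>Every point of \<Omega> has a positive distance from the complement and so
    leaves the layers eventually; the area of the layers tends to 0 by dominated
    convergence.\<close>
  have "(\<lambda>j. \<integral>x. indicat_real (L (1 / Suc j)) x \<partial>lborel) \<longlonglongrightarrow> (\<integral>x. 0 \<partial>(lborel :: (real^2) measure))"
  proof (rule integral_dominated_convergence)
    show "(\<lambda>x. indicat_real (L (1 / Suc j)) x) \<in> borel_measurable lborel" for j using L[of "1 / Suc
        j"] by simp
    show "integrable lborel (\<lambda>x. 1 * indicat_real \<Omega> x)" by (rule i\<Omega>)
    show "AE x in lborel. (\<lambda>j. indicat_real (L (1 / Suc j)) x) \<longlonglongrightarrow> 0"
    proof (intro AE_I2)
      fix x
      show "(\<lambda>j. indicat_real (L (1 / Suc j)) x) \<longlonglongrightarrow> 0"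
      proof (cases "x \<in> \<Omega>")
        case True
        obtain N where N: "\<forall>j\<ge>N. ball x (4 * (1 / real (Suc j))) \<subseteq> \<Omega>" using deep[OF True] by blast
        have "\<forall>j\<ge>N. 0 = indicat_real (L (1 / Suc j)) x" using N by (simp add: L_def)
        then have "\<forall>\<^sub>F j in sequentially. 0 = indicat_real (L (1 / Suc j)) x"
          unfolding eventually_sequentially by blast
        then show ?thesis by (rule Lim_transform_eventually[OF tendsto_const])
      next
        case False
        then show ?thesis by (simp add: L_def)
      qed
    qed
    show "AE x in lborel. norm (indicat_real (L (1 / Suc j)) x) \<le> 1 * indicat_real \<Omega> x" for j
      by (intro AE_I2) (auto simp: L_def indicator_def)
  qed simp
  then have "(\<lambda>j. measure lborel (L (1 / Suc j))) \<longlonglongrightarrow> 0"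
    by simp
  then have "(\<lambda>j. \<kappa> * measure lborel (L (1 / Suc j))) \<longlonglongrightarrow> \<kappa> * 0" by (intro tendsto_intros)
  then have "\<bar>\<integral>x. indicat_real \<Omega> x * Q x \<partial>lborel\<bar> \<le> \<kappa> * 0"
    using lim1 \<theta>(5) by (intro LIMSEQ_le[OF lim1]) auto
  then have Q0: "(\<integral>x. indicat_real \<Omega> x * Q x \<partial>lborel) = 0" by simp
  have Qpos: "Q x > 0" if "s11 x \<noteq> 0 \<or> s12 x \<noteq> 0 \<or> s22 x \<noteq> 0" for x
    using pos[OF that] unfolding Q_def E1_def E2_def E3_def by (simp add: algebra_simps)
  have Qnn: "Q x \<ge> 0" for x
    using Qpos[of x] by (cases "s11 x \<noteq> 0 \<or> s12 x \<noteq> 0 \<or> s22 x \<noteq> 0") (auto simp: Q_def E1_def)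
  have iQ: "integrable lborel (\<lambda>x. indicat_real \<Omega> x * Q x)"
    by (rule Bochner_Integration.integrable_bound[OF i\<Omega>[of "3 * (A * M) * M"]])
       (use mQ QB in \<open>auto simp: indicator_def intro: order_trans[OF _ abs_ge_self]\<close>)
  have ae: "AE x in lborel. indicat_real \<Omega> x * Q x = 0"
    using integral_nonneg_eq_0_iff_AE[OF iQ] Qnn Q0 by simp
  have "Q x = 0"
  \<comment> \<open>The energy density vanishes almost everywhere; by continuity it vanishes at the
    given point too.\<close>
  proof (rule fundamental_lemma[OF \<Omega>(1) smooth_on_continuous_on[OF sQ] _ _ x])
    fix \<psi> assume \<psi>: "\<psi> \<in> test_functions \<Omega>"
    show "integrable lborel (\<lambda>x. Q x * \<psi> x)"
      by (rule test_functions_integrable[OF test_functions_mult[OF \<Omega>(1) sQ \<psi>]])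
    have "AE x in lborel. Q x * \<psi> x = 0"
      using ae
    proof (rule eventually_mono)
      fix x assume "indicat_real \<Omega> x * Q x = 0"
      then show "Q x * \<psi> x = 0" using test_functions_eq_0[OF \<psi>, of x] by (cases "x \<in> \<Omega>") auto
    qed
    then show "(\<integral>x. Q x * \<psi> x \<partial>lborel) = 0" by (rule integral_eq_zero_AE)
  qed
  then show ?thesis using Qpos[of x] by force
qed

section \<open>Reduction to components and conclusion\<close>

lemma integral_scaleR_component:
  fixes f :: "real^2 \<Rightarrow> real^2^2"
  assumes W: "open W" and f: "smooth_on W f" and \<phi>: "\<phi> \<in> test_functions W"
  shows "(\<integral>x. \<phi> x *\<^sub>R f x \<partial>lborel) $ i $ j = (\<integral>x. f x $ i $ j * \<phi> x \<partial>lborel)"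
proof -
  obtain K where K: "compact K" "K \<subseteq> W" "\<And>x. x \<notin> K \<Longrightarrow> \<phi> x = 0" by (metis \<phi> test_functionsE)
  have "continuous_on W (\<lambda>x. \<phi> x *\<^sub>R f x)"
    by (intro continuous_intros continuous_test_function[OF \<phi>] smooth_on_continuous_on[OF f])
  then have int: "integrable lborel (\<lambda>x. \<phi> x *\<^sub>R f x)"
    by (rule integrable_compact_support_within[OF _ K(1,2)]) (simp add: K(3))
  have "bounded_linear (\<lambda>V::real^2^2. V $ i $ j)"
    by (rule bounded_linear_compose[OF bounded_linear_vec_nth bounded_linear_vec_nth])
  from integral_bounded_linear[OF this int] show ?thesis by (simp add: mult.commute)
qed

lemma smooth_on_component:
  fixes f :: "real^2 \<Rightarrow> real^2^2"
  shows "open W \<Longrightarrow> smooth_on W f \<Longrightarrow> smooth_on W (\<lambda>x. f x $ i $ j)"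
  by (rule smooth_on_bounded_linear[OF _ bounded_linear_compose[OF bounded_linear_vec_nth
      bounded_linear_vec_nth]])

lemma Curl_Curl_tensor:
  "Curl (Curl_tensor E) \<phi> = E (partial 1 (partial 1 \<phi>)) $ 2 $ 2 - E (partial 2 (partial 1 \<phi>)) $ 2 $
      1
     - E (partial 1 (partial 2 \<phi>)) $ 1 $ 2 + E (partial 2 (partial 2 \<phi>)) $ 1 $ 1"
  by (simp add: Curl_def Curl_tensor_def distr_deriv_def)

lemma Div_component:
  "Div \<sigma> \<phi> $ i = - (\<sigma> (partial 1 \<phi>) $ i $ 1) - \<sigma> (partial 2 \<phi>) $ i $ 2"
  by (simp add: Div_def distr_deriv_def sum_2)

theorem lemma5p1:
  fixes \<Omega> :: "(real^2) set"
    and n t :: "real^2 \<Rightarrow> real^2"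
    and C :: "real^2^2 \<Rightarrow> real^2^2"
    and B :: "(real^2 \<Rightarrow> real) \<Rightarrow> real^2"
    and N :: "(real^2 \<Rightarrow> real) \<Rightarrow> real"
    and \<sigma>\<^sub>1 \<sigma>\<^sub>2 :: "(real^2 \<Rightarrow> real) \<Rightarrow> real^2^2"
  assumes "open \<Omega>" and "bounded \<Omega>" and "connected \<Omega>" and "simply_connected \<Omega>" and "0 \<in> \<Omega>"
    and "outward_unit_normal \<Omega> n"
    and "elasticity_tensor C"
    and "B \<in> smooth_off_origin \<Omega> UNIV"
    and "smooth_on_subset (frontier \<Omega>) t"
    and "N \<in> smooth_off_origin \<Omega> UNIV"
    and "stress_solution \<Omega> n C B t N \<sigma>\<^sub>1"
    and "stress_solution \<Omega> n C B t N \<sigma>\<^sub>2"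
  shows "\<forall>\<phi>\<in>test_functions \<Omega>. \<sigma>\<^sub>1 \<phi> = \<sigma>\<^sub>2 \<phi>"
proof -
  note \<Omega> = \<open>open \<Omega>\<close> \<open>bounded \<Omega>\<close> \<open>simply_connected \<Omega>\<close> and O = \<open>0 \<in> \<Omega>\<close> and nn = \<open>outward_unit_normal \<Omega>
      n\<close>
  have W0: "open (\<Omega> - {0})" using \<Omega>(1) by auto
  have sol: "\<exists>f. smooth_on (\<Omega> - {0}) f \<and> represented_on (\<Omega> - {0}) \<sigma> f \<and>
        (\<forall>p\<in>frontier \<Omega>. \<exists>S. (f \<longlongrightarrow> S) (at p within \<Omega>) \<and> S *v n p = t p)"
      "\<And>\<phi>. \<phi> \<in> test_functions \<Omega> \<Longrightarrow> \<sigma> \<phi> \<in> Sym"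
      "\<And>\<phi> \<psi> a b. \<phi> \<in> test_functions \<Omega> \<Longrightarrow> \<psi> \<in> test_functions \<Omega> \<Longrightarrow> \<sigma> (\<lambda>x. a * \<phi> x + b * \<psi> x) = a *\<^sub>R \<sigma> \<phi>
          + b *\<^sub>R \<sigma> \<psi>"
      "\<And>\<phi>. \<phi> \<in> test_functions \<Omega> \<Longrightarrow> Div \<sigma> \<phi> = - B \<phi>"
      "\<And>\<phi>. \<phi> \<in> test_functions \<Omega> \<Longrightarrow> Curl (Curl_tensor (\<lambda>\<psi>. inv_into Sym C (\<sigma> \<psi>))) \<phi> = N \<phi>"
    if "stress_solution \<Omega> n C B t N \<sigma>" for \<sigma>
  proof -
    note S = that[unfolded stress_solution_def]
    show "\<exists>f. smooth_on (\<Omega> - {0}) f \<and> represented_on (\<Omega> - {0}) \<sigma> f \<and>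
        (\<forall>p\<in>frontier \<Omega>. \<exists>S. (f \<longlongrightarrow> S) (at p within \<Omega>) \<and> S *v n p = t p)"
      using S unfolding traction_condition_def by simp
    have D: "\<sigma> \<in> distributions \<Omega> Sym" using S unfolding smooth_off_origin_def by simp
    show "\<sigma> \<phi> \<in> Sym" if "\<phi> \<in> test_functions \<Omega>" for \<phi>
      using D that unfolding distributions_def by simp
    show "\<sigma> (\<lambda>x. a * \<phi> x + b * \<psi> x) = a *\<^sub>R \<sigma> \<phi> + b *\<^sub>R \<sigma> \<psi>" if "\<phi> \<in> test_functions \<Omega>" "\<psi> \<in>
        test_functions \<Omega>" for \<phi> \<psi> a b
      using D that unfolding distributions_def by simp
    show "Div \<sigma> \<phi> = - B \<phi>" if "\<phi> \<in> test_functions \<Omega>" for \<phi>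
      using S that by (simp add: eq_neg_iff_add_eq_0)
    show "Curl (Curl_tensor (\<lambda>\<psi>. inv_into Sym C (\<sigma> \<psi>))) \<phi> = N \<phi>" if "\<phi> \<in> test_functions \<Omega>" for \<phi>
      using S that by simp
  qed
  note s1 = sol[OF \<open>stress_solution \<Omega> n C B t N \<sigma>\<^sub>1\<close>] and s2 = sol[OF \<open>stress_solution \<Omega> n C B t N
      \<sigma>\<^sub>2\<close>]
  obtain f1 where f1: "smooth_on (\<Omega> - {0}) f1" "represented_on (\<Omega> - {0}) \<sigma>\<^sub>1 f1"
        "\<And>p. p \<in> frontier \<Omega> \<Longrightarrow> \<exists>S. (f1 \<longlongrightarrow> S) (at p within \<Omega>) \<and> S *v n p = t p" using s1(1) by blast
  obtain f2 where f2: "smooth_on (\<Omega> - {0}) f2" "represented_on (\<Omega> - {0}) \<sigma>\<^sub>2 f2"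
        "\<And>p. p \<in> frontier \<Omega> \<Longrightarrow> \<exists>S. (f2 \<longlongrightarrow> S) (at p within \<Omega>) \<and> S *v n p = t p" using s2(1) by blast
  obtain a11 a12 a13 a22 a23 a33 :: real where
    A: "\<And>p q r. inv_into Sym C (sym_mat p q r) \<in> Sym"
    "\<And>p q r. inv_into Sym C (sym_mat p q r) $ 1 $ 1 = a11 * p + a12 * q + a13 * r"
    "\<And>p q r. 2 * inv_into Sym C (sym_mat p q r) $ 1 $ 2 = a12 * p + a22 * q + a23 * r"
    "\<And>p q r. inv_into Sym C (sym_mat p q r) $ 2 $ 2 = a13 * p + a23 * q + a33 * r"
    and pos: "\<And>p q r. p \<noteq> 0 \<or> q \<noteq> 0 \<or> r \<noteq> 0 \<Longrightarrow>
       a11 * p * p + a22 * q * q + a33 * r * r + 2 * a12 * p * q + 2 * a13 * p * r + 2 * a23 * q * r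
           > 0"
    by (rule compliance_coefficients[OF \<open>elasticity_tensor C\<close>]) blast
  \<comment> \<open>From here on only the difference of the solutions matters, component by
    component: \<open>T\<close> as a distribution, \<open>u\<close> as its representative away from
    the origin. The sources and the traction cancel in it.\<close>
  define T where "T i j \<phi> = \<sigma>\<^sub>1 \<phi> $ i $ j - \<sigma>\<^sub>2 \<phi> $ i $ j" for i j \<phi>
  define u where "u i j x = f1 x $ i $ j - f2 x $ i $ j" for i j x
  have T21: "T 2 1 \<phi> = T 1 2 \<phi>" if "\<phi> \<in> test_functions \<Omega>" for \<phi>
    using s1(2)[OF that] s2(2)[OF that] by (simp add: T_def Sym_iff)
  have lin: "test_linear \<Omega> (T i j)" for i j
    unfolding test_linear_def T_def by (simp add: s1(3) s2(3) algebra_simps)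
  have us: "smooth_on (\<Omega> - {0}) (u i j)" for i j
    unfolding u_def by (intro smooth_on_diff smooth_on_component W0 f1 f2)
  have ur: "T i j \<phi> = (\<integral>x. u i j x * \<phi> x \<partial>lborel)" if \<phi>: "\<phi> \<in> test_functions (\<Omega> - {0})" for i j \<phi>
  proof -
    have "T i j \<phi> = (\<integral>x. f1 x $ i $ j * \<phi> x \<partial>lborel) - (\<integral>x. f2 x $ i $ j * \<phi> x \<partial>lborel)"
      using f1(2) f2(2) \<phi> integral_scaleR_component[OF W0 f1(1) \<phi>] integral_scaleR_component[OF W0
          f2(1) \<phi>]
      unfolding represented_on_def T_def by simp
    also have "\<dots> = (\<integral>x. f1 x $ i $ j * \<phi> x - f2 x $ i $ j * \<phi> x \<partial>lborel)"
      by (intro Bochner_Integration.integral_diff[symmetric] test_functions_integrable[where U = "\<Omega>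
          - {0}"]
          test_functions_mult W0 smooth_on_component f1 f2 \<phi>)
    finally show ?thesis by (simp add: u_def left_diff_distrib)
  qed
  have div: "T 1 1 (partial 1 \<phi>) + T 1 2 (partial 2 \<phi>) = 0" "T 1 2 (partial 1 \<phi>) + T 2 2 (partial 2
      \<phi>) = 0"
    if \<phi>: "\<phi> \<in> test_functions \<Omega>" for \<phi>
  proof -
    have "Div \<sigma>\<^sub>1 \<phi> $ i = Div \<sigma>\<^sub>2 \<phi> $ i" for i using s1(4)[OF \<phi>] s2(4)[OF \<phi>] by simp
    then have d: "T i 1 (partial 1 \<phi>) + T i 2 (partial 2 \<phi>) = 0" for i
      unfolding Div_component T_def by (simp add: algebra_simps)
    show "T 1 1 (partial 1 \<phi>) + T 1 2 (partial 2 \<phi>) = 0" by (rule d)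
    show "T 1 2 (partial 1 \<phi>) + T 2 2 (partial 2 \<phi>) = 0"
      using d[of 2] T21[OF test_functions_partial[OF \<phi>]] by simp
  qed
  have cc: "(a11 * T 1 1 (partial 2 (partial 2 \<phi>)) + a12 * T 1 2 (partial 2 (partial 2 \<phi>)) + a13 * T
      2 2 (partial 2 (partial 2 \<phi>)))
      - (a12 * T 1 1 (partial 1 (partial 2 \<phi>)) + a22 * T 1 2 (partial 1 (partial 2 \<phi>)) + a23 * T 2 2
          (partial 1 (partial 2 \<phi>)))
      + (a13 * T 1 1 (partial 1 (partial 1 \<phi>)) + a23 * T 1 2 (partial 1 (partial 1 \<phi>)) + a33 * T 2 2
          (partial 1 (partial 1 \<phi>))) = 0"
    if \<phi>: "\<phi> \<in> test_functions \<Omega>" for \<phi>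
  proof -
    \<comment> \<open>The compliance acts through the sum of the two off-diagonal strains, which is
      just the combination that occurs in the double curl once mixed derivatives are
      commuted.\<close>
    have comp: "inv_into Sym C V $ 1 $ 1 = a11 * V $ 1 $ 1 + a12 * V $ 1 $ 2 + a13 * V $ 2 $ 2"
      "inv_into Sym C V $ 1 $ 2 + inv_into Sym C V $ 2 $ 1 = a12 * V $ 1 $ 1 + a22 * V $ 1 $ 2 + a23
          * V $ 2 $ 2"
      "inv_into Sym C V $ 2 $ 2 = a13 * V $ 1 $ 1 + a23 * V $ 1 $ 2 + a33 * V $ 2 $ 2" if "V \<in> Sym"
          for V
    proof -
      note V = Sym_eq_sym_mat[OF that]
      note AV = A[of "V $ 1 $ 1" "V $ 1 $ 2" "V $ 2 $ 2", folded V]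
      show "inv_into Sym C V $ 1 $ 1 = a11 * V $ 1 $ 1 + a12 * V $ 1 $ 2 + a13 * V $ 2 $ 2" by (rule
          AV(2))
      show "inv_into Sym C V $ 2 $ 2 = a13 * V $ 1 $ 1 + a23 * V $ 1 $ 2 + a33 * V $ 2 $ 2" by (rule
          AV(4))
      show "inv_into Sym C V $ 1 $ 2 + inv_into Sym C V $ 2 $ 1 = a12 * V $ 1 $ 1 + a22 * V $ 1 $ 2
          + a23 * V $ 2 $ 2"
        using AV(1,3) by (simp add: Sym_iff)
    qed
    have t: "partial i (partial j \<phi>) \<in> test_functions \<Omega>" for i j by (intro test_functions_partial \<phi>)
    have c: "partial 2 (partial 1 \<phi>) = partial 1 (partial 2 \<phi>)" by (rule test_partial_commute[OF \<phi>])
    have ex: "N \<phi> = (a13 * \<sigma> (partial 1 (partial 1 \<phi>)) $ 1 $ 1 + a23 * \<sigma> (partial 1 (partial 1 \<phi>)) $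
        1 $ 2 + a33 * \<sigma> (partial 1 (partial 1 \<phi>)) $ 2 $ 2)
       - (a12 * \<sigma> (partial 1 (partial 2 \<phi>)) $ 1 $ 1 + a22 * \<sigma> (partial 1 (partial 2 \<phi>)) $ 1 $ 2 +
           a23 * \<sigma> (partial 1 (partial 2 \<phi>)) $ 2 $ 2)
       + (a11 * \<sigma> (partial 2 (partial 2 \<phi>)) $ 1 $ 1 + a12 * \<sigma> (partial 2 (partial 2 \<phi>)) $ 1 $ 2 +
           a13 * \<sigma> (partial 2 (partial 2 \<phi>)) $ 2 $ 2)"
      if "stress_solution \<Omega> n C B t N \<sigma>" for \<sigma>
    proof -
      have S: "\<sigma> (partial i (partial j \<phi>)) \<in> Sym" for i j by (rule sol(2)[OF that t])
      show ?thesis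
        using sol(5)[OF that \<phi>] comp(1)[OF S[of 2 2]] comp(2)[OF S[of 1 2]] comp(3)[OF S[of 1 1]]
        unfolding Curl_Curl_tensor c by linarith
    qed
    from ex[OF \<open>stress_solution \<Omega> n C B t N \<sigma>\<^sub>1\<close>] ex[OF \<open>stress_solution \<Omega> n C B t N \<sigma>\<^sub>2\<close>]
    show ?thesis unfolding T_def by algebra
  qed
  note reg = stress_regularity[OF \<Omega>(1) O lin lin lin us ur us ur us ur div cc pos]
  obtain s11 where s11: "smooth_on \<Omega> s11" "\<And>\<phi>. \<phi> \<in> test_functions \<Omega> \<Longrightarrow> T 1 1 \<phi> = (\<integral>x. s11 x * \<phi> x
      \<partial>lborel)"
    using reg(1) by blast
  obtain s12 where s12: "smooth_on \<Omega> s12" "\<And>\<phi>. \<phi> \<in> test_functions \<Omega> \<Longrightarrow> T 1 2 \<phi> = (\<integral>x. s12 x * \<phi> x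
      \<partial>lborel)"
    using reg(2) by blast
  obtain s22 where s22: "smooth_on \<Omega> s22" "\<And>\<phi>. \<phi> \<in> test_functions \<Omega> \<Longrightarrow> T 2 2 \<phi> = (\<integral>x. s22 x * \<phi> x
      \<partial>lborel)"
    using reg(3) by blast
  \<comment> \<open>Regularity yields new representatives \<open>s11\<close>, \<open>s12\<close>,
    \<open>s22\<close>, while the boundary limits are known for the given ones. Both agree off the
    origin, which stays away from the boundary, so the limits carry over.\<close>
  have su: "s x = u i j x" if s: "smooth_on \<Omega> s" "\<And>\<phi>. \<phi> \<in> test_functions \<Omega> \<Longrightarrow> T i j \<phi> = (\<integral>x. s x * \<phi>
      x \<partial>lborel)"
      and x: "x \<in> \<Omega> - {0}" for s i j x
  proof (rule integral_test_zero_imp_eq[OF W0 smooth_on_subset[OF s(1)] us _ x])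
    fix \<phi> assume \<phi>: "\<phi> \<in> test_functions (\<Omega> - {0})"
    have "\<phi> \<in> test_functions \<Omega>" using \<phi> by (rule test_functions_mono) auto
    from s(2)[OF this] ur[OF \<phi>, of i j]
    show "(\<integral>x. s x * \<phi> x \<partial>lborel) = (\<integral>x. u i j x * \<phi> x \<partial>lborel)" by simp
  qed auto
  have s21: "T 2 1 \<phi> = (\<integral>x. s12 x * \<phi> x \<partial>lborel)" if "\<phi> \<in> test_functions \<Omega>" for \<phi>
    using T21[OF that] s12(2)[OF that] by simp
  have lims: "\<exists>S::real^2^2. (s11 \<longlongrightarrow> S $ 1 $ 1) (at p within \<Omega>) \<and> (s12 \<longlongrightarrow> S $ 1 $ 2) (at p within \<Omega>) \<and>
      (s12 \<longlongrightarrow> S $ 2 $ 1) (at p within \<Omega>) \<and> (s22 \<longlongrightarrow> S $ 2 $ 2) (at p within \<Omega>) \<and> S *v n p = 0"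
    if p: "p \<in> frontier \<Omega>" for p
  proof -
    obtain S1 where S1: "(f1 \<longlongrightarrow> S1) (at p within \<Omega>)" "S1 *v n p = t p" using f1(3)[OF p] by blast
    obtain S2 where S2: "(f2 \<longlongrightarrow> S2) (at p within \<Omega>)" "S2 *v n p = t p" using f2(3)[OF p] by blast
    have "p \<notin> \<Omega>" using p \<Omega>(1) by (simp add: frontier_def interior_open)
    then have "p \<noteq> 0" using O by auto
    have ev: "\<forall>\<^sub>F x in at p within \<Omega>. x \<in> \<Omega> - {0}"
      unfolding eventually_at using \<open>p \<noteq> 0\<close> by (intro exI[of _ "norm p"]) (auto simp: dist_norm)
    have lim: "(s \<longlongrightarrow> (S1 - S2) $ i $ j) (at p within \<Omega>)"
      if "smooth_on \<Omega> s" "\<And>\<phi>. \<phi> \<in> test_functions \<Omega> \<Longrightarrow> T i j \<phi> = (\<integral>x. s x * \<phi> x \<partial>lborel)" for s i j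
    proof -
      have "(u i j \<longlongrightarrow> S1 $ i $ j - S2 $ i $ j) (at p within \<Omega>)"
        unfolding u_def by (intro tendsto_intros S1 S2)
      moreover have "\<forall>\<^sub>F x in at p within \<Omega>. u i j x = s x"
        using ev by (rule eventually_mono) (simp add: su[OF that])
      ultimately have "(s \<longlongrightarrow> S1 $ i $ j - S2 $ i $ j) (at p within \<Omega>)" by (rule
          Lim_transform_eventually)
      then show ?thesis by simp
    qed
    have "(S1 - S2) *v n p = 0" using S1(2) S2(2) by (simp add: matrix_vector_mult_diff_rdistrib)
    moreover have "(s11 \<longlongrightarrow> (S1 - S2) $ 1 $ 1) (at p within \<Omega>)" using s11 by (rule lim)
    moreover have "(s12 \<longlongrightarrow> (S1 - S2) $ 1 $ 2) (at p within \<Omega>)" using s12 by (rule lim)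
    moreover have "(s12 \<longlongrightarrow> (S1 - S2) $ 2 $ 1) (at p within \<Omega>)" using s12(1) s21 by (rule lim)
    moreover have "(s22 \<longlongrightarrow> (S1 - S2) $ 2 $ 2) (at p within \<Omega>)" using s22 by (rule lim)
    ultimately show ?thesis by (intro exI[of _ "S1 - S2"] conjI)
  qed
  obtain g11 where g11: "continuous_on (closure \<Omega>) g11" "\<And>x. x \<in> \<Omega> \<Longrightarrow> g11 x = s11 x"
      "\<And>p. p \<in> frontier \<Omega> \<Longrightarrow> (s11 \<longlongrightarrow> g11 p) (at p within \<Omega>)"
    by (rule continuous_extension_closure[OF \<Omega>(1) smooth_on_continuous_on[OF s11(1)]]) (use lims in
        blast)+
  obtain g12 where g12: "continuous_on (closure \<Omega>) g12" "\<And>x. x \<in> \<Omega> \<Longrightarrow> g12 x = s12 x"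
      "\<And>p. p \<in> frontier \<Omega> \<Longrightarrow> (s12 \<longlongrightarrow> g12 p) (at p within \<Omega>)"
    by (rule continuous_extension_closure[OF \<Omega>(1) smooth_on_continuous_on[OF s12(1)]]) (use lims in
        blast)+
  obtain g22 where g22: "continuous_on (closure \<Omega>) g22" "\<And>x. x \<in> \<Omega> \<Longrightarrow> g22 x = s22 x"
      "\<And>p. p \<in> frontier \<Omega> \<Longrightarrow> (s22 \<longlongrightarrow> g22 p) (at p within \<Omega>)"
    by (rule continuous_extension_closure[OF \<Omega>(1) smooth_on_continuous_on[OF s22(1)]]) (use lims in
        blast)+
  have trace: "g11 p * n p $ 1 + g12 p * n p $ 2 = 0 \<and> g12 p * n p $ 1 + g22 p * n p $ 2 = 0" if p:
      "p \<in> frontier \<Omega>" for p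
  proof -
    obtain S :: "real^2^2" where S: "(s11 \<longlongrightarrow> S $ 1 $ 1) (at p within \<Omega>)" "(s12 \<longlongrightarrow> S $ 1 $ 2) (at p
        within \<Omega>)"
      "(s12 \<longlongrightarrow> S $ 2 $ 1) (at p within \<Omega>)" "(s22 \<longlongrightarrow> S $ 2 $ 2) (at p within \<Omega>)" "S *v n p = 0" using
          lims[OF p] by blast
    have "p \<notin> \<Omega>" "p \<in> closure \<Omega>" using p \<Omega>(1) by (simp_all add: frontier_def interior_open)
    then have "p islimpt \<Omega>" by (auto simp: closure_def)
    then have nt: "at p within \<Omega> \<noteq> bot" by (simp add: trivial_limit_within)
    have "g11 p = S $ 1 $ 1" "g12 p = S $ 1 $ 2" "g12 p = S $ 2 $ 1" "g22 p = S $ 2 $ 2"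
      using tendsto_unique[OF nt g11(3)[OF p] S(1)] tendsto_unique[OF nt g12(3)[OF p] S(2)]
        tendsto_unique[OF nt g12(3)[OF p] S(3)] tendsto_unique[OF nt g22(3)[OF p] S(4)] by auto
    moreover have "(S *v n p) $ i = 0" for i using S(5) by simp
    then have "S $ i $ 1 * n p $ 1 + S $ i $ 2 * n p $ 2 = 0" for i
      by (simp add: matrix_vector_mult_def sum_2)
    ultimately show ?thesis by metis
  qed
  have cl: "compact (closure \<Omega>)" using \<Omega>(2) by simp
  have bdd: "\<exists>M. \<forall>x\<in>\<Omega>. \<bar>s x\<bar> \<le> M" if "continuous_on (closure \<Omega>) g" "\<And>x. x \<in> \<Omega> \<Longrightarrow> g x = s x" for g s
      :: "real^2 \<Rightarrow> real"
  proof -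
    have "bounded (g ` closure \<Omega>)" using that(1) cl by (intro compact_imp_bounded
        compact_continuous_image)
    then obtain M where "\<forall>x\<in>closure \<Omega>. \<bar>g x\<bar> \<le> M" unfolding bounded_iff by auto
    then show ?thesis using that(2) closure_subset[of \<Omega>] by (intro exI[of _ M]) (metis subsetD)
  qed
  obtain M1 where M1: "\<forall>x\<in>\<Omega>. \<bar>s11 x\<bar> \<le> M1" using bdd[OF g11(1,2)] by blast
  obtain M2 where M2: "\<forall>x\<in>\<Omega>. \<bar>s12 x\<bar> \<le> M2" using bdd[OF g12(1,2)] by blast
  obtain M3 where M3: "\<forall>x\<in>\<Omega>. \<bar>s22 x\<bar> \<le> M3" using bdd[OF g22(1,2)] by blast
  define M where "M = \<bar>M1\<bar> + \<bar>M2\<bar> + \<bar>M3\<bar>"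
  have M: "\<bar>s11 x\<bar> \<le> M" "\<bar>s12 x\<bar> \<le> M" "\<bar>s22 x\<bar> \<le> M" "M \<ge> 0" if "x \<in> \<Omega>" for x
    using bspec[OF M1 that] bspec[OF M2 that] bspec[OF M3 that] unfolding M_def by linarith+
  \<comment> \<open>Each row of the stress is a divergence-free vector field whose normal component
    vanishes on the boundary.\<close>
  have row: "(\<integral>x. indicat_real \<Omega> x * (s x * partial 1 w x + s' x * partial 2 w x) \<partial>lborel) = 0"
    if s: "smooth_on \<Omega> s" "smooth_on \<Omega> s'" "continuous_on (closure \<Omega>) g" "continuous_on (closure \<Omega>)
        g'"
      "\<And>x. x \<in> \<Omega> \<Longrightarrow> g x = s x" "\<And>x. x \<in> \<Omega> \<Longrightarrow> g' x = s' x"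
      and tr: "\<And>p. p \<in> frontier \<Omega> \<Longrightarrow> g p * n p $ 1 + g' p * n p $ 2 = 0"
      and wdiv: "\<And>\<phi>. \<phi> \<in> test_functions \<Omega> \<Longrightarrow> (\<integral>x. s x * partial 1 \<phi> x \<partial>lborel) + (\<integral>x. s' x * partial
          2 \<phi> x \<partial>lborel) = 0"
      and w: "w \<in> test_functions UNIV" for s s' g g' w
  proof -
    define v V :: "real^2 \<Rightarrow> real^2" where "v x = s x *\<^sub>R axis 1 1 + s' x *\<^sub>R axis 2 1"
      and "V x = g x *\<^sub>R axis 1 1 + g' x *\<^sub>R axis 2 1" for x
    have v: "v x $ 1 = s x" "v x $ 2 = s' x" for x by (simp_all add: v_def axis_def)
    have V: "V x $ 1 = g x" "V x $ 2 = g' x" for x by (simp_all add: V_def axis_def)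
    have "(\<integral>x. indicat_real \<Omega> x * directional v w x \<partial>lborel) = 0"
    proof (rule weak_divergence[OF \<Omega>(1,2) nn])
      show "smooth_on \<Omega> (\<lambda>x. v x $ i)" for i using exhaust_2[of i] s(1,2) by (auto simp: v)
      show "partial 1 (\<lambda>x. v x $ 1) x + partial 2 (\<lambda>x. v x $ 2) x = 0" if "x \<in> \<Omega>" for x
        unfolding v by (rule weak_div_imp_div[OF \<Omega>(1) s(1,2) wdiv that])
      show "continuous_on (closure \<Omega>) V" unfolding V_def by (intro continuous_intros s)
      show "V x = v x" if "x \<in> \<Omega>" for x using s(5,6)[OF that] by (simp add: V_def v_def)
      show "V q \<bullet> n q = 0" if "q \<in> frontier \<Omega>" for q
        using tr[OF that] by (simp add: inner_vec_def sum_2 V)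
    qed (rule w)
    then show ?thesis by (simp add: directional_def v)
  qed
  have d1: "(\<integral>x. s11 x * partial 1 \<phi> x \<partial>lborel) + (\<integral>x. s12 x * partial 2 \<phi> x \<partial>lborel) = 0"
      "(\<integral>x. s12 x * partial 1 \<phi> x \<partial>lborel) + (\<integral>x. s22 x * partial 2 \<phi> x \<partial>lborel) = 0" if \<phi>: "\<phi> \<in>
          test_functions \<Omega>" for \<phi>
    using div[OF \<phi>] unfolding s11(2)[OF test_functions_partial[OF \<phi>]] s12(2)[OF
        test_functions_partial[OF \<phi>]]
      s22(2)[OF test_functions_partial[OF \<phi>]] by auto
  have zero: "s11 x = 0 \<and> s12 x = 0 \<and> s22 x = 0" if x: "x \<in> \<Omega>" for x
  proof (rule compatible_stress_eq_0[OF \<Omega>(1,2) connected_exterior[OF \<Omega> nn] s11(1) s12(1) s22(1) _ _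
      _ _ _ _ _ _ x])
    show "\<bar>s11 x\<bar> \<le> M" "\<bar>s12 x\<bar> \<le> M" "\<bar>s22 x\<bar> \<le> M" if "x \<in> \<Omega>" for x using M[OF that] by auto
    show "M \<ge> 0" by (simp add: M_def)
    show "(\<integral>x. indicat_real \<Omega> x * (s11 x * partial 1 w x + s12 x * partial 2 w x) \<partial>lborel) = 0" if
        "w \<in> test_functions UNIV" for w
      by (rule row[OF s11(1) s12(1) g11(1) g12(1) g11(2) g12(2) _ d1(1) that]) (use trace in auto)
    show "(\<integral>x. indicat_real \<Omega> x * (s12 x * partial 1 w x + s22 x * partial 2 w x) \<partial>lborel) = 0" if
        "w \<in> test_functions UNIV" for w
      by (rule row[OF s12(1) s22(1) g12(1) g22(1) g12(2) g22(2) _ d1(2) that]) (use trace in auto)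
    show "a11 * p * p + a22 * q * q + a33 * r * r + 2 * a12 * p * q + 2 * a13 * p * r + 2 * a23 * q
        * r > 0"
      if "p \<noteq> 0 \<or> q \<noteq> 0 \<or> r \<noteq> 0" for p q r using that by (rule pos)
    show "(\<integral>x. (a11 * s11 x + a12 * s12 x + a13 * s22 x) * partial 2 (partial 2 w) x
        - (a12 * s11 x + a22 * s12 x + a23 * s22 x) * partial 1 (partial 2 w) x
        + (a13 * s11 x + a23 * s12 x + a33 * s22 x) * partial 1 (partial 1 w) x \<partial>lborel) = 0" if w:
            "w \<in> test_functions \<Omega>" for w
    proof -
      have t: "partial i (partial j w) \<in> test_functions \<Omega>" for i j by (intro test_functions_partial
          w)
      have i: "integrable lborel (\<lambda>x. s11 x * \<psi> x)" "integrable lborel (\<lambda>x. s12 x * \<psi> x)"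
          "integrable lborel (\<lambda>x. s22 x * \<psi> x)"
        if "\<psi> \<in> test_functions \<Omega>" for \<psi>
        by (rule test_functions_integrable[OF test_functions_mult[OF \<Omega>(1) s11(1) that]]
            test_functions_integrable[OF test_functions_mult[OF \<Omega>(1) s12(1) that]]
            test_functions_integrable[OF test_functions_mult[OF \<Omega>(1) s22(1) that]])+
      have I: "has_bochner_integral lborel (\<lambda>x. (\<alpha> * s11 x + \<beta> * s12 x + \<gamma> * s22 x) * \<psi> x) (\<alpha> * T 1
          1 \<psi> + \<beta> * T 1 2 \<psi> + \<gamma> * T 2 2 \<psi>)"
        if \<psi>: "\<psi> \<in> test_functions \<Omega>" for \<alpha> \<beta> \<gamma> \<psi>
      proof -
        have "has_bochner_integral lborel (\<lambda>x. \<alpha> * (s11 x * \<psi> x) + \<beta> * (s12 x * \<psi> x) + \<gamma> * (s22 x *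
            \<psi> x)) (\<alpha> * T 1 1 \<psi> + \<beta> * T 1 2 \<psi> + \<gamma> * T 2 2 \<psi>)"
          unfolding s11(2)[OF \<psi>] s12(2)[OF \<psi>] s22(2)[OF \<psi>]
          by (intro has_bochner_integral_add has_bochner_integral_mult_right
              has_bochner_integral_integrable i \<psi>)
        then show ?thesis by (simp add: algebra_simps)
      qed
      have "has_bochner_integral lborel (\<lambda>x. (a11 * s11 x + a12 * s12 x + a13 * s22 x) * partial 2
          (partial 2 w) x
        - (a12 * s11 x + a22 * s12 x + a23 * s22 x) * partial 1 (partial 2 w) x
        + (a13 * s11 x + a23 * s12 x + a33 * s22 x) * partial 1 (partial 1 w) x) 0"
        using has_bochner_integral_add[OF has_bochner_integral_diff[OF I[OF t[of 2 2]] I[OF t[of 1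
            2]]] I[OF t[of 1 1]],
            of a11 a12 a13 a12 a22 a23 a13 a23 a33] cc[OF w] by simp
      then show ?thesis by (rule has_bochner_integral_integral_eq)
    qed
  qed
  show ?thesis
  proof
    fix \<phi> assume \<phi>: "\<phi> \<in> test_functions \<Omega>"
    have z: "(\<integral>x. s x * \<phi> x \<partial>lborel) = 0" if "\<And>x. x \<in> \<Omega> \<Longrightarrow> s x = 0" for s
    proof -
      have "s x * \<phi> x = 0" for x using that test_functions_eq_0[OF \<phi>, of x] by (cases "x \<in> \<Omega>") auto
      then show ?thesis by (simp only: Bochner_Integration.integral_zero)
    qed
    have "T 1 1 \<phi> = 0" "T 1 2 \<phi> = 0" "T 2 2 \<phi> = 0"
      unfolding s11(2)[OF \<phi>] s12(2)[OF \<phi>] s22(2)[OF \<phi>] using zero by (auto intro: z)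
    moreover from this have "T 2 1 \<phi> = 0" using T21[OF \<phi>] by simp
    ultimately show "\<sigma>\<^sub>1 \<phi> = \<sigma>\<^sub>2 \<phi>" by (simp add: T_def vec_eq_iff forall_2)
  qed
qed

end
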